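(* Assume the setting and assumptions (A1)–(A4) described in the context. For each $x\in V$, as $T\to+\infty$ along $T=nT_0$ with $n$ a positive integer, the family of probability measures $\{\mathbb P_x\circ(\bar\mu_T,\bar Q_T)^{-1}\}$ on $\mathcal P(V)\times\mathbb R_+^E$ satisfies a large deviation principle with speed $T$ and good convex rate functional $$\bar I(\bar\mu,\bar Q)=\inf_{(\mu_t,Q_t)_{t\in\mathcal S_{T_0}}}\frac1{T_0}\int_0^{T_0}I_t(\mu_t,Q_t)\,dt,$$ where the infimum (equal to $+\infty$ if taken over the empty set) runs over all measurable maps $\mathcal S_{T_0}\ni t\mapsto(\mu_t,Q_t)\in\mathcal P(V)\times\mathbb R_+^E$ such that $\partial_t\mu_t+\mathrm{div}\,Q_t=0$ weakly, $\frac1{T_0}\int_0^{T_0}\mu_t\,dt=\bar\mu$ and $\frac1{T_0}\int_0^{T_0}Q_t\,dt=\bar Q$.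
   Context: Let $V$ be a finite set and $T_0>0$; let $\mathcal S_{T_0}:=\mathbb R/T_0\mathbb Z$ (functions on $\mathcal S_{T_0}$ are identified with $T_0$-periodic functions). For $y,z\in V$ let $r(y,z;\cdot):[0,\infty)\to[0,\infty)$ be measurable, locally integrable and $T_0$-periodic, with $r(x,x;t)\equiv0$. Let $E$ be the set of ordered pairs $(y,z)$, $y\ne z$, with $r(y,z;t)>0$ for all $t>0$. Assumptions: (A1) if $r(y,z;t)>0$ for some $t>0$ then $r(y,z;t)>0$ for all $t>0$; (A2) the directed graph $(V,E)$ is strongly connected; (A3) $\max_{(y,z)\in E}\sup_{t\in[0,T_0]}r(y,z;t)<\infty$ and $\min_{(y,z)\in E}\inf_{t\in[0,T_0]}r(y,z;t)>0$; (A4) the set of points of $\mathcal S_{T_0}$ at which some map $t\mapsto r(y,z;t)$ ($y,z\in V$) is discontinuous has Lebesgue measure zero. Let $(\xi_t)_{t\ge0}$ be the time-inhomogeneous continuous-time Markov chain on $V$ with càdlàg paths and jump rate $r(y,z;t)$ from $y$ to $z$ at time $t$; $\mathbb P_x$ denotes its law on $D(\mathbb R_+;V)$ when $\xi_0=x$. For a path $X\in D(\mathbb R_+;V)$ and $T>0$: the empirical measure $\bar\mu_T(X)=\frac1T\int_0^T\delta_{X_t}dt\in\mathcal P(V)$ and the empirical flow $\bar Q_T(X)(y,z)=\frac1T\#\{t\in[0,T]:X_{t-}=y,X_t=z\}$, $(y,z)\in E$. $\Phi:\mathbb R_+\times\mathbb R_+\to[0,\infty]$: $\Phi(q,p)=q\log\frac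 qp-(q-p)$ if $q,p>0$; $\Phi(0,p)=p$ for $p\ge0$; $\Phi(q,0)=+\infty$ for $q>0$. For $t\in\mathcal S_{T_0}$, $I_t(\mu,Q):=\sum_{(y,z)\in E}\Phi\big(Q(y,z),\mu(y)r(y,z;t)\big)$ for $\mu\in\mathcal P(V)$, $Q\in\mathbb R_+^E$. For $A\in\mathbb R_+^E$ (extended by $A(y,z)=0$ for $(y,z)\notin E$), $\mathrm{div}A(y)=\sum_zA(y,z)-\sum_zA(z,y)$. The equation $\partial_t\mu_t+\mathrm{div}\,Q_t=0$ weakly means $\int_0^{T_0}\sum_y\mu_s(y)\partial_sf(y,s)\,ds=\int_0^{T_0}\sum_y\mathrm{div}\,Q_s(y)f(y,s)\,ds$ for every $f:V\times\mathcal S_{T_0}\to\mathbb R$ that is $C^1$ in time. *)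

theory Defs
  imports "HOL-Probability.Probability"
begin

definition Phi :: "real \<Rightarrow> real \<Rightarrow> ennreal" where
  "Phi q p = (if q > 0 \<and> p > 0 then ennreal (q * ln (q / p) - (q - p))
              else if q = 0 then ennreal p else \<infinity>)"

definition edges :: "('v \<Rightarrow> 'v \<Rightarrow> real \<Rightarrow> real) \<Rightarrow> ('v \<times> 'v) set" where
  "edges r = {(y, z). y \<noteq> z \<and> (\<forall>t>0. r y z t > 0)}"

definition prob_vecs :: "(real^'v::finite) set" where
  "prob_vecs = {\<mu>. (\<forall>y. \<mu>$y \<ge> 0) \<and> (\<Sum>y\<in>UNIV. \<mu>$y) = 1}"

text \<open>Nonnegative flows on E, extended by zero outside E (i.e. the space R_+^E).\<close>
definition flows :: "('v \<times> 'v) set \<Rightarrow> (real^('v::finite \<times> 'v)) set" where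
  "flows E = {Q. (\<forall>e. Q$e \<ge> 0) \<and> (\<forall>e. e \<notin> E \<longrightarrow> Q$e = 0)}"

definition It :: "('v::finite \<Rightarrow> 'v \<Rightarrow> real \<Rightarrow> real) \<Rightarrow> real \<Rightarrow> real^'v \<Rightarrow> real^('v \<times> 'v) \<Rightarrow> ennreal" where
  "It r t \<mu> Q = (\<Sum>(y, z)\<in>edges r. Phi (Q$(y, z)) (\<mu>$y * r y z t))"

definition divg :: "real^('v::finite \<times> 'v) \<Rightarrow> 'v \<Rightarrow> real" where
  "divg A y = (\<Sum>z\<in>UNIV. A$(y, z)) - (\<Sum>z\<in>UNIV. A$(z, y))"

text \<open>Admissible T0-periodic (i.e. defined on the circle) measurable paths (mu_t, Q_t) solving the
  continuity equation weakly and with time averages (mubar, Qbar).\<close>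
definition admissible ::
  "('v::finite \<Rightarrow> 'v \<Rightarrow> real \<Rightarrow> real) \<Rightarrow> real \<Rightarrow> real^'v \<Rightarrow> real^('v \<times> 'v)
     \<Rightarrow> (real \<Rightarrow> real^'v) \<Rightarrow> (real \<Rightarrow> real^('v \<times> 'v)) \<Rightarrow> bool" where
  "admissible r T0 \<mu>bar Qbar \<mu> Q \<longleftrightarrow>
     \<mu> \<in> borel_measurable borel \<and> Q \<in> borel_measurable borel \<and>
     (\<forall>t. \<mu> (t + T0) = \<mu> t \<and> Q (t + T0) = Q t) \<and>
     (\<forall>t. \<mu> t \<in> prob_vecs \<and> Q t \<in> flows (edges r)) \<and>
     (\<forall>e. set_integrable lborel {0..T0} (\<lambda>t. Q t $ e)) \<and>
     (\<forall>f :: 'v \<Rightarrow> real \<Rightarrow> real.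
        (\<forall>y. (\<forall>t. f y (t + T0) = f y t) \<and> f y C1_differentiable_on UNIV) \<longrightarrow>
        (LINT s:{0..T0}|lborel. (\<Sum>y\<in>UNIV. \<mu> s $ y * deriv (f y) s)) =
        (LINT s:{0..T0}|lborel. (\<Sum>y\<in>UNIV. divg (Q s) y * f y s))) \<and>
     (\<forall>y. (LINT t:{0..T0}|lborel. \<mu> t $ y) / T0 = \<mu>bar $ y) \<and>
     (\<forall>e. (LINT t:{0..T0}|lborel. Q t $ e) / T0 = Qbar $ e)"

definition Ibar :: "('v::finite \<Rightarrow> 'v \<Rightarrow> real \<Rightarrow> real) \<Rightarrow> real \<Rightarrow> (real^'v) \<times> (real^('v \<times> 'v)) \<Rightarrow> ennreal" where
  "Ibar r T0 p = (INF \<mu>Q \<in> {(\<mu>, Q). admissible r T0 (fst p) (snd p) \<mu> Q}.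
       (\<integral>\<^sup>+ t\<in>{0..T0}. It r t (fst \<mu>Q t) (snd \<mu>Q t) \<partial>lborel) / ennreal T0)"

definition logE :: "real \<Rightarrow> ereal" where
  "logE p = (if p = 0 then -\<infinity> else ereal (ln p))"

definition LDP :: "(nat \<Rightarrow> 'a::topological_space measure) \<Rightarrow> (nat \<Rightarrow> real) \<Rightarrow> ('a \<Rightarrow> ennreal) \<Rightarrow> bool" where
  "LDP P s I \<longleftrightarrow>
     (\<forall>G. open G \<longrightarrow>
        - enn2ereal (INF p\<in>G. I p) \<le> liminf (\<lambda>n. ereal (1 / s n) * logE (measure (P n) G))) \<and>
     (\<forall>F. closed F \<longrightarrow>
        limsup (\<lambda>n. ereal (1 / s n) * logE (measure (P n) F)) \<le> - enn2ereal (INF p\<in>F. I p))"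

definition good_rate :: "('a::topological_space \<Rightarrow> ennreal) \<Rightarrow> bool" where
  "good_rate I \<longleftrightarrow> (\<forall>c. closed {p. I p \<le> c}) \<and> (\<forall>c. c < \<infinity> \<longrightarrow> compact {p. I p \<le> c})"

definition convex_rate :: "('a::real_vector \<Rightarrow> ennreal) \<Rightarrow> bool" where
  "convex_rate I \<longleftrightarrow> (\<forall>p q. \<forall>a\<in>{0..1::real}.
      I (a *\<^sub>R p + (1 - a) *\<^sub>R q) \<le> ennreal a * I p + ennreal (1 - a) * I q)"

definition gen :: "('v::finite \<Rightarrow> 'v \<Rightarrow> real \<Rightarrow> real) \<Rightarrow> real \<Rightarrow> 'v \<Rightarrow> 'v \<Rightarrow> real" where
  "gen r u w z = (if w = z then - (\<Sum>z'\<in>UNIV - {w}. r w z' u) else r w z u)"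

text \<open>Transition probabilities K s t y z = P(xi_t = z | xi_s = y), characterised as the solution
  of the (integral form of the) Kolmogorov forward equation.\<close>
definition forward_kernel :: "('v::finite \<Rightarrow> 'v \<Rightarrow> real \<Rightarrow> real) \<Rightarrow> (real \<Rightarrow> real \<Rightarrow> 'v \<Rightarrow> 'v \<Rightarrow> real) \<Rightarrow> bool" where
  "forward_kernel r K \<longleftrightarrow> (\<forall>s t y z. 0 \<le> s \<and> s \<le> t \<longrightarrow>
      set_integrable lborel {s..t} (\<lambda>u. \<Sum>w\<in>UNIV. K s u y w * gen r u w z) \<and>
      K s t y z = (if y = z then 1 else 0) + (LINT u:{s..t}|lborel. (\<Sum>w\<in>UNIV. K s u y w * gen r u w z)))"

text \<open>Cadlag paths with values in the (discrete) finite set V, on [0, infinity).\<close>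
definition cadlag :: "(real \<Rightarrow> 'v) \<Rightarrow> bool" where
  "cadlag X \<longleftrightarrow> (\<forall>t\<ge>0. \<exists>\<delta>>0. \<forall>u\<in>{t..<t+\<delta>}. X u = X t) \<and>
                 (\<forall>t>0. \<exists>\<delta>>0. \<exists>v. \<forall>u\<in>{t-\<delta><..<t}. X u = v)"

definition left_lim :: "(real \<Rightarrow> 'v) \<Rightarrow> real \<Rightarrow> 'v" where
  "left_lim X t = (if t > 0 then (THE v. \<exists>\<delta>>0. \<forall>u\<in>{t-\<delta><..<t}. X u = v) else X t)"

definition is_chain :: "('v::finite \<Rightarrow> 'v \<Rightarrow> real \<Rightarrow> real) \<Rightarrow> 'v \<Rightarrow> 'a measure \<Rightarrow> ('a \<Rightarrow> real \<Rightarrow> 'v) \<Rightarrow> bool" where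
  "is_chain r x M \<xi> \<longleftrightarrow> prob_space M \<and>
     (\<forall>t. (\<lambda>\<omega>. \<xi> \<omega> t) \<in> measurable M (count_space UNIV)) \<and>
     (\<forall>\<omega>\<in>space M. cadlag (\<xi> \<omega>)) \<and>
     (\<exists>K. forward_kernel r K \<and>
        (\<forall>k (tt :: nat \<Rightarrow> real) (yy :: nat \<Rightarrow> 'v).
            tt 0 = 0 \<and> yy 0 = x \<and> (\<forall>i<k. tt i \<le> tt (Suc i)) \<longrightarrow>
            measure M {\<omega>\<in>space M. \<forall>i\<in>{1..k}. \<xi> \<omega> (tt i) = yy i} =
            (\<Prod>i\<in>{1..k}. K (tt (i - 1)) (tt i) (yy (i - 1)) (yy i))))"

definition emp_measure :: "real \<Rightarrow> (real \<Rightarrow> 'v::finite) \<Rightarrow> real^'v" where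
  "emp_measure T X = (\<chi> y. measure lborel {t\<in>{0..T}. X t = y} / T)"

definition emp_flow :: "('v \<times> 'v) set \<Rightarrow> real \<Rightarrow> (real \<Rightarrow> 'v::finite) \<Rightarrow> real^('v \<times> 'v)" where
  "emp_flow E T X = (\<chi> e. if e \<in> E then
       real (card {t\<in>{0..T}. left_lim X t = fst e \<and> X t = snd e}) / T else 0)"

end

theory Submission
  imports Defs
begin

text \<open>
  For a pair \<open>l\<close> of linear forms on measures and flows, a periodic Perron-Frobenius theorem for the tilted
  backward equation yields \<open>L\<close> and a positive periodic \<open>g\<close> with \<open>g' = L g - A\<^sub>l g\<close>. The process
  \<open>exp (T (l \<bullet> p - L)) g\<close>, with \<open>p\<close> the empirical pair, is then a martingale, so \<open>L\<close> is the limiting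
  cumulant generating function, with error bounded by a constant factor. Testing the continuity equation against
  \<open>ln g\<close> shows that the rate functional dominates \<open>l \<bullet> p - L\<close>, with equality exactly at the
  time average of the stationary periodic solution of the chain tilted by \<open>l\<close>. So every \<open>l\<close> exposes a single
  point. Minimisers of \<open>I + N |. - p|\<^sup>2\<close> have subgradients, hence are such exposed points, and they approximate \<open>p\<close>;
  this gives both the duality needed in the upper bound and the density of exposed points needed in the lower bound
  of a Gaertner-Ellis argument.
\<close>

section \<open>Lipschitz functions with almost everywhere derivatives\<close>

text \<open>The rates are only measurable and continuous off a null set, so solutions of the linear
  equations are merely Lipschitz, with a derivative off that set. Hence almost-everywhere
  derivatives are integrated back by a fundamental theorem for Lipschitz functions, and the weak
  continuity equation, stated for C1 test functions, has to be extended to Lipschitz ones such as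
  \<open>ln g\<close>. Uniqueness of the maximiser of \<open>l \<bullet> p - I p\<close> takes the
  place of differentiability of \<open>L\<close> in \<open>l\<close>: it forces the law of the
  empirical pair, reweighted by \<open>exp (T (l \<bullet> p))\<close>, to concentrate at one point,
  so the change of measure happens on the law of the pair. Closed sublevel sets are the delicate
  point of the rate functional, since flows are only integrable; convexity supplies almost
  everywhere convergent near-minimisers. The chain is given by finite-dimensional distributions and
  a forward equation, so exponential moments are computed on uniform grids with an error quadratic
  in the mesh per step, and cadlag paths supply the limit.\<close>

lemma set_integrable_bounded:
  fixes f :: "real \<Rightarrow> real"
  assumes "f \<in> borel_measurable borel" "\<And>t. t \<in> {a..b} \<Longrightarrow> \<bar>f t\<bar> \<le> C"
  shows "set_integrable lborel {a..b} f"
  unfolding set_integrable_def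
  by (rule integrableI_bounded_set_indicator[where B = C])
    (use assms in \<open>auto simp: emeasure_lborel_Icc_eq\<close>)

lemma set_integral_abs_le:
  fixes f :: "real \<Rightarrow> real"
  assumes i: "set_integrable lborel {a..b} f" and "\<And>t. t \<in> {a..b} \<Longrightarrow> \<bar>f t\<bar> \<le> C" "a \<le> b"
  shows "\<bar>LINT t:{a..b}|lborel. f t\<bar> \<le> C * (b - a)"
proof -
  have C0: "C \<ge> 0" using assms(2)[of a] assms(3) by auto
  have "\<bar>LINT t:{a..b}|lborel. f t\<bar> \<le> (LINT t:{a..b}|lborel. \<bar>f t\<bar>)"
    using set_integral_norm_bound[OF i] by simp
  also have "\<dots> \<le> (LINT t:{a..b}|lborel. C)"
    by (rule set_integral_mono[OF set_integrable_abs[OF i] set_integrable_bounded[of _ _ _ C]]) (use assms C0 in auto)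
  also have "\<dots> = C * (b - a)" using assms(3) by (simp add: set_lebesgue_integral_def)
  finally show ?thesis .
qed

lemma set_integral_bounded:
  fixes f :: "real \<Rightarrow> real"
  assumes "f \<in> borel_measurable borel" "\<And>t. t \<in> {a..b} \<Longrightarrow> \<bar>f t\<bar> \<le> C" "a \<le> b"
  shows "\<bar>LINT t:{a..b}|lborel. f t\<bar> \<le> C * (b - a)"
  by (rule set_integral_abs_le[OF set_integrable_bounded]) (use assms in auto)

lemma set_integral_split:
  fixes f :: "real \<Rightarrow> real"
  assumes "set_integrable lborel {a..c} f" "a \<le> b" "b \<le> c"
  shows "(LINT t:{a..c}|lborel. f t) = (LINT t:{a..b}|lborel. f t) + (LINT t:{b..c}|lborel. f t)"
proof -
  have 1: "set_integrable lborel {a..b} f" and 2: "set_integrable lborel {b..c} f"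
    by (rule set_integrable_subset[OF assms(1)]; use assms in auto)+
  show ?thesis
    using Henstock_Kurzweil_Integration.integral_combine[OF assms(2,3) set_borel_integral_eq_integral(1)[OF assms(1)]]
      set_borel_integral_eq_integral(2)[OF assms(1)] set_borel_integral_eq_integral(2)[OF 1]
      set_borel_integral_eq_integral(2)[OF 2] by simp
qed

lemma difference_quotient_tendsto:
  fixes f :: "real \<Rightarrow> real"
  assumes "(f has_real_derivative D) (at t)"
  shows "(\<lambda>n. (f (t + 1 / real (Suc n)) - f t) * real (Suc n)) \<longlonglongrightarrow> D"
proof -
  have "(\<lambda>h. (f (t + h) - f t) / h) \<midarrow>0\<rightarrow> D"
    using assms by (simp add: DERIV_def)
  moreover have "filterlim (\<lambda>n. 1 / real (Suc n)) (at 0) sequentially"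
    unfolding filterlim_at using LIMSEQ_inverse_real_of_nat by (auto simp: inverse_eq_divide)
  ultimately have "(\<lambda>n. (f (t + 1 / real (Suc n)) - f t) / (1 / real (Suc n))) \<longlonglongrightarrow> D"
    by (rule filterlim_compose)
  then show ?thesis by simp
qed

definition lip :: "real \<Rightarrow> real \<Rightarrow> (real \<Rightarrow> real) \<Rightarrow> bool" where
  "lip a b F \<longleftrightarrow> (\<exists>L. \<forall>s\<in>{a..b}. \<forall>t\<in>{a..b}. \<bar>F s - F t\<bar> \<le> L * \<bar>s - t\<bar>)"

lemma lipI: "(\<And>s t. s \<in> {a..b} \<Longrightarrow> t \<in> {a..b} \<Longrightarrow> \<bar>F s - F t\<bar> \<le> L * \<bar>s - t\<bar>) \<Longrightarrow> lip a b F"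
  unfolding lip_def by blast

lemma lipE:
  assumes "lip a b F"
  obtains L where "L \<ge> 0" "\<And>s t. s \<in> {a..b} \<Longrightarrow> t \<in> {a..b} \<Longrightarrow> \<bar>F s - F t\<bar> \<le> L * \<bar>s - t\<bar>"
proof -
  obtain L where L: "\<And>s t. s \<in> {a..b} \<Longrightarrow> t \<in> {a..b} \<Longrightarrow> \<bar>F s - F t\<bar> \<le> L * \<bar>s - t\<bar>"
    using assms unfolding lip_def by blast
  show thesis
  proof (rule that[of "\<bar>L\<bar>"])
    fix s t assume "s \<in> {a..b}" "t \<in> {a..b}"
    then have "\<bar>F s - F t\<bar> \<le> L * \<bar>s - t\<bar>" by (rule L)
    also have "\<dots> \<le> \<bar>L\<bar> * \<bar>s - t\<bar>" by (rule mult_right_mono) auto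
    finally show "\<bar>F s - F t\<bar> \<le> \<bar>L\<bar> * \<bar>s - t\<bar>" .
  qed auto
qed

lemma lip_continuous_on: assumes "lip a b F" shows "continuous_on {a..b} F"
proof -
  obtain L where L: "L \<ge> 0" "\<And>s t. s \<in> {a..b} \<Longrightarrow> t \<in> {a..b} \<Longrightarrow> \<bar>F s - F t\<bar> \<le> L * \<bar>s - t\<bar>"
    using lipE[OF assms] by metis
  have "L-lipschitz_on {a..b} F"
    by (rule lipschitz_onI) (use L in \<open>auto simp: dist_real_def\<close>)
  then show ?thesis by (rule lipschitz_on_continuous_on)
qed

lemma lip_bounded: assumes "lip a b F" obtains M where "M \<ge> 0" "\<And>t. t \<in> {a..b} \<Longrightarrow> \<bar>F t\<bar> \<le> M"
proof -
  have "bounded (F ` {a..b})"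
    by (intro compact_imp_bounded compact_continuous_image lip_continuous_on assms compact_Icc)
  then obtain M where "\<And>t. t \<in> {a..b} \<Longrightarrow> \<bar>F t\<bar> \<le> M" "M > 0"
    unfolding bounded_pos by force
  then show thesis by (intro that[of M]) auto
qed

lemma lip_const: "lip a b (\<lambda>_. c)"
  by (rule lipI[of _ _ _ 0]) auto

lemma lip_add: assumes "lip a b F" "lip a b G" shows "lip a b (\<lambda>t. F t + G t)"
proof -
  obtain L where L: "L \<ge> 0" "\<And>s t. s \<in> {a..b} \<Longrightarrow> t \<in> {a..b} \<Longrightarrow> \<bar>F s - F t\<bar> \<le> L * \<bar>s - t\<bar>"
    using lipE[OF assms(1)] by metis
  obtain K where K: "K \<ge> 0" "\<And>s t. s \<in> {a..b} \<Longrightarrow> t \<in> {a..b} \<Longrightarrow> \<bar>G s - G t\<bar> \<le> K * \<bar>s - t\<bar>"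
    using lipE[OF assms(2)] by metis
  show ?thesis
    by (rule lipI[of _ _ _ "L + K"]) (use L(2) K(2) in \<open>force simp: distrib_right\<close>)
qed

lemma lip_mult: assumes "lip a b F" "lip a b G" shows "lip a b (\<lambda>t. F t * G t)"
proof -
  obtain L where L: "L \<ge> 0" "\<And>s t. s \<in> {a..b} \<Longrightarrow> t \<in> {a..b} \<Longrightarrow> \<bar>F s - F t\<bar> \<le> L * \<bar>s - t\<bar>"
    using lipE[OF assms(1)] by metis
  obtain K where K: "K \<ge> 0" "\<And>s t. s \<in> {a..b} \<Longrightarrow> t \<in> {a..b} \<Longrightarrow> \<bar>G s - G t\<bar> \<le> K * \<bar>s - t\<bar>"
    using lipE[OF assms(2)] by metis
  obtain M where M: "M \<ge> 0" "\<And>t. t \<in> {a..b} \<Longrightarrow> \<bar>F t\<bar> \<le> M" using lip_bounded[OF assms(1)] by metis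
  obtain N where N: "N \<ge> 0" "\<And>t. t \<in> {a..b} \<Longrightarrow> \<bar>G t\<bar> \<le> N" using lip_bounded[OF assms(2)] by metis
  show ?thesis
  proof (rule lipI[of _ _ _ "M * K + L * N"])
    fix s t assume st: "s \<in> {a..b}" "t \<in> {a..b}"
    have "F s * G s - F t * G t = F s * (G s - G t) + (F s - F t) * G t" by (simp add: algebra_simps)
    then have "\<bar>F s * G s - F t * G t\<bar> \<le> \<bar>F s\<bar> * \<bar>G s - G t\<bar> + \<bar>F s - F t\<bar> * \<bar>G t\<bar>"
      by (metis abs_mult abs_triangle_ineq)
    also have "\<dots> \<le> M * (K * \<bar>s - t\<bar>) + (L * \<bar>s - t\<bar>) * N"
      by (intro add_mono mult_mono M N L K st) (use L K M N in auto)
    finally show "\<bar>F s * G s - F t * G t\<bar> \<le> (M * K + L * N) * \<bar>s - t\<bar>" by (simp add: algebra_simps)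
  qed
qed

lemma lip_cmult: "lip a b F \<Longrightarrow> lip a b (\<lambda>t. c * F t)"
  by (rule lip_mult[OF lip_const])

lemma lip_diff: "lip a b F \<Longrightarrow> lip a b G \<Longrightarrow> lip a b (\<lambda>t. F t - G t)"
  using lip_add[OF _ lip_cmult[of a b G "-1"], of F] by simp

lemma lip_sum: "(\<And>i. i \<in> I \<Longrightarrow> lip a b (F i)) \<Longrightarrow> lip a b (\<lambda>t. \<Sum>i\<in>I. F i t)"
  by (induction I rule: infinite_finite_induct) (auto intro: lip_const lip_add)

lemma lip_C1:
  assumes "\<And>t. t \<in> {a..b} \<Longrightarrow> (F has_real_derivative F' t) (at t)" "continuous_on {a..b} F'"
  shows "lip a b F"
proof -
  have "bounded (F' ` {a..b})"
    by (intro compact_imp_bounded compact_continuous_image assms compact_Icc)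
  then obtain M where M: "\<And>t. t \<in> {a..b} \<Longrightarrow> \<bar>F' t\<bar> \<le> M" unfolding bounded_pos by force
  show ?thesis
  proof (rule lipI[of _ _ _ M])
    fix s t assume "s \<in> {a..b}" "t \<in> {a..b}"
    then show "\<bar>F s - F t\<bar> \<le> M * \<bar>s - t\<bar>"
      using field_differentiable_bound[of "{a..b}" F F' M s t] assms(1) M
      by (auto intro: has_field_derivative_at_within)
  qed
qed

lemma lip_exp: "lip a b (\<lambda>t. exp (k * t))"
  by (rule lip_C1[where F' = "\<lambda>t. k * exp (k * t)"]) (auto intro!: derivative_eq_intros continuous_intros)

lemma lip_ln: assumes "lip a b F" "m > 0" "\<And>t. t \<in> {a..b} \<Longrightarrow> F t \<ge> m" shows "lip a b (\<lambda>t. ln (F t))"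
proof -
  obtain L where L: "L \<ge> 0" "\<And>s t. s \<in> {a..b} \<Longrightarrow> t \<in> {a..b} \<Longrightarrow> \<bar>F s - F t\<bar> \<le> L * \<bar>s - t\<bar>"
    using lipE[OF assms(1)] by metis
  have ln: "\<bar>ln x - ln y\<bar> \<le> \<bar>x - y\<bar> / m" if "x \<ge> m" "y \<ge> m" for x y :: real
  proof -
    have *: "ln x - ln y \<le> \<bar>x - y\<bar> / m" if "x \<ge> m" "y \<ge> m" for x y :: real
    proof -
      have "ln x - ln y \<le> (x - y) / y" using that assms(2) by (intro ln_diff_le) auto
      also have "\<dots> \<le> \<bar>x - y\<bar> / y" using that assms(2) by (intro divide_right_mono) auto
      also have "\<dots> \<le> \<bar>x - y\<bar> / m" using that assms(2) by (intro divide_left_mono) auto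
      finally show ?thesis .
    qed
    show ?thesis using *[OF that] *[OF that(2,1)] by (simp add: abs_minus_commute abs_le_iff)
  qed
  show ?thesis
  proof (rule lipI[of _ _ _ "L / m"])
    fix s t assume st: "s \<in> {a..b}" "t \<in> {a..b}"
    have "\<bar>ln (F s) - ln (F t)\<bar> \<le> \<bar>F s - F t\<bar> / m" by (intro ln assms st)
    also have "\<dots> \<le> (L * \<bar>s - t\<bar>) / m" using L(2)[OF st] assms(2) by (intro divide_right_mono) auto
    finally show "\<bar>ln (F s) - ln (F t)\<bar> \<le> L / m * \<bar>s - t\<bar>" by simp
  qed
qed

text \<open>Integrating a difference quotient over \<open>{a..b}\<close> telescopes to difference
  quotients at \<open>b\<close> and \<open>a\<close> of a primitive; these tend to the values of
  \<open>F\<close>, while the quotients themselves are dominated by the Lipschitz constant. Only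
  one-sided quotients along \<open>1 / Suc n\<close> are assumed to converge, so that primitives of
  bounded measurable functions are covered through Lebesgue differentiation.\<close>

lemma lip_FTC_seq:
  assumes lip: "lip a b F" and ab: "a \<le> b" and N: "N \<in> null_sets lborel"
    and der: "\<And>t. t \<in> {a<..<b} \<Longrightarrow> t \<notin> N \<Longrightarrow>
      (\<lambda>n. (F (t + 1 / real (Suc n)) - F t) * real (Suc n)) \<longlonglongrightarrow> F' t"
    and meas: "F' \<in> borel_measurable borel"
  shows "set_integrable lborel {a..b} F'" and "(LINT t:{a..b}|lborel. F' t) = F b - F a"
proof -
  obtain L where L: "L \<ge> 0" "\<And>s t. s \<in> {a..b} \<Longrightarrow> t \<in> {a..b} \<Longrightarrow> \<bar>F s - F t\<bar> \<le> L * \<bar>s - t\<bar>"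
    using lipE[OF lip] by metis
  \<comment> \<open>Clamping the argument extends \<open>F\<close> to the whole line with the same
    Lipschitz constant, so the shifted points \<open>t + 1 / Suc n\<close> may leave
    \<open>{a..b}\<close>.\<close>
  define H where "H t = F (max a (min b t))" for t
  have HL: "\<bar>H s - H t\<bar> \<le> L * \<bar>s - t\<bar>" for s t
  proof -
    have "\<bar>H s - H t\<bar> \<le> L * \<bar>max a (min b s) - max a (min b t)\<bar>"
      unfolding H_def by (rule L) (use ab in auto)
    also have "\<dots> \<le> L * \<bar>s - t\<bar>" by (rule mult_left_mono[OF _ L(1)]) (auto simp: max_def min_def)
    finally show ?thesis .
  qed
  have Hcont: "continuous_on A H" for A
  proof -
    have "L-lipschitz_on A H" by (rule lipschitz_onI) (use HL L in \<open>auto simp: dist_real_def\<close>)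
    then show ?thesis by (rule lipschitz_on_continuous_on)
  qed
  \<comment> \<open>The primitive starts at \<open>a - 1\<close> so that it has two-sided
    derivatives at \<open>a\<close> and at all shifted points up to \<open>b + 1\<close>.\<close>
  define P where "P t = integral {a - 1..t} H" for t
  have P: "(P has_real_derivative H t) (at t)" if "t \<in> {a - 1<..<b + 2}" for t
  proof -
    have "(P has_real_derivative H t) (at t within {a - 1..b + 2})"
      unfolding P_def by (rule integral_has_real_derivative[OF Hcont]) (use that in auto)
    then show ?thesis using that by (metis at_within_Icc_at greaterThanLessThan_iff)
  qed
  define d where "d n t = (H (t + 1 / real (Suc n)) - H t) * real (Suc n)" for n t
  have dm: "d n \<in> borel_measurable borel" for n
    unfolding d_def by (intro borel_measurable_times borel_measurable_diff borel_measurable_const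
      borel_measurable_continuous_onI[OF Hcont]
      measurable_compose[OF _ borel_measurable_continuous_onI[OF Hcont]]) auto
  have db: "\<bar>d n t\<bar> \<le> L" for n t
  proof -
    have "\<bar>d n t\<bar> = \<bar>H (t + 1 / real (Suc n)) - H t\<bar> * real (Suc n)" by (simp add: d_def abs_mult)
    also have "\<dots> \<le> (L * \<bar>1 / real (Suc n)\<bar>) * real (Suc n)"
      using HL[of "t + 1 / real (Suc n)" t] by (intro mult_right_mono) auto
    finally show ?thesis by simp
  qed
  have dlim: "(\<lambda>n. d n t) \<longlonglongrightarrow> F' t" if t: "t \<in> {a<..<b}" "t \<notin> N" for t
  proof -
    have "(\<lambda>n. t + 1 / real (Suc n)) \<longlonglongrightarrow> t + 0"
      by (intro tendsto_add tendsto_const) (use LIMSEQ_inverse_real_of_nat in \<open>simp add: inverse_eq_divide\<close>)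
    then have "eventually (\<lambda>n. t + 1 / real (Suc n) < b) sequentially"
      using t by (intro order_tendstoD(2)[of _ t]) auto
    then have "eventually (\<lambda>n. (F (t + 1 / real (Suc n)) - F t) * real (Suc n) = d n t) sequentially"
    proof eventually_elim
      case (elim n)
      have "max a (min b (t + 1 / real (Suc n))) = t + 1 / real (Suc n)"
        using t elim by (simp add: max_def min_def add_increasing2)
      then show ?case using t by (simp add: d_def H_def)
    qed
    then show ?thesis using der[OF t] by (rule Lim_transform_eventually[rotated])
  qed
  have "{a, b} \<in> null_sets lborel" by (intro countable_imp_null_set_lborel) auto
  then have N': "N \<union> {a, b} \<in> null_sets lborel" using N by blast
  have AE: "AE t in lborel. (\<lambda>n. indicator {a..b} t *\<^sub>R d n t) \<longlonglongrightarrow> indicator {a..b} t *\<^sub>R F' t"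
  proof (rule AE_I'[OF N'], rule subsetI, rule ccontr)
    fix t assume "t \<in> {t \<in> space lborel. \<not> (\<lambda>n. indicator {a..b} t *\<^sub>R d n t) \<longlonglongrightarrow> indicator {a..b} t *\<^sub>R F' t}"
      and t: "t \<notin> N \<union> {a, b}"
    then have "t \<in> {a..b}" "\<not> (\<lambda>n. d n t) \<longlonglongrightarrow> F' t" by (cases "t \<in> {a..b}"; simp)+
    moreover have "(\<lambda>n. d n t) \<longlonglongrightarrow> F' t" by (rule dlim) (use t calculation(1) in auto)
    ultimately show False by simp
  qed
  have AEb: "AE t in lborel. norm (indicator {a..b} t *\<^sub>R d n t) \<le> indicator {a..b} t *\<^sub>R L" for n
    using db by (auto simp: indicator_def L(1))
  have iL: "integrable lborel (\<lambda>t. indicator {a..b} t *\<^sub>R L)"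
    using set_integrable_bounded[of "\<lambda>_. L" a b L] L(1) by (simp add: set_integrable_def)
  have m1: "(\<lambda>t. indicator {a..b} t *\<^sub>R F' t) \<in> borel_measurable lborel" using meas by simp
  have m2: "(\<lambda>t. indicator {a..b} t *\<^sub>R d n t) \<in> borel_measurable lborel" for n using dm[of n] by simp
  show "set_integrable lborel {a..b} F'"
    unfolding set_integrable_def by (rule integrable_dominated_convergence[OF m1 m2 iL AE AEb])
  have lim1: "(\<lambda>n. LINT t:{a..b}|lborel. d n t) \<longlonglongrightarrow> (LINT t:{a..b}|lborel. F' t)"
    unfolding set_lebesgue_integral_def by (rule integral_dominated_convergence[OF m1 m2 iL AE AEb])
  have eq: "(LINT t:{a..b}|lborel. d n t) =
      (P (b + 1 / real (Suc n)) - P b) * real (Suc n) - (P (a + 1 / real (Suc n)) - P a) * real (Suc n)" for n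
  proof -
    define e where "e = 1 / real (Suc n)"
    have e: "0 < e" "e \<le> 1" by (auto simp: e_def)
    have "(LINT t:{a..b}|lborel. d n t) = integral {a..b} (d n)"
      by (rule set_borel_integral_eq_integral(2)) (rule set_integrable_bounded[OF dm db])
    moreover have "(d n has_integral ((P (b + e) - P b) * real (Suc n) - (P (a + e) - P a) * real (Suc n))) {a..b}"
    proof (rule fundamental_theorem_of_calculus[OF ab])
      fix t assume t: "t \<in> {a..b}"
      have "((\<lambda>t. P (t + e)) has_real_derivative H (t + e)) (at t)"
        using DERIV_shift[of P "H (t + e)" t e] P[of "t + e"] t e by auto
      then have "((\<lambda>t. (P (t + e) - P t) * real (Suc n)) has_real_derivative d n t) (at t)"
        unfolding d_def e_def[symmetric] using P[of t] t by (auto intro!: derivative_eq_intros)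
      then show "((\<lambda>t. (P (t + e) - P t) * real (Suc n)) has_vector_derivative d n t) (at t within {a..b})"
        by (simp add: has_real_derivative_iff_has_vector_derivative has_vector_derivative_at_within)
    qed
    ultimately show ?thesis unfolding e_def by (simp add: integral_unique)
  qed
  have "(\<lambda>n. LINT t:{a..b}|lborel. d n t) \<longlonglongrightarrow> H b - H a"
    unfolding eq by (intro tendsto_diff difference_quotient_tendsto P) (use ab in auto)
  then have "(LINT t:{a..b}|lborel. F' t) = H b - H a"
    using lim1 LIMSEQ_unique by blast
  then show "(LINT t:{a..b}|lborel. F' t) = F b - F a" using ab by (simp add: H_def)
qed

lemma lip_FTC:
  assumes "lip a b F" "a \<le> b" "N \<in> null_sets lborel"
    and "\<And>t. t \<in> {a<..<b} \<Longrightarrow> t \<notin> N \<Longrightarrow> (F has_real_derivative F' t) (at t)"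
    and "F' \<in> borel_measurable borel"
  shows "set_integrable lborel {a..b} F'" and "(LINT t:{a..b}|lborel. F' t) = F b - F a"
  by (rule lip_FTC_seq[OF assms(1-3) _ assms(5)], rule difference_quotient_tendsto, rule assms(4), assumption+)+

section \<open>Primitives of bounded measurable functions\<close>

lemma lip_indefinite_integral:
  fixes f :: "real \<Rightarrow> real"
  assumes "f \<in> borel_measurable borel" "\<And>t. t \<in> {a..b} \<Longrightarrow> \<bar>f t\<bar> \<le> C"
  shows "lip a b (\<lambda>x. LINT s:{a..x}|lborel. f s)"
proof (rule lipI[of _ _ _ C])
  have *: "\<bar>(LINT s:{a..t}|lborel. f s) - (LINT s:{a..s}|lborel. f s)\<bar> \<le> C * (t - s)"
    if "s \<in> {a..b}" "t \<in> {a..b}" "s \<le> t" for s t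
  proof -
    have "set_integrable lborel {a..t} f" by (rule set_integrable_bounded[OF assms(1), of _ _ C]) (use assms that in auto)
    then have "(LINT s:{a..t}|lborel. f s) = (LINT s:{a..s}|lborel. f s) + (LINT s:{s..t}|lborel. f s)"
      by (rule set_integral_split) (use that in auto)
    moreover have "\<bar>LINT s:{s..t}|lborel. f s\<bar> \<le> C * (t - s)"
      by (rule set_integral_bounded) (use assms that in auto)
    ultimately show ?thesis by simp
  qed
  fix s t assume "s \<in> {a..b}" "t \<in> {a..b}"
  then show "\<bar>(LINT s:{a..s}|lborel. f s) - (LINT s:{a..t}|lborel. f s)\<bar> \<le> C * \<bar>s - t\<bar>"
    using *[of s t] *[of t s] by (cases "s \<le> t") (auto simp: abs_minus_commute)
qed

lemma indefinite_integral_deriv: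
  fixes f :: "real \<Rightarrow> real"
  assumes "f \<in> borel_measurable borel" "\<And>t. t \<in> {a..b} \<Longrightarrow> \<bar>f t\<bar> \<le> C" "isCont f t" "t \<in> {a<..<b}"
  shows "((\<lambda>x. LINT s:{a..x}|lborel. f s) has_real_derivative f t) (at t)"
proof -
  have i: "set_integrable lborel {a..x} f" if "x \<le> b" for x
    by (rule set_integrable_bounded[OF assms(1), of _ _ C]) (use assms that in auto)
  have "((\<lambda>x. integral {a..x} f) has_vector_derivative f t) (at t within {a..b} - {})"
    by (rule integral_has_vector_derivative_continuous_at[OF set_borel_integral_eq_integral(1)[OF i]])
       (use assms in \<open>auto simp: continuous_at_imp_continuous_within\<close>)
  then have "((\<lambda>x. integral {a..x} f) has_real_derivative f t) (at t)"
    using assms(4) by (auto simp: has_real_derivative_iff_has_vector_derivative at_within_Icc_at)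
  then show ?thesis
    by (rule has_field_derivative_transform_within_open[OF _ _ assms(4)])
       (use set_borel_integral_eq_integral(2)[OF i] in auto)
qed

lemma lip_continuous: assumes "\<And>a b. lip a b F" shows "continuous_on UNIV F"
proof -
  have "isCont F t" for t
  proof -
    have "continuous_on {t - 1..t + 1} F" by (rule lip_continuous_on[OF assms])
    then have "continuous_on {t - 1<..<t + 1} F" by (rule continuous_on_subset) auto
    then show ?thesis by (simp add: continuous_on_eq_continuous_at)
  qed
  then show ?thesis by (simp add: continuous_at_imp_continuous_on)
qed

lemma lip_measurable: "(\<And>a b. lip a b F) \<Longrightarrow> F \<in> borel_measurable borel"
  by (intro borel_measurable_continuous_onI lip_continuous)

section \<open>Periodic extension\<close>

text \<open>Representative in \<open>{0..<T}\<close> of the class of \<open>t\<close> on the circle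
  of length \<open>T\<close>; composing with it is how periodic extensions are built.\<close>

definition tmod :: "real \<Rightarrow> real \<Rightarrow> real" where "tmod T t = t - T * of_int \<lfloor>t / T\<rfloor>"

lemma tmod_range: assumes "T > 0" shows "0 \<le> tmod T t" "tmod T t < T"
  using floor_divide_lower[OF assms, of t] floor_divide_upper[OF assms, of t]
  by (simp_all add: tmod_def algebra_simps)

lemma tmod_id: assumes "T > 0" "0 \<le> t" "t < T" shows "tmod T t = t"
proof -
  have "\<lfloor>t / T\<rfloor> = 0" using assms by (intro floor_unique) auto
  then show ?thesis by (simp add: tmod_def)
qed

lemma tmod_shift: assumes "T > 0" shows "tmod T (t + T * of_int k) = tmod T t"
proof -
  have "(t + T * of_int k) / T = t / T + of_int k" using assms by (simp add: field_simps)
  then show ?thesis by (simp add: tmod_def algebra_simps)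
qed

lemma tmod_periodic: "T > 0 \<Longrightarrow> tmod T (t + T) = tmod T t"
  using tmod_shift[of T t 1] by simp

text \<open>For time reversal: the mirror image of an exceptional set that is a union of translates
  by the period is again of that form.\<close>

lemma tmod_uminus: "T > 0 \<Longrightarrow> tmod T (- tmod T t) = tmod T (- t)"
  using tmod_shift[of T "- t" "\<lfloor>t / T\<rfloor>"] by (simp add: tmod_def)

lemma tmod_measurable [measurable]: "tmod T \<in> borel_measurable borel"
  unfolding tmod_def[abs_def] by measurable

lemma periodic_shift:
  fixes f :: "real \<Rightarrow> 'a"
  assumes "\<And>t. f (t + T) = f t" shows "f (t + T * of_int k) = f t"
proof -
  have n: "f (t + T * of_nat n) = f t" for t n
  proof (induction n)
    case (Suc n)
    have "t + T * of_nat (Suc n) = (t + T * of_nat n) + T" by (simp add: algebra_simps)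
    then show ?case using assms Suc by metis
  qed simp
  show ?thesis
  proof (cases "k \<ge> 0")
    case True
    then show ?thesis using n[of t "nat k"] by simp
  next
    case False
    then show ?thesis using n[of "t + T * of_int k" "nat (- k)"] by (simp add: algebra_simps)
  qed
qed

lemma periodic_fm:
  fixes f :: "real \<Rightarrow> 'a"
  assumes "\<And>t. f (t + T) = f t" shows "f (tmod T t) = f t"
  using periodic_shift[of f T t "- \<lfloor>t / T\<rfloor>", OF assms] by (simp add: tmod_def)

text \<open>Multiples of \<open>T\<close> are excluded because \<open>tmod T\<close> jumps there;
  elsewhere it is locally a translation, so derivatives and continuity carry over.\<close>

lemma tmod_local:
  assumes "T > 0" "tmod T t \<noteq> 0"
  shows "\<exists>S. open S \<and> t \<in> S \<and> (\<forall>s\<in>S. tmod T s = s - T * of_int \<lfloor>t / T\<rfloor>)"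
proof (intro exI conjI ballI)
  define k where "k = \<lfloor>t / T\<rfloor>"
  let ?S = "{T * of_int k<..<T * of_int k + T}"
  show "open ?S" by simp
  show "t \<in> ?S" using tmod_range[OF assms(1), of t] assms(2) by (auto simp: tmod_def k_def)
  fix s assume s: "s \<in> ?S"
  then have "\<lfloor>s / T\<rfloor> = k" using assms(1) by (intro floor_unique) (auto simp: field_simps)
  then show "tmod T s = s - T * of_int \<lfloor>t / T\<rfloor>" by (simp add: tmod_def k_def)
qed

lemma tmod_deriv:
  fixes F :: "real \<Rightarrow> real"
  assumes "T > 0" "tmod T t \<noteq> 0" "(F has_real_derivative D) (at (tmod T t))"
  shows "((\<lambda>t. F (tmod T t)) has_real_derivative D) (at t)"
proof -
  obtain S where S: "open S" "t \<in> S" "\<forall>s\<in>S. tmod T s = s - T * of_int \<lfloor>t / T\<rfloor>"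
    using tmod_local[OF assms(1,2)] by blast
  define k where "k = T * of_int \<lfloor>t / T\<rfloor>"
  have "((\<lambda>s. F (s + (- k))) has_real_derivative D) (at t)"
    using assms(3) DERIV_shift[of F D t "- k"] by (simp add: tmod_def k_def)
  then show ?thesis
    by (rule has_field_derivative_transform_within_open[OF _ S(1,2)]) (use S(3) in \<open>simp add: k_def\<close>)
qed

lemma tmod_isCont:
  fixes F :: "real \<Rightarrow> real"
  assumes "T > 0" "tmod T t \<noteq> 0" "isCont F (tmod T t)"
  shows "isCont (\<lambda>t. F (tmod T t)) t"
proof -
  obtain S where S: "open S" "t \<in> S" "\<forall>s\<in>S. tmod T s = s - T * of_int \<lfloor>t / T\<rfloor>"
    using tmod_local[OF assms(1,2)] by blast
  define k where "k = T * of_int \<lfloor>t / T\<rfloor>"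
  have "isCont (\<lambda>s. F (s - k)) t"
    by (rule isCont_o2) (use assms(3) in \<open>auto simp: tmod_def k_def\<close>)
  moreover have "eventually (\<lambda>s. F (tmod T s) = F (s - k)) (nhds t)"
    unfolding eventually_nhds using S by (auto simp: k_def)
  ultimately show ?thesis by (simp add: isCont_cong)
qed

text \<open>When \<open>s\<close> and \<open>t\<close> lie in different periods, the increment is
  routed through the period end, where \<open>F T = F 0\<close>; the two legs have total length at
  most \<open>t - s\<close>, even if whole periods lie between.\<close>

lemma tmod_lip:
  assumes T: "T > 0" and "lip 0 T F" "F 0 = F T"
  shows "lip a b (\<lambda>t. F (tmod T t))"
proof -
  obtain L where L: "L \<ge> 0" "\<And>s t. s \<in> {0..T} \<Longrightarrow> t \<in> {0..T} \<Longrightarrow> \<bar>F s - F t\<bar> \<le> L * \<bar>s - t\<bar>"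
    using lipE[OF assms(2)] by metis
  note r = tmod_range[OF T]
  have *: "\<bar>F (tmod T s) - F (tmod T t)\<bar> \<le> L * (t - s)" if "s \<le> t" for s t
  proof (cases "\<lfloor>s / T\<rfloor> = \<lfloor>t / T\<rfloor>")
    case True
    then have "tmod T s - tmod T t = s - t" by (simp add: tmod_def)
    then show ?thesis using L(2)[of "tmod T s" "tmod T t"] r[of s] r[of t] that by auto
  next
    case False
    have "\<lfloor>s / T\<rfloor> \<le> \<lfloor>t / T\<rfloor>" using that T by (intro floor_mono divide_right_mono) auto
    then have "real_of_int \<lfloor>s / T\<rfloor> + 1 \<le> real_of_int \<lfloor>t / T\<rfloor>" using False by linarith
    then have "T * (of_int \<lfloor>s / T\<rfloor> + 1) \<le> T * of_int \<lfloor>t / T\<rfloor>" using T by (intro mult_left_mono) auto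
    then have d: "tmod T t - tmod T s + T \<le> t - s" by (simp add: tmod_def algebra_simps)
    have "\<bar>F (tmod T s) - F (tmod T t)\<bar> \<le> \<bar>F T - F (tmod T s)\<bar> + \<bar>F (tmod T t) - F 0\<bar>"
      using assms(3) by simp
    also have "\<dots> \<le> L * (T - tmod T s) + L * tmod T t"
      using L(2)[of T "tmod T s"] L(2)[of "tmod T t" 0] r[of s] r[of t] T by (intro add_mono) auto
    also have "\<dots> = L * (tmod T t - tmod T s + T)" by (simp add: algebra_simps)
    also have "\<dots> \<le> L * (t - s)" by (rule mult_left_mono[OF d L(1)])
    finally show ?thesis .
  qed
  show ?thesis
  proof (rule lipI[of _ _ _ L])
    fix s t show "\<bar>F (tmod T s) - F (tmod T t)\<bar> \<le> L * \<bar>s - t\<bar>"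
      using *[of s t] *[of t s] by (cases "s \<le> t") (auto simp: abs_minus_commute)
  qed
qed

lemma null_set_fm_vimage:
  assumes "T > 0" "N \<in> null_sets lborel"
  shows "{t. tmod T t \<in> N} \<in> null_sets lborel"
proof -
  have "(\<Union>k::int. {t. t - T * of_int k \<in> N}) \<in> null_sets lborel"
    by (intro null_sets_UN null_sets_translation assms)
  moreover have "{t. tmod T t \<in> N} \<subseteq> (\<Union>k::int. {t. t - T * of_int k \<in> N})"
    by (auto simp: tmod_def)
  moreover have "{t. tmod T t \<in> N} \<in> sets lborel"
    using assms(2) measurable_sets[OF tmod_measurable[of T], of N] by (auto simp: vimage_def null_sets_def)
  ultimately show ?thesis by (meson null_sets_subset)
qed

section \<open>Linear equations with periodic coefficients\<close>

text \<open>Solution of \<open>u' = A u\<close> with one exceptional set \<open>N\<close> for all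
  components. The Lipschitz clause is what lets the equation off a null set determine the
  increments.\<close>

definition sol :: "(real \<Rightarrow> 'v \<Rightarrow> 'v \<Rightarrow> real) \<Rightarrow> real set \<Rightarrow> (real \<Rightarrow> 'v::finite \<Rightarrow> real) \<Rightarrow> bool" where
  "sol A N u \<longleftrightarrow> (\<forall>y a b. lip a b (\<lambda>t. u t y)) \<and>
     (\<forall>t y. t \<notin> N \<longrightarrow> ((\<lambda>t. u t y) has_real_derivative (\<Sum>z\<in>UNIV. A t y z * u t z)) (at t))"

text \<open>Since the diagonal is at least \<open>- k\<close>, each \<open>exp (k t) u\<close> is
  nondecreasing, so a zero propagates backwards in time and, by periodicity, to all times. A
  component that vanishes identically has derivative zero; this derivative is a sum of nonnegative
  terms, so the neighbours along \<open>Ed\<close> vanish too, and connectedness finishes.\<close>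

lemma strong_positivity:
  fixes u :: "real \<Rightarrow> 'v::finite \<Rightarrow> real"
  assumes T: "T > 0" and sol: "sol A N u" and N: "N \<in> null_sets lborel"
    and per: "\<And>t. u (t + T) = u t" and nn: "\<And>t y. u t y \<ge> 0"
    and meas: "\<And>y z. (\<lambda>t. A t y z) \<in> borel_measurable borel"
    and off: "\<And>t y z. y \<noteq> z \<Longrightarrow> A t y z \<ge> 0" and diag: "\<And>t y. A t y y \<ge> - k"
    and pos: "\<And>t y z. (y, z) \<in> Ed \<Longrightarrow> y \<noteq> z \<and> A t y z > 0" and conn: "\<And>y z. (y, z) \<in> Ed\<^sup>*"
    and zero: "u t0 y0 = 0"
  shows "u t y = 0"
proof -
  have lip: "lip a b (\<lambda>t. u t y)" for a b y using sol by (auto simp: sol_def)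
  have um: "(\<lambda>t. u t y) \<in> borel_measurable borel" for y by (rule lip_measurable[OF lip])
  have all: "u s y = 0" if z: "u t y = 0" for s t y
  proof -
    \<comment> \<open>A whole number of periods carries \<open>s\<close> to a point
      \<open>s'\<close> not after \<open>t\<close>, where monotonicity applies.\<close>
    define n where "n = \<lceil>(s - t) / T\<rceil>"
    define s' where "s' = s - T * of_int n"
    have s't: "s' \<le> t"
    proof -
      have "(s - t) / T \<le> of_int n" by (simp add: n_def)
      then show ?thesis using T by (simp add: s'_def field_simps)
    qed
    have us: "u s' = u s" using periodic_shift[of u T s "- n", OF per] by (simp add: s'_def)
    let ?F = "\<lambda>t. exp (k * t) * u t y"
    let ?F' = "\<lambda>t. exp (k * t) * (k * u t y + (\<Sum>z\<in>UNIV. A t y z * u t z))"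
    have pos': "?F' t \<ge> 0" for t
    proof -
      have "k * u t y + (\<Sum>z\<in>UNIV. A t y z * u t z) =
          (k + A t y y) * u t y + (\<Sum>z\<in>UNIV - {y}. A t y z * u t z)"
        by (subst sum.remove[of UNIV y]) (auto simp: algebra_simps)
      also have "\<dots> \<ge> 0"
        by (rule add_nonneg_nonneg, rule mult_nonneg_nonneg)
          (use diag[of t y] nn off in \<open>auto intro!: sum_nonneg mult_nonneg_nonneg\<close>)
      finally show ?thesis by simp
    qed
    have "(LINT t:{s'..t}|lborel. ?F' t) = ?F t - ?F s'"
    proof (rule lip_FTC(2)[OF _ s't N])
      show "lip s' t ?F" by (intro lip_mult lip_exp lip)
      fix v assume "v \<notin> N"
      then have "((\<lambda>t. u t y) has_real_derivative (\<Sum>z\<in>UNIV. A v y z * u v z)) (at v)"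
        using sol by (auto simp: sol_def)
      then show "(?F has_real_derivative ?F' v) (at v)"
        by (auto intro!: derivative_eq_intros simp: algebra_simps)
    next
      show "?F' \<in> borel_measurable borel" using um meas by measurable
    qed
    moreover have "(LINT t:{s'..t}|lborel. ?F' t) \<ge> 0"
      unfolding set_lebesgue_integral_def
      by (rule integral_nonneg_AE) (use pos' in \<open>auto simp: indicator_def\<close>)
    ultimately have "exp (k * s') * u s' y \<le> 0" using z by simp
    then have "u s' y \<le> 0" by (simp add: mult_le_0_iff)
    then show ?thesis using nn[of s' y] us by simp
  qed
  \<comment> \<open>One time off \<open>N\<close> is enough, since the derivative of a vanishing
    component is inspected only there.\<close>
  have ne: "\<exists>t. t \<notin> N"
  proof (rule ccontr)
    assume "\<not> (\<exists>t. t \<notin> N)"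
    then have "N = UNIV" by auto
    then show False using N by (auto simp: null_sets_def)
  qed
  have step: "\<exists>t. u t z = 0" if "\<exists>t. u t y = 0" "(y, z) \<in> Ed" for y z
  proof -
    have uy: "u s y = 0" for s using that(1) all by blast
    obtain t where t: "t \<notin> N" using ne by blast
    have "((\<lambda>t. u t y) has_real_derivative (\<Sum>z\<in>UNIV. A t y z * u t z)) (at t)"
      using sol t by (auto simp: sol_def)
    moreover have "((\<lambda>t. u t y) has_real_derivative 0) (at t)" by (simp add: uy)
    ultimately have 0: "(\<Sum>z\<in>UNIV. A t y z * u t z) = 0" by (rule DERIV_unique)
    have nn': "A t y w * u t w \<ge> 0" for w
      by (cases "w = y") (use uy off nn in auto)
    have "A t y z * u t z = 0"
      using sum_nonneg_eq_0_iff[of UNIV "\<lambda>z. A t y z * u t z"] 0 nn' by simp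
    then show ?thesis using pos[OF that(2), of t] by auto
  qed
  have "(y0, y) \<in> Ed\<^sup>*" by (rule conn)
  then have "\<exists>t. u t y = 0"
    by (induction rule: rtrancl_induct) (use zero step in blast)+
  then show ?thesis using all by blast
qed

section \<open>Existence of solutions by monotone Picard iteration\<close>

fun picard :: "(real \<Rightarrow> 'v::finite \<Rightarrow> 'v \<Rightarrow> real) \<Rightarrow> ('v \<Rightarrow> real) \<Rightarrow> nat \<Rightarrow> real \<Rightarrow> 'v \<Rightarrow> real" where
  "picard B v 0 t y = v y"
| "picard B v (Suc n) t y = v y + (LINT s:{0..t}|lborel. (\<Sum>z\<in>UNIV. B s y z * picard B v n s z))"

text \<open>The cut-off written as a condition on the pair of variables makes the integrand jointly
  measurable, so measurability of parameter integrals applies.\<close>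

lemma indefinite_integral_measurable:
  fixes f :: "real \<Rightarrow> real"
  assumes [measurable]: "f \<in> borel_measurable borel"
  shows "(\<lambda>t. LINT s:{a..t}|lborel. f s) \<in> borel_measurable borel"
proof -
  have [measurable]: "f \<in> borel_measurable lborel" by simp
  have "(\<lambda>t. LINT s|lborel. (if a \<le> s \<and> s \<le> t then f s else 0)) \<in> borel_measurable borel"
    by measurable
  moreover have "(LINT s:{a..t}|lborel. f s) = (LINT s|lborel. (if a \<le> s \<and> s \<le> t then f s else 0))" for t
    unfolding set_lebesgue_integral_def by (rule Bochner_Integration.integral_cong) auto
  ultimately show ?thesis by simp
qed

text \<open>With nonnegative coefficients the Picard iterates increase, and they stay below
  \<open>exp (D * t)\<close>; the limit solves the integral equation by dominated convergence.
  Monotonicity also yields \<open>v y \<le> u t y\<close>, which later keeps the monodromy matrix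
  above the identity.\<close>

lemma linear_ode_exists:
  fixes B :: "real \<Rightarrow> 'v::finite \<Rightarrow> 'v \<Rightarrow> real"
  assumes meas: "\<And>y z. (\<lambda>t. B t y z) \<in> borel_measurable borel"
    and B0: "\<And>t y z. 0 \<le> B t y z" and BC: "\<And>t y z. B t y z \<le> C"
    and v0: "\<And>y. 0 \<le> v y" and v1: "\<And>y. v y \<le> 1"
  obtains u where "\<And>y. (\<lambda>t. u t y) \<in> borel_measurable borel"
    "\<And>t y. t \<ge> 0 \<Longrightarrow> v y \<le> u t y" "\<And>b. \<exists>M. \<forall>t\<in>{0..b}. \<forall>y. \<bar>u t y\<bar> \<le> M"
    "\<And>t y. t \<ge> 0 \<Longrightarrow> u t y = v y + (LINT s:{0..t}|lborel. (\<Sum>z\<in>UNIV. B s y z * u s z))"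
proof -
  \<comment> \<open>\<open>D\<close> bounds the row sums of \<open>B\<close>, and
    \<open>exp (D * t)\<close> equals 1 plus the integral of \<open>D * exp (D * s)\<close>, so the
    iteration preserves this upper bound.\<close>
  define D where "D = real CARD('v) * C"
  have C0: "C \<ge> 0" using B0 BC order_trans by blast
  then have D0: "D \<ge> 0" by (simp add: D_def)
  let ?P = "picard B v"
  have m: "(\<lambda>t. ?P n t y) \<in> borel_measurable borel" for n y
  proof (induction n arbitrary: y)
    case (Suc n)
    have "(\<lambda>s. \<Sum>z\<in>UNIV. B s y z * ?P n s z) \<in> borel_measurable borel" using Suc meas by measurable
    from indefinite_integral_measurable[OF this, of 0] show ?case by simp
  qed simp
  have expint: "(LINT s:{0..t}|lborel. D * exp (D * s)) = exp (D * t) - 1" if "t \<ge> 0" for t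
  proof -
    have "(LINT s:{0..t}|lborel. D * exp (D * s)) = exp (D * t) - exp (D * 0)"
      by (rule lip_FTC(2)[OF lip_exp that, of "{}"]) (auto intro!: derivative_eq_intros)
    then show ?thesis by simp
  qed
  have bnd: "0 \<le> ?P n t y \<and> ?P n t y \<le> exp (D * t)" if "t \<ge> 0" for n t y
    using that
  proof (induction n arbitrary: t y)
    case 0
    then show ?case using v0 v1 D0 by (auto intro: order_trans[of _ 1])
  next
    case (Suc n)
    have b: "0 \<le> (\<Sum>z\<in>UNIV. B s y z * ?P n s z) \<and> (\<Sum>z\<in>UNIV. B s y z * ?P n s z) \<le> D * exp (D * s)" if "s \<ge> 0" for s
    proof
      show "0 \<le> (\<Sum>z\<in>UNIV. B s y z * ?P n s z)" using Suc.IH[OF that] B0 by (intro sum_nonneg) auto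
      have "(\<Sum>z\<in>UNIV. B s y z * ?P n s z) \<le> (\<Sum>z\<in>(UNIV::'v set). C * exp (D * s))"
        using Suc.IH[OF that] B0 BC C0 by (intro sum_mono mult_mono) auto
      then show "(\<Sum>z\<in>UNIV. B s y z * ?P n s z) \<le> D * exp (D * s)" by (simp add: D_def)
    qed
    have mm: "(\<lambda>s. \<Sum>z\<in>UNIV. B s y z * ?P n s z) \<in> borel_measurable borel" using m meas by measurable
    have bb: "D * exp (D * s) \<le> D * exp (D * t)" if "s \<in> {0..t}" for s
      using that D0 by (intro mult_left_mono) (auto intro: mult_left_mono)
    have "(LINT s:{0..t}|lborel. (\<Sum>z\<in>UNIV. B s y z * ?P n s z)) \<le> (LINT s:{0..t}|lborel. D * exp (D * s))"
    proof (rule set_integral_mono)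
      show "set_integrable lborel {0..t} (\<lambda>s. \<Sum>z\<in>UNIV. B s y z * ?P n s z)"
        by (rule set_integrable_bounded[OF mm, of _ _ "D * exp (D * t)"]) (use b bb in force)
      show "set_integrable lborel {0..t} (\<lambda>s. D * exp (D * s))"
        by (rule set_integrable_bounded[of _ _ _ "D * exp (D * t)"]) (use bb D0 in auto)
    qed (use b in auto)
    moreover have "(LINT s:{0..t}|lborel. (\<Sum>z\<in>UNIV. B s y z * ?P n s z)) \<ge> 0"
      unfolding set_lebesgue_integral_def
      by (rule integral_nonneg_AE) (use b in \<open>auto simp: indicator_def\<close>)
    ultimately show ?case using expint[OF Suc.prems] v0[of y] v1[of y] by simp
  qed
  have Bb: "\<bar>\<Sum>z\<in>UNIV. B s y z * ?P n s z\<bar> \<le> D * exp (D * t)" if "s \<in> {0..t}" for s t y n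
  proof -
    have "\<bar>\<Sum>z\<in>UNIV. B s y z * ?P n s z\<bar> \<le> (\<Sum>z\<in>(UNIV::'v set). C * exp (D * t))"
    proof (rule order_trans[OF sum_abs], rule sum_mono)
      fix z
      have "?P n s z \<le> exp (D * s)" using bnd[of s n z] that by auto
      also have "\<dots> \<le> exp (D * t)" using that D0 by (auto intro: mult_left_mono)
      finally show "\<bar>B s y z * ?P n s z\<bar> \<le> C * exp (D * t)"
        using bnd[of s n z] B0[of s y z] BC[of s y z] C0 that by (auto simp: abs_mult intro!: mult_mono)
    qed
    then show ?thesis by (simp add: D_def)
  qed
  have mm: "(\<lambda>s. \<Sum>z\<in>UNIV. B s y z * ?P n s z) \<in> borel_measurable borel" for n y using m meas by measurable
  have inc: "?P n t y \<le> ?P (Suc n) t y" if "t \<ge> 0" for n t y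
    using that
  proof (induction n arbitrary: t y)
    case 0
    have "(LINT s:{0..t}|lborel. (\<Sum>z\<in>UNIV. B s y z * ?P 0 s z)) \<ge> 0"
      unfolding set_lebesgue_integral_def
      by (rule integral_nonneg_AE) (use B0 v0 in \<open>auto simp: indicator_def intro!: sum_nonneg\<close>)
    then show ?case by simp
  next
    case (Suc n)
    have "(LINT s:{0..t}|lborel. (\<Sum>z\<in>UNIV. B s y z * ?P n s z)) \<le> (LINT s:{0..t}|lborel. (\<Sum>z\<in>UNIV. B s y z * ?P (Suc n) s z))"
    proof (rule set_integral_mono)
      show "set_integrable lborel {0..t} (\<lambda>s. \<Sum>z\<in>UNIV. B s y z * ?P n s z)"
        by (rule set_integrable_bounded[OF mm Bb])
      show "set_integrable lborel {0..t} (\<lambda>s. \<Sum>z\<in>UNIV. B s y z * ?P (Suc n) s z)"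
        by (rule set_integrable_bounded[OF mm Bb])
      fix s assume "s \<in> {0..t}"
      then show "(\<Sum>z\<in>UNIV. B s y z * ?P n s z) \<le> (\<Sum>z\<in>UNIV. B s y z * ?P (Suc n) s z)"
        by (intro sum_mono mult_left_mono Suc.IH B0) auto
    qed
    then show ?case by simp
  qed
  define u where "u t y = lim (\<lambda>n. ?P n t y)" for t y
  have lim: "(\<lambda>n. ?P n t y) \<longlonglongrightarrow> u t y" if "t \<ge> 0" for t y
  proof -
    have "incseq (\<lambda>n. ?P n t y)" using inc[OF that] by (intro incseq_SucI)
    moreover have "Bseq (\<lambda>n. ?P n t y)" using bnd[OF that] by (intro BseqI'[of _ "exp (D * t)"]) auto
    ultimately have "convergent (\<lambda>n. ?P n t y)" by (intro Bseq_mono_convergent) (auto simp: incseq_def)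
    then show ?thesis by (simp add: u_def convergent_LIMSEQ_iff)
  qed
  have um: "(\<lambda>t. u t y) \<in> borel_measurable borel" for y
    unfolding u_def using m by measurable
  have ub: "v y \<le> u t y \<and> u t y \<le> exp (D * t)" if "t \<ge> 0" for t y
  proof
    have "incseq (\<lambda>n. ?P n t y)" using inc[OF that] by (intro incseq_SucI)
    from incseq_le[OF this lim[OF that], of 0] show "v y \<le> u t y" by simp
    show "u t y \<le> exp (D * t)" using bnd[OF that] by (intro LIMSEQ_le_const2[OF lim[OF that]]) auto
  qed
  show thesis
  proof (rule that[of u])
    fix b show "\<exists>M. \<forall>t\<in>{0..b}. \<forall>y. \<bar>u t y\<bar> \<le> M"
    proof (intro exI[of _ "exp (D * b)"] ballI allI)
      fix t y assume t: "t \<in> {0..b}"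
      have "exp (D * t) \<le> exp (D * b)" using t D0 by (auto intro: mult_left_mono)
      moreover have "0 \<le> u t y" using ub[of t y] v0[of y] t by auto
      moreover have "u t y \<le> exp (D * t)" using ub[of t y] t by auto
      ultimately show "\<bar>u t y\<bar> \<le> exp (D * b)" by linarith
    qed
  next
    fix t :: real and y assume t: "t \<ge> 0"
    have "(\<lambda>n. LINT s:{0..t}|lborel. (\<Sum>z\<in>UNIV. B s y z * ?P n s z)) \<longlonglongrightarrow> (LINT s:{0..t}|lborel. (\<Sum>z\<in>UNIV. B s y z * u s z))"
      unfolding set_lebesgue_integral_def
    proof (rule integral_dominated_convergence[where w = "\<lambda>s. indicator {0..t} s *\<^sub>R (D * exp (D * t))"])
      show "integrable lborel (\<lambda>s. indicator {0..t} s *\<^sub>R (D * exp (D * t)))"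
        using set_integrable_bounded[of "\<lambda>_. D * exp (D * t)" 0 t "D * exp (D * t)"] D0 by (simp add: set_integrable_def)
      show "AE s in lborel. norm (indicator {0..t} s *\<^sub>R (\<Sum>z\<in>UNIV. B s y z * ?P n s z)) \<le> indicator {0..t} s *\<^sub>R (D * exp (D * t))" for n
        using Bb[of _ t y n] by (intro AE_I2) (auto simp: indicator_def)
      show "AE s in lborel. (\<lambda>n. indicator {0..t} s *\<^sub>R (\<Sum>z\<in>UNIV. B s y z * ?P n s z)) \<longlonglongrightarrow> indicator {0..t} s *\<^sub>R (\<Sum>z\<in>UNIV. B s y z * u s z)"
      proof (rule AE_I2)
        fix s show "(\<lambda>n. indicator {0..t} s *\<^sub>R (\<Sum>z\<in>UNIV. B s y z * ?P n s z)) \<longlonglongrightarrow> indicator {0..t} s *\<^sub>R (\<Sum>z\<in>UNIV. B s y z * u s z)"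
          by (cases "s \<in> {0..t}") (auto intro!: tendsto_intros lim)
      qed
    qed (use mm um meas in measurable)
    then have "(\<lambda>n. ?P (Suc n) t y) \<longlonglongrightarrow> v y + (LINT s:{0..t}|lborel. (\<Sum>z\<in>UNIV. B s y z * u s z))"
      by (auto intro!: tendsto_intros)
    moreover have "(\<lambda>n. ?P (Suc n) t y) \<longlonglongrightarrow> u t y" using lim[OF t, of y] by (rule LIMSEQ_Suc)
    ultimately show "u t y = v y + (LINT s:{0..t}|lborel. (\<Sum>z\<in>UNIV. B s y z * u s z))"
      by (rule LIMSEQ_unique[rotated])
  qed (use um ub in auto)
qed

lemma lip_cong: "(\<And>t. t \<in> {a..b} \<Longrightarrow> F t = G t) \<Longrightarrow> lip a b F \<longleftrightarrow> lip a b G"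
  by (simp add: lip_def)

section \<open>A periodic Perron-Frobenius theorem\<close>

lemma convex_prob_vecs: "convex (prob_vecs :: (real^'v::finite) set)"
proof (rule convexI)
  fix x y :: "real^'v" and u v :: real
  assume "x \<in> prob_vecs" "y \<in> prob_vecs" "0 \<le> u" "0 \<le> v" "u + v = 1"
  then show "u *\<^sub>R x + v *\<^sub>R y \<in> prob_vecs"
    by (auto simp: prob_vecs_def sum.distrib simp flip: sum_distrib_left)
qed

lemma compact_prob_vecs: "compact (prob_vecs :: (real^'v::finite) set)"
proof -
  have "prob_vecs = (\<Inter>y. {x :: real^'v. 0 \<le> x $ y}) \<inter> {x. (\<Sum>y\<in>UNIV. x $ y) = 1}"
    by (auto simp: prob_vecs_def)
  moreover have "closed \<dots>"
    by (intro closed_Int closed_INT ballI closed_Collect_le closed_Collect_eq continuous_intros)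
  moreover have "norm x \<le> 1" if "x \<in> prob_vecs" for x :: "real^'v"
    using norm_le_l1_cart[of x] that by (auto simp: prob_vecs_def)
  ultimately show ?thesis by (auto simp: compact_eq_bounded_closed bounded_iff)
qed

lemma prob_vecs_ne: "(prob_vecs :: (real^'v::finite) set) \<noteq> {}"
proof -
  have "(\<chi> y. 1 / real CARD('v)) \<in> (prob_vecs :: (real^'v::finite) set)"
    by (auto simp: prob_vecs_def)
  then show ?thesis by blast
qed

text \<open>Brouwer's theorem on the simplex, for the map that applies \<open>U\<close> and rescales
  to total mass 1. The entries are at least those of the identity, so the rescaling factor is at
  least 1 and serves as the eigenvalue.\<close>

lemma perron_eigenvector:
  fixes U :: "'v::finite \<Rightarrow> 'v \<Rightarrow> real"
  assumes "\<And>y z. U y z \<ge> (if y = z then 1 else 0)"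
  obtains x :: "real^'v" and \<rho> where "x \<in> prob_vecs" "\<rho> > 0" "\<And>y. (\<Sum>z\<in>UNIV. U y z * x $ z) = \<rho> * x $ y"
proof -
  define s where "s x = (\<Sum>y\<in>UNIV. \<Sum>z\<in>UNIV. U y z * x $ z)" for x :: "real^'v"
  define f where "f x = (\<chi> y. (\<Sum>z\<in>UNIV. U y z * x $ z) / s x)" for x :: "real^'v"
  have U0: "U y z \<ge> 0" for y z using assms[of y z] by (auto split: if_splits)
  have s1: "s x \<ge> 1" if "x \<in> prob_vecs" for x
  proof -
    have "1 = (\<Sum>y\<in>UNIV. \<Sum>z\<in>UNIV. (if y = z then 1 else 0) * x $ z)"
      using that by (auto simp: prob_vecs_def if_distrib[of "\<lambda>a. a * _"] cong: if_cong)
    also have "\<dots> \<le> s x" unfolding s_def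
      using that by (intro sum_mono mult_right_mono assms) (auto simp: prob_vecs_def)
    finally show ?thesis .
  qed
  have sc: "continuous_on A s" for A unfolding s_def by (intro continuous_intros)
  have "continuous_on prob_vecs f"
    unfolding f_def by (intro continuous_on_vec_lambda continuous_on_divide continuous_intros sc)
      (use s1 in fastforce)
  moreover have "f \<in> prob_vecs \<rightarrow> prob_vecs"
  proof
    fix x :: "real^'v" assume x: "x \<in> prob_vecs"
    have "(\<Sum>y\<in>UNIV. f x $ y) = 1"
      using s1[OF x] by (simp add: f_def s_def flip: sum_divide_distrib)
    moreover have "f x $ y \<ge> 0" for y
      using x s1[OF x] U0 by (auto simp: f_def prob_vecs_def intro!: divide_nonneg_pos sum_nonneg)
    ultimately show "f x \<in> prob_vecs" by (simp add: prob_vecs_def)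
  qed
  ultimately obtain x where x: "x \<in> prob_vecs" "f x = x"
    using brouwer[OF compact_prob_vecs convex_prob_vecs prob_vecs_ne, of f] by metis
  show thesis
  proof (rule that[OF x(1), of "s x"])
    show "s x > 0" using s1[OF x(1)] by simp
    fix y
    have "(\<Sum>z\<in>UNIV. U y z * x $ z) / s x = x $ y" using x(2) by (simp add: f_def vec_eq_iff)
    then show "(\<Sum>z\<in>UNIV. U y z * x $ z) = s x * x $ y" using s1[OF x(1)] by (simp add: field_simps)
  qed
qed

text \<open>Floquet theory: the fundamental matrix over one period has a Perron eigenvector
  \<open>x\<close>; starting from \<open>x\<close> and discounting by the exponential rate of its
  eigenvalue gives a solution that returns to its starting value, hence extends
  periodically.\<close>

lemma perron_periodic:
  fixes A :: "real \<Rightarrow> 'v::finite \<Rightarrow> 'v \<Rightarrow> real"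
  assumes T: "T > 0" and N0: "N0 \<in> null_sets lborel" "0 \<in> N0" and N: "N = {t. tmod T t \<in> N0}"
    and meas: "\<And>y z. (\<lambda>t. A t y z) \<in> borel_measurable borel"
    and bd: "\<And>t y z. \<bar>A t y z\<bar> \<le> k" and off: "\<And>t y z. y \<noteq> z \<Longrightarrow> A t y z \<ge> 0"
    and per: "\<And>t. A (t + T) = A t"
    and cont: "\<And>t y z. t \<notin> N \<Longrightarrow> isCont (\<lambda>t. A t y z) t"
    and pos: "\<And>t y z. (y, z) \<in> Ed \<Longrightarrow> y \<noteq> z \<and> A t y z > 0" and conn: "\<And>y z. (y, z) \<in> Ed\<^sup>*"
  obtains L g where "sol (\<lambda>t y z. A t y z - (if y = z then L else 0)) N g"
    "\<And>t. g (t + T) = g t" "\<And>t y. g t y > 0"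
proof -
  \<comment> \<open>Adding \<open>k\<close> on the diagonal makes all coefficients nonnegative, as
    the monotone iteration requires; the shift is taken back in \<open>L = c - k\<close>.\<close>
  define B where "B t y z = A t y z + (if y = z then k else 0)" for t y z
  have k0: "k \<ge> 0" using bd[of 0 undefined undefined] by linarith
  have Bm: "(\<lambda>t. B t y z) \<in> borel_measurable borel" for y z unfolding B_def using meas by measurable
  have B0: "0 \<le> B t y z" and BC: "B t y z \<le> 2 * k" for t y z
    using bd[of t y z] off[of y z t] k0 by (auto simp: B_def)
  have Bc: "isCont (\<lambda>t. B t y z) t" if "t \<notin> N" for t y z
    unfolding B_def by (intro continuous_intros cont that)
  \<comment> \<open>\<open>P z u\<close> says that \<open>u\<close> is the column of the fundamental
    matrix that starts at the unit vector \<open>z\<close>.\<close>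
  define P where "P z u \<longleftrightarrow> (\<forall>y. (\<lambda>t. u t y) \<in> borel_measurable borel) \<and>
      (\<forall>t y. t \<ge> 0 \<longrightarrow> (if y = z then 1 else 0) \<le> u t y) \<and> (\<forall>b. \<exists>M. \<forall>t\<in>{0..b}. \<forall>y. \<bar>u t y\<bar> \<le> M) \<and>
      (\<forall>t y. t \<ge> 0 \<longrightarrow> u t y = (if y = z then 1 else 0) + (LINT s:{0..t}|lborel. (\<Sum>w\<in>UNIV. B s y w * u s w)))"
    for z and u :: "real \<Rightarrow> 'v \<Rightarrow> real"
  have "\<exists>u. P z u" for z
  proof (rule linear_ode_exists[where B = B and C = "2 * k" and v = "\<lambda>y. if y = z then 1 else 0"])
    fix u assume "\<And>y. (\<lambda>t. u t y) \<in> borel_measurable borel"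
      "\<And>t y. t \<ge> 0 \<Longrightarrow> (if y = z then 1 else 0) \<le> u t y" "\<And>b. \<exists>M. \<forall>t\<in>{0..b}. \<forall>y. \<bar>u t y\<bar> \<le> M"
      "\<And>t y. t \<ge> 0 \<Longrightarrow> u t y = (if y = z then 1 else 0) + (LINT s:{0..t}|lborel. (\<Sum>z\<in>UNIV. B s y z * u s z))"
    then have "P z u" unfolding P_def by blast
    then show "\<exists>u. P z u" by blast
  qed (use Bm B0 BC in auto)
  then obtain U where U: "\<And>z. P z (U z)" by metis
  have Um: "(\<lambda>t. U z t y) \<in> borel_measurable borel" for z y using U by (simp add: P_def)
  have U1: "(if y = z then 1 else 0) \<le> U z t y" if "t \<ge> 0" for z t y using U that unfolding P_def by blast
  have Ueq: "U z t y = (if y = z then 1 else 0) + (LINT s:{0..t}|lborel. (\<Sum>w\<in>UNIV. B s y w * U z s w))"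
    if "t \<ge> 0" for z t y using U that unfolding P_def by blast
  have Ub: "\<exists>M. \<forall>t\<in>{0..T}. \<forall>y. \<bar>\<Sum>w\<in>UNIV. B t y w * U z t w\<bar> \<le> M" for z
  proof -
    obtain M where M: "\<And>t y. t \<in> {0..T} \<Longrightarrow> \<bar>U z t y\<bar> \<le> M" using U unfolding P_def by metis
    show ?thesis
    proof (intro exI ballI allI)
      fix t y assume t: "t \<in> {0..T}"
      have "\<bar>\<Sum>w\<in>UNIV. B t y w * U z t w\<bar> \<le> (\<Sum>w\<in>(UNIV::'v set). (2 * k) * M)"
        by (rule order_trans[OF sum_abs], rule sum_mono)
           (use M[OF t] B0 BC k0 in \<open>auto simp: abs_mult intro!: mult_mono\<close>)
      then show "\<bar>\<Sum>w\<in>UNIV. B t y w * U z t w\<bar> \<le> (\<Sum>w\<in>(UNIV::'v set). (2 * k) * M)" .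
    qed
  qed
  have fmeas: "(\<lambda>t. \<Sum>w\<in>UNIV. B t y w * U z t w) \<in> borel_measurable borel" for y z using Um Bm by measurable
  have Ulip: "lip 0 T (\<lambda>t. U z t y)" for z y
  proof -
    obtain M where "\<forall>t\<in>{0..T}. \<forall>y. \<bar>\<Sum>w\<in>UNIV. B t y w * U z t w\<bar> \<le> M" using Ub by blast
    then have "lip 0 T (\<lambda>t. (if y = z then 1 else 0) + (LINT s:{0..t}|lborel. (\<Sum>w\<in>UNIV. B s y w * U z s w)))"
      by (intro lip_add lip_const lip_indefinite_integral[OF fmeas, of _ _ _ _ M]) auto
    then show ?thesis by (subst lip_cong[OF Ueq]) auto
  qed
  have Uc: "isCont (\<lambda>t. U z t y) t" if "t \<in> {0<..<T}" for z y t
  proof -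
    have "continuous_on {0<..<T} (\<lambda>t. U z t y)"
      by (rule continuous_on_subset[OF lip_continuous_on[OF Ulip[of z y]]]) auto
    then show ?thesis using that by (simp add: continuous_on_eq_continuous_at)
  qed
  have Ud: "((\<lambda>t. U z t y) has_real_derivative (\<Sum>w\<in>UNIV. B t y w * U z t w)) (at t)"
    if t: "t \<in> {0<..<T}" "t \<notin> N" for z y t
  proof -
    obtain M where M: "\<forall>t\<in>{0..T}. \<forall>y. \<bar>\<Sum>w\<in>UNIV. B t y w * U z t w\<bar> \<le> M" using Ub by blast
    have "((\<lambda>t. LINT s:{0..t}|lborel. (\<Sum>w\<in>UNIV. B s y w * U z s w)) has_real_derivative (\<Sum>w\<in>UNIV. B t y w * U z t w)) (at t)"
      by (rule indefinite_integral_deriv[OF fmeas, of _ T _ _ M])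
         (use M t in \<open>auto intro!: continuous_intros Bc Uc\<close>)
    then have "((\<lambda>t. (if y = z then 1 else 0) + (LINT s:{0..t}|lborel. (\<Sum>w\<in>UNIV. B s y w * U z s w))) has_real_derivative (\<Sum>w\<in>UNIV. B t y w * U z t w)) (at t)"
      by (auto intro!: derivative_eq_intros)
    then show ?thesis
      by (rule has_field_derivative_transform_within_open[OF _ _ t(1)]) (use Ueq in auto)
  qed
  have UT: "(if y = z then 1 else 0) \<le> U z T y" for y z using U1 T by (meson less_imp_le)
  obtain x :: "real^'v" and \<rho> where x: "x \<in> prob_vecs" and \<rho>: "\<rho> > 0"
    and eig: "\<And>y. (\<Sum>z\<in>UNIV. U z T y * x $ z) = \<rho> * x $ y"
    by (rule perron_eigenvector[of "\<lambda>y z. U z T y", OF UT]) blast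
  \<comment> \<open>The discount over one period is \<open>exp (- c * T) = 1 / \<rho>\<close>, so
    \<open>g0 T\<close> and \<open>g0 0\<close> are both the eigenvector \<open>x\<close>.\<close>
  define c where "c = ln \<rho> / T"
  define L where "L = c - k"
  define g0 where "g0 t y = exp (- c * t) * (\<Sum>z\<in>UNIV. U z t y * x $ z)" for t y
  have g00: "g0 0 y = x $ y" for y
  proof -
    have "{0..0::real} \<in> null_sets lborel" by auto
    then have "(LINT s:{0..0}|lborel. (\<Sum>w\<in>UNIV. B s y w * U z s w)) = 0" for z
      using set_integral_bounded[OF fmeas[of y z], of 0 0 "\<bar>\<Sum>w\<in>UNIV. B 0 y w * U z 0 w\<bar>"] by simp
    then have "U z 0 y = (if y = z then 1 else 0)" for z using Ueq[of 0 z y] by simp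
    then show ?thesis by (simp add: g0_def if_distrib[of "\<lambda>a. a * _"] cong: if_cong)
  qed
  have g0T: "g0 T y = x $ y" for y
  proof -
    have "exp (- c * T) = 1 / \<rho>" using T \<rho> by (simp add: c_def exp_minus inverse_eq_divide)
    then show ?thesis using \<rho> by (simp add: g0_def eig)
  qed
  have g0lip: "lip 0 T (\<lambda>t. g0 t y)" for y
    unfolding g0_def by (intro lip_mult lip_exp lip_sum lip_const Ulip)
  have g0d: "((\<lambda>t. g0 t y) has_real_derivative (\<Sum>w\<in>UNIV. (A t y w - (if y = w then L else 0)) * g0 t w)) (at t)"
    if t: "t \<in> {0<..<T}" "t \<notin> N" for t y
  proof -
    have "((\<lambda>t. \<Sum>z\<in>UNIV. U z t y * x $ z) has_real_derivative (\<Sum>z\<in>UNIV. (\<Sum>w\<in>UNIV. B t y w * U z t w) * x $ z)) (at t)"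
      by (intro DERIV_sum DERIV_cmult_right Ud t)
    moreover have "((\<lambda>t. exp (- c * t)) has_real_derivative (- c * exp (- c * t))) (at t)"
      by (auto intro!: derivative_eq_intros)
    ultimately have d: "((\<lambda>t. g0 t y) has_real_derivative
        (- c * exp (- c * t)) * (\<Sum>z\<in>UNIV. U z t y * x $ z) + (\<Sum>z\<in>UNIV. (\<Sum>w\<in>UNIV. B t y w * U z t w) * x $ z) * exp (- c * t)) (at t)"
      unfolding g0_def by (rule DERIV_mult[rotated])
    have "(\<Sum>z\<in>UNIV. (\<Sum>w\<in>UNIV. B t y w * U z t w) * x $ z) * exp (- c * t) = (\<Sum>w\<in>UNIV. B t y w * g0 t w)"
      unfolding g0_def sum_distrib_left sum_distrib_right
      by (subst sum.swap) (simp add: mult_ac)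
    also have "\<dots> = (\<Sum>w\<in>UNIV. (A t y w - (if y = w then L else 0)) * g0 t w + (if y = w then c * g0 t w else 0))"
      by (rule sum.cong) (auto simp: B_def L_def algebra_simps)
    also have "\<dots> = (\<Sum>w\<in>UNIV. (A t y w - (if y = w then L else 0)) * g0 t w) + c * g0 t y"
      by (simp add: sum.distrib)
    finally show ?thesis using d by (simp add: g0_def algebra_simps)
  qed
  define g where "g t = g0 (tmod T t)" for t
  have gper: "g (t + T) = g t" for t by (simp add: g_def tmod_periodic[OF T])
  have gsol: "sol (\<lambda>t y z. A t y z - (if y = z then L else 0)) N g"
    unfolding sol_def
  proof (intro conjI allI impI)
    fix y a b show "lip a b (\<lambda>t. g t y)"
      unfolding g_def by (rule tmod_lip[OF T g0lip]) (simp add: g00 g0T)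
  next
    fix t y assume t: "t \<notin> N"
    \<comment> \<open>Having 0 in \<open>N0\<close> excludes the multiples of the period, where the
      two ends of \<open>g0\<close> are glued and a derivative need not exist.\<close>
    then have f0: "tmod T t \<noteq> 0" using N N0(2) by auto
    have fi: "tmod T t \<in> {0<..<T}" using tmod_range[OF T, of t] f0 by auto
    have ff: "tmod T (tmod T t) = tmod T t" using fi by (intro tmod_id[OF T]) auto
    have "tmod T t \<notin> N" using t ff by (simp add: N)
    from tmod_deriv[OF T f0 g0d[OF fi this]]
    show "((\<lambda>t. g t y) has_real_derivative (\<Sum>z\<in>UNIV. (A t y z - (if y = z then L else 0)) * g t z)) (at t)"
      using periodic_fm[of A T t, OF per] by (simp add: g_def)
  qed
  have gnn: "g t y \<ge> 0" for t y
  proof -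
    have "U z (tmod T t) y \<ge> 0" for z
      using U1[of "tmod T t" y z] tmod_range(1)[OF T, of t] by (auto split: if_splits)
    then show ?thesis using x unfolding g_def g0_def
      by (intro mult_nonneg_nonneg sum_nonneg) (auto simp: prob_vecs_def)
  qed
  \<comment> \<open>A zero anywhere would make \<open>g\<close> vanish identically, in particular at
    time 0, where it is the probability vector \<open>x\<close>.\<close>
  have gpos: "g t y > 0" for t y
  proof (rule ccontr)
    assume "\<not> g t y > 0"
    then have z: "g t y = 0" using gnn[of t y] by simp
    have "g 0 w = 0" for w
    proof (rule strong_positivity[OF T gsol _ gper gnn, where k = "k + L" and Ed = Ed])
      show "N \<in> null_sets lborel" unfolding N by (rule null_set_fm_vimage[OF T N0(1)])
      show "- (k + L) \<le> A t y y - (if y = y then L else 0)" for t y using bd[of t y y] by simp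
    qed (use meas off pos conn z in auto)
    then have "x $ w = 0" for w using g00 tmod_id[OF T, of 0] T by (simp add: g_def)
    then show False using x by (simp add: prob_vecs_def)
  qed
  show thesis by (rule that[OF gsol gper gpos])
qed

lemma set_dominated_convergence:
  fixes f :: "real \<Rightarrow> real"
  assumes "f \<in> borel_measurable borel" "\<And>n. s n \<in> borel_measurable borel"
    and w: "set_integrable lborel {a..b} w" and N: "N \<in> null_sets lborel"
    and lim: "\<And>t. t \<in> {a..b} \<Longrightarrow> t \<notin> N \<Longrightarrow> (\<lambda>n. s n t) \<longlonglongrightarrow> f t"
    and bd: "\<And>n t. t \<in> {a..b} \<Longrightarrow> t \<notin> N \<Longrightarrow> \<bar>s n t\<bar> \<le> w t"
  shows "set_integrable lborel {a..b} f"
    and "(\<lambda>n. LINT t:{a..b}|lborel. s n t) \<longlonglongrightarrow> (LINT t:{a..b}|lborel. f t)"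
proof -
  have m1: "(\<lambda>t. indicator {a..b} t *\<^sub>R f t) \<in> borel_measurable lborel" using assms(1) by simp
  have m2: "(\<lambda>t. indicator {a..b} t *\<^sub>R s n t) \<in> borel_measurable lborel" for n using assms(2)[of n] by simp
  have iL: "integrable lborel (\<lambda>t. indicator {a..b} t *\<^sub>R w t)" using w by (simp add: set_integrable_def)
  have nn: "AE t in lborel. t \<notin> N" using N by (rule AE_not_in)
  have AE: "AE t in lborel. (\<lambda>n. indicator {a..b} t *\<^sub>R s n t) \<longlonglongrightarrow> indicator {a..b} t *\<^sub>R f t"
    using nn
  proof eventually_elim
    case (elim t)
    then show ?case using lim[of t] by (cases "t \<in> {a..b}") (auto intro!: tendsto_intros)
  qed
  have AEb: "AE t in lborel. norm (indicator {a..b} t *\<^sub>R s n t) \<le> indicator {a..b} t *\<^sub>R w t" for n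
    using nn
  proof eventually_elim
    case (elim t)
    then show ?case using bd[of t n] by (cases "t \<in> {a..b}") auto
  qed
  show "set_integrable lborel {a..b} f"
    unfolding set_integrable_def by (rule integrable_dominated_convergence[OF m1 m2 iL AE AEb])
  show "(\<lambda>n. LINT t:{a..b}|lborel. s n t) \<longlonglongrightarrow> (LINT t:{a..b}|lborel. f t)"
    unfolding set_lebesgue_integral_def by (rule integral_dominated_convergence[OF m1 m2 iL AE AEb])
qed

section \<open>The Legendre representation of Phi\<close>

lemma ennreal_add_le: "ennreal (u + v) \<le> ennreal u + ennreal v"
proof (cases "u \<ge> 0")
  case u: True
  show ?thesis
  proof (cases "v \<ge> 0")
    case False
    then have "ennreal (u + v) \<le> ennreal u" by (intro ennreal_leI) simp
    then show ?thesis by (simp add: add_increasing2)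
  qed (use u in simp)
next
  case False
  then have "ennreal (u + v) \<le> ennreal v" by (intro ennreal_leI) simp
  then show ?thesis by (simp add: add_increasing)
qed

lemma ennreal_sum_le: "ennreal (\<Sum>i\<in>I. f i) \<le> (\<Sum>i\<in>I. ennreal (f i))"
proof (induction I rule: infinite_finite_induct)
  case (insert i I)
  have "ennreal (sum f (insert i I)) \<le> ennreal (f i) + ennreal (sum f I)"
    using insert by (simp add: ennreal_add_le)
  also have "\<dots> \<le> ennreal (f i) + (\<Sum>i\<in>I. ennreal (f i))" using insert by (intro add_mono) auto
  finally show ?case using insert by simp
qed auto

lemma integral_le_nn_integral:
  fixes f :: "'a \<Rightarrow> real"
  assumes "integrable M f" "\<And>x. x \<in> space M \<Longrightarrow> ennreal (f x) \<le> h x"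
  shows "ennreal (integral\<^sup>L M f) \<le> (\<integral>\<^sup>+x. h x \<partial>M)"
proof -
  have i: "integrable M (\<lambda>x. max 0 (f x))" using assms(1) by simp
  have "ennreal (integral\<^sup>L M f) \<le> ennreal (\<integral>x. max 0 (f x) \<partial>M)"
    by (intro ennreal_leI integral_mono assms i) auto
  also have "\<dots> = (\<integral>\<^sup>+x. ennreal (max 0 (f x)) \<partial>M)"
    by (rule nn_integral_eq_integral[symmetric, OF i]) auto
  also have "\<dots> \<le> (\<integral>\<^sup>+x. h x \<partial>M)"
    by (intro nn_integral_mono) (use assms(2) in \<open>auto simp: max_def ennreal_neg\<close>)
  finally show ?thesis .
qed

text \<open>Young's inequality: \<open>Phi q p\<close> is the Legendre transform at \<open>q\<close>
  of \<open>\<alpha> \<mapsto> p (exp \<alpha> - 1)\<close>, the cumulant generating function of a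
  Poisson variable with mean \<open>p\<close>. It reduces to \<open>1 + x \<le> exp x\<close> at
  \<open>x = \<alpha> - ln (q / p)\<close>; negative left sides become 0 under
  \<open>ennreal\<close>.\<close>

lemma Phi_ge:
  assumes "q \<ge> 0" "p \<ge> 0"
  shows "ennreal (q * \<alpha> - p * (exp \<alpha> - 1)) \<le> Phi q p"
proof -
  consider "q > 0" "p > 0" | "q = 0" | "q > 0" "p = 0" using assms by linarith
  then show ?thesis
  proof cases
    case 1
    have "1 + (\<alpha> - ln (q / p)) \<le> exp (\<alpha> - ln (q / p))" by (rule exp_ge_add_one_self)
    also have "\<dots> = exp \<alpha> * p / q" using 1 by (simp add: exp_diff)
    finally have "q * (1 + (\<alpha> - ln (q / p))) \<le> q * (exp \<alpha> * p / q)" using 1 by (intro mult_left_mono) auto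
    then have "q * \<alpha> - p * (exp \<alpha> - 1) \<le> q * ln (q / p) - (q - p)" using 1 by (simp add: algebra_simps)
    then show ?thesis using 1 by (auto simp: Phi_def intro: ennreal_leI)
  next
    case 2
    have "- (p * (exp \<alpha> - 1)) \<le> p" using assms by (simp add: algebra_simps)
    then show ?thesis using 2 by (auto simp: Phi_def intro: ennreal_leI)
  next
    case 3
    then show ?thesis by (simp add: Phi_def)
  qed
qed

lemma Phi_eq:
  assumes "p \<ge> 0" "q = p * exp \<alpha>"
  shows "Phi q p = ennreal (q * \<alpha> - p * (exp \<alpha> - 1))"
proof (cases "p = 0")
  case False
  then have "p > 0" using assms by simp
  then show ?thesis using assms by (simp add: Phi_def algebra_simps)
qed (use assms in \<open>simp add: Phi_def\<close>)

text \<open>The other half of the duality. The supremum is reached at \<open>ln (q / p)\<close>,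
  approached as \<alpha> tends to minus infinity if \<open>q = 0\<close>, and infinite if
  \<open>q > 0\<close> and \<open>p = 0\<close>. Thus \<open>Phi\<close> is a supremum of affine
  functions, from which lower semicontinuity and joint convexity are read off.\<close>

lemma Phi_le:
  assumes "q \<ge> 0" "p \<ge> 0" "\<And>\<alpha>. ennreal (q * \<alpha> - p * (exp \<alpha> - 1)) \<le> c"
  shows "Phi q p \<le> c"
proof -
  consider "q > 0" "p > 0" | "q = 0" | "q > 0" "p = 0" using assms by linarith
  then show ?thesis
  proof cases
    case 1
    then have "q = p * exp (ln (q / p))" by simp
    then show ?thesis using Phi_eq[of p q "ln (q / p)"] assms(3)[of "ln (q / p)"] 1 by simp
  next
    case 2
    have e: "(\<lambda>n. exp (- real n)) \<longlonglongrightarrow> 0"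
      by (intro filterlim_compose[OF exp_at_bot] filterlim_compose[OF filterlim_uminus_at_bot_at_top]
          filterlim_real_sequentially)
    have "(\<lambda>n. ennreal (- (p * (exp (- real n) - 1)))) \<longlonglongrightarrow> ennreal (- (p * (0 - 1)))"
      by (intro tendsto_ennrealI tendsto_minus tendsto_mult tendsto_diff tendsto_const e)
    then have "ennreal (- (p * (0 - 1))) \<le> c"
      by (rule LIMSEQ_le_const2) (use assms(3)[of "- real _"] 2 in auto)
    then show ?thesis using 2 by (simp add: Phi_def)
  next
    case 3
    have "c = \<top>"
    proof (rule ccontr)
      assume "c \<noteq> \<top>"
      then obtain c' where c': "c = ennreal c'" "c' \<ge> 0" by (cases c) auto
      have "ennreal (q * ((c' + 1) / q)) \<le> c" using assms(3)[of "(c' + 1) / q"] 3 by simp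
      then have "c' + 1 \<le> c'" using 3 c' by simp
      then show False by simp
    qed
    then show ?thesis by simp
  qed
qed

text \<open>Equality case of \<open>1 + x \<le> exp x\<close>: applying the bound at
  \<open>x / 2\<close> and squaring gains the term \<open>x\<^sup>2 / 4\<close>.\<close>

lemma exp_le_one_plus_imp: assumes "exp (x::real) \<le> 1 + x" shows "x = 0"
proof -
  have "1 + x / 2 \<ge> 0" using assms exp_gt_zero[of x] by linarith
  then have "(1 + x / 2)\<^sup>2 \<le> (exp (x / 2))\<^sup>2" by (intro power_mono exp_ge_add_one_self)
  also have "\<dots> = exp x" by (simp add: power2_eq_square flip: exp_add)
  finally have "(1 + x / 2)\<^sup>2 \<le> 1 + x" using assms by simp
  then have "x\<^sup>2 \<le> 0" by (simp add: power2_eq_square algebra_simps)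
  then show ?thesis by simp
qed

text \<open>Equality in Young's inequality pins down \<open>q\<close>; this is what identifies the
  flow of an optimal path.\<close>

lemma Phi_eqD:
  assumes "q \<ge> 0" "p \<ge> 0" "Phi q p \<noteq> \<top>" "enn2real (Phi q p) \<le> q * \<alpha> - p * (exp \<alpha> - 1)"
  shows "q = p * exp \<alpha>"
proof -
  consider "q > 0" "p > 0" | "q = 0" | "q > 0" "p = 0" using assms by linarith
  then show ?thesis
  proof cases
    case 1
    define x where "x = \<alpha> - ln (q / p)"
    have "q * ln (q / p) - (q - p) \<le> enn2real (Phi q p)"
      using 1 by (cases "0 \<le> q * ln (q / p) - (q - p)") (simp_all add: Phi_def ennreal_neg)
    then have le: "q * ln (q / p) - (q - p) \<le> q * \<alpha> - p * (exp \<alpha> - 1)" using assms(4) by linarith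
    have ex: "exp x = exp \<alpha> * p / q" using 1 by (simp add: x_def exp_diff)
    then have "q * exp x = exp \<alpha> * p" using 1 by simp
    then have "q * exp x \<le> q * (1 + x)" using le by (simp add: x_def algebra_simps)
    then have "exp x \<le> 1 + x" using 1 by simp
    then have "x = 0" by (rule exp_le_one_plus_imp)
    then show ?thesis using ex 1 by (simp add: field_simps)
  next
    case 2
    then have "p \<le> - (p * (exp \<alpha> - 1))" using assms by (simp add: Phi_def)
    then have "p * exp \<alpha> \<le> 0" by (simp add: algebra_simps)
    then have "p = 0" using assms(2) by (simp add: mult_le_0_iff)
    then show ?thesis using 2 by simp
  next
    case 3
    then show ?thesis using assms(3) by (simp add: Phi_def)
  qed
qed

lemma Phi_lsc:
  assumes "q \<longlonglongrightarrow> q0" "p \<longlonglongrightarrow> p0" "\<And>n. q n \<ge> 0" "\<And>n. p n \<ge> 0"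
  shows "Phi q0 p0 \<le> liminf (\<lambda>n. Phi (q n) (p n))"
proof (rule Phi_le)
  show "q0 \<ge> 0" "p0 \<ge> 0" using assms by (auto intro: LIMSEQ_le_const)
  fix \<alpha>
  have "(\<lambda>n. ennreal (q n * \<alpha> - p n * (exp \<alpha> - 1))) \<longlonglongrightarrow> ennreal (q0 * \<alpha> - p0 * (exp \<alpha> - 1))"
    by (intro tendsto_ennrealI tendsto_intros assms)
  then have "ennreal (q0 * \<alpha> - p0 * (exp \<alpha> - 1)) = liminf (\<lambda>n. ennreal (q n * \<alpha> - p n * (exp \<alpha> - 1)))"
    by (intro lim_imp_Liminf[symmetric]) auto
  also have "\<dots> \<le> liminf (\<lambda>n. Phi (q n) (p n))"
    by (intro Liminf_mono always_eventually allI Phi_ge assms)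
  finally show "ennreal (q0 * \<alpha> - p0 * (exp \<alpha> - 1)) \<le> liminf (\<lambda>n. Phi (q n) (p n))" .
qed

lemma Phi_convex:
  assumes "q \<ge> 0" "p \<ge> 0" "q' \<ge> 0" "p' \<ge> 0" "a \<in> {0..1}"
  shows "Phi (a * q + (1 - a) * q') (a * p + (1 - a) * p') \<le> ennreal a * Phi q p + ennreal (1 - a) * Phi q' p'"
proof (rule Phi_le)
  fix \<alpha>
  let ?X = "q * \<alpha> - p * (exp \<alpha> - 1)" and ?Y = "q' * \<alpha> - p' * (exp \<alpha> - 1)"
  have "(a * q + (1 - a) * q') * \<alpha> - (a * p + (1 - a) * p') * (exp \<alpha> - 1) = a * ?X + (1 - a) * ?Y"
    by (simp add: algebra_simps)
  then have "ennreal ((a * q + (1 - a) * q') * \<alpha> - (a * p + (1 - a) * p') * (exp \<alpha> - 1))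
      \<le> ennreal (a * ?X) + ennreal ((1 - a) * ?Y)" using ennreal_add_le by simp
  also have "\<dots> = ennreal a * ennreal ?X + ennreal (1 - a) * ennreal ?Y"
    using assms(5) by (simp add: ennreal_mult')
  also have "\<dots> \<le> ennreal a * Phi q p + ennreal (1 - a) * Phi q' p'"
    by (intro add_mono mult_left_mono Phi_ge assms) auto
  finally show "ennreal ((a * q + (1 - a) * q') * \<alpha> - (a * p + (1 - a) * p') * (exp \<alpha> - 1)) \<le> \<dots>" .
qed (use assms in auto)

lemma Phi_measurable [measurable]:
  assumes [measurable]: "f \<in> borel_measurable M" "g \<in> borel_measurable M"
  shows "(\<lambda>x. Phi (f x) (g x)) \<in> borel_measurable M"
  unfolding Phi_def by measurable

section \<open>Auxiliary facts on integrals, the simplex and periodic functions\<close>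

lemma antiderivative_exists:
  fixes f :: "real \<Rightarrow> real"
  assumes "continuous_on UNIV f"
  obtains P where "\<And>t. (P has_real_derivative f t) (at t)"
proof -
  have "\<exists>F. \<forall>x::real. -\<infinity> < ereal x \<longrightarrow> ereal x < \<infinity> \<longrightarrow> (F has_vector_derivative f x) (at x)"
    by (rule einterval_antiderivative) (use assms in \<open>auto simp: continuous_on_eq_continuous_at\<close>)
  then show thesis using that by (auto simp: has_real_derivative_iff_has_vector_derivative)
qed

lemma set_integral_sum:
  fixes f :: "'i \<Rightarrow> 'a \<Rightarrow> real"
  assumes "\<And>i. i \<in> I \<Longrightarrow> set_integrable M A (f i)"
  shows "set_integrable M A (\<lambda>x. \<Sum>i\<in>I. f i x)"
    and "(LINT x:A|M. (\<Sum>i\<in>I. f i x)) = (\<Sum>i\<in>I. LINT x:A|M. f i x)"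
  using assms unfolding set_integrable_def set_lebesgue_integral_def
  by (simp_all add: sum_distrib_left integral_sum)

lemma prob_vecs_range: assumes "x \<in> prob_vecs" shows "0 \<le> x $ y" "x $ y \<le> 1"
proof -
  show "0 \<le> x $ y" using assms by (simp add: prob_vecs_def)
  have "x $ y \<le> (\<Sum>y\<in>UNIV. x $ y)" using assms by (intro member_le_sum) (auto simp: prob_vecs_def)
  then show "x $ y \<le> 1" using assms by (simp add: prob_vecs_def)
qed

lemma periodic_continuous_bounded:
  fixes f :: "real \<Rightarrow> real"
  assumes "T > 0" "\<And>t. f (t + T) = f t" "continuous_on UNIV f"
  obtains M where "M \<ge> 0" "\<And>t. \<bar>f t\<bar> \<le> M"
proof -
  have "bounded (f ` {0..T})"
    by (intro compact_imp_bounded compact_continuous_image compact_Icc continuous_on_subset[OF assms(3)]) auto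
  then obtain M where M: "M > 0" "\<And>t. t \<in> {0..T} \<Longrightarrow> \<bar>f t\<bar> \<le> M" unfolding bounded_pos by force
  have "\<bar>f t\<bar> \<le> M" for t
    using M(2)[of "tmod T t"] tmod_range[OF assms(1), of t] periodic_fm[of f T t, OF assms(2)] by auto
  then show thesis by (intro that[of M]) (use M(1) in auto)
qed

section \<open>Periodic rates and the tilted eigenproblem\<close>

locale periodic_rates =
  fixes r :: "'v::finite \<Rightarrow> 'v \<Rightarrow> real \<Rightarrow> real" and T0 :: real
  assumes T0_pos: "T0 > 0"
    and r_nonneg: "\<forall>y z t. t \<ge> 0 \<longrightarrow> r y z t \<ge> 0"
    and r_loc_int: "\<forall>y z b. set_integrable lborel {0..b} (r y z)"
    and r_periodic: "\<forall>y z t. t \<ge> 0 \<longrightarrow> r y z (t + T0) = r y z t"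
    and r_diag: "\<forall>y t. t \<ge> 0 \<longrightarrow> r y y t = 0"
    and A1: "\<forall>y z. (\<exists>t>0. r y z t > 0) \<longrightarrow> (\<forall>t>0. r y z t > 0)"
    and A2: "\<forall>y z. (y, z) \<in> (edges r)\<^sup>*"
    and A3_sup: "\<exists>C. \<forall>(y, z)\<in>edges r. \<forall>t\<in>{0..T0}. r y z t \<le> C"
    and A3_inf: "\<exists>c>0. \<forall>(y, z)\<in>edges r. \<forall>t\<in>{0..T0}. c \<le> r y z t"
    and A4: "{t\<in>{0..T0}. \<exists>y z. \<not> isCont (r y z) t} \<in> null_sets lborel"
begin

abbreviation "E \<equiv> edges r"

text \<open>Two-sided extension: the hypotheses speak of nonnegative times only, but reversing time
  evaluates the rates at negative times.\<close>

definition R :: "real \<Rightarrow> 'v \<Rightarrow> 'v \<Rightarrow> real" where "R t y z = r y z (tmod T0 t)"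

text \<open>The point 0 is included because the periodic extension may be discontinuous there.\<close>

definition "N0 = insert 0 {t\<in>{0..T0}. \<exists>y z. \<not> isCont (r y z) t}"

definition "exc_times = {t. tmod T0 t \<in> N0}"

lemma N0_null: "N0 \<in> null_sets lborel"
proof -
  have "{0::real} \<in> null_sets lborel" by (intro countable_imp_null_set_lborel) auto
  from null_sets.Un[OF this A4] show ?thesis unfolding N0_def by simp
qed

lemma exc_times_null: "exc_times \<in> null_sets lborel"
  unfolding exc_times_def by (rule null_set_fm_vimage[OF T0_pos N0_null])

lemma R_eq: assumes "t \<ge> 0" shows "R t y z = r y z t"
proof -
  have n: "r y z (s + T0 * real n) = r y z s" if "s \<ge> 0" for s n
  proof (induction n)
    case (Suc n)
    have e: "s + T0 * real (Suc n) = (s + T0 * real n) + T0" by (simp add: algebra_simps)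
    have "s + T0 * real n \<ge> 0" using that T0_pos by simp
    then have "r y z ((s + T0 * real n) + T0) = r y z (s + T0 * real n)" by (rule r_periodic[rule_format])
    then show ?case unfolding e using Suc by simp
  qed simp
  have "\<lfloor>t / T0\<rfloor> \<ge> 0" using assms T0_pos by simp
  then have "t = tmod T0 t + T0 * real (nat \<lfloor>t / T0\<rfloor>)" by (simp add: tmod_def)
  moreover have "r y z (tmod T0 t + T0 * real (nat \<lfloor>t / T0\<rfloor>)) = R t y z"
    unfolding R_def by (rule n[OF tmod_range(1)[OF T0_pos]])
  ultimately show ?thesis by metis
qed

lemma R_per: "R (t + T0) = R t"
  by (simp add: R_def fun_eq_iff tmod_periodic[OF T0_pos])

lemma R_nonneg: "R t y z \<ge> 0"
  using r_nonneg tmod_range[OF T0_pos] by (simp add: R_def)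

lemma R_off: assumes "(y, z) \<notin> E" shows "R t y z = 0"
proof (cases "y = z")
  case True
  then show ?thesis using r_diag tmod_range[OF T0_pos] by (simp add: R_def)
next
  case False
  then have "\<not> (\<forall>t>0. r y z t > 0)" using assms by (auto simp: edges_def)
  then have "\<not> (\<exists>t>0. r y z t > 0)" using A1 by blast
  then have 0: "r y z t = 0" if "t > 0" for t using r_nonneg[rule_format, of t y z] that by force
  \<comment> \<open>(A1) says nothing at time 0; the value there is the one at
    \<open>T0\<close>.\<close>
  have "r y z t = 0" if "t \<ge> 0" for t
    using r_periodic[rule_format, OF that, of y z] 0[of "t + T0"] T0_pos that by simp
  then show ?thesis using tmod_range[OF T0_pos] by (simp add: R_def)
qed

lemma R_diag: "R t y y = 0"
  by (rule R_off) (simp add: edges_def)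

lemma R_bound: obtains C where "C > 0" "\<And>t y z. R t y z \<le> C"
proof -
  obtain C where C: "\<forall>(y, z)\<in>E. \<forall>t\<in>{0..T0}. r y z t \<le> C" using A3_sup by blast
  have "R t y z \<le> max 1 C" for t y z
  proof (cases "(y, z) \<in> E")
    case True
    then have "R t y z \<le> C" using C tmod_range[OF T0_pos, of t] by (auto simp: R_def)
    then show ?thesis by simp
  qed (simp add: R_off)
  then show thesis by (intro that[of "max 1 C"]) auto
qed

lemma R_pos: assumes "(y, z) \<in> E" shows "R t y z > 0"
proof -
  obtain c where c: "c > 0" "\<forall>(y, z)\<in>E. \<forall>t\<in>{0..T0}. c \<le> r y z t" using A3_inf by blast
  then have "c \<le> R t y z" using assms tmod_range[OF T0_pos, of t] by (auto simp: R_def)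
  then show ?thesis using c(1) by simp
qed

lemma R_meas [measurable]: "(\<lambda>t. R t y z) \<in> borel_measurable borel"
proof -
  have "(\<lambda>t. indicator {0..T0} t *\<^sub>R r y z t) \<in> borel_measurable borel"
    using r_loc_int borel_measurable_integrable unfolding set_integrable_def by fastforce
  from measurable_compose[OF tmod_measurable[of T0] this]
  have "(\<lambda>t. indicator {0..T0} (tmod T0 t) *\<^sub>R r y z (tmod T0 t)) \<in> borel_measurable borel" .
  moreover have "indicator {0..T0} (tmod T0 t) *\<^sub>R r y z (tmod T0 t) = R t y z" for t
    using tmod_range[OF T0_pos, of t] by (simp add: R_def)
  ultimately show ?thesis by simp
qed

lemma R_cont: assumes "t \<notin> exc_times" shows "isCont (\<lambda>t. R t y z) t"
proof -
  have "tmod T0 t \<noteq> 0" "isCont (r y z) (tmod T0 t)"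
    using assms tmod_range[OF T0_pos, of t] by (auto simp: exc_times_def N0_def)
  then show ?thesis unfolding R_def by (intro tmod_isCont T0_pos)
qed

lemma edge_neq: "(y, z) \<in> E \<Longrightarrow> y \<noteq> z" by (simp add: edges_def)

section \<open>The tilted generator and its Floquet eigenfunction\<close>

definition edge_tilt :: "(real^'v) \<times> (real^('v \<times> 'v)) \<Rightarrow> 'v \<Rightarrow> 'v \<Rightarrow> real" where
  "edge_tilt l y z = (if (y, z) \<in> E then snd l $ (y, z) else 0)"

text \<open>Feynman-Kac form: the potential \<open>fst l\<close> weighs the time spent in a state,
  the factor \<open>exp (edge_tilt l y z)\<close> weighs each jump.\<close>

definition tilted_matrix :: "(real^'v) \<times> (real^('v \<times> 'v)) \<Rightarrow> real \<Rightarrow> 'v \<Rightarrow> 'v \<Rightarrow> real" where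
  "tilted_matrix l t y z = (if y = z then fst l $ y - (\<Sum>w\<in>UNIV. R t y w) else R t y z * exp (edge_tilt l y z))"

text \<open>\<open>L\<close> is the principal Floquet exponent of the tilted generator and \<open>g\<close> its eigenfunction,
  solving the backward equation.\<close>

definition tilt :: "(real^'v) \<times> (real^('v \<times> 'v)) \<Rightarrow> real \<Rightarrow> (real \<Rightarrow> 'v \<Rightarrow> real) \<Rightarrow> bool" where
  "tilt l L g \<longleftrightarrow> (\<forall>t. g (t + T0) = g t) \<and> (\<forall>t y. g t y > 0) \<and> (\<forall>y a b. lip a b (\<lambda>t. g t y)) \<and>
     (\<forall>t y. t \<notin> exc_times \<longrightarrow>
        ((\<lambda>t. g t y) has_real_derivative (L * g t y - (\<Sum>z\<in>UNIV. tilted_matrix l t y z * g t z))) (at t))"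

lemma tilted_matrix_meas [measurable]: "(\<lambda>t. tilted_matrix l t y z) \<in> borel_measurable borel"
  unfolding tilted_matrix_def by measurable

lemma tilted_matrix_bound: obtains k where "k \<ge> 0" "\<And>t y z. \<bar>tilted_matrix l t y z\<bar> \<le> k"
proof -
  obtain C where C: "C > 0" "\<And>t y z. R t y z \<le> C" by (rule R_bound) blast
  define k where "k = (\<Sum>y\<in>UNIV. \<bar>fst l $ y\<bar>) + (\<Sum>w\<in>(UNIV::'v set). C) + (\<Sum>y\<in>UNIV. \<Sum>z\<in>UNIV. C * exp (edge_tilt l y z))"
  have 1: "(\<Sum>w\<in>UNIV. R t y w) \<le> (\<Sum>w\<in>(UNIV::'v set). C)" for t y by (intro sum_mono C)
  have 2: "\<bar>fst l $ y\<bar> \<le> (\<Sum>y\<in>UNIV. \<bar>fst l $ y\<bar>)" for y by (rule member_le_sum) auto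
  have 3: "R t y z * exp (edge_tilt l y z) \<le> (\<Sum>y\<in>UNIV. \<Sum>z\<in>UNIV. C * exp (edge_tilt l y z))" for t y z
  proof -
    have "R t y z * exp (edge_tilt l y z) \<le> C * exp (edge_tilt l y z)" by (intro mult_right_mono C) auto
    also have "\<dots> \<le> (\<Sum>z\<in>UNIV. C * exp (edge_tilt l y z))"
      by (rule member_le_sum) (use C in \<open>auto intro: mult_nonneg_nonneg less_imp_le\<close>)
    also have "\<dots> \<le> (\<Sum>y\<in>UNIV. \<Sum>z\<in>UNIV. C * exp (edge_tilt l y z))"
      by (rule member_le_sum[where f = "\<lambda>y. \<Sum>z\<in>UNIV. C * exp (edge_tilt l y z)"]) (use C in \<open>auto intro!: sum_nonneg intro: mult_nonneg_nonneg less_imp_le\<close>)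
    finally show ?thesis .
  qed
  have p1: "(\<Sum>w\<in>UNIV. R t y w) \<ge> 0" for t y by (intro sum_nonneg R_nonneg)
  have p2: "R t y z * exp (edge_tilt l y z) \<ge> 0" for t y z by (intro mult_nonneg_nonneg R_nonneg) auto
  have "\<bar>tilted_matrix l t y z\<bar> \<le> k" for t y z
    using 1[where t=t and y=y] 2[of y] 3[of t y z] p1[where t=t and y=y] p2[of t y z] order_trans[OF p2 3]
      order_trans[OF p1 1] order_trans[OF abs_ge_zero 2]
    unfolding tilted_matrix_def k_def by (auto split: if_splits simp: abs_le_iff)
  moreover have "k \<ge> 0" using calculation[of 0 undefined undefined] by linarith
  ultimately show thesis using that by blast
qed

text \<open>\<open>tilt\<close> is a backward equation, so the periodic Perron theorem is applied to
  the matrix read in reversed time and its solution is reflected.\<close>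

lemma tilt_exists: "\<exists>L g. tilt l L g"
proof -
  obtain k where k: "\<And>t y z. \<bar>tilted_matrix l t y z\<bar> \<le> k" by (rule tilted_matrix_bound) blast
  \<comment> \<open>\<open>N0'\<close> is the mirror image of the whole exceptional set; it contains
    0 and is null because Lebesgue measure is invariant under reflection.\<close>
  define N0' where "N0' = {s. - s \<in> exc_times}"
  have N0'n: "N0' \<in> null_sets lborel"
  proof -
    have "uminus -` exc_times \<inter> space lborel \<in> sets lborel"
      by (rule measurable_sets[of _ _ borel]) (use exc_times_null in \<open>auto simp: null_sets_def\<close>)
    then have "N0' \<in> sets lborel" by (simp add: N0'_def vimage_def)
    moreover have "emeasure (distr lborel borel uminus) exc_times = emeasure lborel N0'"
      using exc_times_null by (subst emeasure_distr) (auto simp: N0'_def vimage_def null_sets_def)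
    ultimately show ?thesis using exc_times_null by (simp add: lborel_distr_uminus null_sets_def)
  qed
  have neg: "{t. tmod T0 t \<in> N0'} = {t. - t \<in> exc_times}"
    by (auto simp: N0'_def exc_times_def tmod_uminus[OF T0_pos])
  obtain L g where g: "sol (\<lambda>t y z. tilted_matrix l (- t) y z - (if y = z then L else 0)) {t. - t \<in> exc_times} g"
      "\<And>t. g (t + T0) = g t" "\<And>t y. g t y > 0"
  proof (rule perron_periodic[OF T0_pos N0'n _ neg[symmetric], where A = "\<lambda>t. tilted_matrix l (- t)" and k = k and Ed = E])
    show "0 \<in> N0'" using tmod_id[OF T0_pos, of 0] T0_pos by (simp add: N0'_def exc_times_def N0_def)
    show "(\<lambda>t. tilted_matrix l (- t) y z) \<in> borel_measurable borel" for y z by measurable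
    show "tilted_matrix l (- t) y z \<ge> 0" if "y \<noteq> z" for t y z using that R_nonneg by (simp add: tilted_matrix_def)
    show "tilted_matrix l (- (t + T0)) = tilted_matrix l (- t)" for t
      using R_per[of "- t - T0"] by (simp add: tilted_matrix_def fun_eq_iff)
    show "isCont (\<lambda>t. tilted_matrix l (- t) y z) t" if "t \<notin> {t. - t \<in> exc_times}" for t y z
    proof -
      have c: "isCont (\<lambda>t. tilted_matrix l t y z) (- t)"
        using that R_cont by (cases "y = z") (auto simp: tilted_matrix_def intro!: continuous_intros)
      show ?thesis
        by (rule isCont_o2[where f = uminus and g = "\<lambda>t. tilted_matrix l t y z"]) (use c in auto)
    qed
    show "y \<noteq> z \<and> tilted_matrix l (- t) y z > 0" if "(y, z) \<in> E" for t y z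
      using that R_pos edge_neq by (simp add: tilted_matrix_def)
  qed (use k A2 in auto)
  define h where "h t = g (- t)" for t
  have "tilt l L h"
    unfolding tilt_def
  proof (intro conjI allI impI)
    show "h (t + T0) = h t" for t using g(2)[of "- t - T0"] by (simp add: h_def)
    show "h t y > 0" for t y by (simp add: h_def g)
    show "lip a b (\<lambda>t. h t y)" for y a b
    proof -
      have "lip (- b) (- a) (\<lambda>t. g t y)" using g(1) by (simp add: sol_def)
      then obtain K where K0: "\<And>s t. s \<in> {-b..-a} \<Longrightarrow> t \<in> {-b..-a} \<Longrightarrow> \<bar>g s y - g t y\<bar> \<le> K * \<bar>s - t\<bar>"
        by (rule lipE) blast
      have K: "\<bar>g (- s) y - g (- t) y\<bar> \<le> K * \<bar>- s - (- t)\<bar>" if "s \<in> {a..b}" "t \<in> {a..b}" for s t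
        by (rule K0) (use that in auto)
      show ?thesis by (rule lipI[of _ _ _ K]) (use K in \<open>auto simp: h_def abs_minus_commute\<close>)
    qed
    fix t y assume t: "t \<notin> exc_times"
    have "((\<lambda>t. g t y) has_real_derivative (\<Sum>z\<in>UNIV. (tilted_matrix l (- (- t)) y z - (if y = z then L else 0)) * g (- t) z)) (at (- t))"
      using g(1)[unfolded sol_def, THEN conjunct2, rule_format, of "- t" y] t by simp
    then have "((\<lambda>t. g t y) has_real_derivative (\<Sum>z\<in>UNIV. (tilted_matrix l t y z - (if y = z then L else 0)) * g (- t) z)) (at (- t))"
      by simp
    then have "((\<lambda>t. h t y) has_real_derivative - (\<Sum>z\<in>UNIV. (tilted_matrix l t y z - (if y = z then L else 0)) * g (- t) z)) (at t)"
      unfolding h_def by (rule DERIV_mirror[THEN iffD1])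
    moreover have "- (\<Sum>z\<in>UNIV. (tilted_matrix l t y z - (if y = z then L else 0)) * g (- t) z) =
        L * h t y - (\<Sum>z\<in>UNIV. tilted_matrix l t y z * h t z)"
      by (simp add: h_def left_diff_distrib sum_subtractf if_distrib[of "\<lambda>x. x * _"] cong: if_cong)
    ultimately show "((\<lambda>t. h t y) has_real_derivative L * h t y - (\<Sum>z\<in>UNIV. tilted_matrix l t y z * h t z)) (at t)" by simp
  qed
  then show ?thesis by blast
qed

end

section \<open>The dual lower bound\<close>

text \<open>The primitive of a periodic function need not be periodic, but its increments are; hence
  moving averages of a periodic function are periodic test functions.\<close>

lemma antiderivative_average_periodic:
  fixes f :: "real \<Rightarrow> real"
  assumes per: "\<And>t. f (t + T) = f t" and P: "\<And>t. (P has_real_derivative f t) (at t)"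
  shows "P (t + T + e) - P (t + T) = P (t + e) - P t"
proof -
  have "((\<lambda>s. P (s + T) - P s) has_real_derivative 0) (at s)" for s
    using P[of s] DERIV_shift[of P "f (s + T)" s T] P[of "s + T"] per[of s]
    by (auto intro!: derivative_eq_intros)
  then have "P (t + e + T) - P (t + e) = P (t + T) - P t"
    using DERIV_isconst_all[of "\<lambda>s. P (s + T) - P s" "t + e" t] by blast
  then show ?thesis by (simp add: algebra_simps)
qed

lemma set_integrable_mult_bounded:
  fixes f h :: "real \<Rightarrow> real"
  assumes "set_integrable lborel {a..b} f" "h \<in> borel_measurable borel" "\<And>t. t \<in> {a..b} \<Longrightarrow> \<bar>h t\<bar> \<le> M"
  shows "set_integrable lborel {a..b} (\<lambda>t. f t * h t)"
proof -
  have fi: "integrable lborel (\<lambda>t. indicator {a..b} t *\<^sub>R f t)" using assms(1) by (simp add: set_integrable_def)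
  have m: "(\<lambda>t. (indicator {a..b} t *\<^sub>R f t) * h t) \<in> borel_measurable lborel"
    using borel_measurable_integrable[OF fi] assms(2) by measurable
  have "integrable lborel (\<lambda>t. (indicator {a..b} t *\<^sub>R f t) * h t)"
  proof (rule Bochner_Integration.integrable_bound[OF integrable_mult_left[OF integrable_norm[OF fi], of M] m], rule AE_I2)
    fix t show "norm (indicator {a..b} t *\<^sub>R f t * h t) \<le> norm (norm (indicator {a..b} t *\<^sub>R f t) * M)"
    proof (cases "t \<in> {a..b}")
      case True
      then have "\<bar>h t\<bar> \<le> \<bar>M\<bar>" using assms(3)[of t] by linarith
      then show ?thesis by (auto simp: abs_mult intro: mult_left_mono)
    qed simp
  qed
  then show ?thesis by (simp add: set_integrable_def mult.assoc)
qed

context periodic_rates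
begin

section \<open>Admissible paths and Lipschitz test functions\<close>

lemma admD:
  assumes "admissible r T0 (fst p) (snd p) \<mu> Q"
  shows "\<mu> \<in> borel_measurable borel" "Q \<in> borel_measurable borel"
    "\<And>y. (\<lambda>t. \<mu> t $ y) \<in> borel_measurable borel" "\<And>e. (\<lambda>t. Q t $ e) \<in> borel_measurable borel"
    "\<And>t. \<mu> (t + T0) = \<mu> t" "\<And>t. Q (t + T0) = Q t" "\<And>t. \<mu> t \<in> prob_vecs" "\<And>t. Q t \<in> flows E"
    "\<And>e. set_integrable lborel {0..T0} (\<lambda>t. Q t $ e)"
    "\<And>y. (LINT t:{0..T0}|lborel. \<mu> t $ y) = T0 * fst p $ y"
    "\<And>e. (LINT t:{0..T0}|lborel. Q t $ e) = T0 * snd p $ e"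
    "\<And>t e. Q t $ e \<ge> 0" "\<And>t e. e \<notin> E \<Longrightarrow> Q t $ e = 0"
proof -
  show m: "\<mu> \<in> borel_measurable borel" "Q \<in> borel_measurable borel"
    using assms by (simp_all add: admissible_def)
  have nth: "(\<lambda>x. x $ i) \<in> borel_measurable borel" for i :: "'n::finite"
    by (intro borel_measurable_continuous_onI continuous_intros)
  show "\<And>y. (\<lambda>t. \<mu> t $ y) \<in> borel_measurable borel" "\<And>e. (\<lambda>t. Q t $ e) \<in> borel_measurable borel"
    using measurable_compose[OF m(1) nth] measurable_compose[OF m(2) nth] by auto
  show "\<And>t. \<mu> (t + T0) = \<mu> t" "\<And>t. Q (t + T0) = Q t" "\<And>t. \<mu> t \<in> prob_vecs" "\<And>t. Q t \<in> flows E"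
    "\<And>e. set_integrable lborel {0..T0} (\<lambda>t. Q t $ e)"
    "\<And>t e. Q t $ e \<ge> 0" "\<And>t e. e \<notin> E \<Longrightarrow> Q t $ e = 0"
    using assms by (auto simp: admissible_def flows_def)
  have "(LINT t:{0..T0}|lborel. \<mu> t $ y) / T0 = fst p $ y" "(LINT t:{0..T0}|lborel. Q t $ e) / T0 = snd p $ e" for y e
    using assms unfolding admissible_def by blast+
  then show "\<And>y. (LINT t:{0..T0}|lborel. \<mu> t $ y) = T0 * fst p $ y"
    "\<And>e. (LINT t:{0..T0}|lborel. Q t $ e) = T0 * snd p $ e"
    using T0_pos by (simp_all add: field_simps)
qed

lemma adm_weak:
  assumes "admissible r T0 (fst p) (snd p) \<mu> Q"
    and "\<And>y t. f y (t + T0) = f y t" "\<And>y. f y C1_differentiable_on UNIV"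
  shows "(LINT s:{0..T0}|lborel. (\<Sum>y\<in>UNIV. \<mu> s $ y * deriv (f y) s)) =
        (LINT s:{0..T0}|lborel. (\<Sum>y\<in>UNIV. divg (Q s) y * f y s))"
  by (rule assms(1)[unfolded admissible_def, THEN conjunct2, THEN conjunct2, THEN conjunct2, THEN conjunct2,
        THEN conjunct2, THEN conjunct1, rule_format]) (use assms in auto)

lemma divg_integrable:
  assumes "admissible r T0 (fst p) (snd p) \<mu> Q"
  shows "set_integrable lborel {0..T0} (\<lambda>t. divg (Q t) y)" "(\<lambda>t. divg (Q t) y) \<in> borel_measurable borel"
  unfolding divg_def using admD(4,9)[OF assms]
  by (auto intro!: set_integral_diff(1) set_integral_sum(1))

text \<open>Moving averages of \<open>f\<close> over windows of length \<open>1 / Suc n\<close> are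
  periodic and C1, with derivative the difference quotient of \<open>f\<close>. Their weak equations
  pass to the limit: the quotients are bounded by the Lipschitz constant and paired with \<mu> in
  the simplex, the averages are bounded by the supremum of \<open>f\<close> and paired with the
  integrable divergence.\<close>

lemma weak_equation_lip:
  assumes adm: "admissible r T0 (fst p) (snd p) \<mu> Q"
    and per: "\<And>y t. f y (t + T0) = f y t" and lip: "\<And>y a b. lip a b (f y)"
    and N: "N \<in> null_sets lborel"
    and der: "\<And>y t. t \<in> {0..T0} \<Longrightarrow> t \<notin> N \<Longrightarrow>
      (\<lambda>n. (f y (t + 1 / real (Suc n)) - f y t) * real (Suc n)) \<longlonglongrightarrow> f' y t"
    and meas: "\<And>y. f' y \<in> borel_measurable borel"
  shows "set_integrable lborel {0..T0} (\<lambda>t. \<Sum>y\<in>UNIV. \<mu> t $ y * f' y t)"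
    and "(LINT t:{0..T0}|lborel. (\<Sum>y\<in>UNIV. \<mu> t $ y * f' y t)) = (LINT t:{0..T0}|lborel. (\<Sum>y\<in>UNIV. divg (Q t) y * f y t))"
proof -
  note a = admD[OF adm]
  have cont: "continuous_on UNIV (f y)" for y by (rule lip_continuous[OF lip])
  have tmod: "f y \<in> borel_measurable borel" for y by (rule borel_measurable_continuous_onI[OF cont])
  have "\<forall>y. \<exists>P. \<forall>t. (P has_real_derivative f y t) (at t)" using antiderivative_exists[OF cont] by blast
  from choice[OF this] obtain P where P: "\<And>y t. (P y has_real_derivative f y t) (at t)" by blast
  define F where "F n y t = (P y (t + 1 / real (Suc n)) - P y t) * real (Suc n)" for n y t
  define d where "d n y t = (f y (t + 1 / real (Suc n)) - f y t) * real (Suc n)" for n y t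
  have Fd: "(F n y has_real_derivative d n y t) (at t)" for n y t
    unfolding F_def d_def using P[of y t] DERIV_shift[of "P y" "f y (t + 1 / real (Suc n))" t "1 / real (Suc n)"]
      P[of y "t + 1 / real (Suc n)"]
    by (auto intro!: derivative_eq_intros)
  have dcont: "continuous_on UNIV (d n y)" for n y
    unfolding d_def by (intro continuous_intros cont continuous_on_compose2[OF cont[of y]]) auto
  have Fcont: "continuous_on UNIV (F n y)" for n y
    using Fd by (intro DERIV_continuous_on) (auto intro: has_field_derivative_at_within)
  have dm: "d n y \<in> borel_measurable borel" and Fm: "F n y \<in> borel_measurable borel" for n y
    by (intro borel_measurable_continuous_onI dcont Fcont)+
  have C1: "F n y C1_differentiable_on UNIV" for n y
    unfolding C1_differentiable_on_def
    by (rule exI[of _ "d n y"]) (use Fd dcont in \<open>auto simp: has_real_derivative_iff_has_vector_derivative\<close>)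
  have Fper: "F n y (t + T0) = F n y t" for n y t
    unfolding F_def using antiderivative_average_periodic[OF per P, of y t "1 / real (Suc n)"]
    by simp
  have eqn: "(LINT t:{0..T0}|lborel. (\<Sum>y\<in>UNIV. \<mu> t $ y * d n y t)) = (LINT t:{0..T0}|lborel. (\<Sum>y\<in>UNIV. divg (Q t) y * F n y t))" for n
  proof -
    have "deriv (F n y) t = d n y t" for y t using Fd by (rule DERIV_imp_deriv)
    moreover have "(LINT t:{0..T0}|lborel. (\<Sum>y\<in>UNIV. \<mu> t $ y * deriv (F n y) t)) = (LINT t:{0..T0}|lborel. (\<Sum>y\<in>UNIV. divg (Q t) y * F n y t))"
      by (rule adm_weak[OF adm Fper C1])
    ultimately show ?thesis by simp
  qed
  \<comment> \<open>The constant is taken on \<open>{0..T0 + 1}\<close> since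
    \<open>t + 1 / Suc n\<close> may exceed \<open>T0\<close> by up to 1.\<close>
  have "\<forall>y. \<exists>K. K \<ge> 0 \<and> (\<forall>s\<in>{0..T0 + 1}. \<forall>t\<in>{0..T0 + 1}. \<bar>f y s - f y t\<bar> \<le> K * \<bar>s - t\<bar>)"
  proof
    fix y show "\<exists>K. K \<ge> 0 \<and> (\<forall>s\<in>{0..T0 + 1}. \<forall>t\<in>{0..T0 + 1}. \<bar>f y s - f y t\<bar> \<le> K * \<bar>s - t\<bar>)"
      by (rule lipE[OF lip[of 0 "T0 + 1" y]]) blast
  qed
  from choice[OF this] obtain K where K: "\<And>y. K y \<ge> 0"
    "\<And>y s t. s \<in> {0..T0 + 1} \<Longrightarrow> t \<in> {0..T0 + 1} \<Longrightarrow> \<bar>f y s - f y t\<bar> \<le> K y * \<bar>s - t\<bar>"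
    by blast
  have db: "\<bar>d n y t\<bar> \<le> K y" if "t \<in> {0..T0}" for n y t
  proof -
    have "1 / real (Suc n) \<le> 1" "1 / real (Suc n) \<ge> 0" by simp_all
    then have e: "t + 1 / real (Suc n) \<in> {0..T0 + 1}" "t \<in> {0..T0 + 1}"
      using that unfolding atLeastAtMost_iff by (intro conjI; linarith)+
    have "\<bar>d n y t\<bar> = \<bar>f y (t + 1 / real (Suc n)) - f y t\<bar> * real (Suc n)" by (simp add: d_def abs_mult)
    also have "\<dots> \<le> (K y * \<bar>1 / real (Suc n)\<bar>) * real (Suc n)"
      using K(2)[OF e, of y] by (intro mult_right_mono) auto
    finally show ?thesis by simp
  qed
  have "\<forall>y. \<exists>M. M \<ge> 0 \<and> (\<forall>t. \<bar>f y t\<bar> \<le> M)"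
    using periodic_continuous_bounded[OF T0_pos per cont] by blast
  from choice[OF this] obtain M where M: "\<And>y. M y \<ge> 0" "\<And>y t. \<bar>f y t\<bar> \<le> M y" by blast
  have Fb: "\<bar>F n y t\<bar> \<le> M y" for n y t
  proof -
    have "\<exists>z. t < z \<and> z < t + 1 / real (Suc n) \<and> P y (t + 1 / real (Suc n)) - P y t = (t + 1 / real (Suc n) - t) * f y z"
      by (rule MVT2) (use P in auto)
    then obtain z where "P y (t + 1 / real (Suc n)) - P y t = (t + 1 / real (Suc n) - t) * f y z" by blast
    then have "F n y t = f y z" by (simp add: F_def)
    then show ?thesis using M by simp
  qed
  have mub: "\<bar>\<Sum>y\<in>UNIV. \<mu> t $ y * h y\<bar> \<le> (\<Sum>y\<in>UNIV. K y)" if "\<And>y. \<bar>h y\<bar> \<le> K y" for t h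
  proof (rule order_trans[OF sum_abs], rule sum_mono)
    fix y
    have "\<bar>\<mu> t $ y * h y\<bar> \<le> 1 * K y"
      unfolding abs_mult using prob_vecs_range[OF a(7)[of t], of y] that by (intro mult_mono) auto
    then show "\<bar>\<mu> t $ y * h y\<bar> \<le> K y" by simp
  qed
  have L1: "set_integrable lborel {0..T0} (\<lambda>t. \<Sum>y\<in>UNIV. \<mu> t $ y * f' y t)"
    "(\<lambda>n. LINT t:{0..T0}|lborel. (\<Sum>y\<in>UNIV. \<mu> t $ y * d n y t)) \<longlonglongrightarrow> (LINT t:{0..T0}|lborel. (\<Sum>y\<in>UNIV. \<mu> t $ y * f' y t))"
  proof -
    have 1: "(\<lambda>t. \<Sum>y\<in>UNIV. \<mu> t $ y * f' y t) \<in> borel_measurable borel" using a(3) meas by measurable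
    have 2: "(\<lambda>t. \<Sum>y\<in>UNIV. \<mu> t $ y * d n y t) \<in> borel_measurable borel" for n using a(3) dm by measurable
    have 3: "set_integrable lborel {0..T0} (\<lambda>t. \<Sum>y\<in>UNIV. K y)"
      by (rule set_integrable_bounded[of _ _ _ "\<Sum>y\<in>UNIV. K y"]) (use K(1) in \<open>auto simp: sum_nonneg\<close>)
    have 4: "(\<lambda>n. \<Sum>y\<in>UNIV. \<mu> t $ y * d n y t) \<longlonglongrightarrow> (\<Sum>y\<in>UNIV. \<mu> t $ y * f' y t)" if "t \<in> {0..T0}" "t \<notin> N" for t
      unfolding d_def by (intro tendsto_intros der that)
    have 5: "\<bar>\<Sum>y\<in>UNIV. \<mu> t $ y * d n y t\<bar> \<le> (\<Sum>y\<in>UNIV. K y)" if "t \<in> {0..T0}" for t n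
      by (rule mub) (rule db[OF that])
    show "set_integrable lborel {0..T0} (\<lambda>t. \<Sum>y\<in>UNIV. \<mu> t $ y * f' y t)"
      by (rule set_dominated_convergence(1)[OF 1 2 3 N 4]) (use 5 in auto)
    show "(\<lambda>n. LINT t:{0..T0}|lborel. (\<Sum>y\<in>UNIV. \<mu> t $ y * d n y t)) \<longlonglongrightarrow> (LINT t:{0..T0}|lborel. (\<Sum>y\<in>UNIV. \<mu> t $ y * f' y t))"
      by (rule set_dominated_convergence(2)[OF 1 2 3 N 4]) (use 5 in auto)
  qed
  have L2: "(\<lambda>n. LINT t:{0..T0}|lborel. (\<Sum>y\<in>UNIV. divg (Q t) y * F n y t)) \<longlonglongrightarrow> (LINT t:{0..T0}|lborel. (\<Sum>y\<in>UNIV. divg (Q t) y * f y t))"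
  proof (rule set_dominated_convergence(2)[where N = "{}" and w = "\<lambda>t. \<Sum>y\<in>UNIV. \<bar>divg (Q t) y\<bar> * M y"])
    show "(\<lambda>t. \<Sum>y\<in>UNIV. divg (Q t) y * f y t) \<in> borel_measurable borel" using divg_integrable(2)[OF adm] tmod by measurable
    show "(\<lambda>t. \<Sum>y\<in>UNIV. divg (Q t) y * F n y t) \<in> borel_measurable borel" for n using divg_integrable(2)[OF adm] Fm by measurable
    show "set_integrable lborel {0..T0} (\<lambda>t. \<Sum>y\<in>UNIV. \<bar>divg (Q t) y\<bar> * M y)"
      by (intro set_integral_sum(1) set_integrable_mult_left set_integrable_abs divg_integrable(1)[OF adm])
    show "(\<lambda>n. \<Sum>y\<in>UNIV. divg (Q t) y * F n y t) \<longlonglongrightarrow> (\<Sum>y\<in>UNIV. divg (Q t) y * f y t)" for t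
      unfolding F_def by (intro tendsto_intros difference_quotient_tendsto P)
    show "\<bar>\<Sum>y\<in>UNIV. divg (Q t) y * F n y t\<bar> \<le> (\<Sum>y\<in>UNIV. \<bar>divg (Q t) y\<bar> * M y)" for n t
      by (rule order_trans[OF sum_abs], rule sum_mono) (auto simp: abs_mult intro: mult_left_mono Fb)
  qed auto
  show "set_integrable lborel {0..T0} (\<lambda>t. \<Sum>y\<in>UNIV. \<mu> t $ y * f' y t)" by (rule L1(1))
  show "(LINT t:{0..T0}|lborel. (\<Sum>y\<in>UNIV. \<mu> t $ y * f' y t)) = (LINT t:{0..T0}|lborel. (\<Sum>y\<in>UNIV. divg (Q t) y * f y t))"
    using L1(2) L2 unfolding eqn by (rule LIMSEQ_unique)
qed

text \<open>Logarithm of the ratio between the tilted rate and \<open>R\<close>: the exponential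
  weight of the jump combined with the Doob transform by \<open>g\<close>. It is also the slope at
  which Young's inequality is used on each edge.\<close>

definition alpha :: "(real^'v) \<times> (real^('v \<times> 'v)) \<Rightarrow> (real \<Rightarrow> 'v \<Rightarrow> real) \<Rightarrow> real \<Rightarrow> 'v \<Rightarrow> 'v \<Rightarrow> real" where
  "alpha l g t y z = edge_tilt l y z + ln (g t z) - ln (g t y)"

text \<open>The logarithmic derivative of \<open>g\<close> as given by its equation; written out so
  that it is defined and measurable at all times.\<close>

definition dlog :: "(real^'v) \<times> (real^('v \<times> 'v)) \<Rightarrow> real \<Rightarrow> (real \<Rightarrow> 'v \<Rightarrow> real) \<Rightarrow> 'v \<Rightarrow> real \<Rightarrow> real" where
  "dlog l L g y t = L - (\<Sum>z\<in>UNIV. tilted_matrix l t y z * g t z) / g t y"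

text \<open>A lower bound for \<open>It\<close> by the Legendre representation of \<open>Phi\<close>; its integral along an admissible path with
  averages \<open>p\<close> is \<open>T0 * (l \<bullet> p - L)\<close>.\<close>

definition gain :: "(real^'v) \<times> (real^('v \<times> 'v)) \<Rightarrow> (real \<Rightarrow> 'v \<Rightarrow> real) \<Rightarrow> real \<Rightarrow> real^'v \<Rightarrow> real^('v \<times> 'v) \<Rightarrow> real" where
  "gain l g t \<mu> Q = (\<Sum>(y, z)\<in>E. Q $ (y, z) * alpha l g t y z - \<mu> $ y * R t y z * (exp (alpha l g t y z) - 1))"

context
  fixes l L g assumes tl: "tilt l L g"
begin

lemma g_per: "g (t + T0) = g t" and g_pos: "g t y > 0" and g_lip: "lip a b (\<lambda>t. g t y)"
  and g_der: "t \<notin> exc_times \<Longrightarrow> ((\<lambda>t. g t y) has_real_derivative (L * g t y - (\<Sum>z\<in>UNIV. tilted_matrix l t y z * g t z))) (at t)"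
  using tl unfolding tilt_def by blast+

lemma g_cont: "continuous_on UNIV (\<lambda>t. g t y)"
  by (rule lip_continuous[OF g_lip])

lemma g_meas: "(\<lambda>t. g t y) \<in> borel_measurable borel"
  by (rule borel_measurable_continuous_onI[OF g_cont])

lemma lng_cont: "continuous_on UNIV (\<lambda>t. ln (g t y))"
  by (intro continuous_on_ln g_cont) (use g_pos in \<open>auto simp: less_imp_neq[symmetric]\<close>)

lemma lng_bounded: obtains M where "M \<ge> 0" "\<And>t y. \<bar>ln (g t y)\<bar> \<le> M"
proof -
  have per: "ln (g (t + T0) y) = ln (g t y)" for t y by (simp add: g_per)
  have "\<forall>y. \<exists>M. M \<ge> 0 \<and> (\<forall>t. \<bar>ln (g t y)\<bar> \<le> M)"
    using periodic_continuous_bounded[OF T0_pos per lng_cont] by blast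
  from choice[OF this] obtain M where M: "\<And>y. M y \<ge> 0" "\<And>y t. \<bar>ln (g t y)\<bar> \<le> M y" by blast
  have "M y \<le> (\<Sum>y\<in>UNIV. M y)" for y by (rule member_le_sum) (use M in auto)
  then have "\<bar>ln (g t y)\<bar> \<le> (\<Sum>y\<in>UNIV. M y)" for t y using M(2)[of t y] order_trans by blast
  moreover have "(\<Sum>y\<in>UNIV. M y) \<ge> 0" by (intro sum_nonneg M)
  ultimately show thesis using that by blast
qed

lemma g_bounds: obtains m M where "m > 0" "\<And>t y. m \<le> g t y" "\<And>t y. g t y \<le> M"
proof -
  obtain M where M: "\<And>t y. \<bar>ln (g t y)\<bar> \<le> M" by (rule lng_bounded) blast
  have "exp (- M) \<le> g t y" "g t y \<le> exp M" for t y
  proof -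
    have "exp (- M) \<le> exp (ln (g t y))" "exp (ln (g t y)) \<le> exp M" using M[of t y] by auto
    then show "exp (- M) \<le> g t y" "g t y \<le> exp M" using g_pos[of t y] by auto
  qed
  then show thesis by (intro that[of "exp (- M)" "exp M"]) auto
qed

lemma lng_lip: "lip a b (\<lambda>t. ln (g t y))"
proof -
  obtain m where m: "m > 0" "\<And>t y. m \<le> g t y" by (rule g_bounds) blast
  show ?thesis by (rule lip_ln[OF g_lip m(1)]) (rule m)
qed

lemma lng_der: "t \<notin> exc_times \<Longrightarrow> ((\<lambda>t. ln (g t y)) has_real_derivative dlog l L g y t) (at t)"
  using g_der[of t y] g_pos[of t y]
  by (auto intro!: derivative_eq_intros simp: dlog_def field_simps)

lemma dlog_meas [measurable]: "dlog l L g y \<in> borel_measurable borel"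
  unfolding dlog_def using g_meas by measurable

lemma alpha_meas [measurable]: "(\<lambda>t. alpha l g t y z) \<in> borel_measurable borel"
  unfolding alpha_def using g_meas by measurable

lemma exp_alpha: "exp (alpha l g t y z) = exp (edge_tilt l y z) * g t z / g t y"
  using g_pos by (simp add: alpha_def exp_add exp_diff)

text \<open>The equation for \<open>g\<close> divided by \<open>g\<close>: the diagonal of
  \<open>tilted_matrix\<close> contributes the potential and minus the exit rate, and
  \<open>g t z / g t y\<close> turns the off-diagonal part into rates weighted by
  \<open>exp (alpha l g t y z)\<close>.\<close>

lemma tilt_identity:
  "(\<Sum>z\<in>UNIV. R t y z * (exp (alpha l g t y z) - 1)) = L - fst l $ y - dlog l L g y t"
proof -
  have "(\<Sum>z\<in>UNIV. tilted_matrix l t y z * g t z) = (fst l $ y - (\<Sum>w\<in>UNIV. R t y w)) * g t y + (\<Sum>z\<in>UNIV - {y}. R t y z * exp (edge_tilt l y z) * g t z)"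
    by (subst sum.remove[of UNIV y]) (auto simp: tilted_matrix_def intro!: sum.cong)
  also have "(\<Sum>z\<in>UNIV - {y}. R t y z * exp (edge_tilt l y z) * g t z) = (\<Sum>z\<in>UNIV. R t y z * exp (edge_tilt l y z) * g t z)"
    by (rule sum.mono_neutral_left) (auto simp: R_diag)
  finally have "(\<Sum>z\<in>UNIV. tilted_matrix l t y z * g t z) / g t y = fst l $ y - (\<Sum>w\<in>UNIV. R t y w) + (\<Sum>z\<in>UNIV. R t y z * exp (edge_tilt l y z) * g t z) / g t y"
    using g_pos[of t y] by (simp add: field_simps)
  also have "(\<Sum>z\<in>UNIV. R t y z * exp (edge_tilt l y z) * g t z) / g t y = (\<Sum>z\<in>UNIV. R t y z * exp (alpha l g t y z))"
    by (simp add: exp_alpha sum_divide_distrib mult.assoc)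
  finally show ?thesis by (simp add: dlog_def right_diff_distrib sum_subtractf)
qed

text \<open>Summation by parts over the graph: pairing \<open>Q\<close> with the increments of
  \<open>ln g\<close> is minus pairing its divergence with \<open>ln g\<close>. The two sums at the
  end are those of the continuity equation tested against \<open>ln g\<close>, and cancel after
  integration in time.\<close>

lemma gain_eq:
  assumes mu: "(\<Sum>y\<in>UNIV. \<mu> $ y) = 1" and Q: "\<And>e. e \<notin> E \<Longrightarrow> Q $ e = 0"
  shows "gain l g t \<mu> Q = l \<bullet> (\<mu>, Q) - L + (\<Sum>y\<in>UNIV. \<mu> $ y * dlog l L g y t) - (\<Sum>y\<in>UNIV. divg Q y * ln (g t y))"
proof -
  have "gain l g t \<mu> Q = (\<Sum>(y, z)\<in>UNIV. Q $ (y, z) * alpha l g t y z - \<mu> $ y * R t y z * (exp (alpha l g t y z) - 1))"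
    unfolding gain_def by (rule sum.mono_neutral_left) (use Q R_off in auto)
  also have "\<dots> = (\<Sum>y\<in>UNIV. \<Sum>z\<in>UNIV. Q $ (y, z) * alpha l g t y z - \<mu> $ y * R t y z * (exp (alpha l g t y z) - 1))"
    by (simp add: sum.cartesian_product)
  also have "\<dots> = (\<Sum>y\<in>UNIV. \<Sum>z\<in>UNIV. Q $ (y, z) * alpha l g t y z) - (\<Sum>y\<in>UNIV. \<mu> $ y * (\<Sum>z\<in>UNIV. R t y z * (exp (alpha l g t y z) - 1)))"
    by (simp add: sum_subtractf sum_distrib_left mult.assoc)
  also have "(\<Sum>y\<in>UNIV. \<mu> $ y * (\<Sum>z\<in>UNIV. R t y z * (exp (alpha l g t y z) - 1))) = L - fst l \<bullet> \<mu> - (\<Sum>y\<in>UNIV. \<mu> $ y * dlog l L g y t)"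
    unfolding tilt_identity using mu
    by (simp add: right_diff_distrib sum_subtractf inner_vec_def mult.commute flip: sum_distrib_left)
  also have "(\<Sum>y\<in>UNIV. \<Sum>z\<in>UNIV. Q $ (y, z) * alpha l g t y z) =
      (\<Sum>y\<in>UNIV. \<Sum>z\<in>UNIV. snd l $ (y, z) * Q $ (y, z)) + (\<Sum>y\<in>UNIV. \<Sum>z\<in>UNIV. Q $ (y, z) * ln (g t z)) - (\<Sum>y\<in>UNIV. \<Sum>z\<in>UNIV. Q $ (y, z) * ln (g t y))"
  proof -
    have "Q $ (y, z) * alpha l g t y z = snd l $ (y, z) * Q $ (y, z) + Q $ (y, z) * ln (g t z) - Q $ (y, z) * ln (g t y)" for y z
      using Q[of "(y, z)"] by (cases "(y, z) \<in> E") (auto simp: alpha_def edge_tilt_def algebra_simps)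
    then show ?thesis by (simp add: sum.distrib sum_subtractf)
  qed
  also have "(\<Sum>y\<in>UNIV. \<Sum>z\<in>UNIV. snd l $ (y, z) * Q $ (y, z)) = snd l \<bullet> Q"
    by (simp add: inner_vec_def sum.cartesian_product)
  also have "(\<Sum>y\<in>UNIV. \<Sum>z\<in>UNIV. Q $ (y, z) * ln (g t z)) = (\<Sum>z\<in>UNIV. (\<Sum>y\<in>UNIV. Q $ (y, z)) * ln (g t z))"
    by (subst sum.swap) (simp add: sum_distrib_right)
  finally show ?thesis
    by (simp add: divg_def left_diff_distrib sum_subtractf inner_prod_def sum_distrib_right)
qed

lemma gain_integral:
  assumes adm: "admissible r T0 (fst p) (snd p) \<mu> Q"
  shows "set_integrable lborel {0..T0} (\<lambda>t. gain l g t (\<mu> t) (Q t))"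
    and "(LINT t:{0..T0}|lborel. gain l g t (\<mu> t) (Q t)) = T0 * (l \<bullet> p - L)"
proof -
  note a = admD[OF adm]
  have eq: "gain l g t (\<mu> t) (Q t) = ((\<Sum>y\<in>UNIV. fst l $ y * \<mu> t $ y) + (\<Sum>e\<in>UNIV. snd l $ e * Q t $ e) - L)
      + (\<Sum>y\<in>UNIV. \<mu> t $ y * dlog l L g y t) - (\<Sum>y\<in>UNIV. divg (Q t) y * ln (g t y))" for t
  proof -
    have "(\<Sum>y\<in>UNIV. \<mu> t $ y) = 1" using a(7)[of t] by (simp add: prob_vecs_def)
    then show ?thesis by (subst gain_eq) (use a(13) in \<open>auto simp: inner_prod_def inner_vec_def\<close>)
  qed
  have mui: "set_integrable lborel {0..T0} (\<lambda>t. \<mu> t $ y)" for y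
    by (rule set_integrable_bounded[OF a(3), of _ _ _ 1]) (use prob_vecs_range[OF a(7)] in auto)
  have ci: "set_integrable lborel {0..T0} (\<lambda>t. L)"
    by (rule set_integrable_bounded[of _ _ _ "\<bar>L\<bar>"]) auto
  have cv: "(LINT t:{0..T0}|lborel. L) = T0 * L"
    using T0_pos by (simp add: set_lebesgue_integral_def)
  have i1: "set_integrable lborel {0..T0} (\<lambda>t. \<Sum>y\<in>UNIV. fst l $ y * \<mu> t $ y)"
    "set_integrable lborel {0..T0} (\<lambda>t. \<Sum>e\<in>UNIV. snd l $ e * Q t $ e)"
    by (intro set_integral_sum(1) set_integrable_mult_right mui a(9))+
  have v1: "(LINT t:{0..T0}|lborel. (\<Sum>y\<in>UNIV. fst l $ y * \<mu> t $ y)) = T0 * (fst l \<bullet> fst p)"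
    "(LINT t:{0..T0}|lborel. (\<Sum>e\<in>UNIV. snd l $ e * Q t $ e)) = T0 * (snd l \<bullet> snd p)"
    by (simp_all add: set_integral_sum(2) set_integrable_mult_right mui a(9,10,11) inner_vec_def sum_distrib_left mult_ac)
  note w = weak_equation_lip[OF adm, where f = "\<lambda>y t. ln (g t y)" and f' = "dlog l L g", OF _ lng_lip exc_times_null difference_quotient_tendsto[OF lng_der] dlog_meas]
  have w1: "set_integrable lborel {0..T0} (\<lambda>t. \<Sum>y\<in>UNIV. \<mu> t $ y * dlog l L g y t)"
    by (rule w(1)) (simp_all add: g_per)
  have w2: "(LINT t:{0..T0}|lborel. (\<Sum>y\<in>UNIV. \<mu> t $ y * dlog l L g y t)) = (LINT t:{0..T0}|lborel. (\<Sum>y\<in>UNIV. divg (Q t) y * ln (g t y)))"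
    by (rule w(2)) (simp_all add: g_per)
  obtain M where M: "\<And>t y. \<bar>ln (g t y)\<bar> \<le> M" by (rule lng_bounded) blast
  have w3: "set_integrable lborel {0..T0} (\<lambda>t. \<Sum>y\<in>UNIV. divg (Q t) y * ln (g t y))"
    by (intro set_integral_sum(1) set_integrable_mult_bounded[where M = M] divg_integrable(1)[OF adm] M) (use g_meas in measurable)
  have j: "set_integrable lborel {0..T0} (\<lambda>t. (\<Sum>y\<in>UNIV. fst l $ y * \<mu> t $ y) + (\<Sum>e\<in>UNIV. snd l $ e * Q t $ e) - L)"
    by (intro set_integral_diff(1) set_integral_add(1) i1 ci)
  show "set_integrable lborel {0..T0} (\<lambda>t. gain l g t (\<mu> t) (Q t))"
    unfolding eq by (intro set_integral_diff(1) set_integral_add(1) i1 ci w1 w3)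
  show "(LINT t:{0..T0}|lborel. gain l g t (\<mu> t) (Q t)) = T0 * (l \<bullet> p - L)"
    unfolding eq set_integral_diff(2)[OF set_integral_add(1)[OF j w1] w3] set_integral_add(2)[OF j w1]
        set_integral_diff(2)[OF set_integral_add(1)[OF i1] ci] set_integral_add(2)[OF i1] v1 w2 cv inner_prod_def
    by (simp add: algebra_simps)
qed

lemma gain_le_It:
  assumes "t \<ge> 0" "\<mu> \<in> prob_vecs" "\<And>e. Q $ e \<ge> 0"
  shows "ennreal (gain l g t \<mu> Q) \<le> It r t \<mu> Q"
proof -
  have "ennreal (gain l g t \<mu> Q) \<le> (\<Sum>e\<in>E. ennreal (case e of (y, z) \<Rightarrow> Q $ (y, z) * alpha l g t y z - \<mu> $ y * R t y z * (exp (alpha l g t y z) - 1)))"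
    unfolding gain_def by (rule ennreal_sum_le)
  also have "\<dots> \<le> It r t \<mu> Q"
    unfolding It_def
  proof (intro sum_mono)
    fix e assume "e \<in> E"
    obtain y z where e: "e = (y, z)" by (cases e)
    have "ennreal (Q $ (y, z) * alpha l g t y z - \<mu> $ y * R t y z * (exp (alpha l g t y z) - 1)) \<le> Phi (Q $ (y, z)) (\<mu> $ y * R t y z)"
      by (rule Phi_ge) (use assms R_nonneg prob_vecs_range in \<open>auto intro!: mult_nonneg_nonneg\<close>)
    then show "ennreal (case e of (y, z) \<Rightarrow> Q $ (y, z) * alpha l g t y z - \<mu> $ y * R t y z * (exp (alpha l g t y z) - 1)) \<le> (case e of (y, z) \<Rightarrow> Phi (Q $ (y, z)) (\<mu> $ y * r y z t))"
      using R_eq[OF assms(1)] by (simp add: e)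
  qed
  finally show ?thesis .
qed

lemma adm_lower:
  assumes adm: "admissible r T0 (fst p) (snd p) \<mu> Q"
  shows "ennreal (T0 * (l \<bullet> p - L)) \<le> (\<integral>\<^sup>+ t\<in>{0..T0}. It r t (\<mu> t) (Q t) \<partial>lborel)"
proof -
  note a = admD[OF adm]
  have "ennreal (LINT t|lborel. indicator {0..T0} t *\<^sub>R gain l g t (\<mu> t) (Q t)) \<le> (\<integral>\<^sup>+ t\<in>{0..T0}. It r t (\<mu> t) (Q t) \<partial>lborel)"
  proof (rule integral_le_nn_integral)
    show "integrable lborel (\<lambda>t. indicator {0..T0} t *\<^sub>R gain l g t (\<mu> t) (Q t))"
      using gain_integral(1)[OF adm] by (simp add: set_integrable_def)
    fix t show "ennreal (indicator {0..T0} t *\<^sub>R gain l g t (\<mu> t) (Q t)) \<le> It r t (\<mu> t) (Q t) * indicator {0..T0} t"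
      using gain_le_It[of t "\<mu> t" "Q t"] a(7,12) by (cases "t \<in> {0..T0}") auto
  qed
  then show ?thesis using gain_integral(2)[OF adm] by (simp add: set_lebesgue_integral_def)
qed

lemma Ibar_lower: "ennreal (l \<bullet> p - L) \<le> Ibar r T0 p"
  unfolding Ibar_def
proof (rule INF_greatest, clarsimp)
  fix \<mu> Q assume adm: "admissible r T0 (fst p) (snd p) \<mu> Q"
  have "ennreal (l \<bullet> p - L) = ennreal (T0 * (l \<bullet> p - L)) / ennreal T0"
  proof (cases "l \<bullet> p - L \<ge> 0")
    case True
    then show ?thesis using T0_pos by (simp add: divide_ennreal)
  next
    case False
    then have "T0 * (l \<bullet> p - L) \<le> 0" using T0_pos by (simp add: mult_le_0_iff)
    then show ?thesis using False by (simp add: ennreal_neg)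
  qed
  also have "\<dots> \<le> (\<integral>\<^sup>+ t\<in>{0..T0}. It r t (\<mu> t) (Q t) \<partial>lborel) / ennreal T0"
    by (intro divide_right_mono_ennreal adm_lower adm)
  finally show "ennreal (l \<bullet> p - L) \<le> (\<integral>\<^sup>+ t\<in>{0..T0}. It r t (\<mu> t) (Q t) \<partial>lborel) / ennreal T0" .
qed

end

end

lemma borel_measurable_vec:
  fixes f :: "'a \<Rightarrow> real^'n::finite"
  assumes "\<And>i. (\<lambda>x. f x $ i) \<in> borel_measurable M"
  shows "f \<in> borel_measurable M"
proof (subst borel_measurable_euclidean_space, rule ballI)
  fix b :: "real^'n" assume "b \<in> Basis"
  then obtain i where "b = axis i 1" by (auto simp: Basis_vec_def)
  then have "(\<lambda>x. f x \<bullet> b) = (\<lambda>x. f x $ i)" by (auto simp: inner_axis)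
  then show "(\<lambda>x. f x \<bullet> b) \<in> borel_measurable M" using assms by simp
qed

context periodic_rates
begin

section \<open>Attainment of the dual bound\<close>

definition tilted_rate :: "(real^'v) \<times> (real^('v \<times> 'v)) \<Rightarrow> (real \<Rightarrow> 'v \<Rightarrow> real) \<Rightarrow> real \<Rightarrow> 'v \<Rightarrow> 'v \<Rightarrow> real" where
  "tilted_rate l g t y z = R t y z * exp (alpha l g t y z)"

text \<open>Acts on laws, not on functions: the off-diagonal entry at \<open>(y, z)\<close> is the
  rate from \<open>z\<close> to \<open>y\<close>, so \<open>sol (tilted_gen l g)\<close> is the
  forward equation of the tilted chain.\<close>

definition tilted_gen :: "(real^'v) \<times> (real^('v \<times> 'v)) \<Rightarrow> (real \<Rightarrow> 'v \<Rightarrow> real) \<Rightarrow> real \<Rightarrow> 'v \<Rightarrow> 'v \<Rightarrow> real" where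
  "tilted_gen l g t y z = (if y = z then - (\<Sum>w\<in>UNIV. tilted_rate l g t y w) else tilted_rate l g t z y)"

definition flow :: "(real^'v) \<times> (real^('v \<times> 'v)) \<Rightarrow> (real \<Rightarrow> 'v \<Rightarrow> real) \<Rightarrow> real \<Rightarrow> ('v \<Rightarrow> real) \<Rightarrow> real^('v \<times> 'v)" where
  "flow l g t m = (\<chi> e. m (fst e) * tilted_rate l g t (fst e) (snd e))"

lemma tilted_rate_off: "(y, z) \<notin> E \<Longrightarrow> tilted_rate l g t y z = 0"
  by (simp add: tilted_rate_def R_off)

lemma tilted_rate_nonneg: "tilted_rate l g t y z \<ge> 0"
  by (simp add: tilted_rate_def R_nonneg)

lemma tilted_rate_pos: "(y, z) \<in> E \<Longrightarrow> tilted_rate l g t y z > 0"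
  by (simp add: tilted_rate_def R_pos)

lemma tilted_gen_flow: "(\<Sum>z\<in>UNIV. tilted_gen l g t y z * m z) = - divg (flow l g t m) y"
proof -
  have d: "tilted_rate l g t y y = 0" for y by (rule tilted_rate_off) (auto simp: edges_def)
  have "(\<Sum>z\<in>UNIV. tilted_gen l g t y z * m z) = - (\<Sum>w\<in>UNIV. tilted_rate l g t y w) * m y + (\<Sum>z\<in>UNIV - {y}. tilted_rate l g t z y * m z)"
    by (subst sum.remove[of UNIV y]) (auto simp: tilted_gen_def intro!: sum.cong)
  also have "(\<Sum>z\<in>UNIV - {y}. tilted_rate l g t z y * m z) = (\<Sum>z\<in>UNIV. tilted_rate l g t z y * m z)"
    by (rule sum.mono_neutral_left) (auto simp: d)
  finally show ?thesis by (simp add: divg_def flow_def sum_distrib_left sum_distrib_right mult.commute)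
qed

lemma divg_sum: "(\<Sum>y\<in>UNIV. divg Q y) = 0"
  unfolding divg_def sum_subtractf by (subst sum.swap) simp

context
  fixes l L g assumes tl: "tilt l L g"
begin

lemma tilted_rate_meas [measurable]: "(\<lambda>t. tilted_rate l g t y z) \<in> borel_measurable borel"
  unfolding tilted_rate_def using alpha_meas[OF tl] by measurable

lemma tilted_rate_per: "tilted_rate l g (t + T0) = tilted_rate l g t"
  by (simp add: tilted_rate_def alpha_def R_per g_per[OF tl] fun_eq_iff)

lemma tilted_rate_bound: obtains C where "C > 0" "\<And>t y z. tilted_rate l g t y z \<le> C"
proof -
  obtain C where C: "C > 0" "\<And>t y z. R t y z \<le> C" by (rule R_bound) blast
  obtain M where M: "\<And>t y. \<bar>ln (g t y)\<bar> \<le> M" by (rule lng_bounded[OF tl]) blast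
  define D where "D = C * exp ((\<Sum>e\<in>UNIV. \<bar>edge_tilt l (fst e) (snd e)\<bar>) + 2 * M)"
  have "tilted_rate l g t y z \<le> D" for t y z
  proof -
    have "\<bar>edge_tilt l (fst (y, z)) (snd (y, z))\<bar> \<le> (\<Sum>e\<in>UNIV. \<bar>edge_tilt l (fst e) (snd e)\<bar>)"
      by (rule member_le_sum) auto
    then have "alpha l g t y z \<le> (\<Sum>e\<in>UNIV. \<bar>edge_tilt l (fst e) (snd e)\<bar>) + 2 * M"
      using M[of t y] M[of t z] unfolding alpha_def by (simp add: abs_le_iff)
    then show ?thesis unfolding tilted_rate_def D_def by (intro mult_mono) (use C R_nonneg in auto)
  qed
  moreover have "D > 0" using C by (simp add: D_def)
  ultimately show thesis using that by blast
qed

lemma tilted_rate_cont: assumes "t \<notin> exc_times" shows "isCont (\<lambda>t. tilted_rate l g t y z) t"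
proof -
  have "isCont (\<lambda>t. g t y) t" "g t y \<noteq> 0" for y
    using g_cont[OF tl] g_pos[OF tl, of t y] by (simp_all add: continuous_on_eq_continuous_at)
  then show ?thesis unfolding tilted_rate_def alpha_def by (intro continuous_intros R_cont assms)
qed

lemma tilted_gen_meas [measurable]: "(\<lambda>t. tilted_gen l g t y z) \<in> borel_measurable borel"
  unfolding tilted_gen_def by measurable

lemma tilted_gen_per: "tilted_gen l g (t + T0) = tilted_gen l g t"
  by (simp add: tilted_gen_def tilted_rate_per fun_eq_iff)

lemma tilted_gen_bound: obtains C where "C > 0" "\<And>t y z. \<bar>tilted_gen l g t y z\<bar> \<le> C"
proof -
  obtain C where C: "C > 0" "\<And>t y z. tilted_rate l g t y z \<le> C" by (rule tilted_rate_bound) blast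
  define D where "D = (\<Sum>w\<in>(UNIV::'v set). C)"
  have CD: "C \<le> D" unfolding D_def by (rule member_le_sum[where f = "\<lambda>_. C"]) (use C in auto)
  have "\<bar>tilted_gen l g t y z\<bar> \<le> D" for t y z
  proof (cases "y = z")
    case True
    have "(\<Sum>w\<in>UNIV. tilted_rate l g t y w) \<le> D" unfolding D_def by (intro sum_mono C)
    moreover have "(\<Sum>w\<in>UNIV. tilted_rate l g t y w) \<ge> 0" by (intro sum_nonneg tilted_rate_nonneg)
    ultimately show ?thesis using True by (simp add: tilted_gen_def)
  next
    case False
    then show ?thesis using CD C(2)[of t z y] tilted_rate_nonneg[of l g t z y] by (simp add: tilted_gen_def)
  qed
  then show thesis using that[of D] CD C(1) by force
qed

lemma tilted_gen_cont: "t \<notin> exc_times \<Longrightarrow> isCont (\<lambda>t. tilted_gen l g t y z) t"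
  by (cases "y = z") (auto simp: tilted_gen_def intro!: continuous_intros tilted_rate_cont)

lemma tilted_gen_off: "y \<noteq> z \<Longrightarrow> tilted_gen l g t y z \<ge> 0"
  by (simp add: tilted_gen_def tilted_rate_nonneg)

lemma tilted_gen_edge: "(y, z) \<in> E\<inverse> \<Longrightarrow> y \<noteq> z \<and> tilted_gen l g t y z > 0"
  using edge_neq tilted_rate_pos by (auto simp: tilted_gen_def)

lemma conn_converse: "(y, z) \<in> (E\<inverse>)\<^sup>*"
  using A2 by (simp add: rtrancl_converse)

text \<open>Perron's theorem yields a periodic solution with some exponent \<open>K\<close>. The
  forward equation conserves mass, so the total mass is an exponential with rate \<open>- K\<close>;
  being periodic and positive it is constant and \<open>K = 0\<close>. Dividing by the mass
  normalises.\<close>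

lemma stationary_exists:
  obtains m where "sol (tilted_gen l g) exc_times m" "\<And>t. m (t + T0) = m t" "\<And>t y. m t y > 0" "\<And>t. (\<Sum>y\<in>UNIV. m t y) = 1"
proof -
  obtain C where C: "\<And>t y z. \<bar>tilted_gen l g t y z\<bar> \<le> C" by (rule tilted_gen_bound) blast
  obtain K m where m: "sol (\<lambda>t y z. tilted_gen l g t y z - (if y = z then K else 0)) exc_times m"
    "\<And>t. m (t + T0) = m t" "\<And>t y. m t y > 0"
    \<comment> \<open>The edges are reversed because the matrix is transposed.\<close>
    by (rule perron_periodic[OF T0_pos N0_null _ exc_times_def, where A = "tilted_gen l g" and k = C and Ed = "E\<inverse>"])
       (use C tilted_gen_meas tilted_gen_off tilted_gen_per tilted_gen_cont tilted_gen_edge conn_converse in \<open>auto simp: N0_def\<close>)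
  define s where "s t = (\<Sum>y\<in>UNIV. m t y)" for t
  have lip: "lip a b s" for a b unfolding s_def using m(1) by (intro lip_sum) (simp add: sol_def)
  have spos: "s t > 0" for t unfolding s_def by (intro sum_pos m(3)) auto
  have der: "(s has_real_derivative (- K * s t)) (at t)" if "t \<notin> exc_times" for t
  proof -
    have "(s has_real_derivative (\<Sum>y\<in>UNIV. \<Sum>z\<in>UNIV. (tilted_gen l g t y z - (if y = z then K else 0)) * m t z)) (at t)"
      unfolding s_def using m(1) that by (intro DERIV_sum) (simp add: sol_def)
    moreover have "(\<Sum>y\<in>UNIV. \<Sum>z\<in>UNIV. (tilted_gen l g t y z - (if y = z then K else 0)) * m t z) = - K * s t"
      by (simp add: left_diff_distrib sum_subtractf tilted_gen_flow sum_negf divg_sum s_def sum_distrib_left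
          if_distrib[of "\<lambda>x. x * _"] cong: if_cong)
    ultimately show ?thesis by simp
  qed
  have const: "exp (K * b) * s b = exp (K * a) * s a" if "a \<le> b" for a b
  proof -
    have "(LINT t:{a..b}|lborel. 0) = exp (K * b) * s b - exp (K * a) * s a"
    proof (rule lip_FTC(2)[OF _ that exc_times_null])
      show "lip a b (\<lambda>t. exp (K * t) * s t)" by (intro lip_mult lip_exp lip)
      fix t assume "t \<notin> exc_times"
      then show "((\<lambda>t. exp (K * t) * s t) has_real_derivative 0) (at t)"
        using der[of t] by (auto intro!: derivative_eq_intros simp: algebra_simps)
    qed auto
    then show ?thesis by (simp add: set_lebesgue_integral_def)
  qed
  have "s T0 = s 0" using m(2)[of 0] by (simp add: s_def)
  then have "exp (K * T0) = 1" using const[of 0 T0] T0_pos spos[of 0] by simp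
  then have K: "K = 0" using T0_pos by simp
  have sc: "s t = s 0" for t using const[of 0 t] const[of t 0] K by (cases "t \<ge> 0") auto
  show thesis
  proof (rule that[of "\<lambda>t y. m t y / s 0"])
    show "sol (tilted_gen l g) exc_times (\<lambda>t y. m t y / s 0)"
      unfolding sol_def
    proof (intro conjI allI impI)
      fix y a b
      have "lip a b (\<lambda>t. (1 / s 0) * m t y)" using m(1) by (intro lip_cmult) (simp add: sol_def)
      then show "lip a b (\<lambda>t. m t y / s 0)" by simp
    next
      fix t y assume "t \<notin> exc_times"
      then have "((\<lambda>t. m t y) has_real_derivative (\<Sum>z\<in>UNIV. tilted_gen l g t y z * m t z)) (at t)"
        using m(1) K by (simp add: sol_def cong: if_cong)
      from DERIV_cdivide[OF this, of "s 0"]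
      show "((\<lambda>t. m t y / s 0) has_real_derivative (\<Sum>z\<in>UNIV. tilted_gen l g t y z * (m t z / s 0))) (at t)"
        by (simp add: sum_divide_distrib)
    qed
    show "(\<Sum>y\<in>UNIV. m t y / s 0) = 1" for t
      using sc[of t] spos[of 0] by (simp add: s_def flip: sum_divide_distrib)
  qed (use m spos in auto)
qed

text \<open>On the flow of the tilted chain Young's inequality is an equality on every edge. Each
  edge term is nonnegative, by \<open>1 - a \<le> exp (- a)\<close>, so taking
  \<open>ennreal\<close> edge by edge loses nothing.\<close>

lemma flow_gain:
  assumes "\<And>y. m $ y \<ge> 0" "t \<ge> 0"
  shows "It r t m (flow l g t (($) m)) = ennreal (gain l g t m (flow l g t (($) m)))"
    and "gain l g t m (flow l g t (($) m)) \<ge> 0"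
proof -
  let ?f = "\<lambda>(y, z). flow l g t (($) m) $ (y, z) * alpha l g t y z - m $ y * R t y z * (exp (alpha l g t y z) - 1)"
  have nn: "?f e \<ge> 0" for e
  proof -
    obtain y z where e: "e = (y, z)" by (cases e)
    let ?a = "alpha l g t y z"
    have "1 - ?a \<le> exp (- ?a)" using exp_ge_add_one_self[of "- ?a"] by simp
    then have "exp ?a * (1 - ?a) \<le> exp ?a * exp (- ?a)" by (intro mult_left_mono) auto
    then have "0 \<le> exp ?a * ?a - (exp ?a - 1)" by (simp add: algebra_simps flip: exp_add)
    then have "0 \<le> (m $ y * R t y z) * (exp ?a * ?a - (exp ?a - 1))"
      by (intro mult_nonneg_nonneg assms R_nonneg)
    then show ?thesis by (simp add: e flow_def tilted_rate_def algebra_simps)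
  qed
  show "gain l g t m (flow l g t (($) m)) \<ge> 0" unfolding gain_def by (intro sum_nonneg nn)
  have "It r t m (flow l g t (($) m)) = (\<Sum>e\<in>E. ennreal (?f e))"
    unfolding It_def
  proof (rule sum.cong[OF refl])
    fix e assume "e \<in> E"
    obtain y z where e: "e = (y, z)" by (cases e)
    have "Phi (flow l g t (($) m) $ (y, z)) (m $ y * R t y z) = ennreal (?f (y, z))"
      unfolding prod.case by (rule Phi_eq) (use assms R_nonneg in \<open>auto simp: flow_def tilted_rate_def intro!: mult_nonneg_nonneg\<close>)
    then show "(case e of (y, z) \<Rightarrow> Phi (flow l g t (($) m) $ (y, z)) (m $ y * r y z t)) = ennreal (?f e)"
      using R_eq[OF assms(2)] by (simp add: e)
  qed
  also have "\<dots> = ennreal (\<Sum>e\<in>E. ?f e)" by (rule sum_ennreal) (rule nn)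
  finally show "It r t m (flow l g t (($) m)) = ennreal (gain l g t m (flow l g t (($) m)))"
    by (simp add: gain_def)
qed

text \<open>The derivative of \<open>\<Sum>y. m t y * f y t\<close> is given by the forward equation
  off \<open>exc_times\<close>, and its integral over one period vanishes; this is the weak
  equation.\<close>

lemma stationary_admissible:
  assumes m: "sol (tilted_gen l g) exc_times m" "\<And>t. m (t + T0) = m t" "\<And>t y. m t y \<ge> 0" "\<And>t. (\<Sum>y\<in>UNIV. m t y) = 1"
  defines "p \<equiv> ((\<chi> y. (LINT t:{0..T0}|lborel. m t y) / T0), (\<chi> e. (LINT t:{0..T0}|lborel. flow l g t (m t) $ e) / T0))"
  shows "admissible r T0 (fst p) (snd p) (\<lambda>t. \<chi> y. m t y) (\<lambda>t. flow l g t (m t))"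
proof -
  have mlip: "lip a b (\<lambda>t. m t y)" for a b y using m(1) by (simp add: sol_def)
  have mm [measurable]: "(\<lambda>t. m t y) \<in> borel_measurable borel" for y by (rule lip_measurable[OF mlip])
  have m1: "m t y \<le> 1" for t y
  proof -
    have "m t y \<le> (\<Sum>y\<in>UNIV. m t y)" by (rule member_le_sum) (use m in auto)
    then show ?thesis using m(4) by simp
  qed
  have tmod: "(\<lambda>t. flow l g t (m t) $ e) \<in> borel_measurable borel" for e
    unfolding flow_def by simp
  obtain C where C: "C > 0" "\<And>t y z. tilted_rate l g t y z \<le> C" by (rule tilted_rate_bound) blast
  have f0: "flow l g t (m t) $ e \<ge> 0" for t e
    unfolding flow_def by (simp add: m tilted_rate_nonneg)
  have fC: "flow l g t (m t) $ e \<le> 1 * C" for t e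
    unfolding flow_def vec_lambda_beta by (intro mult_mono m1 C) (use tilted_rate_nonneg in auto)
  have fi: "set_integrable lborel {0..T0} (\<lambda>t. flow l g t (m t) $ e)" for e
    by (rule set_integrable_bounded[OF tmod, of _ _ _ C]) (use f0 fC in auto)
  have dm: "(\<lambda>t. divg (flow l g t (m t)) y) \<in> borel_measurable borel" for y
    unfolding divg_def using tmod by measurable
  have dM: "set_integrable lborel {0..T0} (\<lambda>t. divg (flow l g t (m t)) y)" for y
    unfolding divg_def by (intro set_integral_diff(1) set_integral_sum(1) fi)
  have weak: "(LINT s:{0..T0}|lborel. (\<Sum>y\<in>UNIV. m s y * deriv (f y) s)) =
        (LINT s:{0..T0}|lborel. (\<Sum>y\<in>UNIV. divg (flow l g s (m s)) y * f y s))"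
    if f: "\<And>y t. f y (t + T0) = f y t" "\<And>y. f y C1_differentiable_on UNIV" for f :: "'v \<Rightarrow> real \<Rightarrow> real"
  proof -
    have "\<forall>y. \<exists>D. (\<forall>t. (f y has_real_derivative D t) (at t)) \<and> continuous_on UNIV D"
      using f(2) by (simp add: C1_differentiable_on_def has_real_derivative_iff_has_vector_derivative)
    from choice[OF this] obtain D where D: "\<And>y t. (f y has_real_derivative D y t) (at t)" "\<And>y. continuous_on UNIV (D y)"
      by blast
    have dD: "deriv (f y) t = D y t" for y t by (rule DERIV_imp_deriv[OF D(1)])
    have Dm: "D y \<in> borel_measurable borel" for y by (rule borel_measurable_continuous_onI[OF D(2)])
    have flip: "lip a b (f y)" for a b y by (rule lip_C1[OF D(1)]) (rule continuous_on_subset[OF D(2)], simp)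
    have fme: "f y \<in> borel_measurable borel" for y by (rule lip_measurable[OF flip])
    have Di: "set_integrable lborel {0..T0} (\<lambda>t. \<Sum>y\<in>UNIV. m t y * D y t)"
    proof (rule set_integral_sum(1))
      fix y
      have ix: "set_integrable lborel {0..T0} (D y)"
        by (rule borel_integrable_compact[unfolded set_integrable_def[symmetric]])
           (auto intro: continuous_on_subset[OF D(2)])
      have "set_integrable lborel {0..T0} (\<lambda>t. D y t * m t y)"
        by (rule set_integrable_mult_bounded[OF ix, of _ 1]) (use m m1 in auto)
      then show "set_integrable lborel {0..T0} (\<lambda>t. m t y * D y t)" by (simp add: mult.commute)
    qed
    have gi: "set_integrable lborel {0..T0} (\<lambda>t. \<Sum>y\<in>UNIV. divg (flow l g t (m t)) y * f y t)"
    proof (rule set_integral_sum(1))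
      fix y
      obtain M where "\<And>t. t \<in> {0..T0} \<Longrightarrow> \<bar>f y t\<bar> \<le> M" by (rule lip_bounded[OF flip]) blast
      then show "set_integrable lborel {0..T0} (\<lambda>t. divg (flow l g t (m t)) y * f y t)"
        by (intro set_integrable_mult_bounded[OF dM fme])
    qed
    have "(LINT t:{0..T0}|lborel. (\<Sum>y\<in>UNIV. m t y * D y t) - (\<Sum>y\<in>UNIV. divg (flow l g t (m t)) y * f y t)) =
        (\<Sum>y\<in>UNIV. m T0 y * f y T0) - (\<Sum>y\<in>UNIV. m 0 y * f y 0)"
    proof (rule lip_FTC(2)[OF _ _ exc_times_null])
      show "lip 0 T0 (\<lambda>t. \<Sum>y\<in>UNIV. m t y * f y t)" by (intro lip_sum lip_mult mlip flip)
      fix t assume t: "t \<notin> exc_times"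
      have "((\<lambda>t. m t y) has_real_derivative - divg (flow l g t (m t)) y) (at t)" for y
        using m(1)[unfolded sol_def, THEN conjunct2, rule_format, OF t, of y] unfolding tilted_gen_flow .
      then have "((\<lambda>t. \<Sum>y\<in>UNIV. m t y * f y t) has_real_derivative (\<Sum>y\<in>UNIV. - divg (flow l g t (m t)) y * f y t + D y t * m t y)) (at t)"
        by (intro DERIV_sum DERIV_mult D(1))
      then show "((\<lambda>t. \<Sum>y\<in>UNIV. m t y * f y t) has_real_derivative (\<Sum>y\<in>UNIV. m t y * D y t) - (\<Sum>y\<in>UNIV. divg (flow l g t (m t)) y * f y t)) (at t)"
        by (simp add: sum.distrib sum_subtractf sum_negf mult.commute)
    next
      show "(\<lambda>t. (\<Sum>y\<in>UNIV. m t y * D y t) - (\<Sum>y\<in>UNIV. divg (flow l g t (m t)) y * f y t)) \<in> borel_measurable borel"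
        using Dm dm fme by measurable
    qed (use T0_pos in auto)
    also have "\<dots> = 0" using m(2)[of 0] f(1)[of _ 0] by simp
    finally show ?thesis unfolding dD by (simp add: set_integral_diff(2)[OF Di gi])
  qed
  show ?thesis
    unfolding admissible_def
  proof (intro conjI allI impI)
    show "(\<lambda>t. \<chi> y. m t y) \<in> borel_measurable borel" by (rule borel_measurable_vec) simp
    show "(\<lambda>t. flow l g t (m t)) \<in> borel_measurable borel" by (rule borel_measurable_vec[OF tmod])
    show "flow l g t (m t) \<in> flows E" for t using f0 by (auto simp: flows_def flow_def tilted_rate_off)
    show "(LINT s:{0..T0}|lborel. (\<Sum>y\<in>UNIV. (\<chi> y. m s y) $ y * deriv (f y) s)) =
        (LINT s:{0..T0}|lborel. (\<Sum>y\<in>UNIV. divg (flow l g s (m s)) y * f y s))"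
      if "\<forall>y. (\<forall>t. f y (t + T0) = f y t) \<and> f y C1_differentiable_on UNIV" for f :: "'v \<Rightarrow> real \<Rightarrow> real"
      using weak[of f] that by simp
  qed (use m fi in \<open>auto simp: prob_vecs_def p_def flow_def tilted_rate_per\<close>)
qed

text \<open>The stationary path turns the pointwise bound \<open>gain_le_It\<close> into an
  equality, so its average realises \<open>Ibar_lower\<close>; the nonnegativity recorded with it
  ensures that \<open>ennreal\<close> has not truncated the value.\<close>

lemma Ibar_attained: obtains p where "Ibar r T0 p = ennreal (l \<bullet> p - L)" "l \<bullet> p - L \<ge> 0"
proof -
  obtain m where m: "sol (tilted_gen l g) exc_times m" "\<And>t. m (t + T0) = m t" "\<And>t y. m t y > 0" "\<And>t. (\<Sum>y\<in>UNIV. m t y) = 1"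
    by (rule stationary_exists) blast
  define p :: "(real^'v) \<times> (real^('v \<times> 'v))" where
    "p = ((\<chi> y. (LINT t:{0..T0}|lborel. m t y) / T0), (\<chi> e. (LINT t:{0..T0}|lborel. flow l g t (m t) $ e) / T0))"
  let ?mu = "\<lambda>t. \<chi> y. m t y" and ?Q = "\<lambda>t. flow l g t (m t)"
  have adm: "admissible r T0 (fst p) (snd p) ?mu ?Q"
    unfolding p_def by (rule stationary_admissible) (use m in \<open>auto intro: less_imp_le\<close>)
  have Qe: "?Q t = flow l g t (($) (?mu t))" for t by (simp add: flow_def)
  have It: "It r t (?mu t) (?Q t) = ennreal (gain l g t (?mu t) (?Q t))" "gain l g t (?mu t) (?Q t) \<ge> 0" if "t \<ge> 0" for t
    unfolding Qe using flow_gain[of "?mu t" t] that m(3) by (auto intro: less_imp_le)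
  have gi: "integrable lborel (\<lambda>t. indicator {0..T0} t *\<^sub>R gain l g t (?mu t) (?Q t))"
    using gain_integral(1)[OF tl adm] by (simp add: set_integrable_def)
  have nn: "indicator {0..T0} t *\<^sub>R gain l g t (?mu t) (?Q t) \<ge> 0" for t
    using It(2)[of t] by (cases "t \<in> {0..T0}") auto
  have "(\<integral>\<^sup>+ t\<in>{0..T0}. It r t (?mu t) (?Q t) \<partial>lborel) = (\<integral>\<^sup>+ t. ennreal (indicator {0..T0} t *\<^sub>R gain l g t (?mu t) (?Q t)) \<partial>lborel)"
  proof (rule nn_integral_cong)
    fix t show "It r t (?mu t) (?Q t) * indicator {0..T0} t = ennreal (indicator {0..T0} t *\<^sub>R gain l g t (?mu t) (?Q t))"
      using It(1)[of t] by (cases "t \<in> {0..T0}") auto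
  qed
  also have "\<dots> = ennreal (LINT t|lborel. indicator {0..T0} t *\<^sub>R gain l g t (?mu t) (?Q t))"
    by (rule nn_integral_eq_integral[OF gi]) (use nn in auto)
  also have "\<dots> = ennreal (T0 * (l \<bullet> p - L))"
    using gain_integral(2)[OF tl adm] by (simp add: set_lebesgue_integral_def)
  finally have I: "(\<integral>\<^sup>+ t\<in>{0..T0}. It r t (?mu t) (?Q t) \<partial>lborel) = ennreal (T0 * (l \<bullet> p - L))" .
  have "(LINT t|lborel. indicator {0..T0} t *\<^sub>R gain l g t (?mu t) (?Q t)) \<ge> 0"
    by (rule integral_nonneg_AE) (use nn in auto)
  then have "T0 * (l \<bullet> p - L) \<ge> 0"
    using gain_integral(2)[OF tl adm] by (simp add: set_lebesgue_integral_def)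
  then have nn': "l \<bullet> p - L \<ge> 0" using T0_pos by (simp add: zero_le_mult_iff)
  have "Ibar r T0 p \<le> (\<integral>\<^sup>+ t\<in>{0..T0}. It r t (?mu t) (?Q t) \<partial>lborel) / ennreal T0"
    unfolding Ibar_def by (rule INF_lower2[of "(?mu, ?Q)"]) (use adm in auto)
  also have "\<dots> = ennreal (l \<bullet> p - L)"
    unfolding I using T0_pos nn' by (simp add: divide_ennreal)
  finally have "Ibar r T0 p = ennreal (l \<bullet> p - L)" using Ibar_lower[OF tl, of p] by (intro antisym)
  then show thesis using nn' that by blast
qed

end

end

section \<open>Uniqueness of the exposed point\<close>

text \<open>It makes the primitive of a bounded measurable function eligible for
  \<open>weak_equation_lip\<close> and \<open>lip_FTC_seq\<close>, whose derivative hypotheses are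
  right quotients along \<open>1 / Suc n\<close>.\<close>

lemma lebesgue_differentiation_seq:
  fixes f :: "real \<Rightarrow> real"
  assumes m: "f \<in> borel_measurable borel" and b: "\<And>t. \<bar>f t\<bar> \<le> C"
  obtains N where "N \<in> null_sets lborel"
    "\<And>t. t \<notin> N \<Longrightarrow> (\<lambda>n. (LINT s:{t..t + 1 / real (Suc n)}|lborel. f s) * real (Suc n)) \<longlonglongrightarrow> f t"
proof -
  have i: "set_integrable lborel {a..b} f" for a b by (rule set_integrable_bounded[OF m b])
  have "f integrable_on cbox a b" for a b using set_borel_integral_eq_integral(1)[OF i] by simp
  then obtain N where N: "negligible N"
    "\<And>x e. x \<notin> N \<Longrightarrow> 0 < e \<Longrightarrow> \<exists>d>0. \<forall>h. 0 < h \<and> h < d \<longrightarrow>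
       norm (integral (cbox x (x + h *\<^sub>R One)) f /\<^sub>R h ^ DIM(real) - f x) < e"
    by (rule integrable_ccontinuous_explicit) blast
  have "N \<in> null_sets lebesgue" using N(1) by (simp add: negligible_iff_null_sets)
  then obtain N' where N': "N' \<in> null_sets lborel" "N \<subseteq> N'" using null_sets_completionI null_sets_completion_iff2
    by (metis completion.complete2 null_sets_completion_iff2)
  show thesis
  proof (rule that[OF N'(1)])
    fix t assume "t \<notin> N'"
    then have t: "t \<notin> N" using N' by blast
    show "(\<lambda>n. (LINT s:{t..t + 1 / real (Suc n)}|lborel. f s) * real (Suc n)) \<longlonglongrightarrow> f t"
    proof (rule LIMSEQ_I)
      fix e :: real assume "e > 0"
      from N(2)[OF t this] obtain d where d: "d > 0"
        "\<forall>h. 0 < h \<and> h < d \<longrightarrow> norm (integral (cbox t (t + h *\<^sub>R One)) f /\<^sub>R h ^ DIM(real) - f t) < e" by blast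
      obtain n0 where n0: "1 / real (Suc n0) < d" using d(1) nat_approx_posE by blast
      show "\<exists>no. \<forall>n\<ge>no. norm ((LINT s:{t..t + 1 / real (Suc n)}|lborel. f s) * real (Suc n) - f t) < e"
      proof (intro exI allI impI)
        fix n assume "n \<ge> n0"
        then have "1 / real (Suc n) \<le> 1 / real (Suc n0)" by (intro divide_left_mono) auto
        then have "1 / real (Suc n) < d" using n0 by linarith
        with d(2)[rule_format, of "1 / real (Suc n)"]
        have "norm (integral (cbox t (t + (1 / real (Suc n)) *\<^sub>R One)) f /\<^sub>R (1 / real (Suc n)) ^ DIM(real) - f t) < e" by simp
        then show "norm ((LINT s:{t..t + 1 / real (Suc n)}|lborel. f s) * real (Suc n) - f t) < e"
          using set_borel_integral_eq_integral(2)[OF i] by (simp add: mult.commute)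
      qed
    qed
  qed
qed

text \<open>A negative value would persist on an interval, which has positive measure.\<close>

lemma AE_continuous_nonneg:
  fixes f :: "real \<Rightarrow> real"
  assumes ab: "a < b" and N: "N \<in> null_sets lborel" and c: "continuous_on {a..b} f"
    and nn: "\<And>t. t \<in> {a..b} \<Longrightarrow> t \<notin> N \<Longrightarrow> f t \<ge> 0" and t: "t \<in> {a..b}"
  shows "f t \<ge> 0"
proof (rule ccontr)
  assume "\<not> f t \<ge> 0"
  then have "f t < 0" by simp
  then obtain d where d: "d > 0" "\<And>s. s \<in> {a..b} \<Longrightarrow> dist s t < d \<Longrightarrow> dist (f s) (f t) < - f t"
    using c[unfolded continuous_on_iff, rule_format, OF t, of "- f t"] by auto
  define u v where "u = max a (t - d / 2)" and "v = min b (t + d / 2)"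
  have uv: "u < v" "{u..v} \<subseteq> {a..b}" using t ab d(1) by (auto simp: u_def v_def)
  have "{u..v} \<subseteq> N"
  proof
    fix s assume s: "s \<in> {u..v}"
    then have "dist s t < d" using d(1) by (auto simp: u_def v_def dist_real_def abs_less_iff)
    then have "dist (f s) (f t) < - f t" using d(2) s uv(2) by blast
    then have "f s < 0" by (auto simp: dist_real_def)
    then show "s \<in> N" using nn[of s] s uv(2) by force
  qed
  then have "emeasure lborel {u..v} \<le> emeasure lborel N" using N by (intro emeasure_mono) auto
  then show False using N uv(1) by (auto simp: null_sets_def)
qed

context periodic_rates
begin

text \<open>Du Bois-Reymond argument: with \<open>W\<close> the primitive of \<open>w\<close> and
  \<open>c\<close> the mean of \<open>\<mu> + W\<close>, the function
  \<open>v = \<mu> + W - c\<close> has mean zero, so its primitive \<open>V\<close> is periodic and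
  may be used as test function. Comparing with integration by parts for \<open>W V\<close> shows
  that the integral of \<open>v\<^sup>2\<close> is 0.\<close>

lemma du_bois_reymond:
  assumes adm: "admissible r T0 (fst p) (snd p) \<mu> Q"
    and w: "w \<in> borel_measurable borel" "\<And>t. \<bar>w t\<bar> \<le> C"
    and N: "N \<in> null_sets lborel" and wd: "\<And>t. t \<in> {0..T0} \<Longrightarrow> t \<notin> N \<Longrightarrow> divg (Q t) y = w t"
  obtains c N' where "N' \<in> null_sets lborel" "(LINT s:{0..T0}|lborel. w s) = 0"
    "\<And>t. t \<in> {0..T0} \<Longrightarrow> t \<notin> N' \<Longrightarrow> \<mu> t $ y = c - (LINT s:{0..t}|lborel. w s)"
proof -
  note a = admD[OF adm]
  have wi: "set_integrable lborel {a..b} w" for a b by (rule set_integrable_bounded[OF w])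
  have dw: "(LINT t:{0..T0}|lborel. divg (Q t) y * f t) = (LINT t:{0..T0}|lborel. w t * f t)"
    if [measurable]: "f \<in> borel_measurable borel" for f
    unfolding set_lebesgue_integral_def
  proof (rule integral_cong_AE)
    have [measurable]: "w \<in> borel_measurable borel" "(\<lambda>t. divg (Q t) y) \<in> borel_measurable borel"
      using w divg_integrable(2)[OF adm] by auto
    show "(\<lambda>t. indicator {0..T0} t *\<^sub>R (divg (Q t) y * f t)) \<in> borel_measurable lborel"
      "(\<lambda>t. indicator {0..T0} t *\<^sub>R (w t * f t)) \<in> borel_measurable lborel" by simp_all
    show "AE t in lborel. indicator {0..T0} t *\<^sub>R (divg (Q t) y * f t) = indicator {0..T0} t *\<^sub>R (w t * f t)"
      using AE_not_in[OF N] by eventually_elim (use wd in \<open>auto simp: indicator_def\<close>)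
  qed
  let ?T = "\<lambda>f y'. (if y' = y then f else (\<lambda>_. 0)) :: real \<Rightarrow> real"
  have weak: "(LINT t:{0..T0}|lborel. \<mu> t $ y * f' t) = (LINT t:{0..T0}|lborel. w t * f t)"
    if f: "\<And>t. f (t + T0) = f t" "\<And>a b. lip a b f" "M \<in> null_sets lborel"
      "\<And>t. t \<in> {0..T0} \<Longrightarrow> t \<notin> M \<Longrightarrow> (\<lambda>n. (f (t + 1 / real (Suc n)) - f t) * real (Suc n)) \<longlonglongrightarrow> f' t"
      "f' \<in> borel_measurable borel" for f f' :: "real \<Rightarrow> real" and M
  proof -
    have "(LINT t:{0..T0}|lborel. (\<Sum>y'\<in>UNIV. \<mu> t $ y' * ?T f' y' t)) = (LINT t:{0..T0}|lborel. (\<Sum>y'\<in>UNIV. divg (Q t) y' * ?T f y' t))"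
      by (rule weak_equation_lip(2)[OF adm, where N = M]) (use f in \<open>auto intro: lip_const\<close>)
    moreover have "(\<Sum>y'\<in>UNIV. \<mu> t $ y' * ?T h y' t) = \<mu> t $ y * h t" "(\<Sum>y'\<in>UNIV. divg (Q t) y' * ?T h y' t) = divg (Q t) y * h t" for t h
      by (subst sum.remove[of UNIV y]; simp)+
    ultimately show ?thesis using dw[OF lip_measurable[OF f(2)]] by simp
  qed
  \<comment> \<open>Testing against the constant 1 gives mean zero, so that \<open>W\<close>
    vanishes at both ends of the period.\<close>
  have w0: "(LINT s:{0..T0}|lborel. w s) = 0"
    using weak[of "\<lambda>_. 1" "{}" "\<lambda>_. 0"] lip_const by (simp add: set_lebesgue_integral_def)
  define W where "W t = (LINT s:{0..t}|lborel. w s)" for t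
  have Wlip: "lip 0 b W" for b unfolding W_def by (rule lip_indefinite_integral[OF w])
  have Wm: "W \<in> borel_measurable borel" unfolding W_def by (rule indefinite_integral_measurable[OF w(1)])
  have z: "(LINT s:{0..0}|lborel. f s) = 0" if "f \<in> borel_measurable borel" "\<And>t. \<bar>f t\<bar> \<le> K" for f :: "real \<Rightarrow> real" and K
    using set_integral_bounded[OF that(1), of 0 0 K] that(2) by simp
  obtain N1 where N1: "N1 \<in> null_sets lborel"
    "\<And>t. t \<notin> N1 \<Longrightarrow> (\<lambda>n. (LINT s:{t..t + 1 / real (Suc n)}|lborel. w s) * real (Suc n)) \<longlonglongrightarrow> w t"
    by (rule lebesgue_differentiation_seq[OF w]) blast
  have inc: "(LINT s:{0..t + h}|lborel. f s) - (LINT s:{0..t}|lborel. f s) = (LINT s:{t..t + h}|lborel. f s)"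
    if "t \<ge> 0" "h \<ge> 0" "\<And>a b. set_integrable lborel {a..b} f" for t h and f :: "real \<Rightarrow> real"
    using set_integral_split[OF that(3)[of 0 "t + h"], of t] that(1,2) by simp
  have Wder: "(\<lambda>n. (W (t + 1 / real (Suc n)) - W t) * real (Suc n)) \<longlonglongrightarrow> w t" if "t \<ge> 0" "t \<notin> N1" for t
    using N1(2)[OF that(2)] unfolding W_def by (subst inc[OF that(1) _ wi]) auto
  obtain MW where MW: "MW \<ge> 0" "\<And>t. t \<in> {0..T0} \<Longrightarrow> \<bar>W t\<bar> \<le> MW" by (rule lip_bounded[OF Wlip]) blast
  define c where "c = (LINT t:{0..T0}|lborel. \<mu> t $ y + W t) / T0"
  define v0 where "v0 t = \<mu> t $ y + W t - c" for t
  \<comment> \<open>Composing with \<open>tmod\<close> bounds \<open>v\<close> on the whole line,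
    where \<open>v0\<close> need not be bounded; on the period they differ at most at
    \<open>T0\<close>.\<close>
  define v where "v t = v0 (tmod T0 t)" for t
  have v0m: "v0 \<in> borel_measurable borel" unfolding v0_def using a(3) Wm by measurable
  have vm: "v \<in> borel_measurable borel" unfolding v_def using v0m by measurable
  have vb: "\<bar>v t\<bar> \<le> 1 + MW + \<bar>c\<bar>" for t
  proof -
    have "\<bar>W (tmod T0 t)\<bar> \<le> MW" by (rule MW(2)) (use tmod_range[OF T0_pos, of t] in auto)
    then show ?thesis using prob_vecs_range[OF a(7)[of "tmod T0 t"], of y] unfolding v_def v0_def by linarith
  qed
  have vi: "set_integrable lborel {a..b} v" for a b by (rule set_integrable_bounded[OF vm vb])
  have T0n: "{T0} \<in> null_sets lborel" by (intro countable_imp_null_set_lborel) auto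
  have vv0: "v t = v0 t" if "t \<in> {0..T0}" "t \<notin> {T0}" for t
    unfolding v_def using that by (subst tmod_id[OF T0_pos]) auto
  have swap: "(LINT t:{0..T0}|lborel. h t * v t) = (LINT t:{0..T0}|lborel. h t * v0 t)"
    if [measurable]: "h \<in> borel_measurable borel" for h
    unfolding set_lebesgue_integral_def
  proof (rule integral_cong_AE)
    show "(\<lambda>t. indicator {0..T0} t *\<^sub>R (h t * v t)) \<in> borel_measurable lborel"
      "(\<lambda>t. indicator {0..T0} t *\<^sub>R (h t * v0 t)) \<in> borel_measurable lborel" using vm v0m by simp_all
    show "AE t in lborel. indicator {0..T0} t *\<^sub>R (h t * v t) = indicator {0..T0} t *\<^sub>R (h t * v0 t)"
      using AE_not_in[OF T0n] by eventually_elim (use vv0 in \<open>auto simp: indicator_def\<close>)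
  qed
  have mui: "set_integrable lborel {0..T0} (\<lambda>t. \<mu> t $ y)"
    by (rule set_integrable_bounded[OF a(3), of _ _ _ 1]) (use prob_vecs_range[OF a(7)] in auto)
  have Wi: "set_integrable lborel {0..T0} W" by (rule set_integrable_bounded[OF Wm MW(2)])
  have ci: "set_integrable lborel {0..T0} (\<lambda>t. c)"
    by (rule set_integrable_bounded[of _ _ _ "\<bar>c\<bar>"]) auto
  have vmean: "(LINT t:{0..T0}|lborel. v t) = 0"
  proof -
    have "(LINT t:{0..T0}|lborel. v t) = (LINT t:{0..T0}|lborel. v0 t)" using swap[of "\<lambda>_. 1"] by simp
    also have "\<dots> = (LINT t:{0..T0}|lborel. \<mu> t $ y + W t) - (LINT t:{0..T0}|lborel. c)"
      unfolding v0_def by (rule set_integral_diff(2)[OF set_integral_add(1)[OF mui Wi] ci])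
    also have "(LINT t:{0..T0}|lborel. c) = T0 * c" using T0_pos by (simp add: set_lebesgue_integral_def)
    finally show ?thesis using T0_pos by (simp add: c_def)
  qed
  define V0 where "V0 t = (LINT s:{0..t}|lborel. v s)" for t
  define V where "V t = V0 (tmod T0 t)" for t
  have V0lip: "lip 0 b V0" for b unfolding V0_def by (rule lip_indefinite_integral[OF vm vb])
  have V00: "V0 0 = 0" unfolding V0_def by (rule z[OF vm vb])
  have V0T: "V0 T0 = 0" unfolding V0_def by (rule vmean)
  have Vlip: "lip a b V" for a b unfolding V_def by (rule tmod_lip[OF T0_pos V0lip]) (simp add: V00 V0T)
  have Vper: "V (t + T0) = V t" for t by (simp add: V_def tmod_periodic[OF T0_pos])
  have VV0: "V t = V0 t" if "t \<in> {0..T0}" for t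
  proof (cases "t = T0")
    case True
    then show ?thesis using tmod_periodic[OF T0_pos, of 0] tmod_id[OF T0_pos, of 0] T0_pos by (simp add: V_def V00 V0T)
  qed (use that in \<open>simp add: V_def tmod_id[OF T0_pos]\<close>)
  obtain N2 where N2: "N2 \<in> null_sets lborel"
    "\<And>t. t \<notin> N2 \<Longrightarrow> (\<lambda>n. (LINT s:{t..t + 1 / real (Suc n)}|lborel. v s) * real (Suc n)) \<longlonglongrightarrow> v t"
    by (rule lebesgue_differentiation_seq[OF vm vb]) blast
  have seq0: "(\<lambda>n. t + 1 / real (Suc n)) \<longlonglongrightarrow> t" for t :: real
    using tendsto_add[OF tendsto_const[of t] LIMSEQ_inverse_real_of_nat] by (simp add: inverse_eq_divide)
  have Vder: "(\<lambda>n. (V (t + 1 / real (Suc n)) - V t) * real (Suc n)) \<longlonglongrightarrow> v t" if t: "t \<in> {0..T0}" "t \<notin> N2 \<union> {T0}" for t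
  proof -
    have "(\<lambda>n. (V0 (t + 1 / real (Suc n)) - V0 t) * real (Suc n)) \<longlonglongrightarrow> v t"
      using N2(2)[of t] t unfolding V0_def by (subst inc[OF _ _ vi]) auto
    moreover have "eventually (\<lambda>n. t + 1 / real (Suc n) < T0) sequentially"
      by (rule order_tendstoD(2)[OF seq0]) (use t in auto)
    then have "eventually (\<lambda>n. (V0 (t + 1 / real (Suc n)) - V0 t) * real (Suc n) = (V (t + 1 / real (Suc n)) - V t) * real (Suc n)) sequentially"
    proof eventually_elim
      case (elim n)
      have "0 \<le> t + 1 / real (Suc n)" using t by simp
      then have "V (t + 1 / real (Suc n)) = V0 (t + 1 / real (Suc n))" using elim by (intro VV0) auto
      then show ?case using VV0[OF t(1)] by simp
    qed
    ultimately show ?thesis by (rule Lim_transform_eventually)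
  qed
  have N2n: "N2 \<union> {T0} \<in> null_sets lborel" using N2(1) T0n by blast
  have e1: "(LINT t:{0..T0}|lborel. \<mu> t $ y * v t) = (LINT t:{0..T0}|lborel. w t * V t)"
    by (rule weak[OF Vper Vlip N2n Vder vm])
  have Vc: "continuous_on UNIV V" by (rule lip_continuous[OF Vlip])
  have Vm: "V \<in> borel_measurable borel" by (rule borel_measurable_continuous_onI[OF Vc])
  \<comment> \<open>Product rule for \<open>W V\<close> along the quotients; the boundary terms
    vanish because \<open>W\<close> does at both ends.\<close>
  have e2: "(LINT t:{0..T0}|lborel. W t * v t + w t * V t) = W T0 * V T0 - W 0 * V 0"
  proof (rule lip_FTC_seq(2)[where N = "N1 \<union> (N2 \<union> {T0})"])
    show "lip 0 T0 (\<lambda>t. W t * V t)" by (intro lip_mult Wlip Vlip)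
    show "N1 \<union> (N2 \<union> {T0}) \<in> null_sets lborel" using N1(1) N2n by blast
    fix t assume t: "t \<in> {0<..<T0}" "t \<notin> N1 \<union> (N2 \<union> {T0})"
    have "isCont V t" using Vc by (simp add: continuous_on_eq_continuous_at)
    then have "(\<lambda>n. V (t + 1 / real (Suc n))) \<longlonglongrightarrow> V t" using seq0 by (rule isCont_tendsto_compose)
    then have "(\<lambda>n. W t * ((V (t + 1 / real (Suc n)) - V t) * real (Suc n)) + ((W (t + 1 / real (Suc n)) - W t) * real (Suc n)) * V (t + 1 / real (Suc n)))
        \<longlonglongrightarrow> W t * v t + w t * V t"
      using t by (intro tendsto_intros Vder Wder) auto
    then show "(\<lambda>n. (W (t + 1 / real (Suc n)) * V (t + 1 / real (Suc n)) - W t * V t) * real (Suc n)) \<longlonglongrightarrow> W t * v t + w t * V t"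
      by (simp add: algebra_simps)
  qed (use T0_pos w vm Vm Wm in auto)
  have WT: "W T0 = 0" "W 0 = 0" using w0 z[OF w] by (simp_all add: W_def)
  obtain MV where MV: "\<And>t. t \<in> {0..T0} \<Longrightarrow> \<bar>V t\<bar> \<le> MV" by (rule lip_bounded[OF Vlip]) blast
  have i1: "set_integrable lborel {0..T0} (\<lambda>t. W t * v t)" "set_integrable lborel {0..T0} (\<lambda>t. \<mu> t $ y * v t)"
     "set_integrable lborel {0..T0} (\<lambda>t. c * v t)"
    by (intro set_integrable_mult_bounded[OF _ vm vb] Wi mui ci)+
  have i2: "set_integrable lborel {0..T0} (\<lambda>t. w t * V t)"
    by (rule set_integrable_mult_bounded[OF wi Vm MV])
  have "(LINT t:{0..T0}|lborel. W t * v t) + (LINT t:{0..T0}|lborel. w t * V t) = 0"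
    using e2 set_integral_add(2)[OF i1(1) i2] WT by simp
  then have e3: "(LINT t:{0..T0}|lborel. \<mu> t $ y * v t) + (LINT t:{0..T0}|lborel. W t * v t) = 0" using e1 by simp
  \<comment> \<open>One factor \<open>v\<close> is expanded as \<open>\<mu> + W - c\<close>; the
    first two terms cancel by the weak equation and the parts formula, the third by mean
    zero.\<close>
  have "(LINT t:{0..T0}|lborel. v t * v t) = (LINT t:{0..T0}|lborel. v t * v0 t)" by (rule swap[OF vm])
  also have "\<dots> = (LINT t:{0..T0}|lborel. v0 t * v t)" by (simp add: mult.commute)
  also have "\<dots> = (LINT t:{0..T0}|lborel. (\<mu> t $ y * v t + W t * v t) - c * v t)"
    unfolding v0_def by (simp add: algebra_simps)
  also have "\<dots> = (LINT t:{0..T0}|lborel. \<mu> t $ y * v t) + (LINT t:{0..T0}|lborel. W t * v t) - c * (LINT t:{0..T0}|lborel. v t)"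
    by (simp add: set_integral_diff(2)[OF set_integral_add(1)[OF i1(2,1)] i1(3)] set_integral_add(2)[OF i1(2,1)])
  finally have v20: "(LINT t|lborel. indicator {0..T0} t *\<^sub>R (v t * v t)) = 0" using e3 vmean by (simp add: set_lebesgue_integral_def)
  have "AE t in lborel. indicator {0..T0} t *\<^sub>R (v t * v t) = 0"
  proof (subst integral_nonneg_eq_0_iff_AE[symmetric])
    show "integrable lborel (\<lambda>t. indicator {0..T0} t *\<^sub>R (v t * v t))"
      using set_integrable_mult_bounded[OF vi vm vb] by (simp add: set_integrable_def)
  qed (use v20 in auto)
  then obtain N3 where N3: "N3 \<in> null_sets lborel" "{t \<in> space lborel. \<not> indicator {0..T0} t *\<^sub>R (v t * v t) = 0} \<subseteq> N3"
    by (rule AE_E) (auto simp: null_sets_def)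
  show thesis
  proof (rule that[of "N3 \<union> {T0}" c])
    show "N3 \<union> {T0} \<in> null_sets lborel" using N3(1) T0n by blast
    show "(LINT s:{0..T0}|lborel. w s) = 0" by (rule w0)
    fix t assume t: "t \<in> {0..T0}" "t \<notin> N3 \<union> {T0}"
    then have "v t = 0" using N3(2) by (auto simp: indicator_def)
    then have "v0 t = 0" using vv0[of t] t by auto
    then show "\<mu> t $ y = c - (LINT s:{0..t}|lborel. w s)" by (simp add: v0_def W_def)
  qed
qed

end

lemma set_integral_cong_null:
  fixes f h :: "real \<Rightarrow> real"
  assumes [measurable]: "f \<in> borel_measurable borel" "h \<in> borel_measurable borel"
    and N: "N \<in> null_sets lborel" and eq: "\<And>t. t \<in> {a..b} \<Longrightarrow> t \<notin> N \<Longrightarrow> f t = h t"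
  shows "(LINT t:{a..b}|lborel. f t) = (LINT t:{a..b}|lborel. h t)"
  unfolding set_lebesgue_integral_def
proof (rule integral_cong_AE)
  show "AE t in lborel. indicator {a..b} t *\<^sub>R f t = indicator {a..b} t *\<^sub>R h t"
    using AE_not_in[OF N] by eventually_elim (use eq in \<open>auto simp: indicator_def\<close>)
qed simp_all

context periodic_rates
begin

section \<open>Paths attaining the dual bound\<close>

lemma It_R: "t \<ge> 0 \<Longrightarrow> It r t \<mu> Q = (\<Sum>(y, z)\<in>E. Phi (Q $ (y, z)) (\<mu> $ y * R t y z))"
  by (simp add: It_def R_eq)

lemma It_R_meas:
  assumes "admissible r T0 (fst p) (snd p) \<mu> Q"
  shows "(\<lambda>t. \<Sum>(y, z)\<in>E. Phi (Q t $ (y, z)) (\<mu> t $ y * R t y z)) \<in> borel_measurable borel"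
proof -
  note [measurable] = admD(3,4)[OF assms]
  show ?thesis unfolding case_prod_beta by measurable
qed

lemma nn_integral_It_R:
  "(\<integral>\<^sup>+ t\<in>{0..T0}. It r t (\<mu> t) (Q t) \<partial>lborel) =
   (\<integral>\<^sup>+ t\<in>{0..T0}. (\<Sum>(y, z)\<in>E. Phi (Q t $ (y, z)) (\<mu> t $ y * R t y z)) \<partial>lborel)"
proof (rule nn_integral_cong)
  fix t show "It r t (\<mu> t) (Q t) * indicator {0..T0} t = (\<Sum>(y, z)\<in>E. Phi (Q t $ (y, z)) (\<mu> t $ y * R t y z)) * indicator {0..T0} t"
    using It_R[of t "\<mu> t" "Q t"] by (cases "t \<in> {0..T0}") auto
qed

context
  fixes l L g assumes tl: "tilt l L g"
begin

text \<open>The integrand dominates \<open>gain\<close> and their integrals agree, so they are equal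
  almost everywhere; finiteness then allows the equality to be split into edges, where
  \<open>Phi_eqD\<close> applies.\<close>

lemma optimal_flow:
  assumes adm: "admissible r T0 (fst p) (snd p) \<mu> Q" and nn: "l \<bullet> p - L \<ge> 0"
    and opt: "(\<integral>\<^sup>+ t\<in>{0..T0}. It r t (\<mu> t) (Q t) \<partial>lborel) \<le> ennreal (T0 * (l \<bullet> p - L))"
  obtains N where "N \<in> null_sets lborel" "\<And>t. t \<in> {0..T0} \<Longrightarrow> t \<notin> N \<Longrightarrow> Q t = flow l g t (($) (\<mu> t))"
proof -
  note a = admD[OF adm]
  define J where "J t = (\<Sum>(y, z)\<in>E. Phi (Q t $ (y, z)) (\<mu> t $ y * R t y z)) * indicator {0..T0} t" for t
  define X where "X = T0 * (l \<bullet> p - L)"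
  have X0: "X \<ge> 0" using nn T0_pos by (simp add: X_def)
  have Jm [measurable]: "J \<in> borel_measurable lborel" unfolding J_def using It_R_meas[OF adm] by simp
  have JX: "(\<integral>\<^sup>+ t. J t \<partial>lborel) \<le> ennreal X" using opt unfolding nn_integral_It_R J_def X_def .
  have "(\<integral>\<^sup>+ t. J t \<partial>lborel) < \<top>" by (rule order_le_less_trans[OF JX]) simp
  then have "(\<integral>\<^sup>+ t. J t \<partial>lborel) \<noteq> \<infinity>" by simp
  then have AEfin: "AE t in lborel. J t \<noteq> \<infinity>" by (rule nn_integral_PInf_AE[OF Jm])
  define \<gamma> where "\<gamma> t = indicator {0..T0} t *\<^sub>R gain l g t (\<mu> t) (Q t)" for t
  have \<gamma>i: "integrable lborel \<gamma>" using gain_integral(1)[OF tl adm] by (simp add: \<gamma>_def[abs_def] set_integrable_def)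
  have \<gamma>v: "(LINT t|lborel. \<gamma> t) = X" using gain_integral(2)[OF tl adm] by (simp add: \<gamma>_def X_def set_lebesgue_integral_def)
  have \<gamma>J: "ennreal (\<gamma> t) \<le> J t" for t
    using gain_le_It[OF tl, of t "\<mu> t" "Q t"] a(7,12) It_R[of t "\<mu> t" "Q t"] by (cases "t \<in> {0..T0}") (auto simp: \<gamma>_def J_def)
  define h where "h t = enn2real (J t)" for t
  have hm: "h \<in> borel_measurable lborel" unfolding h_def by measurable
  have "(\<integral>\<^sup>+ t. ennreal (h t) \<partial>lborel) = (\<integral>\<^sup>+ t. J t \<partial>lborel)"
    by (rule nn_integral_cong_AE) (use AEfin in \<open>auto simp: h_def less_top\<close>)
  then have hX: "(\<integral>\<^sup>+ t. ennreal (h t) \<partial>lborel) \<le> ennreal X" using JX by simp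
  have hi: "integrable lborel h"
    by (rule integrableI_nonneg[OF hm]) (use hX in \<open>auto simp: h_def intro: le_less_trans\<close>)
  have "ennreal (LINT t|lborel. h t) \<le> ennreal X"
    using hX by (subst nn_integral_eq_integral[OF hi, symmetric]) (auto simp: h_def)
  then have hv: "(LINT t|lborel. h t) \<le> X" using X0 by simp
  have AEge: "AE t in lborel. h t - \<gamma> t \<ge> 0"
    using AEfin
  proof eventually_elim
    case (elim t)
    then have "J t = ennreal (h t)" by (simp add: h_def less_top)
    moreover have "h t \<ge> 0" by (simp add: h_def)
    ultimately have "\<gamma> t \<le> h t" using \<gamma>J[of t] by (cases "\<gamma> t \<ge> 0") auto
    then show ?case by simp
  qed
  have di: "integrable lborel (\<lambda>t. h t - \<gamma> t)" using hi \<gamma>i by simp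
  have "(LINT t|lborel. h t - \<gamma> t) \<ge> 0" by (rule integral_nonneg_AE[OF AEge])
  then have "(LINT t|lborel. h t - \<gamma> t) = 0" using hv \<gamma>v hi \<gamma>i by simp
  then have AEeq: "AE t in lborel. h t - \<gamma> t = 0" using integral_nonneg_eq_0_iff_AE[OF di AEge] by simp
  have "AE t in lborel. J t \<noteq> \<infinity> \<and> h t = \<gamma> t" using AEfin AEeq by eventually_elim simp
  then obtain N where N: "N \<in> null_sets lborel" "{t \<in> space lborel. \<not> (J t \<noteq> \<infinity> \<and> h t = \<gamma> t)} \<subseteq> N"
    by (rule AE_E) (auto simp: null_sets_def)
  show thesis
  proof (rule that[OF N(1)])
    fix t assume t: "t \<in> {0..T0}" "t \<notin> N"
    then have fin: "J t \<noteq> \<infinity>" and eq: "h t = \<gamma> t" using N(2) by auto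
    let ?P = "\<lambda>e. Phi (Q t $ e) (\<mu> t $ (fst e) * R t (fst e) (snd e))"
    let ?X = "\<lambda>e. Q t $ e * alpha l g t (fst e) (snd e) - \<mu> t $ (fst e) * R t (fst e) (snd e) * (exp (alpha l g t (fst e) (snd e)) - 1)"
    have Jt: "J t = (\<Sum>e\<in>E. ?P e)" using t by (simp add: J_def case_prod_beta)
    have pf: "?P e \<noteq> \<top>" if "e \<in> E" for e
    proof
      assume top: "?P e = \<top>"
      have "?P e \<le> J t" unfolding Jt by (rule member_le_sum) (use that in auto)
      then show False using fin top by (simp add: top_unique)
    qed
    have "h t = (\<Sum>e\<in>E. enn2real (?P e))"
      unfolding h_def Jt using enn2real_sum[of E ?P] pf by (simp add: less_top comp_def)
    moreover have "\<gamma> t = (\<Sum>e\<in>E. ?X e)" using t by (simp add: \<gamma>_def gain_def case_prod_beta)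
    ultimately have s0: "(\<Sum>e\<in>E. enn2real (?P e) - ?X e) = 0" using eq by (simp add: sum_subtractf)
    have pnn: "\<mu> t $ y * R t y z \<ge> 0" for y z using prob_vecs_range[OF a(7)[of t]] R_nonneg by (intro mult_nonneg_nonneg) auto
    have ge: "enn2real (?P e) - ?X e \<ge> 0" if "e \<in> E" for e
    proof -
      have "ennreal (?X e) \<le> ?P e" by (rule Phi_ge[OF a(12) pnn])
      also have "\<dots> = ennreal (enn2real (?P e))" using pf[OF that] by (simp add: less_top)
      finally have "ennreal (?X e) \<le> ennreal (enn2real (?P e))" .
      then have "?X e \<le> enn2real (?P e)"
        using enn2real_nonneg[of "?P e"] by (simp only: ennreal_le_iff)
      then show ?thesis by simp
    qed
    have all: "enn2real (?P e) - ?X e = 0" if "e \<in> E" for e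
      using sum_nonneg_eq_0_iff[of E "\<lambda>e. enn2real (?P e) - ?X e"] ge s0 that by simp
    have "Q t $ e = flow l g t (($) (\<mu> t)) $ e" for e
    proof (cases "e \<in> E")
      case True
      have "Q t $ e = \<mu> t $ (fst e) * R t (fst e) (snd e) * exp (alpha l g t (fst e) (snd e))"
        by (rule Phi_eqD[OF a(12) pnn pf[OF True]]) (use all[OF True] in simp)
      then show ?thesis by (simp add: flow_def tilted_rate_def mult.assoc)
    next
      case False
      then show ?thesis using a(13) tilted_rate_off[of "fst e" "snd e"] by (simp add: flow_def)
    qed
    then show "Q t = flow l g t (($) (\<mu> t))" by (simp add: vec_eq_iff)
  qed
qed

text \<open>Knowing the flow makes the divergence a bounded function of time, so \<mu> coincides
  almost everywhere with a Lipschitz \<open>m\<close>, which inherits sign and mass by continuity.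
  Replacing \<mu> by \<open>m\<close> in the flow makes it continuous off \<open>exc_times\<close>,
  and the integral equation can be differentiated there.\<close>

lemma optimal_stationary:
  assumes adm: "admissible r T0 (fst p) (snd p) \<mu> Q"
    and N: "N \<in> null_sets lborel" "\<And>t. t \<in> {0..T0} \<Longrightarrow> t \<notin> N \<Longrightarrow> Q t = flow l g t (($) (\<mu> t))"
  obtains m N' where "sol (tilted_gen l g) exc_times m" "\<And>t. m (t + T0) = m t" "\<And>t y. m t y \<ge> 0" "\<And>t. (\<Sum>y\<in>UNIV. m t y) = 1"
    "N' \<in> null_sets lborel" "\<And>t y. t \<in> {0..T0} \<Longrightarrow> t \<notin> N' \<Longrightarrow> \<mu> t $ y = m t y"
proof -
  note a = admD[OF adm]
  note [measurable] = a(3) tilted_rate_meas[OF tl]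
  define w where "w y t = divg (flow l g t (($) (\<mu> t))) y" for y t
  obtain C where C: "C > 0" "\<And>t y z. tilted_rate l g t y z \<le> C" by (rule tilted_rate_bound[OF tl]) blast
  have wm: "w y \<in> borel_measurable borel" for y unfolding w_def divg_def flow_def by simp
  have fb: "0 \<le> flow l g t (($) (\<mu> t)) $ e \<and> flow l g t (($) (\<mu> t)) $ e \<le> 1 * C" for t e
    unfolding flow_def vec_lambda_beta
    by (intro conjI mult_mono mult_nonneg_nonneg tilted_rate_nonneg C) (use prob_vecs_range[OF a(7)[of t]] in auto)
  have wb: "\<bar>w y t\<bar> \<le> (\<Sum>z\<in>(UNIV::'v set). C)" for y t
  proof -
    have "0 \<le> (\<Sum>z\<in>UNIV. flow l g t (($) (\<mu> t)) $ (y, z))" "(\<Sum>z\<in>UNIV. flow l g t (($) (\<mu> t)) $ (y, z)) \<le> (\<Sum>z\<in>(UNIV::'v set). C)"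
      "0 \<le> (\<Sum>z\<in>UNIV. flow l g t (($) (\<mu> t)) $ (z, y))" "(\<Sum>z\<in>UNIV. flow l g t (($) (\<mu> t)) $ (z, y)) \<le> (\<Sum>z\<in>(UNIV::'v set). C)"
      using fb by (auto intro!: sum_nonneg sum_mono simp del: sum_constant)
    then show ?thesis unfolding w_def divg_def by linarith
  qed
  have wd: "divg (Q t) y = w y t" if "t \<in> {0..T0}" "t \<notin> N" for t y
    using N(2)[OF that] by (simp add: w_def)
  have "\<forall>y. \<exists>cM. snd cM \<in> null_sets lborel \<and> (LINT s:{0..T0}|lborel. w y s) = 0 \<and>
      (\<forall>t. t \<in> {0..T0} \<longrightarrow> t \<notin> snd cM \<longrightarrow> \<mu> t $ y = fst cM - (LINT s:{0..t}|lborel. w y s))"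
  proof
    fix y
    obtain c M where "M \<in> null_sets lborel" "(LINT s:{0..T0}|lborel. w y s) = 0"
      "\<And>t. t \<in> {0..T0} \<Longrightarrow> t \<notin> M \<Longrightarrow> \<mu> t $ y = c - (LINT s:{0..t}|lborel. w y s)"
      by (rule du_bois_reymond[OF adm wm wb N(1) wd, of y]) blast+
    then show "\<exists>cM. snd cM \<in> null_sets lborel \<and> (LINT s:{0..T0}|lborel. w y s) = 0 \<and>
      (\<forall>t. t \<in> {0..T0} \<longrightarrow> t \<notin> snd cM \<longrightarrow> \<mu> t $ y = fst cM - (LINT s:{0..t}|lborel. w y s))"
      by (intro exI[of _ "(c, M)"]) auto
  qed
  from choice[OF this] obtain cM where cM: "\<forall>y. snd (cM y) \<in> null_sets lborel \<and> (LINT s:{0..T0}|lborel. w y s) = 0 \<and>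
      (\<forall>t. t \<in> {0..T0} \<longrightarrow> t \<notin> snd (cM y) \<longrightarrow> \<mu> t $ y = fst (cM y) - (LINT s:{0..t}|lborel. w y s))" ..
  define c M where "c y = fst (cM y)" and "M y = snd (cM y)" for y
  have M: "M y \<in> null_sets lborel" and w0: "(LINT s:{0..T0}|lborel. w y s) = 0"
    and eq: "t \<in> {0..T0} \<Longrightarrow> t \<notin> M y \<Longrightarrow> \<mu> t $ y = c y - (LINT s:{0..t}|lborel. w y s)" for y t
    using cM[rule_format, of y] by (auto simp: c_def M_def)
  define N' where "N' = (\<Union>y. M y)"
  have N'n: "N' \<in> null_sets lborel" unfolding N'_def by (intro null_sets_UN' M) auto
  define W where "W y t = (LINT s:{0..t}|lborel. w y s)" for y t
  have Wlip: "lip 0 b (W y)" for b y unfolding W_def by (rule lip_indefinite_integral[OF wm wb])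
  have W0: "W y 0 = 0" for y unfolding W_def using set_integral_bounded[OF wm wb, of 0 0] by simp
  have WT: "W y T0 = 0" for y unfolding W_def by (rule w0)
  define m where "m t y = c y - W y (tmod T0 t)" for t y
  have mper: "m (t + T0) = m t" for t by (rule ext) (simp add: m_def tmod_periodic[OF T0_pos])
  have mlip: "lip a b (\<lambda>t. m t y)" for a b y
    unfolding m_def by (intro lip_diff lip_const tmod_lip[OF T0_pos Wlip]) (simp add: W0 WT)
  have mW: "m t y = c y - W y t" if "t \<in> {0..T0}" for t y
  proof (cases "t = T0")
    case True
    then show ?thesis using tmod_periodic[OF T0_pos, of 0] tmod_id[OF T0_pos, of 0] T0_pos by (simp add: m_def W0 WT)
  qed (use that in \<open>simp add: m_def tmod_id[OF T0_pos]\<close>)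
  have meq: "\<mu> t $ y = m t y" if "t \<in> {0..T0}" "t \<notin> N'" for t y
    using eq[of t y] mW[of t y] that by (simp add: N'_def W_def)
  have mc: "continuous_on A (\<lambda>t. m t y)" for A y
    by (rule continuous_on_subset[OF lip_continuous[OF mlip]]) simp
  have mnn0: "m t y \<ge> 0" if "t \<in> {0..T0}" for t y
  proof (rule AE_continuous_nonneg[OF T0_pos N'n mc _ that])
    fix t assume "t \<in> {0..T0}" "t \<notin> N'"
    then show "m t y \<ge> 0" using prob_vecs_range(1)[OF a(7)[of t], of y] meq[of t y] by simp
  qed
  have fmi: "tmod T0 t \<in> {0..T0}" for t using tmod_range[OF T0_pos, of t] by auto
  have mfm: "m (tmod T0 t) = m t" for t by (rule periodic_fm[of m, OF mper])
  have mnn: "m t y \<ge> 0" for t y using mnn0[OF fmi[of t], of y] mfm by simp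
  have s1: "(\<Sum>y\<in>UNIV. m t y) = 1" if "t \<in> {0..T0}" for t
  proof -
    have e: "(\<Sum>y\<in>UNIV. m t y) = 1" if "t \<in> {0..T0}" "t \<notin> N'" for t
      using a(7)[of t] meq[OF that] by (simp add: prob_vecs_def)
    have c1: "continuous_on {0..T0} (\<lambda>t. (\<Sum>y\<in>UNIV. m t y) - 1)" and c2: "continuous_on {0..T0} (\<lambda>t. 1 - (\<Sum>y\<in>UNIV. m t y))"
      by (intro continuous_intros mc)+
    have "(\<Sum>y\<in>UNIV. m t y) - 1 \<ge> 0" by (rule AE_continuous_nonneg[OF T0_pos N'n c1 _ that]) (use e in auto)
    moreover have "1 - (\<Sum>y\<in>UNIV. m t y) \<ge> 0" by (rule AE_continuous_nonneg[OF T0_pos N'n c2 _ that]) (use e in auto)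
    ultimately show ?thesis by simp
  qed
  have sum: "(\<Sum>y\<in>UNIV. m t y) = 1" for t using s1[OF fmi[of t]] mfm by simp
  have mm [measurable]: "(\<lambda>t. m t y) \<in> borel_measurable borel" for y by (rule lip_measurable[OF mlip])
  \<comment> \<open>\<open>w\<close> is built on \<mu>, which is only measurable; \<open>v\<close>
    is the same expression on \<open>m\<close>, equal almost everywhere on the period but continuous
    off \<open>exc_times\<close>.\<close>
  define v where "v y t = divg (flow l g t (m t)) y" for y t
  have vm: "v y \<in> borel_measurable borel" for y unfolding v_def divg_def flow_def by simp
  have m1: "m t y \<le> 1" for t y
  proof -
    have "m t y \<le> (\<Sum>y\<in>UNIV. m t y)" by (rule member_le_sum) (use mnn in auto)
    then show ?thesis using sum by simp
  qed
  have fb': "0 \<le> flow l g t (m t) $ e \<and> flow l g t (m t) $ e \<le> 1 * C" for t e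
    unfolding flow_def vec_lambda_beta
    by (intro conjI mult_mono mult_nonneg_nonneg tilted_rate_nonneg C) (use mnn m1 in auto)
  have vb: "\<bar>v y t\<bar> \<le> (\<Sum>z\<in>(UNIV::'v set). C)" for y t
  proof -
    have "0 \<le> (\<Sum>z\<in>UNIV. flow l g t (m t) $ (y, z))" "(\<Sum>z\<in>UNIV. flow l g t (m t) $ (y, z)) \<le> (\<Sum>z\<in>(UNIV::'v set). C)"
      "0 \<le> (\<Sum>z\<in>UNIV. flow l g t (m t) $ (z, y))" "(\<Sum>z\<in>UNIV. flow l g t (m t) $ (z, y)) \<le> (\<Sum>z\<in>(UNIV::'v set). C)"
      using fb' by (auto intro!: sum_nonneg sum_mono simp del: sum_constant)
    then show ?thesis unfolding v_def divg_def by linarith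
  qed
  have Wv: "W y t = (LINT s:{0..t}|lborel. v y s)" if "t \<le> T0" for y t
    unfolding W_def
  proof (rule set_integral_cong_null[OF wm vm N'n])
    fix s assume s: "s \<in> {0..t}" "s \<notin> N'"
    then have "($) (\<mu> s) = m s" using meq[of s] that by (auto simp: fun_eq_iff)
    then show "w y s = v y s" by (simp add: w_def v_def)
  qed
  have "sol (tilted_gen l g) exc_times m"
    unfolding sol_def
  proof (intro conjI allI impI mlip)
    fix t y assume t: "t \<notin> exc_times"
    have f0: "tmod T0 t \<noteq> 0" using t by (auto simp: exc_times_def N0_def)
    have fi: "tmod T0 t \<in> {0<..<T0}" using tmod_range[OF T0_pos, of t] f0 by auto
    have "tmod T0 (tmod T0 t) = tmod T0 t" using fi by (intro tmod_id[OF T0_pos]) auto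
    then have tN: "tmod T0 t \<notin> exc_times" using t by (simp add: exc_times_def)
    have "isCont (v y) (tmod T0 t)"
    proof -
      have "isCont (\<lambda>t. m t z) s" for z s using mc[of UNIV z] by (simp add: continuous_on_eq_continuous_at)
      then show ?thesis unfolding v_def divg_def flow_def vec_lambda_beta by (intro continuous_intros tilted_rate_cont[OF tl tN])
    qed
    then have "((\<lambda>x. LINT s:{0..x}|lborel. v y s) has_real_derivative v y (tmod T0 t)) (at (tmod T0 t))"
      by (intro indefinite_integral_deriv[OF vm vb _ fi])
    then have "(W y has_real_derivative v y (tmod T0 t)) (at (tmod T0 t))"
      by (rule has_field_derivative_transform_within_open[OF _ _ fi]) (use Wv in auto)
    from tmod_deriv[OF T0_pos f0 this]
    have "((\<lambda>t. c y - W y (tmod T0 t)) has_real_derivative (0 - v y (tmod T0 t))) (at t)"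
      by (intro DERIV_diff DERIV_const)
    moreover have "v y (tmod T0 t) = v y t"
      using periodic_fm[of "tilted_rate l g" T0 t, OF tilted_rate_per[OF tl]] mfm[of t] by (simp add: v_def flow_def)
    moreover have "(\<lambda>t. m t y) = (\<lambda>t. c y - W y (tmod T0 t))" by (simp add: m_def fun_eq_iff)
    ultimately show "((\<lambda>t. m t y) has_real_derivative (\<Sum>z\<in>UNIV. tilted_gen l g t y z * m t z)) (at t)"
      unfolding tilted_gen_flow by (simp add: v_def)
  qed
  then show thesis by (rule that[OF _ mper mnn sum N'n meq])
qed

text \<open>Let \<rho> be the largest number with \<open>\<rho> m \<le> m'\<close>. The difference
  is a nonnegative periodic solution touching zero, so it vanishes by
  \<open>strong_positivity\<close>; comparing masses gives \<open>\<rho> = 1\<close>.\<close>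

lemma stationary_unique:
  assumes m: "sol (tilted_gen l g) exc_times m" "\<And>t. m (t + T0) = m t" "\<And>t y. m t y > 0" "\<And>t. (\<Sum>y\<in>UNIV. m t y) = 1"
    and m': "sol (tilted_gen l g) exc_times m'" "\<And>t. m' (t + T0) = m' t" "\<And>t y. m' t y \<ge> 0" "\<And>t. (\<Sum>y\<in>UNIV. m' t y) = 1"
  shows "m' = m"
proof -
  have mc: "continuous_on A (\<lambda>t. m t y)" and mc': "continuous_on A (\<lambda>t. m' t y)" for A y
    using m(1) m'(1) by (auto simp: sol_def intro!: continuous_on_subset[OF lip_continuous])
  have "\<forall>y. \<exists>s. s \<in> {0..T0} \<and> (\<forall>t\<in>{0..T0}. m' s y / m s y \<le> m' t y / m t y)"
  proof
    fix y
    have ne: "m t y \<noteq> 0" for t using m(3)[of t y] by simp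
    have "continuous_on {0..T0} (\<lambda>t. m' t y / m t y)" using ne by (intro continuous_intros mc mc') auto
    from continuous_attains_inf[OF compact_Icc _ this]
    show "\<exists>s. s \<in> {0..T0} \<and> (\<forall>t\<in>{0..T0}. m' s y / m s y \<le> m' t y / m t y)" using T0_pos by auto
  qed
  from choice[OF this] obtain s where s: "\<And>y. s y \<in> {0..T0}" "\<And>y t. t \<in> {0..T0} \<Longrightarrow> m' (s y) y / m (s y) y \<le> m' t y / m t y"
    by blast
  define \<rho> where "\<rho> = (MIN y. m' (s y) y / m (s y) y)"
  have "\<rho> \<in> range (\<lambda>y. m' (s y) y / m (s y) y)" unfolding \<rho>_def by (intro Min_in) auto
  then obtain y0 where y0: "\<rho> = m' (s y0) y0 / m (s y0) y0" by auto
  have ge: "\<rho> * m t y \<le> m' t y" for t y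
  proof -
    have "\<rho> \<le> m' (s y) y / m (s y) y" unfolding \<rho>_def by (intro Min_le) auto
    also have "\<dots> \<le> m' (tmod T0 t) y / m (tmod T0 t) y" by (rule s(2)) (use tmod_range[OF T0_pos, of t] in auto)
    also have "\<dots> = m' t y / m t y" using periodic_fm[of m, OF m(2)] periodic_fm[of m', OF m'(2)] by simp
    finally show ?thesis using m(3)[of t y] by (simp add: field_simps)
  qed
  obtain C where C: "\<And>t y z. \<bar>tilted_gen l g t y z\<bar> \<le> C" by (rule tilted_gen_bound[OF tl]) blast
  define u where "u t y = m' t y - \<rho> * m t y" for t y
  have usol: "sol (tilted_gen l g) exc_times u"
    unfolding sol_def
  proof (intro conjI allI impI)
    show "lip a b (\<lambda>t. u t y)" for y a b
      unfolding u_def using m(1) m'(1) by (intro lip_diff lip_cmult) (simp_all add: sol_def)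
    fix t y assume t: "t \<notin> exc_times"
    have "((\<lambda>t. u t y) has_real_derivative (\<Sum>z\<in>UNIV. tilted_gen l g t y z * m' t z) - \<rho> * (\<Sum>z\<in>UNIV. tilted_gen l g t y z * m t z)) (at t)"
      unfolding u_def using m(1)[unfolded sol_def, THEN conjunct2, rule_format, OF t, of y]
        m'(1)[unfolded sol_def, THEN conjunct2, rule_format, OF t, of y] by (intro DERIV_diff DERIV_cmult)
    moreover have "(\<Sum>z\<in>UNIV. tilted_gen l g t y z * m' t z) - \<rho> * (\<Sum>z\<in>UNIV. tilted_gen l g t y z * m t z) = (\<Sum>z\<in>UNIV. tilted_gen l g t y z * u t z)"
      by (simp add: u_def right_diff_distrib sum_subtractf sum_distrib_left mult_ac)
    ultimately show "((\<lambda>t. u t y) has_real_derivative (\<Sum>z\<in>UNIV. tilted_gen l g t y z * u t z)) (at t)" by simp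
  qed
  have uz: "u t y = 0" for t y
  proof (rule strong_positivity[OF T0_pos usol exc_times_null, where k = C and Ed = "E\<inverse>" and ?t0.0 = "s y0" and ?y0.0 = y0])
    show "u (t + T0) = u t" for t by (simp add: u_def m(2) m'(2) fun_eq_iff)
    show "u t y \<ge> 0" for t y using ge by (simp add: u_def)
    show "- C \<le> tilted_gen l g t y y" for t y using C[of t y y] by simp
    show "u (s y0) y0 = 0" using y0 m(3)[of "s y0" y0] by (simp add: u_def)
  qed (use tilted_gen_meas[OF tl] tilted_gen_off[OF tl] tilted_gen_edge[OF tl] conn_converse[OF tl] in auto)
  have "(\<Sum>y\<in>UNIV. u 0 y) = 1 - \<rho>" by (simp add: u_def sum_subtractf m'(4) m(4) flip: sum_distrib_left)
  then have "\<rho> = 1" using uz by simp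
  then show ?thesis using uz by (auto simp: u_def fun_eq_iff)
qed

text \<open>An optimal path is determined only up to null sets of times, which do not affect its
  averages.\<close>

lemma optimal_unique:
  obtains p0 where "\<And>p \<mu> Q. admissible r T0 (fst p) (snd p) \<mu> Q \<Longrightarrow> l \<bullet> p - L \<ge> 0 \<Longrightarrow>
    (\<integral>\<^sup>+ t\<in>{0..T0}. It r t (\<mu> t) (Q t) \<partial>lborel) \<le> ennreal (T0 * (l \<bullet> p - L)) \<Longrightarrow> p = p0"
proof -
  obtain m where m: "sol (tilted_gen l g) exc_times m" "\<And>t. m (t + T0) = m t" "\<And>t y. m t y > 0" "\<And>t. (\<Sum>y\<in>UNIV. m t y) = 1"
    by (rule stationary_exists[OF tl]) blast
  have mlip: "lip a b (\<lambda>t. m t y)" for a b y using m(1) by (simp add: sol_def)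
  have mm [measurable]: "(\<lambda>t. m t y) \<in> borel_measurable borel" for y by (rule lip_measurable[OF mlip])
  note [measurable] = tilted_rate_meas[OF tl]
  define p0 :: "(real^'v) \<times> (real^('v \<times> 'v))" where
    "p0 = ((\<chi> y. (LINT t:{0..T0}|lborel. m t y) / T0), (\<chi> e. (LINT t:{0..T0}|lborel. flow l g t (m t) $ e) / T0))"
  show thesis
  proof (rule that[of p0])
    fix p \<mu> Q assume adm: "admissible r T0 (fst p) (snd p) \<mu> Q" and nn: "l \<bullet> p - L \<ge> 0"
      and opt: "(\<integral>\<^sup>+ t\<in>{0..T0}. It r t (\<mu> t) (Q t) \<partial>lborel) \<le> ennreal (T0 * (l \<bullet> p - L))"
    note a = admD[OF adm]
    obtain N where N: "N \<in> null_sets lborel" "\<And>t. t \<in> {0..T0} \<Longrightarrow> t \<notin> N \<Longrightarrow> Q t = flow l g t (($) (\<mu> t))"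
      by (rule optimal_flow[OF adm nn opt]) blast
    obtain m' N' where m': "sol (tilted_gen l g) exc_times m'" "\<And>t. m' (t + T0) = m' t" "\<And>t y. m' t y \<ge> 0" "\<And>t. (\<Sum>y\<in>UNIV. m' t y) = 1"
      and N': "N' \<in> null_sets lborel" and meq': "\<And>t y. t \<in> {0..T0} \<Longrightarrow> t \<notin> N' \<Longrightarrow> \<mu> t $ y = m' t y"
      by (rule optimal_stationary[OF adm N]) blast+
    have "m' = m" by (rule stationary_unique[OF m m'])
    then have meq: "\<And>t y. t \<in> {0..T0} \<Longrightarrow> t \<notin> N' \<Longrightarrow> \<mu> t $ y = m t y" using meq' by simp
    have "T0 * fst p $ y = T0 * fst p0 $ y" for y
      using set_integral_cong_null[OF a(3)[of y] mm[of y] N' meq] a(10)[of y] T0_pos by (simp add: p0_def)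
    then have 1: "fst p = fst p0" using T0_pos by (simp add: vec_eq_iff)
    have tmod: "(\<lambda>t. flow l g t (m t) $ e) \<in> borel_measurable borel" for e unfolding flow_def by simp
    have NN': "N \<union> N' \<in> null_sets lborel" using N(1) N' by blast
    have "(LINT t:{0..T0}|lborel. Q t $ e) = (LINT t:{0..T0}|lborel. flow l g t (m t) $ e)" for e
      by (rule set_integral_cong_null[OF a(4) tmod NN']) (use N(2) meq in \<open>auto simp: flow_def\<close>)
    then have "T0 * snd p $ e = T0 * snd p0 $ e" for e using a(11)[of e] T0_pos by (simp add: p0_def)
    then have 2: "snd p = snd p0" using T0_pos by (simp add: vec_eq_iff)
    show "p = p0" using 1 2 by (simp add: prod_eq_iff)
  qed
qed

end

end

section \<open>Convexity and lower semicontinuity\<close>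

lemma ennreal_liminf_add: "liminf f + liminf g \<le> liminf (\<lambda>n. f n + g n)" for f g :: "nat \<Rightarrow> ennreal"
proof -
  have "liminf f + liminf g = (SUP n. (INF i\<in>{n..}. f i) + (INF i\<in>{n..}. g i))"
    unfolding liminf_SUP_INF
    by (rule ennreal_SUP_add[symmetric]) (auto simp: incseq_def intro!: INF_superset_mono)
  also have "\<dots> \<le> liminf (\<lambda>n. f n + g n)"
    unfolding liminf_SUP_INF by (intro SUP_mono' INF_greatest add_mono INF_lower) auto
  finally show ?thesis .
qed

lemma ennreal_liminf_sum: "(\<Sum>i\<in>I. liminf (f i)) \<le> liminf (\<lambda>n. \<Sum>i\<in>I. f i n)" for f :: "'i \<Rightarrow> nat \<Rightarrow> ennreal"
proof (induction I rule: infinite_finite_induct)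
  case (insert i I)
  have "(\<Sum>i\<in>insert i I. liminf (f i)) \<le> liminf (f i) + liminf (\<lambda>n. \<Sum>i\<in>I. f i n)"
    using insert by (simp add: add_left_mono)
  also have "\<dots> \<le> liminf (\<lambda>n. f i n + (\<Sum>i\<in>I. f i n))" by (rule ennreal_liminf_add)
  finally show ?case using insert by simp
qed auto

text \<open>Vitali's theorem. The tail hypothesis passes to \<open>f\<close> by Fatou; truncating at
  \<open>K\<close> costs at most \<open>M * \<eta>\<close> for the sequence and for the limit, and
  the truncated integrals converge by domination.\<close>

lemma uniformly_integrable_limit:
  fixes f :: "real \<Rightarrow> real" and s :: "nat \<Rightarrow> real \<Rightarrow> real"
  assumes ab: "a \<le> b" and tmod [measurable]: "f \<in> borel_measurable borel" and sm [measurable]: "\<And>n. s n \<in> borel_measurable borel"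
    and N: "N \<in> null_sets lborel" and lim: "\<And>t. t \<in> {a..b} \<Longrightarrow> t \<notin> N \<Longrightarrow> (\<lambda>n. s n t) \<longlonglongrightarrow> f t"
    and s0: "\<And>n t. s n t \<ge> 0" and f0: "\<And>t. f t \<ge> 0" and si: "\<And>n. set_integrable lborel {a..b} (s n)"
    and ui: "\<And>\<eta>. \<eta> > 0 \<Longrightarrow> \<exists>K\<ge>0. \<forall>n. (\<integral>\<^sup>+ t\<in>{a..b}. ennreal (s n t - K) \<partial>lborel) \<le> ennreal \<eta>"
  shows "set_integrable lborel {a..b} f"
    and "\<And>h M. h \<in> borel_measurable borel \<Longrightarrow> (\<And>t. t \<in> {a..b} \<Longrightarrow> \<bar>h t\<bar> \<le> M) \<Longrightarrow>
      (\<lambda>n. LINT t:{a..b}|lborel. s n t * h t) \<longlonglongrightarrow> (LINT t:{a..b}|lborel. f t * h t)"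
proof -
  have ui_f: "(\<integral>\<^sup>+ t\<in>{a..b}. ennreal (f t - K) \<partial>lborel) \<le> ennreal \<eta>"
    if K: "\<forall>n. (\<integral>\<^sup>+ t\<in>{a..b}. ennreal (s n t - K) \<partial>lborel) \<le> ennreal \<eta>" for K \<eta>
  proof -
    have "(\<integral>\<^sup>+ t\<in>{a..b}. ennreal (f t - K) \<partial>lborel) \<le> (\<integral>\<^sup>+ t. liminf (\<lambda>n. ennreal (s n t - K) * indicator {a..b} t) \<partial>lborel)"
    proof (rule nn_integral_mono_AE)
      show "AE t in lborel. ennreal (f t - K) * indicator {a..b} t \<le> liminf (\<lambda>n. ennreal (s n t - K) * indicator {a..b} t)"
        using AE_not_in[OF N]
      proof eventually_elim
        case (elim t)
        show ?case
        proof (cases "t \<in> {a..b}")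
          case True
          have "(\<lambda>n. ennreal (s n t - K)) \<longlonglongrightarrow> ennreal (f t - K)"
            by (intro tendsto_ennrealI tendsto_diff tendsto_const lim True elim)
          then have "liminf (\<lambda>n. ennreal (s n t - K)) = ennreal (f t - K)" by (intro lim_imp_Liminf) auto
          then show ?thesis using True by simp
        qed simp
      qed
    qed
    also have "\<dots> \<le> liminf (\<lambda>n. \<integral>\<^sup>+ t\<in>{a..b}. ennreal (s n t - K) \<partial>lborel)"
      by (rule nn_integral_liminf) simp
    also have "\<dots> \<le> ennreal \<eta>"
      by (rule Liminf_le) (use K in auto)
    finally show ?thesis .
  qed
  have tail: "set_integrable lborel {a..b} (\<lambda>t. max 0 (u t - K)) \<and> (LINT t:{a..b}|lborel. max 0 (u t - K)) \<le> \<eta>"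
    if u: "u \<in> borel_measurable borel" "(\<integral>\<^sup>+ t\<in>{a..b}. ennreal (u t - K) \<partial>lborel) \<le> ennreal \<eta>" "\<eta> > 0" for u K \<eta>
  proof -
    let ?v = "\<lambda>t. indicator {a..b} t *\<^sub>R max 0 (u t - K)"
    have e: "ennreal (?v t) = ennreal (u t - K) * indicator {a..b} t" for t
      by (cases "t \<in> {a..b}") (auto simp: max_def ennreal_neg)
    have vm: "?v \<in> borel_measurable lborel" using u(1) by simp
    have vX: "(\<integral>\<^sup>+ t. ennreal (?v t) \<partial>lborel) \<le> ennreal \<eta>" unfolding e by (rule u(2))
    have v0: "?v t \<ge> 0" for t by (auto simp: indicator_def)
    have vi: "integrable lborel ?v"
      by (rule integrableI_nonneg[OF vm]) (use vX v0 in \<open>auto intro: le_less_trans\<close>)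
    have "ennreal (LINT t|lborel. ?v t) \<le> ennreal \<eta>"
      using vX by (subst nn_integral_eq_integral[OF vi, symmetric]) (use v0 in auto)
    then have "(LINT t|lborel. ?v t) \<le> \<eta>" using u(3) by simp
    then show ?thesis using vi by (simp add: set_integrable_def set_lebesgue_integral_def)
  qed
  show fi: "set_integrable lborel {a..b} f"
  proof -
    obtain K where K: "K \<ge> 0" "\<forall>n. (\<integral>\<^sup>+ t\<in>{a..b}. ennreal (s n t - K) \<partial>lborel) \<le> ennreal 1" using ui[of 1] by auto
    have i1: "set_integrable lborel {a..b} (\<lambda>t. max 0 (f t - K))" using tail[OF tmod ui_f[OF K(2)]] by simp
    have i2: "set_integrable lborel {a..b} (\<lambda>t. min (f t) K)"
      by (rule set_integrable_bounded[of _ _ _ K]) (use f0 K(1) in auto)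
    have "f t = max 0 (f t - K) + min (f t) K" for t by auto
    then show ?thesis using set_integral_add(1)[OF i1 i2] by simp
  qed
  fix h :: "real \<Rightarrow> real" and M assume hm [measurable]: "h \<in> borel_measurable borel" and hM: "\<And>t. t \<in> {a..b} \<Longrightarrow> \<bar>h t\<bar> \<le> M"
  have M0: "M \<ge> 0" using hM[of a] ab by auto
  show "(\<lambda>n. LINT t:{a..b}|lborel. s n t * h t) \<longlonglongrightarrow> (LINT t:{a..b}|lborel. f t * h t)"
  proof (rule LIMSEQ_I)
    fix e :: real assume e: "e > 0"
    \<comment> \<open>Two truncation errors of at most \<open>e / 4\<close> each;
      \<open>M + 1\<close> avoids dividing by zero when \<open>M = 0\<close>.\<close>
    define \<eta> where "\<eta> = e / (4 * (M + 1))"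
    have \<eta>: "\<eta> > 0" using e M0 by (simp add: \<eta>_def)
    have M\<eta>: "2 * (M * \<eta>) < e / 2 + e / 4"
    proof -
      have "M * \<eta> \<le> (M + 1) * \<eta>" using \<eta> by simp
      also have "\<dots> = e / 4" using M0 by (simp add: \<eta>_def field_simps)
      finally show ?thesis using e by simp
    qed
    obtain K where K: "K \<ge> 0" "\<forall>n. (\<integral>\<^sup>+ t\<in>{a..b}. ennreal (s n t - K) \<partial>lborel) \<le> ennreal \<eta>" using ui[OF \<eta>] by blast
    have trunc: "\<bar>(LINT t:{a..b}|lborel. u t * h t) - (LINT t:{a..b}|lborel. min (u t) K * h t)\<bar> \<le> M * \<eta>"
      if u: "u \<in> borel_measurable borel" "set_integrable lborel {a..b} u" "\<And>t. u t \<ge> 0" "(\<integral>\<^sup>+ t\<in>{a..b}. ennreal (u t - K) \<partial>lborel) \<le> ennreal \<eta>" for u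
    proof -
      note t = tail[OF u(1,4) \<eta>]
      have i2: "set_integrable lborel {a..b} (\<lambda>t. min (u t) K)"
        by (rule set_integrable_bounded[of _ _ _ K]) (use u K(1) in auto)
      have j1: "set_integrable lborel {a..b} (\<lambda>t. u t * h t)" "set_integrable lborel {a..b} (\<lambda>t. min (u t) K * h t)"
        "set_integrable lborel {a..b} (\<lambda>t. max 0 (u t - K) * h t)"
        using set_integrable_mult_bounded[OF u(2) hm hM] set_integrable_mult_bounded[OF i2 hm hM]
          set_integrable_mult_bounded[OF conjunct1[OF t] hm hM] by blast+
      have "(LINT t:{a..b}|lborel. u t * h t) - (LINT t:{a..b}|lborel. min (u t) K * h t) = (LINT t:{a..b}|lborel. u t * h t - min (u t) K * h t)"
        by (rule set_integral_diff(2)[symmetric, OF j1(1,2)])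
      also have "(\<lambda>t. u t * h t - min (u t) K * h t) = (\<lambda>t. max 0 (u t - K) * h t)"
        by (auto simp: fun_eq_iff max_def min_def algebra_simps)
      finally have "\<bar>(LINT t:{a..b}|lborel. u t * h t) - (LINT t:{a..b}|lborel. min (u t) K * h t)\<bar> = \<bar>LINT t:{a..b}|lborel. max 0 (u t - K) * h t\<bar>" by simp
      also have "\<dots> \<le> (LINT t:{a..b}|lborel. \<bar>max 0 (u t - K) * h t\<bar>)"
        using set_integral_norm_bound[OF j1(3)] by simp
      also have "\<dots> \<le> (LINT t:{a..b}|lborel. M * max 0 (u t - K))"
      proof (rule set_integral_mono)
        show "set_integrable lborel {a..b} (\<lambda>t. \<bar>max 0 (u t - K) * h t\<bar>)" by (rule set_integrable_abs[OF j1(3)])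
        show "set_integrable lborel {a..b} (\<lambda>t. M * max 0 (u t - K))" using t by simp
        fix t assume "t \<in> {a..b}"
        then have "\<bar>h t\<bar> * max 0 (u t - K) \<le> M * max 0 (u t - K)" by (intro mult_right_mono hM) auto
        then show "\<bar>max 0 (u t - K) * h t\<bar> \<le> M * max 0 (u t - K)" by (simp add: abs_mult mult.commute)
      qed
      also have "\<dots> = M * (LINT t:{a..b}|lborel. max 0 (u t - K))" by simp
      also have "\<dots> \<le> M * \<eta>" using t M0 by (intro mult_left_mono) auto
      finally show ?thesis .
    qed
    have "(\<lambda>n. LINT t:{a..b}|lborel. min (s n t) K * h t) \<longlonglongrightarrow> (LINT t:{a..b}|lborel. min (f t) K * h t)"
    proof (rule set_dominated_convergence(2)[OF _ _ _ N, where w = "\<lambda>t. K * M"])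
      show "set_integrable lborel {a..b} (\<lambda>t. K * M)" by (rule set_integrable_bounded[of _ _ _ "K * M"]) (use K M0 in auto)
      show "(\<lambda>n. min (s n t) K * h t) \<longlonglongrightarrow> min (f t) K * h t" if "t \<in> {a..b}" "t \<notin> N" for t
        by (intro tendsto_intros lim that)
      show "\<bar>min (s n t) K * h t\<bar> \<le> K * M" if "t \<in> {a..b}" for n t
        unfolding abs_mult using that s0[of n t] K(1) hM[OF that] by (intro mult_mono) auto
    qed auto
    from LIMSEQ_D[OF this, of "e / 4"] e
    obtain n0 where n0: "\<And>n. n \<ge> n0 \<Longrightarrow> \<bar>(LINT t:{a..b}|lborel. min (s n t) K * h t) - (LINT t:{a..b}|lborel. min (f t) K * h t)\<bar> < e / 4" by auto
    show "\<exists>n0. \<forall>n\<ge>n0. norm ((LINT t:{a..b}|lborel. s n t * h t) - (LINT t:{a..b}|lborel. f t * h t)) < e"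
    proof (intro exI allI impI)
      fix n assume "n \<ge> n0"
      from n0[OF this] trunc[OF sm[of n] si s0 K(2)[rule_format, of n]] trunc[OF tmod fi f0 ui_f[OF K(2)]] M\<eta>
      show "norm ((LINT t:{a..b}|lborel. s n t * h t) - (LINT t:{a..b}|lborel. f t * h t)) < e"
        unfolding real_norm_def by linarith
    qed
  qed
qed

context periodic_rates
begin

section \<open>Convexity of the admissible set and of the energy\<close>

definition energy :: "(real \<Rightarrow> real^'v) \<Rightarrow> (real \<Rightarrow> real^('v \<times> 'v)) \<Rightarrow> ennreal" where
  "energy \<mu> Q = (\<integral>\<^sup>+ t\<in>{0..T0}. It r t (\<mu> t) (Q t) \<partial>lborel)"

abbreviation adm :: "(real^'v) \<times> (real^('v \<times> 'v)) \<Rightarrow> (real \<Rightarrow> real^'v) \<Rightarrow> (real \<Rightarrow> real^('v \<times> 'v)) \<Rightarrow> bool" where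
  "adm p \<equiv> admissible r T0 (fst p) (snd p)"

lemma test_function:
  assumes f: "\<And>t. f (t + T0) = f t" "f C1_differentiable_on UNIV"
  obtains M where "f \<in> borel_measurable borel" "deriv f \<in> borel_measurable borel"
    "\<And>t. t \<in> {0..T0} \<Longrightarrow> \<bar>f t\<bar> \<le> M" "\<And>t. t \<in> {0..T0} \<Longrightarrow> \<bar>deriv f t\<bar> \<le> M"
proof -
  obtain D where D: "\<And>t. (f has_real_derivative D t) (at t)" "continuous_on UNIV D"
    using f(2) by (auto simp: C1_differentiable_on_def has_real_derivative_iff_has_vector_derivative)
  have "deriv f t = D t" for t by (rule DERIV_imp_deriv[OF D(1)])
  then have dD: "deriv f = D" by (simp add: fun_eq_iff)
  have fc: "continuous_on UNIV f" using D(1) by (intro DERIV_continuous_on) (auto intro: has_field_derivative_at_within)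
  have bd: "\<exists>M>0. \<forall>t\<in>{0..T0}. \<bar>h t\<bar> \<le> M" if "continuous_on UNIV h" for h :: "real \<Rightarrow> real"
  proof -
    have "bounded (h ` {0..T0})"
      by (intro compact_imp_bounded compact_continuous_image compact_Icc continuous_on_subset[OF that]) auto
    then show ?thesis unfolding bounded_pos by force
  qed
  obtain M1 where M1: "M1 > 0" "\<forall>t\<in>{0..T0}. \<bar>f t\<bar> \<le> M1" using bd[OF fc] by blast
  obtain M2 where M2: "M2 > 0" "\<forall>t\<in>{0..T0}. \<bar>D t\<bar> \<le> M2" using bd[OF D(2)] by blast
  show thesis
  proof (rule that[of "max M1 M2"])
    show "f \<in> borel_measurable borel" "deriv f \<in> borel_measurable borel"
      unfolding dD using fc D(2) by (auto intro: borel_measurable_continuous_onI)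
  qed (use M1 M2 dD in force)+
qed

lemma adm_mu_integrable:
  assumes a: "adm p \<mu> Q" and h: "h \<in> borel_measurable borel" "\<And>t. t \<in> {0..T0} \<Longrightarrow> \<bar>h t\<bar> \<le> M"
  shows "set_integrable lborel {0..T0} (\<lambda>t. \<mu> t $ y * h t)"
proof (rule set_integrable_mult_bounded[OF _ h])
  show "set_integrable lborel {0..T0} (\<lambda>t. \<mu> t $ y)"
    by (rule set_integrable_bounded[OF admD(3)[OF a], of _ _ _ 1]) (use prob_vecs_range[OF admD(7)[OF a]] in auto)
qed

lemma divg_linear: "divg (u *\<^sub>R Q + v *\<^sub>R Q') y = u * divg Q y + v * divg Q' y"
  by (simp add: divg_def sum.distrib sum_distrib_left algebra_simps)

lemma adm_convex:
  assumes a: "adm p \<mu> Q" and b: "adm p' \<mu>' Q'" and uv: "u \<ge> 0" "v \<ge> 0" "u + v = 1"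
  shows "adm (u *\<^sub>R p + v *\<^sub>R p') (\<lambda>t. u *\<^sub>R \<mu> t + v *\<^sub>R \<mu>' t) (\<lambda>t. u *\<^sub>R Q t + v *\<^sub>R Q' t)"
proof -
  note A = admD[OF a] and B = admD[OF b]
  have lin: "(LINT t:{0..T0}|lborel. u * f t + v * h t) = u * (LINT t:{0..T0}|lborel. f t) + v * (LINT t:{0..T0}|lborel. h t)"
    if "set_integrable lborel {0..T0} f" "set_integrable lborel {0..T0} h" for f h :: "real \<Rightarrow> real"
    using that by (subst set_integral_add(2)) auto
  have one: "set_integrable lborel {0..T0} (\<lambda>t. \<mu> t $ y)" "set_integrable lborel {0..T0} (\<lambda>t. \<mu>' t $ y)" for y
    using adm_mu_integrable[OF a, of "\<lambda>_. 1" 1] adm_mu_integrable[OF b, of "\<lambda>_. 1" 1] by auto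
  show ?thesis
    unfolding admissible_def
  proof (intro conjI allI impI)
    show "(\<lambda>t. u *\<^sub>R \<mu> t + v *\<^sub>R \<mu>' t) \<in> borel_measurable borel" using A(1) B(1) by measurable
    show "(\<lambda>t. u *\<^sub>R Q t + v *\<^sub>R Q' t) \<in> borel_measurable borel" using A(2) B(2) by measurable
    show "u *\<^sub>R \<mu> (t + T0) + v *\<^sub>R \<mu>' (t + T0) = u *\<^sub>R \<mu> t + v *\<^sub>R \<mu>' t" for t by (simp add: A(5) B(5))
    show "u *\<^sub>R Q (t + T0) + v *\<^sub>R Q' (t + T0) = u *\<^sub>R Q t + v *\<^sub>R Q' t" for t by (simp add: A(6) B(6))
    show "u *\<^sub>R \<mu> t + v *\<^sub>R \<mu>' t \<in> prob_vecs" for t by (rule convexD[OF convex_prob_vecs A(7) B(7) uv])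
    show "u *\<^sub>R Q t + v *\<^sub>R Q' t \<in> flows E" for t using A(12,13) B(12,13) uv by (simp add: flows_def)
    show "set_integrable lborel {0..T0} (\<lambda>t. (u *\<^sub>R Q t + v *\<^sub>R Q' t) $ e)" for e
      using A(9)[of e] B(9)[of e] by (auto intro!: set_integral_add(1))
    show "(LINT t:{0..T0}|lborel. (u *\<^sub>R \<mu> t + v *\<^sub>R \<mu>' t) $ y) / T0 = fst (u *\<^sub>R p + v *\<^sub>R p') $ y" for y
      using lin[OF one, of y] A(10)[of y] B(10)[of y] T0_pos by (simp add: field_simps)
    show "(LINT t:{0..T0}|lborel. (u *\<^sub>R Q t + v *\<^sub>R Q' t) $ e) / T0 = snd (u *\<^sub>R p + v *\<^sub>R p') $ e" for e
      using lin[OF A(9) B(9), of e] A(11)[of e] B(11)[of e] T0_pos by (simp add: field_simps)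
    fix f :: "'v \<Rightarrow> real \<Rightarrow> real" assume f: "\<forall>y. (\<forall>t. f y (t + T0) = f y t) \<and> f y C1_differentiable_on UNIV"
    have i: "set_integrable lborel {0..T0} (\<lambda>t. \<mu> t $ y * deriv (f y) t) \<and> set_integrable lborel {0..T0} (\<lambda>t. \<mu>' t $ y * deriv (f y) t) \<and>
        set_integrable lborel {0..T0} (\<lambda>t. divg (Q t) y * f y t) \<and> set_integrable lborel {0..T0} (\<lambda>t. divg (Q' t) y * f y t)" for y
    proof -
      obtain M where "f y \<in> borel_measurable borel" "deriv (f y) \<in> borel_measurable borel"
        "\<And>t. t \<in> {0..T0} \<Longrightarrow> \<bar>f y t\<bar> \<le> M" "\<And>t. t \<in> {0..T0} \<Longrightarrow> \<bar>deriv (f y) t\<bar> \<le> M"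
        by (rule test_function[of "f y"]) (use f in auto)
      then show ?thesis
        by (intro conjI adm_mu_integrable[OF a] adm_mu_integrable[OF b] set_integrable_mult_bounded[OF divg_integrable(1)[OF a]]
            set_integrable_mult_bounded[OF divg_integrable(1)[OF b]]) auto
    qed
    have "(LINT s:{0..T0}|lborel. (\<Sum>y\<in>UNIV. (u *\<^sub>R \<mu> s + v *\<^sub>R \<mu>' s) $ y * deriv (f y) s)) =
        (LINT s:{0..T0}|lborel. u * (\<Sum>y\<in>UNIV. \<mu> s $ y * deriv (f y) s) + v * (\<Sum>y\<in>UNIV. \<mu>' s $ y * deriv (f y) s))"
      by (simp add: sum.distrib sum_distrib_left algebra_simps)
    also have "\<dots> = u * (LINT s:{0..T0}|lborel. (\<Sum>y\<in>UNIV. \<mu> s $ y * deriv (f y) s)) + v * (LINT s:{0..T0}|lborel. (\<Sum>y\<in>UNIV. \<mu>' s $ y * deriv (f y) s))"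
      by (rule lin) (intro set_integral_sum(1), use i in blast)+
    also have "\<dots> = u * (LINT s:{0..T0}|lborel. (\<Sum>y\<in>UNIV. divg (Q s) y * f y s)) + v * (LINT s:{0..T0}|lborel. (\<Sum>y\<in>UNIV. divg (Q' s) y * f y s))"
      using adm_weak[OF a, of f] adm_weak[OF b, of f] f by simp
    also have "\<dots> = (LINT s:{0..T0}|lborel. u * (\<Sum>y\<in>UNIV. divg (Q s) y * f y s) + v * (\<Sum>y\<in>UNIV. divg (Q' s) y * f y s))"
      by (rule lin[symmetric]) (intro set_integral_sum(1), use i in blast)+
    also have "\<dots> = (LINT s:{0..T0}|lborel. (\<Sum>y\<in>UNIV. divg (u *\<^sub>R Q s + v *\<^sub>R Q' s) y * f y s))"
      by (simp add: divg_linear sum.distrib sum_distrib_left algebra_simps)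
    finally show "(LINT s:{0..T0}|lborel. (\<Sum>y\<in>UNIV. (u *\<^sub>R \<mu> s + v *\<^sub>R \<mu>' s) $ y * deriv (f y) s)) =
        (LINT s:{0..T0}|lborel. (\<Sum>y\<in>UNIV. divg (u *\<^sub>R Q s + v *\<^sub>R Q' s) y * f y s))" .
  qed
qed

lemma energy_convex:
  assumes a: "adm p \<mu> Q" and b: "adm p' \<mu>' Q'" and uv: "u \<ge> 0" "v \<ge> 0" "u + v = 1"
  shows "energy (\<lambda>t. u *\<^sub>R \<mu> t + v *\<^sub>R \<mu>' t) (\<lambda>t. u *\<^sub>R Q t + v *\<^sub>R Q' t) \<le> ennreal u * energy \<mu> Q + ennreal v * energy \<mu>' Q'"
proof -
  note A = admD[OF a] and B = admD[OF b]
  let ?I = "\<lambda>\<mu> Q t. \<Sum>(y, z)\<in>E. Phi (Q t $ (y, z)) (\<mu> t $ y * R t y z)"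
  have v: "v = 1 - u" "u \<in> {0..1}" using uv by auto
  have pw: "?I (\<lambda>t. u *\<^sub>R \<mu> t + v *\<^sub>R \<mu>' t) (\<lambda>t. u *\<^sub>R Q t + v *\<^sub>R Q' t) t \<le> ennreal u * ?I \<mu> Q t + ennreal v * ?I \<mu>' Q' t" for t
  proof -
    have "?I (\<lambda>t. u *\<^sub>R \<mu> t + v *\<^sub>R \<mu>' t) (\<lambda>t. u *\<^sub>R Q t + v *\<^sub>R Q' t) t \<le>
        (\<Sum>(y, z)\<in>E. ennreal u * Phi (Q t $ (y, z)) (\<mu> t $ y * R t y z) + ennreal v * Phi (Q' t $ (y, z)) (\<mu>' t $ y * R t y z))"
    proof (rule sum_mono, clarify)
      fix y z
      have "Phi (u * Q t $ (y, z) + (1 - u) * Q' t $ (y, z)) (u * (\<mu> t $ y * R t y z) + (1 - u) * (\<mu>' t $ y * R t y z)) \<le>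
          ennreal u * Phi (Q t $ (y, z)) (\<mu> t $ y * R t y z) + ennreal (1 - u) * Phi (Q' t $ (y, z)) (\<mu>' t $ y * R t y z)"
        by (rule Phi_convex) (use A(12) B(12) v prob_vecs_range[OF A(7)] prob_vecs_range[OF B(7)] R_nonneg in auto)
      then show "Phi ((u *\<^sub>R Q t + v *\<^sub>R Q' t) $ (y, z)) ((u *\<^sub>R \<mu> t + v *\<^sub>R \<mu>' t) $ y * R t y z) \<le>
          ennreal u * Phi (Q t $ (y, z)) (\<mu> t $ y * R t y z) + ennreal v * Phi (Q' t $ (y, z)) (\<mu>' t $ y * R t y z)"
        unfolding v(1) by (simp add: algebra_simps)
    qed
    then show ?thesis by (simp add: sum.distrib case_prod_beta sum_distrib_left)
  qed
  have [measurable]: "?I \<mu> Q \<in> borel_measurable lborel" "?I \<mu>' Q' \<in> borel_measurable lborel"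
    using It_R_meas[OF a] It_R_meas[OF b] by auto
  have "energy (\<lambda>t. u *\<^sub>R \<mu> t + v *\<^sub>R \<mu>' t) (\<lambda>t. u *\<^sub>R Q t + v *\<^sub>R Q' t) \<le>
      (\<integral>\<^sup>+ t. ennreal u * (?I \<mu> Q t * indicator {0..T0} t) + ennreal v * (?I \<mu>' Q' t * indicator {0..T0} t) \<partial>lborel)"
    unfolding energy_def nn_integral_It_R
  proof (rule nn_integral_mono)
    fix t
    show "?I (\<lambda>t. u *\<^sub>R \<mu> t + v *\<^sub>R \<mu>' t) (\<lambda>t. u *\<^sub>R Q t + v *\<^sub>R Q' t) t * indicator {0..T0} t
      \<le> ennreal u * (?I \<mu> Q t * indicator {0..T0} t) + ennreal v * (?I \<mu>' Q' t * indicator {0..T0} t)"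
      using pw[of t] by (cases "t \<in> {0..T0}") auto
  qed
  also have "\<dots> = ennreal u * energy \<mu> Q + ennreal v * energy \<mu>' Q'"
    unfolding energy_def nn_integral_It_R by (subst nn_integral_add) (auto simp: nn_integral_cmult)
  finally show ?thesis .
qed

text \<open>Minimising the strictly convex functional \<open>penalty\<close> over nested convex sets of almost optimal
  paths makes a sequence Cauchy in \<open>L\<^sup>2\<close>, by the parallelogram law for \<open>exp (- x / 2)\<close>.
  This replaces weak compactness in \<open>L\<^sup>1\<close>.\<close>

definition expvec :: "(real \<Rightarrow> real^'v) \<Rightarrow> (real \<Rightarrow> real^('v \<times> 'v)) \<Rightarrow> real \<Rightarrow> (real^'v) \<times> (real^('v \<times> 'v))" where
  "expvec \<mu> Q t = ((\<chi> y. exp (- \<mu> t $ y / 2)), (\<chi> e. exp (- Q t $ e / 2)))"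

definition expsum :: "(real \<Rightarrow> real^'v) \<Rightarrow> (real \<Rightarrow> real^('v \<times> 'v)) \<Rightarrow> real \<Rightarrow> real" where
  "expsum \<mu> Q t = (\<Sum>y\<in>UNIV. exp (- \<mu> t $ y)) + (\<Sum>e\<in>UNIV. exp (- Q t $ e))"

definition penalty :: "(real \<Rightarrow> real^'v) \<Rightarrow> (real \<Rightarrow> real^('v \<times> 'v)) \<Rightarrow> real" where
  "penalty \<mu> Q = (LINT t:{0..T0}|lborel. expsum \<mu> Q t)"

text \<open>\<open>expsum\<close> is the squared norm of \<open>expvec\<close>, and
  \<open>exp (- x / 2) * exp (- y / 2)\<close> is \<open>exp\<close> of minus the midpoint, so the
  cross term of the square is the penalty density of the midpoint path.\<close>

lemma expvec_parallelogram:
  "(norm (expvec \<mu> Q t - expvec \<mu>' Q' t))\<^sup>2 =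
     expsum \<mu> Q t + expsum \<mu>' Q' t - 2 * expsum (\<lambda>t. (1/2) *\<^sub>R \<mu> t + (1/2) *\<^sub>R \<mu>' t) (\<lambda>t. (1/2) *\<^sub>R Q t + (1/2) *\<^sub>R Q' t) t"
proof -
  have *: "(exp (- x / 2) - exp (- y / 2)) * (exp (- x / 2) - exp (- y / 2)) = exp (- x) + exp (- y) - 2 * exp (- (1/2 * x + 1/2 * y))" for x y :: real
  proof -
    have "exp (- x / 2) * exp (- x / 2) = exp (- x)" "exp (- y / 2) * exp (- y / 2) = exp (- y)"
      "exp (- x / 2) * exp (- y / 2) = exp (- (1/2 * x + 1/2 * y))"
      by (simp_all flip: exp_add add: field_simps)
    then show ?thesis by (simp add: algebra_simps)
  qed
  have "(norm (expvec \<mu> Q t - expvec \<mu>' Q' t))\<^sup>2 =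
      (\<Sum>y\<in>UNIV. (exp (- \<mu> t $ y / 2) - exp (- \<mu>' t $ y / 2)) * (exp (- \<mu> t $ y / 2) - exp (- \<mu>' t $ y / 2))) +
      (\<Sum>e\<in>UNIV. (exp (- Q t $ e / 2) - exp (- Q' t $ e / 2)) * (exp (- Q t $ e / 2) - exp (- Q' t $ e / 2)))"
    by (simp add: power2_norm_eq_inner inner_prod_def inner_vec_def expvec_def)
  then show ?thesis
    unfolding * by (simp add: expsum_def sum.distrib sum_subtractf sum_distrib_left)
qed

lemma expsum_bounds:
  assumes "adm p \<mu> Q"
  shows "0 \<le> expsum \<mu> Q t" "expsum \<mu> Q t \<le> real CARD('v) + real CARD('v \<times> 'v)" "expsum \<mu> Q \<in> borel_measurable borel"
    "set_integrable lborel {0..T0} (expsum \<mu> Q)" "0 \<le> penalty \<mu> Q" "penalty \<mu> Q \<le> (real CARD('v) + real CARD('v \<times> 'v)) * T0"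
proof -
  note a = admD[OF assms]
  show 0: "0 \<le> expsum \<mu> Q t" for t unfolding expsum_def by (intro add_nonneg_nonneg sum_nonneg) auto
  have "(\<Sum>y\<in>UNIV. exp (- \<mu> t $ y)) \<le> (\<Sum>y\<in>(UNIV::'v set). 1)" for t
    by (intro sum_mono) (use prob_vecs_range[OF a(7)] in auto)
  moreover have "(\<Sum>e\<in>UNIV. exp (- Q t $ e)) \<le> (\<Sum>e\<in>(UNIV::('v \<times> 'v) set). 1)" for t
    by (intro sum_mono) (use a(12) in auto)
  ultimately show 1: "expsum \<mu> Q t \<le> real CARD('v) + real CARD('v \<times> 'v)" for t
    unfolding expsum_def by (intro add_mono) (simp_all only: sum_constant mult_1_right of_nat_1)
  show m: "expsum \<mu> Q \<in> borel_measurable borel" unfolding expsum_def using a(3,4) by measurable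
  show i: "set_integrable lborel {0..T0} (expsum \<mu> Q)"
    by (rule set_integrable_bounded[OF m, of _ _ "real CARD('v) + real CARD('v \<times> 'v)"]) (unfold abs_of_nonneg[OF 0], rule 1)
  show "0 \<le> penalty \<mu> Q" unfolding penalty_def set_lebesgue_integral_def by (rule integral_nonneg_AE) (use 0 in \<open>auto simp: indicator_def\<close>)
  have "\<bar>penalty \<mu> Q\<bar> \<le> (real CARD('v) + real CARD('v \<times> 'v)) * (T0 - 0)"
    unfolding penalty_def by (rule set_integral_bounded[OF m]) (unfold abs_of_nonneg[OF 0], rule 1, use T0_pos in simp)
  then show "penalty \<mu> Q \<le> (real CARD('v) + real CARD('v \<times> 'v)) * T0" by simp
qed

lemma expvec_meas:
  assumes "adm p \<mu> Q" shows "expvec \<mu> Q \<in> borel_measurable borel"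
proof -
  note a = admD[OF assms]
  have "(\<lambda>t. \<chi> y. exp (- \<mu> t $ y / 2)) \<in> borel_measurable borel" "(\<lambda>t. \<chi> e. exp (- Q t $ e / 2)) \<in> borel_measurable borel"
    using a(3,4) by (auto intro!: borel_measurable_vec)
  then show ?thesis unfolding expvec_def[abs_def] by measurable
qed

lemma expvec_norm:
  assumes "adm p \<mu> Q" shows "norm (expvec \<mu> Q t) \<le> real CARD('v) + real CARD('v \<times> 'v)"
proof -
  note a = admD[OF assms]
  have "norm (expvec \<mu> Q t) \<le> norm (\<chi> y. exp (- \<mu> t $ y / 2)) + norm (\<chi> e. exp (- Q t $ e / 2))"
    unfolding expvec_def by (rule norm_Pair_le)
  also have "\<dots> \<le> (\<Sum>y\<in>(UNIV::'v set). 1) + (\<Sum>e\<in>(UNIV::('v \<times> 'v) set). 1)"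
  proof (rule add_mono; rule order_trans[OF norm_le_l1_cart]; rule sum_mono)
    show "\<bar>(\<chi> y. exp (- \<mu> t $ y / 2)) $ i\<bar> \<le> 1" for i using prob_vecs_range[OF a(7)] by simp
    show "\<bar>(\<chi> e. exp (- Q t $ e / 2)) $ i\<bar> \<le> 1" for i using a(12) by simp
  qed
  finally show ?thesis by simp
qed

lemma near_optimal_sequence:
  assumes c: "c \<ge> 0" and ne: "\<And>n::nat. \<exists>p' \<mu> Q. adm p' \<mu> Q \<and> norm (p' - p) \<le> 1 / real (Suc n) \<and> energy \<mu> Q \<le> ennreal (c + 1 / real (Suc n))"
  obtains ps \<mu> Q N where "\<And>n::nat. adm (ps n) (\<mu> n) (Q n)" "\<And>n. norm (ps n - p) \<le> 1 / real (Suc n)"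
    "\<And>n. energy (\<mu> n) (Q n) \<le> ennreal (c + 1 / real (Suc n))" "N \<in> null_sets lborel"
    "\<And>t. t \<in> {0..T0} \<Longrightarrow> t \<notin> N \<Longrightarrow> Cauchy (\<lambda>n. expvec (\<mu> n) (Q n) t)"
proof -
  \<comment> \<open>The constraint sets shrink as \<open>n\<close> grows and are closed under
    midpoints: admissibility is preserved by convex combinations, and the norm ball and the energy
    bound are convex conditions.\<close>
  define CC where "CC n x \<longleftrightarrow> adm (fst x) (fst (snd x)) (snd (snd x)) \<and> norm (fst x - p) \<le> 1 / real (Suc n) \<and>
      energy (fst (snd x)) (snd (snd x)) \<le> ennreal (c + 1 / real (Suc n))" for n x
  define mid where "mid x x' = ((1/2) *\<^sub>R fst x + (1/2) *\<^sub>R fst x', (\<lambda>t. (1/2) *\<^sub>R fst (snd x) t + (1/2) *\<^sub>R fst (snd x') t),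
      (\<lambda>t. (1/2) *\<^sub>R snd (snd x) t + (1/2) *\<^sub>R snd (snd x') t))"
    for x x' :: "((real^'v) \<times> (real^('v \<times> 'v))) \<times> (real \<Rightarrow> real^'v) \<times> (real \<Rightarrow> real^('v \<times> 'v))"
  define J where "J x = penalty (fst (snd x)) (snd (snd x))" for x :: "((real^'v) \<times> (real^('v \<times> 'v))) \<times> (real \<Rightarrow> real^'v) \<times> (real \<Rightarrow> real^('v \<times> 'v))"
  have CCne: "\<exists>x. CC n x" for n using ne[of n] by (auto simp: CC_def)
  have CCmono: "CC n x" if "CC k x" "n \<le> k" for n k x
  proof -
    have "1 / real (Suc k) \<le> 1 / real (Suc n)" using that(2) by (intro divide_left_mono) auto
    moreover from this have "ennreal (c + 1 / real (Suc k)) \<le> ennreal (c + 1 / real (Suc n))" by (intro ennreal_leI) simp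
    ultimately show ?thesis using that(1) unfolding CC_def by (meson order_trans)
  qed
  have CCmid: "CC n (mid x x')" if x: "CC n x" "CC n x'" for n x x'
  proof -
    define d where "d = 1 / real (Suc n)"
    have h: "(1/2::real) \<ge> 0" "(1/2::real) + 1/2 = 1" by auto
    have a: "adm (fst x) (fst (snd x)) (snd (snd x))" "adm (fst x') (fst (snd x')) (snd (snd x'))" using x by (auto simp: CC_def)
    have "adm ((1/2) *\<^sub>R fst x + (1/2) *\<^sub>R fst x') (fst (snd (mid x x'))) (snd (snd (mid x x')))"
      unfolding mid_def by simp (rule adm_convex[OF a h(1) h(1) h(2), simplified])
    moreover have "norm (((1/2) *\<^sub>R fst x + (1/2) *\<^sub>R fst x') - p) \<le> d"
    proof -
      have "((1/2) *\<^sub>R fst x + (1/2) *\<^sub>R fst x') - p = (1/2) *\<^sub>R (fst x - p) + (1/2) *\<^sub>R (fst x' - p)"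
        by (simp add: algebra_simps flip: scaleR_add_left)
      also have "norm \<dots> \<le> norm ((1/2) *\<^sub>R (fst x - p)) + norm ((1/2) *\<^sub>R (fst x' - p))" by (rule norm_triangle_ineq)
      also have "\<dots> \<le> d" using x unfolding CC_def d_def by simp
      finally show ?thesis .
    qed
    moreover have "energy (fst (snd (mid x x'))) (snd (snd (mid x x'))) \<le> ennreal (c + d)"
    proof -
      have "energy (fst (snd (mid x x'))) (snd (snd (mid x x'))) \<le> ennreal (1/2) * energy (fst (snd x)) (snd (snd x)) + ennreal (1/2) * energy (fst (snd x')) (snd (snd x'))"
        unfolding mid_def by (simp only: fst_conv snd_conv) (rule energy_convex[OF a h(1) h(1) h(2)])
      also have "\<dots> \<le> ennreal (1/2) * ennreal (c + d) + ennreal (1/2) * ennreal (c + d)"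
        using x unfolding CC_def d_def by (intro add_mono mult_left_mono) auto
      also have "\<dots> = ennreal (c + d)"
      proof -
        have "c + d \<ge> 0" using c by (simp add: d_def)
        then have "ennreal (1/2) * ennreal (c + d) + ennreal (1/2) * ennreal (c + d) = ennreal (1/2 * (c + d) + 1/2 * (c + d))"
          by (simp only: ennreal_mult'[symmetric] ennreal_plus[symmetric] mult_nonneg_nonneg h(1))
        then show ?thesis by simp
      qed
      finally show ?thesis .
    qed
    ultimately show ?thesis unfolding CC_def d_def by (simp add: mid_def)
  qed
  \<comment> \<open>The infima increase because the sets shrink, and they are bounded because the
    penalty is; their convergence is what makes near-minimisers Cauchy.\<close>
  define j where "j n = Inf (J ` {x. CC n x})" for n
  have bdd: "bdd_below (J ` {x. CC n x})" for n
  proof (rule bdd_belowI[of _ 0])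
    fix z assume "z \<in> J ` {x. CC n x}"
    then obtain x where "CC n x" "z = J x" by blast
    then show "0 \<le> z" using expsum_bounds(5)[of "fst x" "fst (snd x)" "snd (snd x)"] unfolding J_def CC_def by blast
  qed
  have jle: "j n \<le> J x" if "CC n x" for n x
    unfolding j_def by (rule cInf_lower[OF _ bdd]) (use that in auto)
  have "\<exists>x. CC n x \<and> J x < j n + 1 / real (Suc n)" for n
  proof -
    have ne': "J ` {x. CC n x} \<noteq> {}" using CCne by auto
    have "Inf (J ` {x. CC n x}) < j n + 1 / real (Suc n)" by (simp add: j_def)
    from cInf_lessD[OF ne' this] show ?thesis by auto
  qed
  then have "\<forall>n. \<exists>x. CC n x \<and> J x < j n + 1 / real (Suc n)" by blast
  from choice[OF this] obtain x where x: "\<forall>n. CC n (x n) \<and> J (x n) < j n + 1 / real (Suc n)" ..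
  have xC: "CC n (x n)" and xJ: "J (x n) < j n + 1 / real (Suc n)" for n using x by auto
  define K where "K = (real CARD('v) + real CARD('v \<times> 'v)) * T0"
  have jinc: "j n \<le> j k" if "n \<le> k" for n k
    unfolding j_def[of k] by (rule cInf_greatest) (use CCne CCmono[OF _ that] jle in auto)
  have jK: "j n \<le> K" for n
    using jle[OF xC[of n]] expsum_bounds(6)[of "fst (x n)" "fst (snd (x n))" "snd (snd (x n))"] xC[of n] by (simp add: J_def CC_def K_def)
  have j0: "j n \<ge> 0" for n
    unfolding j_def
  proof (rule cInf_greatest)
    show "J ` {x. CC n x} \<noteq> {}" using CCne by blast
    fix z assume "z \<in> J ` {x. CC n x}"
    then obtain x where "CC n x" "z = J x" by blast
    then show "0 \<le> z" using expsum_bounds(5)[of "fst x" "fst (snd x)" "snd (snd x)"] unfolding J_def CC_def by blast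
  qed
  have "convergent j"
  proof (rule Bseq_mono_convergent)
    show "Bseq j" by (rule BseqI'[of _ K]) (use jK j0 in auto)
  qed (use jinc in blast)
  then have jC: "Cauchy j" by (rule convergent_Cauchy)
  let ?u = "\<lambda>n. expvec (fst (snd (x n))) (snd (snd (x n)))"
  have ax: "adm (fst (x n)) (fst (snd (x n))) (snd (snd (x n)))" for n using xC by (auto simp: CC_def)
  have um: "?u n \<in> borel_measurable borel" for n by (rule expvec_meas[OF ax])
  define B where "B = real CARD('v) + real CARD('v \<times> 'v)"
  have ub: "norm (?u n t) \<le> B" for n t unfolding B_def by (rule expvec_norm[OF ax])
  \<comment> \<open>For \<open>i \<le> k\<close> the midpoint of \<open>x i\<close> and
    \<open>x k\<close> still lies in the larger set of index \<open>i\<close>, so its penalty is at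
    least \<open>j i\<close>; the parallelogram identity then bounds the squared distance.\<close>
  have D: "(LINT t:{0..T0}|lborel. (norm (?u i t - ?u k t))\<^sup>2) \<le> j k - j i + 2 / real (Suc i)" if "i \<le> k" for i k
  proof -
    let ?m = "mid (x i) (x k)"
    have mC: "CC i ?m" by (rule CCmid[OF xC CCmono[OF xC that]])
    have am: "adm (fst ?m) (fst (snd ?m)) (snd (snd ?m))" using mC by (auto simp: CC_def)
    have si: "set_integrable lborel {0..T0} (\<lambda>t. 2 * expsum (fst (snd ?m)) (snd (snd ?m)) t)"
      using expsum_bounds(4)[OF am] by simp
    have "(LINT t:{0..T0}|lborel. (norm (?u i t - ?u k t))\<^sup>2) = (LINT t:{0..T0}|lborel. (expsum (fst (snd (x i))) (snd (snd (x i))) t + expsum (fst (snd (x k))) (snd (snd (x k))) t) - 2 * expsum (fst (snd ?m)) (snd (snd ?m)) t)"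
      unfolding expvec_parallelogram mid_def by simp
    also have "\<dots> = J (x i) + J (x k) - 2 * J ?m"
      by (subst set_integral_diff(2)[OF set_integral_add(1)[OF expsum_bounds(4)[OF ax] expsum_bounds(4)[OF ax]] si])
         (subst set_integral_add(2)[OF expsum_bounds(4)[OF ax] expsum_bounds(4)[OF ax]], simp add: J_def penalty_def)
    also have "\<dots> \<le> (j i + 1 / real (Suc i)) + (j k + 1 / real (Suc k)) - 2 * j i"
      using xJ[of i] xJ[of k] jle[OF mC] by linarith
    also have "\<dots> \<le> j k - j i + 2 / real (Suc i)"
    proof -
      have "1 / real (Suc k) \<le> 1 / real (Suc i)" using that by (intro divide_left_mono) auto
      then show ?thesis by simp
    qed
    finally show ?thesis .
  qed
  have D2: "\<exists>N. \<forall>i\<ge>N. \<forall>k\<ge>N. (LINT t:{0..T0}|lborel. (norm (?u i t - ?u k t))\<^sup>2) < e" if e: "e > 0" for e :: real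
  proof -
    from jC[unfolded Cauchy_def, rule_format, of "e / 2"] e
    obtain N1 where N1: "\<And>i k. i \<ge> N1 \<Longrightarrow> k \<ge> N1 \<Longrightarrow> dist (j i) (j k) < e / 2" by auto
    obtain N2 where N2: "1 / real (Suc N2) < e / 4" using e nat_approx_posE[of "e / 4"] by auto
    have main: "(LINT t:{0..T0}|lborel. (norm (?u i t - ?u k t))\<^sup>2) < e" if "i \<ge> max N1 N2" "i \<le> k" for i k
    proof -
      have "1 / real (Suc i) \<le> 1 / real (Suc N2)" using that by (intro divide_left_mono) auto
      then have "2 / real (Suc i) < e / 2" using N2 by simp
      moreover have "dist (j i) (j k) < e / 2" by (rule N1) (use that in auto)
      then have "j k - j i < e / 2" unfolding dist_real_def by linarith
      ultimately show ?thesis using D[OF that(2)] by linarith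
    qed
    show ?thesis
    proof (intro exI[of _ "max N1 N2"] allI impI)
      fix i k assume "i \<ge> max N1 N2" "k \<ge> max N1 N2"
      then show "(LINT t:{0..T0}|lborel. (norm (?u i t - ?u k t))\<^sup>2) < e"
        using main[of i k] main[of k i] by (cases "i \<le> k") (auto simp: norm_minus_commute)
    qed
  qed
  let ?s = "\<lambda>n t. indicator {0..T0} t *\<^sub>R ?u n t"
  have s_int: "integrable lborel (?s n)" for n
    by (rule integrableI_bounded_set_indicator[where B = B]) (use um ub in \<open>auto simp: emeasure_lborel_Icc_eq\<close>)
  have dm: "(\<lambda>t. norm (?u i t - ?u k t)) \<in> borel_measurable borel" for i k using um by measurable
  have db: "norm (?u i t - ?u k t) \<le> 2 * B" for i k t
    using norm_triangle_ineq4[of "?u i t" "?u k t"] ub[of i t] ub[of k t] by linarith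
  \<comment> \<open>From squares to first powers by \<open>a \<le> h + a\<^sup>2 / h\<close>; with
    \<open>h = e / (2 * T0)\<close> both contributions are at most \<open>e / 2\<close>.\<close>
  have L1: "\<exists>N. \<forall>i\<ge>N. \<forall>k\<ge>N. (LINT t|lborel. norm (?s i t - ?s k t)) < e" if e: "e > 0" for e
  proof -
    define h where "h = e / (2 * T0)"
    have h: "h > 0" using e T0_pos by (simp add: h_def)
    obtain N where N: "\<And>i k. i \<ge> N \<Longrightarrow> k \<ge> N \<Longrightarrow> (LINT t:{0..T0}|lborel. (norm (?u i t - ?u k t))\<^sup>2) < h * (e / 2)"
      using D2[of "h * (e / 2)"] h e by auto
    show ?thesis
    proof (intro exI[of _ N] allI impI)
      fix i k assume ik: "i \<ge> N" "k \<ge> N"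
      let ?n = "\<lambda>t. norm (?u i t - ?u k t)"
      have i1: "set_integrable lborel {0..T0} ?n" by (rule set_integrable_bounded[OF dm, of _ _ _ _ "2 * B"]) (use db in auto)
      have i2: "set_integrable lborel {0..T0} (\<lambda>t. (?n t)\<^sup>2 / h)"
      proof (rule set_integrable_bounded[of _ _ _ "(2 * B)\<^sup>2 / h"])
        show "(\<lambda>t. (?n t)\<^sup>2 / h) \<in> borel_measurable borel" using dm by measurable
        have "(?n t)\<^sup>2 \<le> (2 * B)\<^sup>2" for t by (intro power_mono db norm_ge_zero)
        then show "\<bar>(?n t)\<^sup>2 / h\<bar> \<le> (2 * B)\<^sup>2 / h" for t
          using h by (simp only: abs_divide abs_of_pos abs_power2 divide_right_mono less_imp_le)
      qed
      have i3: "set_integrable lborel {0..T0} (\<lambda>t. h)" by (rule set_integrable_bounded[of _ _ _ h]) (use h in auto)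
      have "(LINT t|lborel. norm (?s i t - ?s k t)) = (LINT t:{0..T0}|lborel. ?n t)"
        unfolding set_lebesgue_integral_def
        by (rule Bochner_Integration.integral_cong) (auto simp: indicator_def)
      also have "\<dots> \<le> (LINT t:{0..T0}|lborel. h + (?n t)\<^sup>2 / h)"
      proof (rule set_integral_mono[OF i1 set_integral_add(1)[OF i3 i2]])
        fix t
        show "?n t \<le> h + (?n t)\<^sup>2 / h"
        proof (cases "?n t \<le> h")
          case False
          then have "?n t * h \<le> ?n t * ?n t" by (intro mult_left_mono) auto
          then have "?n t \<le> (?n t)\<^sup>2 / h" using h by (simp add: field_simps power2_eq_square)
          then show ?thesis using h by linarith
        qed (use h in \<open>simp add: add_increasing2\<close>)
      qed
      also have "\<dots> = h * T0 + (LINT t:{0..T0}|lborel. (?n t)\<^sup>2) / h"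
        by (subst set_integral_add(2)[OF i3 i2]) (use T0_pos in \<open>simp add: set_lebesgue_integral_def mult.commute\<close>)
      also have "\<dots> < h * T0 + (h * (e / 2)) / h"
        using N[OF ik] h by (intro add_strict_left_mono divide_strict_right_mono)
      also have "\<dots> = e" using h T0_pos by (simp add: h_def)
      finally show "(LINT t|lborel. norm (?s i t - ?s k t)) < e" .
    qed
  qed
  obtain \<rho> where \<rho>: "strict_mono \<rho>" "AE t in lborel. Cauchy (\<lambda>i. ?s (\<rho> i) t)"
    by (rule cauchy_L1_AE_cauchy_subseq[OF s_int L1]) auto
  from \<rho>(2) obtain N where N: "N \<in> null_sets lborel" "{t \<in> space lborel. \<not> Cauchy (\<lambda>i. ?s (\<rho> i) t)} \<subseteq> N"
    by (rule AE_E) (auto simp: null_sets_def)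
  show thesis
  proof (rule that[of "\<lambda>n. fst (x (\<rho> n))" "\<lambda>n. fst (snd (x (\<rho> n)))" "\<lambda>n. snd (snd (x (\<rho> n)))" N])
    fix n
    \<comment> \<open>\<open>\<rho> n \<ge> n\<close>, so the constraint of index \<open>n\<close>
      survives the extraction of a subsequence.\<close>
    have "CC n (x (\<rho> n))" by (rule CCmono[OF xC]) (rule seq_suble[OF \<rho>(1)])
    then show "adm (fst (x (\<rho> n))) (fst (snd (x (\<rho> n)))) (snd (snd (x (\<rho> n))))" "norm (fst (x (\<rho> n)) - p) \<le> 1 / real (Suc n)"
      "energy (fst (snd (x (\<rho> n)))) (snd (snd (x (\<rho> n)))) \<le> ennreal (c + 1 / real (Suc n))" by (auto simp: CC_def)
  next
    fix t assume t: "t \<in> {0..T0}" "t \<notin> N"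
    then have "Cauchy (\<lambda>i. ?s (\<rho> i) t)" using N(2) by (auto simp only: space_lborel space_borel)
    then show "Cauchy (\<lambda>n. ?u (\<rho> n) t)" using t(1) by simp
  qed (rule N(1))
qed

section \<open>Limits of almost optimal paths\<close>

lemma It_lsc:
  assumes "\<And>n. \<mu> n \<in> prob_vecs" "\<And>n e. Q n $ e \<ge> 0" "\<mu> \<longlonglongrightarrow> \<mu>0" "Q \<longlonglongrightarrow> Q0" "t \<ge> 0"
  shows "It r t \<mu>0 Q0 \<le> liminf (\<lambda>n. It r t (\<mu> n) (Q n))"
proof -
  have "It r t \<mu>0 Q0 \<le> (\<Sum>e\<in>E. liminf (\<lambda>n. Phi (Q n $ (fst e, snd e)) (\<mu> n $ (fst e) * R t (fst e) (snd e))))"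
    unfolding It_R[OF assms(5)] case_prod_beta
  proof (rule sum_mono)
    fix e
    show "Phi (Q0 $ (fst e, snd e)) (\<mu>0 $ fst e * R t (fst e) (snd e)) \<le> liminf (\<lambda>n. Phi (Q n $ (fst e, snd e)) (\<mu> n $ (fst e) * R t (fst e) (snd e)))"
    proof (rule Phi_lsc)
      show "(\<lambda>n. Q n $ (fst e, snd e)) \<longlonglongrightarrow> Q0 $ (fst e, snd e)" by (intro tendsto_vec_nth assms)
      show "(\<lambda>n. \<mu> n $ fst e * R t (fst e) (snd e)) \<longlonglongrightarrow> \<mu>0 $ fst e * R t (fst e) (snd e)"
        by (intro tendsto_mult tendsto_const tendsto_vec_nth assms)
      show "\<mu> n $ fst e * R t (fst e) (snd e) \<ge> 0" for n
        by (intro mult_nonneg_nonneg R_nonneg prob_vecs_range(1)[OF assms(1)])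
    qed (rule assms)
  qed
  also have "\<dots> \<le> liminf (\<lambda>n. \<Sum>e\<in>E. Phi (Q n $ (fst e, snd e)) (\<mu> n $ (fst e) * R t (fst e) (snd e)))"
    by (rule ennreal_liminf_sum)
  finally show ?thesis unfolding It_R[OF assms(5)] case_prod_beta .
qed

text \<open>Superlinear growth of \<open>Phi\<close> in \<open>q\<close>, quantified: Young's
  inequality with slope \<alpha> bounds \<open>Q - C exp \<alpha> / \<alpha>\<close> by
  \<open>It / \<alpha>\<close>, whose integral is at most \<open>b / \<alpha>\<close>. The choice
  \<open>\<alpha> = (b + 1) / \<eta>\<close> makes this at most \<eta> and keeps \<alpha> positive
  for \<open>b = 0\<close>.\<close>

lemma flow_tail_bound:
  assumes a: "adm p \<mu> Q" and en: "energy \<mu> Q \<le> ennreal b" and b: "b \<ge> 0" and e: "\<eta> > 0"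
    and C: "C > 0" "\<And>t y z. R t y z \<le> C"
  shows "(\<integral>\<^sup>+ t\<in>{0..T0}. ennreal (Q t $ e - C * exp ((b + 1) / \<eta>) / ((b + 1) / \<eta>)) \<partial>lborel) \<le> ennreal \<eta>"
proof -
  define \<alpha> where "\<alpha> = (b + 1) / \<eta>"
  have \<alpha>: "\<alpha> > 0" using b e by (simp add: \<alpha>_def)
  note A = admD[OF a]
  have pw: "ennreal (Q t $ e - C * exp \<alpha> / \<alpha>) \<le> ennreal (1 / \<alpha>) * It r t (\<mu> t) (Q t)" if t: "t \<ge> 0" for t
  proof (cases "e \<in> E")
    case True
    obtain y z where yz: "e = (y, z)" by (cases e)
    let ?p = "\<mu> t $ y * R t y z"
    have p0: "?p \<ge> 0" using prob_vecs_range[OF A(7)[of t]] R_nonneg by (intro mult_nonneg_nonneg) auto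
    have "?p \<le> 1 * C" by (intro mult_mono C(2)) (use prob_vecs_range[OF A(7)[of t]] R_nonneg in auto)
    then have "?p * (exp \<alpha> - 1) \<le> C * exp \<alpha>" using \<alpha> p0 C by (intro mult_mono) auto
    then have "(Q t $ e * \<alpha> - C * exp \<alpha>) \<le> Q t $ e * \<alpha> - ?p * (exp \<alpha> - 1)" by simp
    then have "(Q t $ e * \<alpha> - C * exp \<alpha>) / \<alpha> \<le> (Q t $ e * \<alpha> - ?p * (exp \<alpha> - 1)) / \<alpha>" using \<alpha> by (intro divide_right_mono) auto
    then have "ennreal (Q t $ e - C * exp \<alpha> / \<alpha>) \<le> ennreal (1 / \<alpha> * (Q t $ e * \<alpha> - ?p * (exp \<alpha> - 1)))"
      using \<alpha> by (intro ennreal_leI) (simp add: diff_divide_distrib)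
    also have "\<dots> = ennreal (1 / \<alpha>) * ennreal (Q t $ e * \<alpha> - ?p * (exp \<alpha> - 1))" using \<alpha> by (intro ennreal_mult') simp
    also have "\<dots> \<le> ennreal (1 / \<alpha>) * Phi (Q t $ e) ?p" by (intro mult_left_mono Phi_ge A(12) p0) simp
    also have "\<dots> \<le> ennreal (1 / \<alpha>) * It r t (\<mu> t) (Q t)"
    proof (intro mult_left_mono)
      have "(case e of (y, z) \<Rightarrow> Phi (Q t $ (y, z)) (\<mu> t $ y * R t y z)) \<le> (\<Sum>(y, z)\<in>E. Phi (Q t $ (y, z)) (\<mu> t $ y * R t y z))"
        by (rule member_le_sum) (use True in auto)
      then show "Phi (Q t $ e) ?p \<le> It r t (\<mu> t) (Q t)" unfolding It_R[OF t] by (simp add: yz)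
    qed simp
    finally show ?thesis .
  next
    case False
    then have "Q t $ e - C * exp \<alpha> / \<alpha> \<le> 0" using A(13)[OF False, of t] C \<alpha> by simp
    then show ?thesis by (simp add: ennreal_neg)
  qed
  have "(\<integral>\<^sup>+ t\<in>{0..T0}. ennreal (Q t $ e - C * exp \<alpha> / \<alpha>) \<partial>lborel) \<le>
      (\<integral>\<^sup>+ t. ennreal (1 / \<alpha>) * ((\<Sum>(y, z)\<in>E. Phi (Q t $ (y, z)) (\<mu> t $ y * R t y z)) * indicator {0..T0} t) \<partial>lborel)"
  proof (rule nn_integral_mono)
    fix t show "ennreal (Q t $ e - C * exp \<alpha> / \<alpha>) * indicator {0..T0} t \<le>
        ennreal (1 / \<alpha>) * ((\<Sum>(y, z)\<in>E. Phi (Q t $ (y, z)) (\<mu> t $ y * R t y z)) * indicator {0..T0} t)"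
      using pw[of t] It_R[of t "\<mu> t" "Q t"] by (cases "t \<in> {0..T0}") auto
  qed
  also have "\<dots> = ennreal (1 / \<alpha>) * energy \<mu> Q"
    unfolding energy_def nn_integral_It_R by (rule nn_integral_cmult) (use It_R_meas[OF a] in simp)
  also have "\<dots> \<le> ennreal (1 / \<alpha>) * ennreal b" by (intro mult_left_mono en) simp
  also have "\<dots> = ennreal (1 / \<alpha> * b)" using b \<alpha> by (intro ennreal_mult[symmetric]) auto
  also have "\<dots> \<le> ennreal \<eta>"
  proof (rule ennreal_leI)
    have "1 / \<alpha> * b = \<eta> * (b / (b + 1))" by (simp add: \<alpha>_def)
    also have "\<dots> \<le> \<eta> * 1" using b e by (intro mult_left_mono) auto
    finally show "1 / \<alpha> * b \<le> \<eta>" by simp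
  qed
  finally show ?thesis by (simp add: \<alpha>_def)
qed

text \<open>Bounded energies make the flows uniformly integrable, so pointwise convergence passes to
  the averages and to the weak equation; the energy bound passes by Fatou and lower semicontinuity
  of \<open>It\<close>.\<close>

lemma admissible_limit:
  assumes a: "\<And>n::nat. adm (ps n) (\<mu> n) (Q n)" and ps: "ps \<longlonglongrightarrow> p"
    and en: "\<And>n. energy (\<mu> n) (Q n) \<le> ennreal (c + 1 / real (Suc n))" and c: "c \<ge> 0"
    and N: "N \<in> null_sets lborel" and conv: "\<And>t. t \<in> {0..T0} \<Longrightarrow> t \<notin> N \<Longrightarrow> convergent (\<lambda>n. \<mu> n t) \<and> convergent (\<lambda>n. Q n t)"
  shows "\<exists>\<mu>0 Q0. adm p \<mu>0 Q0 \<and> energy \<mu>0 Q0 \<le> ennreal c"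
proof -
  note A = admD[OF a]
  \<comment> \<open>Convergence is tested by the Cauchy property, which gives a measurable set
    invariant under the period; outside it the path of index 0 serves as default, so periodicity and
    the pointwise constraints hold at every time.\<close>
  define G where "G = {t. Cauchy (\<lambda>n. \<mu> n t) \<and> Cauchy (\<lambda>n. Q n t)}"
  define \<mu>0 where "\<mu>0 t = (if t \<in> G then lim (\<lambda>n. \<mu> n t) else \<mu> 0 t)" for t
  define Q0 where "Q0 t = (if t \<in> G then lim (\<lambda>n. Q n t) else Q 0 t)" for t
  have Gm [measurable]: "G \<in> sets borel"
    using sets.Int[OF sets_Collect_Cauchy[of \<mu> borel, OF A(1)] sets_Collect_Cauchy[of Q borel, OF A(2)]]
    by (simp add: G_def Collect_conj_eq)
  have m0: "\<mu>0 \<in> borel_measurable borel" "Q0 \<in> borel_measurable borel"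
    unfolding \<mu>0_def Q0_def
    by (intro measurable_If_set borel_measurable_lim_metric A(1,2); use Gm in simp)+
  have nth: "(\<lambda>x. x $ i) \<in> borel_measurable borel" for i :: "'n::finite"
    by (intro borel_measurable_continuous_onI continuous_intros)
  have m0y: "(\<lambda>t. \<mu>0 t $ y) \<in> borel_measurable borel" for y using measurable_compose[OF m0(1) nth] by auto
  have Q0e: "(\<lambda>t. Q0 t $ e) \<in> borel_measurable borel" for e using measurable_compose[OF m0(2) nth] by auto
  have limG: "(\<lambda>n. \<mu> n t) \<longlonglongrightarrow> \<mu>0 t" "(\<lambda>n. Q n t) \<longlonglongrightarrow> Q0 t" if "t \<in> G" for t
    using that by (auto simp: G_def \<mu>0_def Q0_def Cauchy_convergent_iff convergent_LIMSEQ_iff)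
  have inG: "t \<in> G" if "t \<in> {0..T0}" "t \<notin> N" for t
    using conv[OF that] by (simp add: G_def Cauchy_convergent_iff)
  have per: "\<mu>0 (t + T0) = \<mu>0 t" "Q0 (t + T0) = Q0 t" for t
    by (simp_all add: \<mu>0_def Q0_def G_def A(5,6))
  have mp: "\<mu>0 t \<in> prob_vecs" for t
  proof (cases "t \<in> G")
    case True
    show ?thesis
      by (rule closed_sequentially[OF compact_imp_closed[OF compact_prob_vecs] _ limG(1)[OF True]]) (use A(7) in auto)
  qed (simp add: \<mu>0_def A(7))
  have Q0nn: "Q0 t $ e \<ge> 0" for t e
  proof (cases "t \<in> G")
    case True
    show ?thesis by (rule LIMSEQ_le_const[OF tendsto_vec_nth[OF limG(2)[OF True]]]) (use A(12) in auto)
  qed (simp add: Q0_def A(12))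
  have Q0off: "Q0 t $ e = 0" if "e \<notin> E" for t e
  proof (cases "t \<in> G")
    case True
    have "(\<lambda>n. Q n t $ e) \<longlonglongrightarrow> Q0 t $ e" by (rule tendsto_vec_nth[OF limG(2)[OF True]])
    moreover have "(\<lambda>n. Q n t $ e) = (\<lambda>n. 0)" using A(13)[OF that] by simp
    ultimately show ?thesis by (simp add: LIMSEQ_const_iff)
  qed (simp add: Q0_def A(13)[OF that])
  obtain C where C: "C > 0" "\<And>t y z. R t y z \<le> C" by (rule R_bound) blast
  have en1: "energy (\<mu> n) (Q n) \<le> ennreal (c + 1)" for n
  proof -
    have "1 / real (Suc n) \<le> 1" by simp
    then show ?thesis using order_trans[OF en[of n] ennreal_leI[of "c + 1 / real (Suc n)" "c + 1"]] by linarith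
  qed
  have ui: "\<exists>K\<ge>0. \<forall>n. (\<integral>\<^sup>+ t\<in>{0..T0}. ennreal (Q n t $ e - K) \<partial>lborel) \<le> ennreal \<eta>" if "\<eta> > 0" for \<eta> e
  proof (intro exI conjI allI)
    show "C * exp ((c + 1 + 1) / \<eta>) / ((c + 1 + 1) / \<eta>) \<ge> 0" using C c that by simp
    show "(\<integral>\<^sup>+ t\<in>{0..T0}. ennreal (Q n t $ e - C * exp ((c + 1 + 1) / \<eta>) / ((c + 1 + 1) / \<eta>)) \<partial>lborel) \<le> ennreal \<eta>" for n
      by (rule flow_tail_bound[OF a en1 _ that C]) (use c in auto)
  qed
  have Qlim: "(\<lambda>n. Q n t $ e) \<longlonglongrightarrow> Q0 t $ e" if "t \<in> {0..T0}" "t \<notin> N" for t e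
    by (rule tendsto_vec_nth[OF limG(2)[OF inG[OF that]]])
  note ul = uniformly_integrable_limit[OF less_imp_le[OF T0_pos] Q0e A(4) N Qlim A(12) Q0nn A(9) ui]
  have Q0i: "set_integrable lborel {0..T0} (\<lambda>t. Q0 t $ e)" for e by (rule ul(1))
  have Qconv: "(\<lambda>n. LINT t:{0..T0}|lborel. Q n t $ e * h t) \<longlonglongrightarrow> (LINT t:{0..T0}|lborel. Q0 t $ e * h t)"
    if "h \<in> borel_measurable borel" "\<And>t. t \<in> {0..T0} \<Longrightarrow> \<bar>h t\<bar> \<le> M" for h M e
    by (rule ul(2)) (use that in auto)
  have mconv: "(\<lambda>n. LINT t:{0..T0}|lborel. \<mu> n t $ y * h t) \<longlonglongrightarrow> (LINT t:{0..T0}|lborel. \<mu>0 t $ y * h t)"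
    if h: "h \<in> borel_measurable borel" "\<And>t. t \<in> {0..T0} \<Longrightarrow> \<bar>h t\<bar> \<le> M" for h M y
  proof (rule set_dominated_convergence(2)[OF _ _ _ N, where w = "\<lambda>_. M"])
    have M0: "M \<ge> 0" using h(2)[of 0] T0_pos by auto
    show "(\<lambda>t. \<mu>0 t $ y * h t) \<in> borel_measurable borel" "(\<lambda>t. \<mu> n t $ y * h t) \<in> borel_measurable borel" for n
      using m0y A(3) h(1) by measurable
    show "set_integrable lborel {0..T0} (\<lambda>_. M)" by (rule set_integrable_bounded[of _ _ _ M]) (use M0 in auto)
    show "(\<lambda>n. \<mu> n t $ y * h t) \<longlonglongrightarrow> \<mu>0 t $ y * h t" if "t \<in> {0..T0}" "t \<notin> N" for t
      by (intro tendsto_mult tendsto_const tendsto_vec_nth limG(1)[OF inG[OF that]])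
    show "\<bar>\<mu> n t $ y * h t\<bar> \<le> M" if "t \<in> {0..T0}" for n t
    proof -
      have "\<bar>\<mu> n t $ y * h t\<bar> \<le> 1 * M"
        unfolding abs_mult using prob_vecs_range[OF A(7)[of n t], of y] h(2)[OF that] by (intro mult_mono) auto
      then show ?thesis by simp
    qed
  qed
  have mui: "set_integrable lborel {0..T0} (\<lambda>t. \<mu>0 t $ y)" for y
    by (rule set_integrable_bounded[OF m0y, of _ _ _ 1]) (use prob_vecs_range[OF mp] in auto)
  have adm0: "adm p \<mu>0 Q0"
    unfolding admissible_def
  proof (intro conjI allI impI m0 per mp Q0i)
    show "Q0 t \<in> flows E" for t using Q0nn Q0off by (auto simp: flows_def)
    show "(LINT t:{0..T0}|lborel. \<mu>0 t $ y) / T0 = fst p $ y" for y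
    proof -
      have "(\<lambda>n. LINT t:{0..T0}|lborel. \<mu> n t $ y * 1) \<longlonglongrightarrow> (LINT t:{0..T0}|lborel. \<mu>0 t $ y * 1)"
        by (rule mconv[of _ 1]) auto
      moreover have "(\<lambda>n. T0 * fst (ps n) $ y) \<longlonglongrightarrow> T0 * fst p $ y"
        by (intro tendsto_mult tendsto_const tendsto_vec_nth tendsto_fst ps)
      ultimately have "(LINT t:{0..T0}|lborel. \<mu>0 t $ y) = T0 * fst p $ y" using LIMSEQ_unique by (simp add: A(10))
      then show ?thesis using T0_pos by simp
    qed
    show "(LINT t:{0..T0}|lborel. Q0 t $ e) / T0 = snd p $ e" for e
    proof -
      have "(\<lambda>n. LINT t:{0..T0}|lborel. Q n t $ e * 1) \<longlonglongrightarrow> (LINT t:{0..T0}|lborel. Q0 t $ e * 1)"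
        by (rule Qconv[of _ 1]) auto
      moreover have "(\<lambda>n. T0 * snd (ps n) $ e) \<longlonglongrightarrow> T0 * snd p $ e"
        by (intro tendsto_mult tendsto_const tendsto_vec_nth tendsto_snd ps)
      ultimately have "(LINT t:{0..T0}|lborel. Q0 t $ e) = T0 * snd p $ e" using LIMSEQ_unique by (simp add: A(11))
      then show ?thesis using T0_pos by simp
    qed
    fix f :: "'v \<Rightarrow> real \<Rightarrow> real" assume f: "\<forall>y. (\<forall>t. f y (t + T0) = f y t) \<and> f y C1_differentiable_on UNIV"
    have "\<forall>y. \<exists>M. f y \<in> borel_measurable borel \<and> deriv (f y) \<in> borel_measurable borel \<and>
        (\<forall>t\<in>{0..T0}. \<bar>f y t\<bar> \<le> M) \<and> (\<forall>t\<in>{0..T0}. \<bar>deriv (f y) t\<bar> \<le> M)"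
    proof
      fix y show "\<exists>M. f y \<in> borel_measurable borel \<and> deriv (f y) \<in> borel_measurable borel \<and>
        (\<forall>t\<in>{0..T0}. \<bar>f y t\<bar> \<le> M) \<and> (\<forall>t\<in>{0..T0}. \<bar>deriv (f y) t\<bar> \<le> M)"
        by (rule test_function[of "f y"]) (use f in blast)+
    qed
    from choice[OF this] obtain M where M: "\<forall>y. f y \<in> borel_measurable borel \<and> deriv (f y) \<in> borel_measurable borel \<and>
        (\<forall>t\<in>{0..T0}. \<bar>f y t\<bar> \<le> M y) \<and> (\<forall>t\<in>{0..T0}. \<bar>deriv (f y) t\<bar> \<le> M y)" ..
    have fmm: "f y \<in> borel_measurable borel" "deriv (f y) \<in> borel_measurable borel"
      "t \<in> {0..T0} \<Longrightarrow> \<bar>f y t\<bar> \<le> M y" "t \<in> {0..T0} \<Longrightarrow> \<bar>deriv (f y) t\<bar> \<le> M y" for y t using M by auto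
    have Lm: "(LINT s:{0..T0}|lborel. (\<Sum>y\<in>UNIV. m s $ y * deriv (f y) s)) = (\<Sum>y\<in>UNIV. LINT s:{0..T0}|lborel. m s $ y * deriv (f y) s)"
      if "\<And>y. set_integrable lborel {0..T0} (\<lambda>t. m t $ y)" for m
      by (rule set_integral_sum(2)) (rule set_integrable_mult_bounded[OF that fmm(2,4)])
    have LQ: "(LINT s:{0..T0}|lborel. (\<Sum>y\<in>UNIV. divg (q s) y * f y s)) =
        (\<Sum>y\<in>UNIV. (\<Sum>z\<in>UNIV. LINT s:{0..T0}|lborel. q s $ (y, z) * f y s) - (\<Sum>z\<in>UNIV. LINT s:{0..T0}|lborel. q s $ (z, y) * f y s))"
      if q: "\<And>e. set_integrable lborel {0..T0} (\<lambda>t. q t $ e)" for q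
    proof -
      have i: "set_integrable lborel {0..T0} (\<lambda>s. q s $ e * f y s)" for e y by (rule set_integrable_mult_bounded[OF q fmm(1,3)])
      have e: "divg (q s) y * f y s = (\<Sum>z\<in>UNIV. q s $ (y, z) * f y s) - (\<Sum>z\<in>UNIV. q s $ (z, y) * f y s)" for s y
        by (simp add: divg_def left_diff_distrib sum_distrib_right)
      have i1: "set_integrable lborel {0..T0} (\<lambda>s. \<Sum>z\<in>UNIV. q s $ (y, z) * f y s)" "set_integrable lborel {0..T0} (\<lambda>s. \<Sum>z\<in>UNIV. q s $ (z, y) * f y s)" for y
        by (intro set_integral_sum(1) i)+
      have "(LINT s:{0..T0}|lborel. (\<Sum>y\<in>UNIV. divg (q s) y * f y s)) = (\<Sum>y\<in>UNIV. LINT s:{0..T0}|lborel. divg (q s) y * f y s)"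
        unfolding e by (rule set_integral_sum(2)) (intro set_integral_diff(1) i1)
      also have "\<dots> = (\<Sum>y\<in>UNIV. (LINT s:{0..T0}|lborel. (\<Sum>z\<in>UNIV. q s $ (y, z) * f y s)) - (LINT s:{0..T0}|lborel. (\<Sum>z\<in>UNIV. q s $ (z, y) * f y s)))"
        unfolding e by (intro sum.cong refl set_integral_diff(2) i1)
      finally show ?thesis by (simp add: set_integral_sum(2)[OF i])
    qed
    have mi: "set_integrable lborel {0..T0} (\<lambda>t. \<mu> n t $ y)" for n y
      using adm_mu_integrable[OF a, of "\<lambda>_. 1" 1] by simp
    have l1: "(\<lambda>n. LINT s:{0..T0}|lborel. (\<Sum>y\<in>UNIV. \<mu> n s $ y * deriv (f y) s)) \<longlonglongrightarrow> (LINT s:{0..T0}|lborel. (\<Sum>y\<in>UNIV. \<mu>0 s $ y * deriv (f y) s))"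
      unfolding Lm[OF mi] Lm[OF mui] by (intro tendsto_sum mconv[OF fmm(2,4)])
    have l2: "(\<lambda>n. LINT s:{0..T0}|lborel. (\<Sum>y\<in>UNIV. divg (Q n s) y * f y s)) \<longlonglongrightarrow> (LINT s:{0..T0}|lborel. (\<Sum>y\<in>UNIV. divg (Q0 s) y * f y s))"
      unfolding LQ[OF A(9)] LQ[OF Q0i] by (intro tendsto_sum tendsto_diff Qconv[OF fmm(1,3)])
    have "(LINT s:{0..T0}|lborel. (\<Sum>y\<in>UNIV. \<mu> n s $ y * deriv (f y) s)) = (LINT s:{0..T0}|lborel. (\<Sum>y\<in>UNIV. divg (Q n s) y * f y s))" for n
      by (rule adm_weak[OF a]) (use f in auto)
    then show "(LINT s:{0..T0}|lborel. (\<Sum>y\<in>UNIV. \<mu>0 s $ y * deriv (f y) s)) = (LINT s:{0..T0}|lborel. (\<Sum>y\<in>UNIV. divg (Q0 s) y * f y s))"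
      using LIMSEQ_unique[OF l1] l2 by simp
  qed
  let ?I = "\<lambda>n t. (\<Sum>(y, z)\<in>E. Phi (Q n t $ (y, z)) (\<mu> n t $ y * R t y z)) * indicator {0..T0} t"
  have "energy \<mu>0 Q0 \<le> (\<integral>\<^sup>+ t. liminf (\<lambda>n. ?I n t) \<partial>lborel)"
    unfolding energy_def
  proof (rule nn_integral_mono_AE)
    show "AE t in lborel. It r t (\<mu>0 t) (Q0 t) * indicator {0..T0} t \<le> liminf (\<lambda>n. ?I n t)"
      using AE_not_in[OF N]
    proof eventually_elim
      case (elim t)
      show ?case
      proof (cases "t \<in> {0..T0}")
        case True
        have "It r t (\<mu>0 t) (Q0 t) \<le> liminf (\<lambda>n. It r t (\<mu> n t) (Q n t))"
          by (rule It_lsc) (use A(7,12) limG[OF inG[OF True elim]] True in auto)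
        then show ?thesis using True It_R[of t] by simp
      qed simp
    qed
  qed
  also have "\<dots> \<le> liminf (\<lambda>n. \<integral>\<^sup>+ t. ?I n t \<partial>lborel)"
    by (rule nn_integral_liminf) (use It_R_meas[OF a] in simp)
  also have "\<dots> \<le> liminf (\<lambda>n. ennreal (c + 1 / real (Suc n)))"
    by (intro Liminf_mono always_eventually allI) (use en in \<open>simp add: energy_def nn_integral_It_R\<close>)
  also have "\<dots> = ennreal c"
  proof -
    have "(\<lambda>n. ennreal (c + 1 / real (Suc n))) \<longlonglongrightarrow> ennreal (c + 0)"
      using LIMSEQ_inverse_real_of_nat by (intro tendsto_ennrealI tendsto_add tendsto_const) (simp add: inverse_eq_divide)
    then show ?thesis by (intro lim_imp_Liminf) auto
  qed
  finally show ?thesis using adm0 by blast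
qed

text \<open>Convergence of \<open>exp (- x / 2)\<close> gives convergence of \<open>x\<close> once
  the limit is positive. For \<mu> this holds as the values are at most 1; for \<open>Q\<close> a
  zero limit means divergence to infinity, which Fatou and the bounded averages exclude almost
  everywhere.\<close>

lemma lsc:
  assumes c: "c \<ge> 0" and ne: "\<And>n::nat. \<exists>p' \<mu> Q. adm p' \<mu> Q \<and> norm (p' - p) \<le> 1 / real (Suc n) \<and> energy \<mu> Q \<le> ennreal (c + 1 / real (Suc n))"
  shows "\<exists>\<mu> Q. adm p \<mu> Q \<and> energy \<mu> Q \<le> ennreal c"
proof -
  obtain ps \<mu> Q N where a: "\<And>n::nat. adm (ps n) (\<mu> n) (Q n)" and pn: "\<And>n. norm (ps n - p) \<le> 1 / real (Suc n)"
    and en: "\<And>n. energy (\<mu> n) (Q n) \<le> ennreal (c + 1 / real (Suc n))" and N: "N \<in> null_sets lborel"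
    and cau: "\<And>t. t \<in> {0..T0} \<Longrightarrow> t \<notin> N \<Longrightarrow> Cauchy (\<lambda>n. expvec (\<mu> n) (Q n) t)"
    by (rule near_optimal_sequence[OF c ne]) blast+
  note A = admD[OF a]
  have "(\<lambda>n. 1 / real (Suc n)) \<longlonglongrightarrow> 0" using LIMSEQ_inverse_real_of_nat by (simp add: inverse_eq_divide)
  then have "(\<lambda>n. ps n - p) \<longlonglongrightarrow> 0" by (rule Lim_null_comparison[rotated]) (use pn in auto)
  then have ps: "ps \<longlonglongrightarrow> p" by (simp add: LIM_zero_iff)
  define B where "B = T0 * (norm p + 1)"
  have Qint: "(\<integral>\<^sup>+ t\<in>{0..T0}. ennreal (Q n t $ e) \<partial>lborel) \<le> ennreal B" for n e
  proof -
    have "(\<integral>\<^sup>+ t\<in>{0..T0}. ennreal (Q n t $ e) \<partial>lborel) = (\<integral>\<^sup>+ t. ennreal (indicator {0..T0} t *\<^sub>R Q n t $ e) \<partial>lborel)"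
      by (rule nn_integral_cong) (auto simp: indicator_def)
    also have "\<dots> = ennreal (LINT t|lborel. indicator {0..T0} t *\<^sub>R Q n t $ e)"
      by (rule nn_integral_eq_integral) (use A(9,12) in \<open>auto simp: set_integrable_def indicator_def\<close>)
    also have "\<dots> = ennreal (T0 * snd (ps n) $ e)" using A(11)[of n e] by (simp add: set_lebesgue_integral_def)
    also have "\<dots> \<le> ennreal B"
    proof (rule ennreal_leI)
      have "snd (ps n) $ e \<le> norm (snd (ps n))" using component_le_norm_cart[of "snd (ps n)" e] by simp
      also have "\<dots> \<le> norm (ps n)" using norm_snd_le[of "snd (ps n)" "fst (ps n)"] by simp
      also have "\<dots> \<le> norm p + norm (ps n - p)" using norm_triangle_sub[of "ps n" p] by simp
      also have "\<dots> \<le> norm p + 1"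
      proof -
        have "1 / real (Suc n) \<le> 1" by simp
        then show ?thesis using pn[of n] by linarith
      qed
      finally show "T0 * snd (ps n) $ e \<le> B" unfolding B_def using T0_pos by (intro mult_left_mono) auto
    qed
    finally show ?thesis .
  qed
  let ?L = "\<lambda>e t. liminf (\<lambda>n. ennreal (Q n t $ e) * indicator {0..T0} t)"
  have "AE t in lborel. \<forall>e. ?L e t \<noteq> \<infinity>"
  proof -
    have "AE t in lborel. ?L e t \<noteq> \<infinity>" for e
    proof (rule nn_integral_PInf_AE)
      show "?L e \<in> borel_measurable lborel" using A(4)[of _ e] by measurable
      have "(\<integral>\<^sup>+ t. ?L e t \<partial>lborel) \<le> liminf (\<lambda>n. \<integral>\<^sup>+ t\<in>{0..T0}. ennreal (Q n t $ e) \<partial>lborel)"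
        by (rule nn_integral_liminf) (use A(4)[of _ e] in simp)
      also have "\<dots> \<le> ennreal B" by (rule Liminf_le) (use Qint in auto)
      also have "\<dots> < \<top>" by simp
      finally show "(\<integral>\<^sup>+ t. ?L e t \<partial>lborel) \<noteq> \<infinity>" by simp
    qed
    then show ?thesis by (simp add: AE_all_countable)
  qed
  then obtain N2 where N2: "N2 \<in> null_sets lborel" "{t \<in> space lborel. \<not> (\<forall>e. ?L e t \<noteq> \<infinity>)} \<subseteq> N2"
    by (rule AE_E) (auto simp: null_sets_def)
  have NN2: "N \<union> N2 \<in> null_sets lborel" using N N2(1) by blast
  show ?thesis
  proof (rule admissible_limit[OF a ps en c NN2])
    fix t assume t: "t \<in> {0..T0}" "t \<notin> N \<union> N2"
    have "convergent (\<lambda>n. expvec (\<mu> n) (Q n) t)" using cau[of t] t by (simp add: Cauchy_convergent_iff)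
    then obtain d where d: "(\<lambda>n. expvec (\<mu> n) (Q n) t) \<longlonglongrightarrow> d" by (auto simp: convergent_def)
    have d1: "(\<lambda>n. exp (- \<mu> n t $ y / 2)) \<longlonglongrightarrow> fst d $ y" for y
      using tendsto_vec_nth[OF tendsto_fst[OF d], of y] by (simp add: expvec_def)
    have d2: "(\<lambda>n. exp (- Q n t $ e / 2)) \<longlonglongrightarrow> snd d $ e" for e
      using tendsto_vec_nth[OF tendsto_snd[OF d], of e] by (simp add: expvec_def)
    have ln_lim: "(\<lambda>n. x n) \<longlonglongrightarrow> - 2 * ln z" if "(\<lambda>n. exp (- x n / 2)) \<longlonglongrightarrow> z" "z > 0" for x :: "nat \<Rightarrow> real" and z
    proof -
      have "(\<lambda>n. - 2 * ln (exp (- x n / 2))) \<longlonglongrightarrow> - 2 * ln z" using that by (intro tendsto_intros) auto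
      then show ?thesis by simp
    qed
    have p1: "fst d $ y > 0" for y
    proof -
      have "exp (- (1/2)) \<le> fst d $ y"
        by (rule LIMSEQ_le_const[OF d1]) (use prob_vecs_range[OF A(7)] in auto)
      then show ?thesis using exp_gt_zero[of "- (1/2) :: real"] by linarith
    qed
    have p2: "snd d $ e > 0" for e
    proof (rule ccontr)
      assume "\<not> snd d $ e > 0"
      have "t \<notin> {t \<in> space lborel. \<not> (\<forall>e. ?L e t \<noteq> \<infinity>)}" using N2(2) t(2) by blast
      then have "?L e t \<noteq> \<infinity>" by (simp only: mem_Collect_eq space_lborel space_borel UNIV_I simp_thms not_not)
      then have "liminf (\<lambda>n. ennreal (Q n t $ e)) < \<top>" using t by (simp add: less_top)
      then obtain b where b: "liminf (\<lambda>n. ennreal (Q n t $ e)) = ennreal b" "b \<ge> 0" by (cases "liminf (\<lambda>n. ennreal (Q n t $ e))") auto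
      \<comment> \<open>A zero limit pushes \<open>Q n t $ e\<close> eventually above
        \<open>b + 1\<close>, against the finite lower limit \<open>b\<close>.\<close>
      have "eventually (\<lambda>n. exp (- Q n t $ e / 2) < exp (- (b + 1) / 2)) sequentially"
        by (rule order_tendstoD(2)[OF d2]) (use \<open>\<not> snd d $ e > 0\<close> exp_gt_zero[of "- (b + 1) / 2"] in linarith)
      then have "eventually (\<lambda>n. ennreal (b + 1) \<le> ennreal (Q n t $ e)) sequentially"
        by eventually_elim (auto intro!: ennreal_leI)
      then have "ennreal (b + 1) \<le> liminf (\<lambda>n. ennreal (Q n t $ e))" by (rule Liminf_bounded)
      then show False using b by simp
    qed
    have "(\<lambda>n. \<mu> n t) \<longlonglongrightarrow> (\<chi> y. - 2 * ln (fst d $ y))"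
      by (rule vec_tendstoI) (use ln_lim[OF d1 p1] in simp)
    moreover have "(\<lambda>n. Q n t) \<longlonglongrightarrow> (\<chi> e. - 2 * ln (snd d $ e))"
      by (rule vec_tendstoI) (use ln_lim[OF d2 p2] in simp)
    ultimately show "convergent (\<lambda>n. \<mu> n t) \<and> convergent (\<lambda>n. Q n t)" by (auto simp: convergent_def)
  qed
qed

section \<open>Minimisers, convexity and closed sublevel sets of the rate functional\<close>

lemma Ibar_En: "Ibar r T0 p = (INF (\<mu>, Q) \<in> {(\<mu>, Q). adm p \<mu> Q}. energy \<mu> Q / ennreal T0)"
  by (simp add: Ibar_def energy_def case_prod_beta)

lemma Ibar_le: "adm p \<mu> Q \<Longrightarrow> Ibar r T0 p \<le> energy \<mu> Q / ennreal T0"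
  unfolding Ibar_En by (rule INF_lower2[of "(\<mu>, Q)"]) auto

lemma Ibar_less_obtain:
  assumes "Ibar r T0 p < ennreal c" "c > 0"
  obtains \<mu> Q where "adm p \<mu> Q" "energy \<mu> Q \<le> ennreal (T0 * c)"
proof -
  obtain \<mu> Q where a: "adm p \<mu> Q" and l: "energy \<mu> Q / ennreal T0 < ennreal c"
    using assms(1) unfolding Ibar_En by (auto simp: INF_less_iff)
  have "energy \<mu> Q = (energy \<mu> Q / ennreal T0) * ennreal T0"
    using T0_pos by (simp add: ennreal_divide_times ennreal_times_divide mult_divide_eq_ennreal)
  also have "\<dots> \<le> ennreal c * ennreal T0" using l by (intro mult_right_mono) auto
  also have "\<dots> = ennreal (T0 * c)" using assms(2) T0_pos by (simp add: ennreal_mult' mult.commute)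
  finally show thesis using a that by blast
qed

lemma ennreal_div_T0: "e \<le> ennreal (T0 * c) \<Longrightarrow> c \<ge> 0 \<Longrightarrow> e / ennreal T0 \<le> ennreal c"
proof -
  assume "e \<le> ennreal (T0 * c)" "c \<ge> 0"
  then have "e / ennreal T0 \<le> ennreal (T0 * c) / ennreal T0" by (intro divide_right_mono_ennreal)
  also have "\<dots> = ennreal c" using T0_pos \<open>c \<ge> 0\<close> by (simp add: divide_ennreal)
  finally show "e / ennreal T0 \<le> ennreal c" .
qed

text \<open>Closedness of sublevel sets and existence of minimisers in one statement: the constant
  sequence gives the latter.\<close>

lemma Ibar_closure:
  assumes c: "c \<ge> 0" and l: "ps \<longlonglongrightarrow> p" and b: "\<And>e. e > 0 \<Longrightarrow> eventually (\<lambda>n. Ibar r T0 (ps n) \<le> ennreal (c + e)) sequentially"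
  obtains \<mu> Q where "adm p \<mu> Q" "energy \<mu> Q \<le> ennreal (T0 * c)"
proof -
  have "\<exists>\<mu> Q. adm p \<mu> Q \<and> energy \<mu> Q \<le> ennreal (T0 * c)"
  proof (rule lsc)
    show "T0 * c \<ge> 0" using c T0_pos by simp
    fix n :: nat
    define d where "d = 1 / real (Suc n)"
    have d: "d > 0" by (simp add: d_def)
    \<comment> \<open>\<open>Ibar\<close> is the energy divided by \<open>T0\<close>, so a slack
      \<open>d\<close> in the energy is a slack \<open>d / T0\<close> in the rate; half of it is
      spent to make an inequality strict.\<close>
    define e where "e = d / T0"
    have e: "e > 0" using d T0_pos by (simp add: e_def)
    have "eventually (\<lambda>n. dist (ps n) p < d) sequentially" using l d by (rule tendstoD)
    then have "eventually (\<lambda>n. dist (ps n) p < d \<and> Ibar r T0 (ps n) \<le> ennreal (c + e / 2)) sequentially"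
      using b[of "e / 2"] e by (intro eventually_conj) auto
    then obtain k where k: "dist (ps k) p < d" "Ibar r T0 (ps k) \<le> ennreal (c + e / 2)"
      by (auto dest: eventually_happens)
    have "ennreal (c + e / 2) < ennreal (c + e)" using e c by (intro ennreal_lessI) auto
    with k(2) have "Ibar r T0 (ps k) < ennreal (c + e)" by (rule order_le_less_trans)
    moreover have "c + e > 0" using e c by simp
    ultimately obtain \<mu> Q where "adm (ps k) \<mu> Q" "energy \<mu> Q \<le> ennreal (T0 * (c + e))" by (rule Ibar_less_obtain)
    moreover have "T0 * (c + e) = T0 * c + d" using T0_pos by (simp add: e_def algebra_simps)
    ultimately show "\<exists>p' \<mu> Q. adm p' \<mu> Q \<and> norm (p' - p) \<le> 1 / real (Suc n) \<and> energy \<mu> Q \<le> ennreal (T0 * c + 1 / real (Suc n))"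
      using k(1) unfolding d_def by (intro exI[of _ "ps k"] exI[of _ \<mu>] exI[of _ Q]) (auto simp: dist_norm)
  qed
  then show thesis using that by blast
qed

lemma Ibar_minimizer:
  assumes "Ibar r T0 p \<le> ennreal c" "c \<ge> 0"
  obtains \<mu> Q where "adm p \<mu> Q" "energy \<mu> Q \<le> ennreal (T0 * c)"
  by (rule Ibar_closure[OF assms(2) tendsto_const[of p]])
     (use assms in \<open>auto intro!: order_trans[OF assms(1)] ennreal_leI\<close>)

text \<open>Finite values are attained by paths, and the convex combination of two such paths is a
  competitor for the convex combination of their averages.\<close>

lemma Ibar_convex: "convex_rate (Ibar r T0)"
  unfolding convex_rate_def
proof (intro allI ballI)
  fix p q and a :: real assume a: "a \<in> {0..1}"
  show "Ibar r T0 (a *\<^sub>R p + (1 - a) *\<^sub>R q) \<le> ennreal a * Ibar r T0 p + ennreal (1 - a) * Ibar r T0 q"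
  proof (cases "a = 0 \<or> a = 1 \<or> Ibar r T0 p = \<top> \<or> Ibar r T0 q = \<top>")
    case True
    then consider "a = 0" | "a = 1" | "0 < a" "a < 1" "Ibar r T0 p = \<top> \<or> Ibar r T0 q = \<top>" using a by force
    then show ?thesis
    proof cases
      case 3
      then have "ennreal a * Ibar r T0 p + ennreal (1 - a) * Ibar r T0 q = \<top>" by (auto simp: ennreal_mult_top)
      then show ?thesis by (simp only: top_greatest)
    qed auto
  next
    case False
    obtain c where c: "Ibar r T0 p = ennreal c" "c \<ge> 0" using False by (cases "Ibar r T0 p") auto
    obtain d where d: "Ibar r T0 q = ennreal d" "d \<ge> 0" using False by (cases "Ibar r T0 q") auto
    obtain \<mu> Q where 1: "adm p \<mu> Q" "energy \<mu> Q \<le> ennreal (T0 * c)" by (rule Ibar_minimizer[of p c]) (use c in auto)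
    obtain \<mu>' Q' where 2: "adm q \<mu>' Q'" "energy \<mu>' Q' \<le> ennreal (T0 * d)" by (rule Ibar_minimizer[of q d]) (use d in auto)
    have u: "a \<ge> 0" "1 - a \<ge> 0" "a + (1 - a) = 1" using a by auto
    have "energy (\<lambda>t. a *\<^sub>R \<mu> t + (1 - a) *\<^sub>R \<mu>' t) (\<lambda>t. a *\<^sub>R Q t + (1 - a) *\<^sub>R Q' t) \<le> ennreal a * energy \<mu> Q + ennreal (1 - a) * energy \<mu>' Q'"
      by (rule energy_convex[OF 1(1) 2(1) u])
    also have "\<dots> \<le> ennreal a * ennreal (T0 * c) + ennreal (1 - a) * ennreal (T0 * d)"
      by (intro add_mono mult_left_mono 1 2) auto
    also have "\<dots> = ennreal (a * (T0 * c) + (1 - a) * (T0 * d))"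
    proof -
      have "T0 * c \<ge> 0" "T0 * d \<ge> 0" using c d T0_pos by auto
      then show ?thesis using u by (simp add: ennreal_mult ennreal_plus)
    qed
    also have "a * (T0 * c) + (1 - a) * (T0 * d) = T0 * (a * c + (1 - a) * d)" by (simp add: algebra_simps)
    finally have "energy (\<lambda>t. a *\<^sub>R \<mu> t + (1 - a) *\<^sub>R \<mu>' t) (\<lambda>t. a *\<^sub>R Q t + (1 - a) *\<^sub>R Q' t) \<le> ennreal (T0 * (a * c + (1 - a) * d))" .
    from order_trans[OF Ibar_le[OF adm_convex[OF 1(1) 2(1) u]] ennreal_div_T0[OF this]]
    have "Ibar r T0 (a *\<^sub>R p + (1 - a) *\<^sub>R q) \<le> ennreal (a * c + (1 - a) * d)" using u c d by simp
    also have "\<dots> = ennreal a * Ibar r T0 p + ennreal (1 - a) * Ibar r T0 q"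
      unfolding c(1) d(1) using u c d by (simp add: ennreal_mult ennreal_plus)
    finally show ?thesis .
  qed
qed

lemma Ibar_closed: "closed {p. Ibar r T0 p \<le> c}"
proof (cases "c = \<top>")
  case False
  then obtain c' where c': "c = ennreal c'" "c' \<ge> 0" by (cases c) auto
  show ?thesis
    unfolding closed_sequential_limits
  proof (intro allI impI)
    fix ps p assume h: "(\<forall>n. ps n \<in> {p. Ibar r T0 p \<le> c}) \<and> ps \<longlonglongrightarrow> p"
    obtain \<mu> Q where "adm p \<mu> Q" "energy \<mu> Q \<le> ennreal (T0 * c')"
    proof (rule Ibar_closure[OF c'(2), of ps p])
      fix e :: real assume "e > 0"
      then have "ennreal c' \<le> ennreal (c' + e)" by (intro ennreal_leI) simp
      then show "eventually (\<lambda>n. Ibar r T0 (ps n) \<le> ennreal (c' + e)) sequentially"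
        using h c'(1) by (intro always_eventually allI) (auto intro: order_trans)
    qed (use h in auto)
    then show "p \<in> {p. Ibar r T0 p \<le> c}"
      using order_trans[OF Ibar_le ennreal_div_T0] c' by blast
  qed
qed simp

end

section \<open>Large deviations when every slope exposes one point\<close>

locale exposed_ldp =
  fixes I :: "'a::euclidean_space \<Rightarrow> ennreal" and Lam :: "'a \<Rightarrow> real" and P :: "nat \<Rightarrow> 'a measure" and s :: "nat \<Rightarrow> real"
  assumes lower: "\<And>l p. ennreal (l \<bullet> p - Lam l) \<le> I p"
    and attained: "\<And>l. \<exists>p. I p = ennreal (l \<bullet> p - Lam l) \<and> l \<bullet> p - Lam l \<ge> 0"
    and unique: "\<And>l p q. I p \<le> ennreal (l \<bullet> p - Lam l) \<Longrightarrow> l \<bullet> p - Lam l \<ge> 0 \<Longrightarrow>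
      I q \<le> ennreal (l \<bullet> q - Lam l) \<Longrightarrow> l \<bullet> q - Lam l \<ge> 0 \<Longrightarrow> p = q"
    and conv: "convex_rate I" and closed_sub: "\<And>c. closed {p. I p \<le> c}"
    and s_top: "filterlim s at_top sequentially" and s_nonneg: "\<And>n. s n \<ge> 0"
    and prob: "\<And>n. prob_space (P n)" and sets_P: "\<And>n. sets (P n) = sets borel"
    and integrable_exp: "\<And>n l. integrable (P n) (\<lambda>p. exp (s n * (l \<bullet> p)))"
    and mgf: "\<And>l. \<exists>c>0. \<exists>C. \<forall>n. c * exp (s n * Lam l) \<le> (\<integral>p. exp (s n * (l \<bullet> p)) \<partial>P n) \<and>
      (\<integral>p. exp (s n * (l \<bullet> p)) \<partial>P n) \<le> C * exp (s n * Lam l)"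
begin

section \<open>Compact sublevel sets and proximal points\<close>

lemma slab_bounded:
  fixes c :: real and u v :: "'a \<Rightarrow> real"
  shows "bounded {p :: 'a. \<forall>b\<in>Basis. b \<bullet> p - u b \<le> c \<and> (- b) \<bullet> p - v b \<le> c}"
proof -
  have "norm p \<le> (\<Sum>b\<in>Basis. \<bar>c\<bar> + \<bar>u b\<bar> + \<bar>v b\<bar>)" if p: "\<forall>b\<in>Basis. b \<bullet> p - u b \<le> c \<and> (- b) \<bullet> p - v b \<le> c" for p :: 'a
  proof -
    have "norm p \<le> (\<Sum>b\<in>Basis. \<bar>p \<bullet> b\<bar>)" by (rule norm_le_l1)
    also have "\<dots> \<le> (\<Sum>b\<in>Basis. \<bar>c\<bar> + \<bar>u b\<bar> + \<bar>v b\<bar>)"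
    proof (rule sum_mono)
      fix b :: 'a assume "b \<in> Basis"
      then have "b \<bullet> p - u b \<le> c" "(- b) \<bullet> p - v b \<le> c" using p by auto
      then show "\<bar>p \<bullet> b\<bar> \<le> \<bar>c\<bar> + \<bar>u b\<bar> + \<bar>v b\<bar>" by (simp add: inner_commute abs_le_iff) linarith
    qed
    finally show ?thesis .
  qed
  then show ?thesis by (auto simp: bounded_iff)
qed

text \<open>Testing the linear lower bounds with plus and minus each basis vector bounds every
  coordinate.\<close>

lemma compact_sub: assumes "c < \<top>" shows "compact {p. I p \<le> c}"
proof -
  obtain c' where c': "c = ennreal c'" "c' \<ge> 0" using assms by (cases c) auto
  have "{p. I p \<le> c} \<subseteq> {p. \<forall>b\<in>Basis. b \<bullet> p - Lam b \<le> c' \<and> (- b) \<bullet> p - Lam (- b) \<le> c'}"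
  proof (intro subsetI CollectI ballI conjI)
    fix p b assume "p \<in> {p. I p \<le> c}"
    then have "ennreal (l \<bullet> p - Lam l) \<le> ennreal c'" for l using order_trans[OF lower[of l p], of "ennreal c'"] c' by auto
    then have "l \<bullet> p - Lam l \<le> c'" for l using c'(2) by (simp add: ennreal_le_iff)
    then show "b \<bullet> p - Lam b \<le> c'" "(- b) \<bullet> p - Lam (- b) \<le> c'" by blast+
  qed
  then have "bounded {p. I p \<le> c}" using slab_bounded[of Lam c' "\<lambda>b. Lam (- b)"] bounded_subset by blast
  then show ?thesis using closed_sub by (simp add: compact_eq_bounded_closed)
qed

lemma closed_limit:
  assumes "q \<longlonglongrightarrow> p" "\<And>e. e > 0 \<Longrightarrow> eventually (\<lambda>n. I (q n) \<le> ennreal (c + e)) sequentially" "c \<ge> 0"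
  shows "I p \<le> ennreal c"
proof (rule ennreal_le_epsilon)
  fix e :: real assume e: "e > 0"
  have "p \<in> {p. I p \<le> ennreal (c + e)}"
    by (rule Lim_in_closed_set[OF closed_sub _ _ assms(1)]) (use assms(2)[OF e] in auto)
  then show "I p \<le> ennreal c + ennreal e" using assms(3) e by simp
qed

text \<open>Direct method: a minimising sequence stays in one compact sublevel set, and a limit
  point is a minimiser since the quadratic term is continuous and \<open>I\<close> has closed
  sublevel sets.\<close>

lemma proximal_point:
  assumes N: "N > 0"
  obtains q where "I q \<noteq> \<top>"
    "\<And>p. I p \<noteq> \<top> \<Longrightarrow> enn2real (I q) + N * (norm (q - p0))\<^sup>2 \<le> enn2real (I p) + N * (norm (p - p0))\<^sup>2"
proof -
  define V where "V p = enn2real (I p) + N * (norm (p - p0))\<^sup>2" for p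
  define A where "A = V ` {p. I p \<noteq> \<top>}"
  define m where "m = Inf A"
  have V0: "V p \<ge> 0" for p using N by (simp add: V_def)
  have bdd: "bdd_below A" by (rule bdd_belowI[of _ 0]) (auto simp: A_def V0)
  have "\<exists>p. I p \<noteq> \<top>" using attained[of 0] by (metis ennreal_neq_top)
  then have ne: "A \<noteq> {}" by (auto simp: A_def)
  have mle: "m \<le> V p" if "I p \<noteq> \<top>" for p unfolding m_def by (rule cInf_lower[OF _ bdd]) (use that in \<open>auto simp: A_def\<close>)
  have "\<forall>n. \<exists>p. I p \<noteq> \<top> \<and> V p < m + 1 / real (Suc n)"
  proof
    fix n
    have "Inf A < m + 1 / real (Suc n)" by (simp add: m_def)
    from cInf_lessD[OF ne this] show "\<exists>p. I p \<noteq> \<top> \<and> V p < m + 1 / real (Suc n)" by (auto simp: A_def)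
  qed
  from choice[OF this] obtain q where q: "\<And>n. I (q n) \<noteq> \<top>" "\<And>n. V (q n) < m + 1 / real (Suc n)" by blast
  have Iq: "I (q n) = ennreal (enn2real (I (q n)))" for n using q(1)[of n] by (simp add: less_top)
  have "I (q n) \<le> ennreal (m + 1)" for n
  proof -
    have "1 / real (Suc n) \<le> 1" by simp
    moreover have "enn2real (I (q n)) \<le> V (q n)" using N by (simp add: V_def)
    ultimately have "enn2real (I (q n)) \<le> m + 1" using q(2)[of n] by linarith
    then show ?thesis by (subst Iq) (rule ennreal_leI)
  qed
  then obtain z \<rho> where z: "strict_mono \<rho>" "(q \<circ> \<rho>) \<longlonglongrightarrow> z"
    using compact_sub[of "ennreal (m + 1)"] unfolding compact_def by force
  define c where "c = m - N * (norm (z - p0))\<^sup>2"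
  have ev: "eventually (\<lambda>n. enn2real (I ((q \<circ> \<rho>) n)) \<le> c + e) sequentially" if e: "e > 0" for e
  proof -
    have "(\<lambda>n. m + 1 / real (Suc n) - N * (norm ((q \<circ> \<rho>) n - p0))\<^sup>2) \<longlonglongrightarrow> m + 0 - N * (norm (z - p0))\<^sup>2"
      using LIMSEQ_inverse_real_of_nat by (intro tendsto_intros z) (simp add: inverse_eq_divide)
    then have "eventually (\<lambda>n. m + 1 / real (Suc n) - N * (norm ((q \<circ> \<rho>) n - p0))\<^sup>2 < c + e) sequentially"
      by (rule order_tendstoD(2)) (use e in \<open>simp add: c_def\<close>)
    then show ?thesis
    proof eventually_elim
      case (elim n)
      have "n \<le> \<rho> n" by (rule seq_suble[OF z(1)])
      then have "1 / real (Suc (\<rho> n)) \<le> 1 / real (Suc n)" by (intro divide_left_mono) auto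
      then show ?case using elim q(2)[of "\<rho> n"] by (simp add: V_def)
    qed
  qed
  have c0: "c \<ge> 0"
  proof (rule field_le_epsilon)
    fix e :: real assume "e > 0"
    from eventually_happens[OF ev[OF this]] obtain n where "enn2real (I ((q \<circ> \<rho>) n)) \<le> c + e" by auto
    then show "0 \<le> c + e" by (rule order_trans[OF enn2real_nonneg])
  qed
  have "I z \<le> ennreal c"
  proof (rule closed_limit[OF z(2) _ c0])
    fix e :: real assume "e > 0"
    from ev[OF this] show "eventually (\<lambda>n. I ((q \<circ> \<rho>) n) \<le> ennreal (c + e)) sequentially"
      by eventually_elim (metis Iq comp_apply ennreal_leI)
  qed
  then have zf: "I z \<noteq> \<top>" and "enn2real (I z) \<le> c" using c0 by (auto simp: top_unique enn2real_leI)
  then have "V z \<le> m" by (simp add: V_def c_def)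
  then show thesis using that[OF zf] mle unfolding V_def by force
qed

text \<open>The first-order condition at a minimiser of \<open>I + N |. - p0|\<^sup>2\<close> makes
  \<open>l = 2 N (p0 - q)\<close> a subgradient at \<open>q\<close>. Comparing with the point where
  the bound of slope \<open>l\<close> is attained shows that it is attained at \<open>q\<close> too,
  so \<open>q\<close> is exposed by \<open>l\<close>.\<close>

lemma proximal_subgradient:
  assumes N: "N > 0"
  obtains q where "I q \<noteq> \<top>" "enn2real (I q) = ((2 * N) *\<^sub>R (p0 - q)) \<bullet> q - Lam ((2 * N) *\<^sub>R (p0 - q))"
    "\<And>p. I p \<noteq> \<top> \<Longrightarrow> enn2real (I q) + N * (norm (q - p0))\<^sup>2 \<le> enn2real (I p) + N * (norm (p - p0))\<^sup>2"
proof -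
  obtain q where q: "I q \<noteq> \<top>"
    "\<And>p. I p \<noteq> \<top> \<Longrightarrow> enn2real (I q) + N * (norm (q - p0))\<^sup>2 \<le> enn2real (I p) + N * (norm (p - p0))\<^sup>2"
    by (rule proximal_point[OF N, of p0]) blast
  define l where "l = (2 * N) *\<^sub>R (p0 - q)"
  have Iq: "I q = ennreal (enn2real (I q))" using q(1) by (simp add: less_top)
  have sub: "enn2real (I q) + l \<bullet> (p - q) \<le> enn2real (I p)" if p: "I p \<noteq> \<top>" for p
  proof (rule ccontr)
    assume n: "\<not> ?thesis"
    define X where "X = enn2real (I q) + l \<bullet> (p - q) - enn2real (I p)"
    define D where "D = N * (norm (p - q))\<^sup>2"
    have X: "X > 0" using n by (simp add: X_def)
    have D: "D \<ge> 0" using N by (simp add: D_def)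
    have Ip: "I p = ennreal (enn2real (I p))" using p by (simp add: less_top)
    \<comment> \<open>On the segment towards \<open>p\<close> the supposed gain is linear in
      \<open>t\<close> and the quadratic cost is \<open>t\<^sup>2 D\<close>; this \<open>t\<close>
      makes \<open>t * D\<close> smaller than the deficit \<open>X\<close>.\<close>
    define t where "t = min 1 (X / (2 * (D + 1)))"
    have t: "0 < t" "t \<le> 1" using X D by (auto simp: t_def)
    have tD: "t * D < X"
    proof -
      have "t * D \<le> X / (2 * (D + 1)) * D" using D by (intro mult_right_mono) (auto simp: t_def)
      also have "\<dots> = X * (D / (2 * (D + 1)))" by simp
      also have "\<dots> < X * 1" using X D by (intro mult_strict_left_mono) (auto simp: divide_simps)
      finally show ?thesis by simp
    qed
    define w where "w = t *\<^sub>R p + (1 - t) *\<^sub>R q"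
    have "I w \<le> ennreal t * I p + ennreal (1 - t) * I q"
      unfolding w_def using conv t by (auto simp: convex_rate_def)
    also have "\<dots> = ennreal (t * enn2real (I p) + (1 - t) * enn2real (I q))"
      by (subst Ip, subst Iq) (use t in \<open>simp add: ennreal_mult ennreal_plus\<close>)
    finally have Iw: "I w \<le> ennreal (t * enn2real (I p) + (1 - t) * enn2real (I q))" .
    then have wf: "I w \<noteq> \<top>" by (auto simp: top_unique)
    have fw: "enn2real (I w) \<le> t * enn2real (I p) + (1 - t) * enn2real (I q)"
      by (rule enn2real_leI[OF _ Iw]) (use t in auto)
    have wp: "w - p0 = (q - p0) + t *\<^sub>R (p - q)" by (simp add: w_def algebra_simps)
    have "(norm (u + t *\<^sub>R v))\<^sup>2 = (norm u)\<^sup>2 + 2 * t * (u \<bullet> v) + t * t * (norm v)\<^sup>2" for u v :: 'a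
      by (simp add: power2_norm_eq_inner inner_add_left inner_add_right inner_commute algebra_simps)
    then have nw: "(norm (w - p0))\<^sup>2 = (norm (q - p0))\<^sup>2 + 2 * t * ((q - p0) \<bullet> (p - q)) + t * t * (norm (p - q))\<^sup>2"
      by (simp only: wp)
    have "N * (norm (w - p0))\<^sup>2 = N * (norm (q - p0))\<^sup>2 - t * (l \<bullet> (p - q)) + t * (t * D)"
      unfolding nw by (simp add: l_def D_def inner_diff_left algebra_simps)
    then have "0 \<le> t * (enn2real (I p) - enn2real (I q) - l \<bullet> (p - q) + t * D)"
      using q(2)[OF wf] fw by (simp add: algebra_simps)
    then have "0 \<le> enn2real (I p) - enn2real (I q) - l \<bullet> (p - q) + t * D" using t by (simp add: zero_le_mult_iff)
    then show False using tD by (simp add: X_def)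
  qed
  obtain p where p: "I p = ennreal (l \<bullet> p - Lam l)" "l \<bullet> p - Lam l \<ge> 0" using attained[of l] by blast
  have "enn2real (I q) + l \<bullet> (p - q) \<le> l \<bullet> p - Lam l" using sub[of p] p by simp
  then have 1: "enn2real (I q) \<le> l \<bullet> q - Lam l" by (simp add: inner_diff_right)
  have "ennreal (l \<bullet> q - Lam l) \<le> ennreal (enn2real (I q))" using lower[of l q] Iq by simp
  then have "l \<bullet> q - Lam l \<le> enn2real (I q)" by (simp add: ennreal_le_iff)
  with 1 have "enn2real (I q) = l \<bullet> q - Lam l" by simp
  then show thesis using that[OF q(1)] q(2) unfolding l_def by blast
qed

text \<open>If no slope did better than \<open>c\<close> at \<open>p\<close>, the proximal points
  with \<open>N = k + 1\<close> would satisfy \<open>I q + N |q - p|\<^sup>2 \<le> c\<close>, hence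
  converge to \<open>p\<close> and force \<open>I p \<le> c\<close>. The case \<open>c < 0\<close>
  is listed apart because \<open>ennreal\<close> would read it as 0.\<close>

lemma biconjugate:
  assumes "c < 0 \<or> ennreal c < I p"
  shows "\<exists>l. c < l \<bullet> p - Lam l"
proof (rule ccontr)
  assume "\<not> ?thesis"
  then have n: "l \<bullet> p - Lam l \<le> c" for l by (auto simp: not_less)
  have "\<forall>k. \<exists>q. I q \<noteq> \<top> \<and> enn2real (I q) + real (Suc k) * (norm (q - p))\<^sup>2 \<le> c"
  proof
    fix k
    define N where "N = real (Suc k)"
    have N: "N > 0" by (simp add: N_def)
    obtain q where q: "I q \<noteq> \<top>" "enn2real (I q) = ((2 * N) *\<^sub>R (p - q)) \<bullet> q - Lam ((2 * N) *\<^sub>R (p - q))"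
      by (rule proximal_subgradient[OF N, of p]) blast
    define l where "l = (2 * N) *\<^sub>R (p - q)"
    have lq: "enn2real (I q) = l \<bullet> q - Lam l" using q(2) by (simp only: l_def)
    have "l \<bullet> p - Lam l = enn2real (I q) + l \<bullet> (p - q)" by (simp add: lq inner_diff_right)
    also have "l \<bullet> (p - q) = 2 * N * (norm (p - q))\<^sup>2" unfolding l_def inner_scaleR_left power2_norm_eq_inner ..
    also have "norm (p - q) = norm (q - p)" by (rule norm_minus_commute)
    finally have "enn2real (I q) + 2 * N * (norm (q - p))\<^sup>2 \<le> c" using n[of l] by simp
    moreover have "N * (norm (q - p))\<^sup>2 \<le> 2 * N * (norm (q - p))\<^sup>2" using N by simp
    ultimately have "enn2real (I q) + N * (norm (q - p))\<^sup>2 \<le> c" by linarith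
    then show "\<exists>q. I q \<noteq> \<top> \<and> enn2real (I q) + real (Suc k) * (norm (q - p))\<^sup>2 \<le> c"
      using q(1) unfolding N_def by (intro exI[of _ q] conjI)
  qed
  from choice[OF this] obtain q where q: "\<And>k. I (q k) \<noteq> \<top>" "\<And>k. enn2real (I (q k)) + real (Suc k) * (norm (q k - p))\<^sup>2 \<le> c" by blast
  have pos: "real (Suc k) * (norm (q k - p))\<^sup>2 \<ge> 0" for k by simp
  have fq: "enn2real (I (q k)) \<le> c" for k using q(2)[of k] pos[of k] by linarith
  then have c0: "c \<ge> 0" using order_trans[OF enn2real_nonneg fq[of 0]] by simp
  have nb: "norm ((norm (q k - p))\<^sup>2) \<le> c * (1 / real (Suc k))" for k
  proof -
    have "real (Suc k) * (norm (q k - p))\<^sup>2 \<le> c" using q(2)[of k] enn2real_nonneg[of "I (q k)"] by linarith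
    then have "1 / real (Suc k) * (real (Suc k) * (norm (q k - p))\<^sup>2) \<le> 1 / real (Suc k) * c"
      by (rule mult_left_mono) simp
    then show ?thesis by (simp add: mult.assoc[symmetric])
  qed
  have "(\<lambda>k. c * (1 / real (Suc k))) \<longlonglongrightarrow> c * 0"
    using LIMSEQ_inverse_real_of_nat by (intro tendsto_intros) (simp add: inverse_eq_divide)
  then have "(\<lambda>k. c * (1 / real (Suc k))) \<longlonglongrightarrow> 0" by simp
  then have "(\<lambda>k. (norm (q k - p))\<^sup>2) \<longlonglongrightarrow> 0"
    by (rule Lim_null_comparison[rotated]) (rule always_eventually, rule allI, rule nb)
  from tendsto_real_sqrt[OF this] have "(\<lambda>k. norm (q k - p)) \<longlonglongrightarrow> 0" by simp
  then have "(\<lambda>k. q k - p) \<longlonglongrightarrow> 0" by (rule tendsto_norm_zero_cancel)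
  then have "q \<longlonglongrightarrow> p" by (rule LIM_zero_cancel)
  then have "I p \<le> ennreal c"
  proof (rule closed_limit[OF _ _ c0])
    fix e :: real assume e: "e > 0"
    have "I (q k) \<le> ennreal (c + e)" for k
    proof -
      have "I (q k) = ennreal (enn2real (I (q k)))" using q(1)[of k] by (simp add: less_top)
      also have "\<dots> \<le> ennreal (c + e)" using fq[of k] e by (intro ennreal_leI) simp
      finally show ?thesis .
    qed
    then show "eventually (\<lambda>k. I (q k) \<le> ennreal (c + e)) sequentially" by simp
  qed
  then show False using assms c0 by (auto simp: not_less)
qed

text \<open>Open half-spaces \<open>H \<theta>\<close> cover \<open>F\<close>: finitely many cover a
  compact part, and those from coordinate slopes cover the rest. On each the exponential Markov
  bound applies. The weight \<open>exp (s n * (l \<bullet> p))\<close> serves the lower bound, where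
  it shows how little of the reweighted mass lies in \<open>F\<close>; \<open>l = 0\<close> gives
  the upper bound.\<close>

lemma chernoff_closed:
  assumes F: "closed F" and sep: "\<And>p. p \<in> F \<Longrightarrow> \<exists>\<theta>. c < \<theta> \<bullet> p - Lam (\<theta> + l)"
  obtains K where "K > 0" "\<And>n. (\<integral>p. indicator F p * exp (s n * (l \<bullet> p)) \<partial>P n) \<le> K * exp (- (c * s n))"
proof -
  define H where "H \<theta> = {p. c < \<theta> \<bullet> p - Lam (\<theta> + l)}" for \<theta>
  have Ho: "open (H \<theta>)" for \<theta> unfolding H_def by (intro open_Collect_less continuous_intros)
  define T0 where "T0 = Basis \<union> uminus ` (Basis :: 'a set)"
  \<comment> \<open>\<open>Kb\<close> is what the coordinate half-spaces leave uncovered; it is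
    bounded because both signs of each basis vector are imposed.\<close>
  define Kb where "Kb = {p. \<forall>b\<in>Basis. b \<bullet> p - Lam (b + l) \<le> c \<and> (- b) \<bullet> p - Lam (- b + l) \<le> c}"
  have "Kb = (\<Inter>b\<in>Basis. {p. b \<bullet> p - Lam (b + l) \<le> c} \<inter> {p. (- b) \<bullet> p - Lam (- b + l) \<le> c})" by (auto simp: Kb_def)
  moreover have "closed \<dots>" by (intro closed_INT ballI closed_Int closed_Collect_le continuous_intros)
  moreover have "bounded Kb" unfolding Kb_def by (rule slab_bounded)
  ultimately have "compact Kb" by (simp add: compact_eq_bounded_closed)
  then have cF: "compact (F \<inter> Kb)" using F by (simp add: closed_Int_compact)
  have "F \<inter> Kb \<subseteq> (\<Union>\<theta>\<in>UNIV. H \<theta>)" using sep by (auto simp: H_def)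
  then obtain T1 where T1: "finite T1" "F \<inter> Kb \<subseteq> (\<Union>\<theta>\<in>T1. H \<theta>)"
    by (rule compactE_image[OF cF Ho]) blast
  define T where "T = T0 \<union> T1"
  have Tf: "finite T" using T1 by (simp add: T_def T0_def)
  have cov: "F \<subseteq> (\<Union>\<theta>\<in>T. H \<theta>)"
  proof
    fix p assume p: "p \<in> F"
    show "p \<in> (\<Union>\<theta>\<in>T. H \<theta>)"
    proof (cases "p \<in> Kb")
      case True
      then show ?thesis using p T1 by (auto simp: T_def)
    next
      case False
      then obtain b where "b \<in> Basis" "c < b \<bullet> p - Lam (b + l) \<or> c < (- b) \<bullet> p - Lam (- b + l)" by (auto simp: Kb_def not_le)
      then have "p \<in> H b \<or> p \<in> H (- b)" by (simp add: H_def)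
      then show ?thesis using \<open>b \<in> Basis\<close> by (auto simp: T_def T0_def)
    qed
  qed
  have "\<forall>\<theta>. \<exists>C. \<forall>n. (\<integral>p. exp (s n * ((\<theta> + l) \<bullet> p)) \<partial>P n) \<le> C * exp (s n * Lam (\<theta> + l))"
  proof
    fix \<theta>
    from mgf[of "\<theta> + l"] obtain c C where "\<forall>n. c * exp (s n * Lam (\<theta> + l)) \<le> (\<integral>p. exp (s n * ((\<theta> + l) \<bullet> p)) \<partial>P n) \<and>
      (\<integral>p. exp (s n * ((\<theta> + l) \<bullet> p)) \<partial>P n) \<le> C * exp (s n * Lam (\<theta> + l))" by blast
    then show "\<exists>C. \<forall>n. (\<integral>p. exp (s n * ((\<theta> + l) \<bullet> p)) \<partial>P n) \<le> C * exp (s n * Lam (\<theta> + l))" by (intro exI[of _ C]) simp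
  qed
  from choice[OF this] obtain C where C: "\<And>\<theta> n. (\<integral>p. exp (s n * ((\<theta> + l) \<bullet> p)) \<partial>P n) \<le> C \<theta> * exp (s n * Lam (\<theta> + l))" by blast
  have im: "integrable (P n) (\<lambda>p. indicator A p * exp (s n * (l \<bullet> p)))" if "A \<in> sets borel" for A n
    using integrable_real_mult_indicator[OF _ integrable_exp[of n l], of A] that sets_P by (simp add: mult.commute)
  have half: "(\<integral>p. indicator (H \<theta>) p * exp (s n * (l \<bullet> p)) \<partial>P n) \<le> C \<theta> * exp (- (c * s n))" for \<theta> n
  proof -
    \<comment> \<open>On \<open>H \<theta>\<close> the weight of slope \<open>l\<close> is at most
      \<open>k\<close> times that of slope \<open>\<theta> + l\<close>, whose mean is controlled by
      \<open>mgf\<close>.\<close>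
    define k where "k = exp (- (s n * (Lam (\<theta> + l) + c)))"
    have "(\<integral>p. indicator (H \<theta>) p * exp (s n * (l \<bullet> p)) \<partial>P n) \<le> (\<integral>p. k * exp (s n * ((\<theta> + l) \<bullet> p)) \<partial>P n)"
    proof (rule integral_mono[OF im])
      show "H \<theta> \<in> sets borel" using Ho by simp
      show "integrable (P n) (\<lambda>p. k * exp (s n * ((\<theta> + l) \<bullet> p)))" using integrable_exp by simp
      fix p
      show "indicator (H \<theta>) p * exp (s n * (l \<bullet> p)) \<le> k * exp (s n * ((\<theta> + l) \<bullet> p))"
      proof (cases "p \<in> H \<theta>")
        case True
        have "s n * (Lam (\<theta> + l) + c) \<le> s n * (\<theta> \<bullet> p)"
          by (rule mult_left_mono[OF _ s_nonneg]) (use True in \<open>simp add: H_def\<close>)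
        then have "s n * (l \<bullet> p) \<le> - (s n * (Lam (\<theta> + l) + c)) + s n * ((\<theta> + l) \<bullet> p)"
          by (simp add: inner_add_left algebra_simps)
        then show ?thesis using True by (simp add: k_def flip: exp_add)
      qed (simp add: k_def)
    qed
    also have "\<dots> = k * (\<integral>p. exp (s n * ((\<theta> + l) \<bullet> p)) \<partial>P n)" by simp
    also have "\<dots> \<le> k * (C \<theta> * exp (s n * Lam (\<theta> + l)))" by (rule mult_left_mono[OF C]) (simp add: k_def)
    also have "\<dots> = C \<theta> * exp (- (c * s n))" by (simp add: k_def algebra_simps flip: exp_add)
    finally show ?thesis .
  qed
  show thesis
  \<comment> \<open>The absolute value plus 1 makes the constant positive, so that its logarithm can
    be taken later.\<close>
  proof (rule that[of "\<bar>\<Sum>\<theta>\<in>T. C \<theta>\<bar> + 1"])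
    fix n
    have "(\<integral>p. indicator F p * exp (s n * (l \<bullet> p)) \<partial>P n) \<le> (\<integral>p. (\<Sum>\<theta>\<in>T. indicator (H \<theta>) p * exp (s n * (l \<bullet> p))) \<partial>P n)"
    proof (rule integral_mono[OF im])
      show "F \<in> sets borel" using F by simp
      show "integrable (P n) (\<lambda>p. \<Sum>\<theta>\<in>T. indicator (H \<theta>) p * exp (s n * (l \<bullet> p)))"
        by (intro Bochner_Integration.integrable_sum im) (use Ho in simp)
      fix p
      show "indicator F p * exp (s n * (l \<bullet> p)) \<le> (\<Sum>\<theta>\<in>T. indicator (H \<theta>) p * exp (s n * (l \<bullet> p)))"
      proof (cases "p \<in> F")
        case True
        then obtain \<theta> where \<theta>: "\<theta> \<in> T" "p \<in> H \<theta>" using cov by auto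
        have "indicator (H \<theta>) p * exp (s n * (l \<bullet> p)) \<le> (\<Sum>\<theta>\<in>T. indicator (H \<theta>) p * exp (s n * (l \<bullet> p)))"
          by (rule member_le_sum[OF \<theta>(1)]) (use Tf in auto)
        then show ?thesis using True \<theta> by simp
      qed (simp add: sum_nonneg)
    qed
    also have "\<dots> = (\<Sum>\<theta>\<in>T. \<integral>p. indicator (H \<theta>) p * exp (s n * (l \<bullet> p)) \<partial>P n)"
      by (rule Bochner_Integration.integral_sum) (rule im, use Ho in simp)
    also have "\<dots> \<le> (\<Sum>\<theta>\<in>T. C \<theta> * exp (- (c * s n)))" by (intro sum_mono half)
    also have "\<dots> = (\<Sum>\<theta>\<in>T. C \<theta>) * exp (- (c * s n))" by (simp add: sum_distrib_right)
    also have "\<dots> \<le> (\<bar>\<Sum>\<theta>\<in>T. C \<theta>\<bar> + 1) * exp (- (c * s n))" by (intro mult_right_mono) auto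
    finally show "(\<integral>p. indicator F p * exp (s n * (l \<bullet> p)) \<partial>P n) \<le> (\<bar>\<Sum>\<theta>\<in>T. C \<theta>\<bar> + 1) * exp (- (c * s n))" .
  qed simp
qed

section \<open>The upper bound and the lower bound\<close>

lemma s_pos_ev: "eventually (\<lambda>n. s n > 0) sequentially"
  using s_top by (simp add: filterlim_at_top_dense)

lemma inv_s: "(\<lambda>n. a / s n) \<longlonglongrightarrow> 0"
  by (rule real_tendsto_divide_at_top[OF tendsto_const s_top])

lemma upper_bound:
  assumes F: "closed F"
  shows "limsup (\<lambda>n. ereal (1 / s n) * logE (measure (P n) F)) \<le> - enn2ereal (INF p\<in>F. I p)"
proof (rule ccontr)
  let ?X = "limsup (\<lambda>n. ereal (1 / s n) * logE (measure (P n) F))"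
  assume "\<not> ?X \<le> - enn2ereal (INF p\<in>F. I p)"
  then have "- enn2ereal (INF p\<in>F. I p) < ?X" by simp
  then obtain d where d: "- enn2ereal (INF p\<in>F. I p) < ereal d" "ereal d < ?X" using ereal_dense2 by blast
  define c where "c = - d"
  have cI: "ereal c < enn2ereal (INF p\<in>F. I p)" using d(1) unfolding c_def by (metis ereal_uminus_less_reorder uminus_ereal.simps(1))
  have "\<exists>\<theta>. c < \<theta> \<bullet> p - Lam (\<theta> + 0)" if "p \<in> F" for p
  proof -
    have "c < 0 \<or> ennreal c < I p"
    proof (cases "c < 0")
      case False
      have "(INF p\<in>F. I p) \<le> I p" by (rule INF_lower[OF that])
      then have "enn2ereal (INF p\<in>F. I p) \<le> enn2ereal (I p)" by (simp add: less_eq_ennreal.rep_eq)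
      then have "ereal c < enn2ereal (I p)" using cI by simp
      then have "enn2ereal (ennreal c) < enn2ereal (I p)" using False by (simp add: enn2ereal_ennreal)
      then show ?thesis by (simp add: less_ennreal.rep_eq)
    qed simp
    from biconjugate[OF this] show ?thesis by simp
  qed
  then obtain K where K: "K > 0" "\<And>n. (\<integral>p. indicator F p * exp (s n * (0 \<bullet> p)) \<partial>P n) \<le> K * exp (- (c * s n))"
    using chernoff_closed[OF F, of c 0] by blast
  have meas: "measure (P n) F \<le> K * exp (- (c * s n))" for n
  proof -
    interpret prob_space "P n" by (rule prob)
    have "F \<in> sets (P n)" using F sets_P by simp
    then have "(\<integral>p. indicator F p * exp (s n * (0 \<bullet> p)) \<partial>P n) = measure (P n) F" by simp
    then show ?thesis using K(2)[of n] by simp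
  qed
  have "eventually (\<lambda>n. ereal (1 / s n) * logE (measure (P n) F) \<le> ereal (ln K / s n - c)) sequentially"
    using s_pos_ev
  proof eventually_elim
    case (elim n)
    show ?case
    proof (cases "measure (P n) F = 0")
      case True
      then show ?thesis using elim by (simp add: logE_def)
    next
      case False
      then have m: "measure (P n) F > 0" by (simp add: less_le)
      have "ln (measure (P n) F) \<le> ln (K * exp (- (c * s n)))" using m meas[of n] by (intro ln_mono) auto
      also have "\<dots> = ln K - c * s n" using K(1) by (simp add: ln_mult)
      finally have "1 / s n * ln (measure (P n) F) \<le> 1 / s n * (ln K - c * s n)" using elim by (intro mult_left_mono) auto
      also have "\<dots> = ln K / s n - c" using elim by (simp add: field_simps)
      finally show ?thesis using False by (simp add: logE_def)
    qed
  qed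
  then have "?X \<le> limsup (\<lambda>n. ereal (ln K / s n - c))" by (rule Limsup_mono)
  also have "\<dots> = ereal (- c)"
  proof (rule lim_imp_Limsup)
    have "(\<lambda>n. ln K / s n - c) \<longlonglongrightarrow> 0 - c" by (intro tendsto_diff inv_s tendsto_const)
    then show "(\<lambda>n. ereal (ln K / s n - c)) \<longlonglongrightarrow> ereal (- c)" by simp
  qed simp
  finally show False using d(2) by (simp add: c_def)
qed

text \<open>A uniform gap from uniqueness: points of \<open>F\<close> with gap at most
  \<open>1 / Suc k\<close> for every \<open>k\<close> would be bounded, since perturbed slopes also
  bound \<open>I\<close> from below, and an accumulation point in \<open>F\<close> would attain the
  bound of slope \<open>l\<close>, hence be \<open>q\<close>.\<close>

lemma exposed_gap:
  assumes q: "I q = ennreal (l \<bullet> q - Lam l)" "l \<bullet> q - Lam l \<ge> 0" and F: "closed F" "q \<notin> F"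
  obtains h where "h > 0" "\<And>p. p \<in> F \<Longrightarrow> l \<bullet> p - Lam l + h < 0 \<or> ennreal (l \<bullet> p - Lam l + h) < I p"
proof (rule ccontr)
  assume "\<not> thesis"
  then have "\<forall>k. \<exists>p. p \<in> F \<and> l \<bullet> p - Lam l + 1 / real (Suc k) \<ge> 0 \<and> I p \<le> ennreal (l \<bullet> p - Lam l + 1 / real (Suc k))"
    using that by (meson not_less zero_less_divide_1_iff of_nat_0_less_iff zero_less_Suc)
  from choice[OF this] obtain p where p: "\<And>k. p k \<in> F" "\<And>k. l \<bullet> p k - Lam l + 1 / real (Suc k) \<ge> 0"
    "\<And>k. I (p k) \<le> ennreal (l \<bullet> p k - Lam l + 1 / real (Suc k))" by blast
  \<comment> \<open>Slopes \<open>l\<close> plus or minus a basis vector: combining their lower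
    bounds with the near-optimality for \<open>l\<close> limits each coordinate.\<close>
  define B where "B = {p. \<forall>b\<in>Basis. b \<bullet> p - Lam (b + l) \<le> 1 - Lam l \<and> (- b) \<bullet> p - Lam (- b + l) \<le> 1 - Lam l}"
  have pB: "p k \<in> B" for k
  proof -
    have "l' \<bullet> p k - Lam (l' + l) \<le> 1 - Lam l" for l'
    proof -
      have "ennreal ((l' + l) \<bullet> p k - Lam (l' + l)) \<le> ennreal (l \<bullet> p k - Lam l + 1 / real (Suc k))"
        using lower[of "l' + l" "p k"] p(3)[of k] by (rule order_trans)
      then have "(l' + l) \<bullet> p k - Lam (l' + l) \<le> l \<bullet> p k - Lam l + 1 / real (Suc k)"
        using p(2)[of k] by (simp add: ennreal_le_iff)
      moreover have "1 / real (Suc k) \<le> 1" by simp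
      ultimately show ?thesis unfolding inner_add_left by linarith
    qed
    then show ?thesis unfolding B_def by blast
  qed
  have "bounded B" unfolding B_def by (rule slab_bounded)
  then have "bounded (range p)" by (rule bounded_subset) (use pB in auto)
  then obtain z \<rho> where z: "strict_mono \<rho>" "(p \<circ> \<rho>) \<longlonglongrightarrow> z" using bounded_imp_convergent_subsequence by blast
  have zF: "z \<in> F" by (rule closed_sequentially[OF F(1) _ z(2)]) (use p(1) in auto)
  have lim: "(\<lambda>n. l \<bullet> (p \<circ> \<rho>) n - Lam l + 1 / real (Suc n)) \<longlonglongrightarrow> l \<bullet> z - Lam l + 0"
    using LIMSEQ_inverse_real_of_nat by (intro tendsto_intros z) (simp add: inverse_eq_divide)
  have le: "1 / real (Suc (\<rho> n)) \<le> 1 / real (Suc n)" for n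
    using seq_suble[OF z(1), of n] by (intro divide_left_mono) auto
  have z0: "l \<bullet> z - Lam l \<ge> 0"
  proof -
    have "0 \<le> l \<bullet> (p \<circ> \<rho>) n - Lam l + 1 / real (Suc n)" for n using p(2)[of "\<rho> n"] le[of n] by simp
    then have "0 \<le> l \<bullet> z - Lam l + 0" by (intro LIMSEQ_le_const[OF lim]) blast
    then show ?thesis by simp
  qed
  have "I z \<le> ennreal (l \<bullet> z - Lam l)"
  proof (rule closed_limit[OF z(2) _ z0])
    fix e :: real assume e: "e > 0"
    have "eventually (\<lambda>n. l \<bullet> (p \<circ> \<rho>) n - Lam l + 1 / real (Suc n) < l \<bullet> z - Lam l + e) sequentially"
      by (rule order_tendstoD(2)[OF lim]) (use e in simp)
    then show "eventually (\<lambda>n. I ((p \<circ> \<rho>) n) \<le> ennreal (l \<bullet> z - Lam l + e)) sequentially"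
    proof eventually_elim
      case (elim n)
      have "ennreal (l \<bullet> p (\<rho> n) - Lam l + 1 / real (Suc (\<rho> n))) \<le> ennreal (l \<bullet> z - Lam l + e)"
        using elim le[of n] by (intro ennreal_leI) simp
      then show ?case using p(3)[of "\<rho> n"] by (auto intro: order_trans)
    qed
  qed
  then have "z = q" by (rule unique) (use z0 q in auto)
  then show False using zF F(2) by simp
qed

text \<open>Reweighted by \<open>exp (s n * (l \<bullet> p))\<close> the mass is at least of order
  \<open>exp (s n * Lam l)\<close>, while outside a ball around \<open>q\<close> it is smaller by a
  factor of order \<open>exp (- h * s n)\<close>. So eventually a fixed share of it sits in the
  ball, where the weight is at most \<open>exp (s n * (l \<bullet> q + e))\<close>.\<close>

lemma lower_bound_exposed:
  assumes q: "I q = ennreal (l \<bullet> q - Lam l)" "l \<bullet> q - Lam l \<ge> 0" and G: "open G" "q \<in> G"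
  shows "ereal (- (l \<bullet> q - Lam l)) \<le> liminf (\<lambda>n. ereal (1 / s n) * logE (measure (P n) G))"
proof (rule ereal_le_epsilon2)
  fix e :: real assume e: "e > 0"
  let ?X = "liminf (\<lambda>n. ereal (1 / s n) * logE (measure (P n) G))"
  obtain d0 where d0: "d0 > 0" "ball q d0 \<subseteq> G" using G open_contains_ball by blast
  \<comment> \<open>On a ball of radius \<open>d\<close> the form \<open>l\<close> varies by at most
    \<open>e\<close>; \<open>norm l + 1\<close> avoids division by zero.\<close>
  define d where "d = min d0 (e / (norm l + 1))"
  have d: "d > 0" using d0 e by (simp add: d_def add_nonneg_pos)
  have le: "norm l * d \<le> e"
  proof -
    have "norm l * d \<le> norm l * (e / (norm l + 1))" by (intro mult_left_mono) (auto simp: d_def)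
    also have "\<dots> = e * (norm l / (norm l + 1))" by simp
    also have "\<dots> \<le> e * 1" using e by (intro mult_left_mono) (auto simp: divide_simps add_nonneg_pos)
    finally show ?thesis by simp
  qed
  define F where "F = - ball q d"
  have F: "closed F" "q \<notin> F" using d by (auto simp: F_def)
  obtain h where h: "h > 0" "\<And>p. p \<in> F \<Longrightarrow> l \<bullet> p - Lam l + h < 0 \<or> ennreal (l \<bullet> p - Lam l + h) < I p"
    by (rule exposed_gap[OF q F]) blast
  have "\<exists>\<theta>. - Lam l + h < \<theta> \<bullet> p - Lam (\<theta> + l)" if pF: "p \<in> F" for p
  proof -
    obtain l' where "l \<bullet> p - Lam l + h < l' \<bullet> p - Lam l'" using biconjugate[OF h(2)[OF pF]] by blast
    then show ?thesis by (intro exI[of _ "l' - l"]) (simp add: inner_diff_left)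
  qed
  then obtain K where K: "K > 0" "\<And>n. (\<integral>p. indicator F p * exp (s n * (l \<bullet> p)) \<partial>P n) \<le> K * exp (- ((- Lam l + h) * s n))"
    using chernoff_closed[OF F(1), of "- Lam l + h" l] by blast
  obtain c where c: "c > 0" "\<And>n. c * exp (s n * Lam l) \<le> (\<integral>p. exp (s n * (l \<bullet> p)) \<partial>P n)" using mgf[of l] by blast
  have main: "c * exp (s n * Lam l) - K * exp (s n * (Lam l - h)) \<le> exp (s n * (l \<bullet> q + e)) * measure (P n) G" for n
  proof -
    interpret prob_space "P n" by (rule prob)
    have bs: "ball q d \<in> sets (P n)" "G \<in> sets (P n)" "F \<in> sets (P n)" using G F sets_P by auto
    have i: "integrable (P n) (\<lambda>p. indicator A p * exp (s n * (l \<bullet> p)))" if "A \<in> sets (P n)" for A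
      using integrable_real_mult_indicator[OF that integrable_exp[of n l]] by (simp add: mult.commute)
    have "(\<integral>p. exp (s n * (l \<bullet> p)) \<partial>P n) = (\<integral>p. indicator (ball q d) p * exp (s n * (l \<bullet> p)) + indicator F p * exp (s n * (l \<bullet> p)) \<partial>P n)"
      by (rule Bochner_Integration.integral_cong) (auto simp: F_def indicator_def)
    also have "\<dots> = (\<integral>p. indicator (ball q d) p * exp (s n * (l \<bullet> p)) \<partial>P n) + (\<integral>p. indicator F p * exp (s n * (l \<bullet> p)) \<partial>P n)"
      by (rule Bochner_Integration.integral_add[OF i[OF bs(1)] i[OF bs(3)]])
    also have "(\<integral>p. indicator (ball q d) p * exp (s n * (l \<bullet> p)) \<partial>P n) \<le> (\<integral>p. exp (s n * (l \<bullet> q + e)) * indicator G p \<partial>P n)"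
    proof (rule integral_mono[OF i[OF bs(1)]])
      show "integrable (P n) (\<lambda>p. exp (s n * (l \<bullet> q + e)) * indicator G p)"
        using bs(2) by (intro integrable_mult_right) (simp add: emeasure_eq_measure)
      fix p
      show "indicator (ball q d) p * exp (s n * (l \<bullet> p)) \<le> exp (s n * (l \<bullet> q + e)) * indicator G p"
      proof (cases "p \<in> ball q d")
        case True
        then have "p \<in> G" using d0(2) by (auto simp: d_def)
        have "l \<bullet> p = l \<bullet> q + l \<bullet> (p - q)" by (simp add: inner_diff_right)
        also have "l \<bullet> (p - q) \<le> norm l * norm (p - q)" by (rule norm_cauchy_schwarz)
        also have "\<dots> \<le> norm l * d" using True by (intro mult_left_mono) (auto simp: dist_norm norm_minus_commute)
        finally have "l \<bullet> p \<le> l \<bullet> q + e" using le by simp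
        then have "s n * (l \<bullet> p) \<le> s n * (l \<bullet> q + e)" by (rule mult_left_mono[OF _ s_nonneg])
        then show ?thesis using True \<open>p \<in> G\<close> by simp
      qed simp
    qed
    also have "\<dots> = exp (s n * (l \<bullet> q + e)) * measure (P n) G" using bs(2) by simp
    finally have "(\<integral>p. exp (s n * (l \<bullet> p)) \<partial>P n) \<le> exp (s n * (l \<bullet> q + e)) * measure (P n) G + (\<integral>p. indicator F p * exp (s n * (l \<bullet> p)) \<partial>P n)" by simp
    moreover have "- ((- Lam l + h) * s n) = s n * (Lam l - h)" by (simp add: algebra_simps)
    ultimately show ?thesis using c(2)[of n] K(2)[of n] by simp
  qed
  have "filterlim (\<lambda>n. h * s n) at_top sequentially"
    by (rule filterlim_tendsto_pos_mult_at_top[OF tendsto_const h(1) s_top])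
  \<comment> \<open>From here on the mass outside the ball is at most half of the lower bound
    \<open>c * exp (s n * Lam l)\<close>.\<close>
  then have "eventually (\<lambda>n. h * s n \<ge> ln (2 * K / c)) sequentially" by (simp add: filterlim_at_top)
  then have "eventually (\<lambda>n. ereal (ln (c / 2) / s n - (l \<bullet> q - Lam l + e)) \<le> ereal (1 / s n) * logE (measure (P n) G)) sequentially"
    using s_pos_ev
  proof eventually_elim
    case (elim n)
    have "K * exp (s n * (Lam l - h)) \<le> (c / 2) * exp (s n * Lam l)"
    proof -
      have "exp (- (h * s n)) \<le> exp (- ln (2 * K / c))" using elim by simp
      also have "\<dots> = c / (2 * K)" using K(1) c(1) by (simp add: exp_minus)
      finally have "K * exp (- (h * s n)) \<le> K * (c / (2 * K))" using K(1) by (intro mult_left_mono) auto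
      then have "K * exp (- (h * s n)) \<le> c / 2" using K(1) by simp
      then have "K * exp (- (h * s n)) * exp (s n * Lam l) \<le> c / 2 * exp (s n * Lam l)" by (intro mult_right_mono) auto
      then show ?thesis by (simp add: mult.assoc algebra_simps flip: exp_add)
    qed
    then have "(c / 2) * exp (s n * Lam l) \<le> exp (s n * (l \<bullet> q + e)) * measure (P n) G" using main[of n] by simp
    then have "(c / 2) * exp (s n * Lam l) * exp (- (s n * (l \<bullet> q + e))) \<le> exp (s n * (l \<bullet> q + e)) * measure (P n) G * exp (- (s n * (l \<bullet> q + e)))"
      by (rule mult_right_mono) simp
    also have "\<dots> = measure (P n) G * (exp (s n * (l \<bullet> q + e)) * exp (- (s n * (l \<bullet> q + e))))" by (simp only: mult_ac)
    also have "exp (s n * (l \<bullet> q + e)) * exp (- (s n * (l \<bullet> q + e))) = 1" by (simp only: exp_add[symmetric] add.right_inverse exp_zero)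
    also have "(c / 2) * exp (s n * Lam l) * exp (- (s n * (l \<bullet> q + e))) = (c / 2) * exp (- (s n * (l \<bullet> q - Lam l + e)))"
    proof -
      have "s n * Lam l + - (s n * (l \<bullet> q + e)) = - (s n * (l \<bullet> q - Lam l + e))" by (simp add: algebra_simps)
      then show ?thesis by (simp only: mult.assoc exp_add[symmetric])
    qed
    finally have lb: "(c / 2) * exp (- (s n * (l \<bullet> q - Lam l + e))) \<le> measure (P n) G" by simp
    then have m: "measure (P n) G > 0" using c(1) by (intro less_le_trans[OF _ lb]) auto
    have "ln (c / 2) - s n * (l \<bullet> q - Lam l + e) = ln ((c / 2) * exp (- (s n * (l \<bullet> q - Lam l + e))))"
      using c(1) by (subst ln_mult_pos) auto
    also have "\<dots> \<le> ln (measure (P n) G)" using lb c(1) by (intro ln_mono) auto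
    finally have "1 / s n * (ln (c / 2) - s n * (l \<bullet> q - Lam l + e)) \<le> 1 / s n * ln (measure (P n) G)"
      using elim by (intro mult_left_mono) auto
    moreover have "1 / s n * (ln (c / 2) - s n * (l \<bullet> q - Lam l + e)) = ln (c / 2) / s n - (l \<bullet> q - Lam l + e)"
      using elim(2) by (simp add: diff_divide_distrib)
    ultimately show ?case using m by (simp add: logE_def)
  qed
  then have "liminf (\<lambda>n. ereal (ln (c / 2) / s n - (l \<bullet> q - Lam l + e))) \<le> ?X" by (rule Liminf_mono)
  moreover have "liminf (\<lambda>n. ereal (ln (c / 2) / s n - (l \<bullet> q - Lam l + e))) = ereal (- (l \<bullet> q - Lam l + e))"
  proof (rule lim_imp_Liminf)
    have "(\<lambda>n. ln (c / 2) / s n - (l \<bullet> q - Lam l + e)) \<longlonglongrightarrow> 0 - (l \<bullet> q - Lam l + e)" by (intro tendsto_diff inv_s tendsto_const)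
    then show "(\<lambda>n. ereal (ln (c / 2) / s n - (l \<bullet> q - Lam l + e))) \<longlonglongrightarrow> ereal (- (l \<bullet> q - Lam l + e))" by simp
  qed simp
  ultimately have "ereal (- (l \<bullet> q - Lam l + e)) \<le> ?X" by simp
  then have "ereal (- (l \<bullet> q - Lam l + e)) + ereal e \<le> ?X + ereal e" by (rule add_right_mono)
  then show "ereal (- (l \<bullet> q - Lam l)) \<le> ?X + ereal e" by simp
qed

text \<open>A point \<open>p0\<close> nearly realising the infimum need not be exposed. Its proximal
  point \<open>q\<close> is exposed, has no larger rate, and lies within \<open>r\<close> of
  \<open>p0\<close> by the choice of \<open>N\<close>.\<close>

lemma lower_bound:
  assumes G: "open G"
  shows "- enn2ereal (INF p\<in>G. I p) \<le> liminf (\<lambda>n. ereal (1 / s n) * logE (measure (P n) G))"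
proof (rule ccontr)
  let ?X = "liminf (\<lambda>n. ereal (1 / s n) * logE (measure (P n) G))"
  assume "\<not> - enn2ereal (INF p\<in>G. I p) \<le> ?X"
  then have "?X < - enn2ereal (INF p\<in>G. I p)" by simp
  then obtain d where d: "?X < ereal d" "ereal d < - enn2ereal (INF p\<in>G. I p)" using ereal_dense2 by blast
  define c where "c = - d"
  have cI: "enn2ereal (INF p\<in>G. I p) < ereal c" using d(2) unfolding c_def ereal_less_uminus_reorder[of "ereal d"] by simp
  have c0: "c > 0"
  proof -
    have "ereal 0 \<le> enn2ereal (INF p\<in>G. I p)" by (simp add: zero_ereal_def[symmetric])
    then have "ereal 0 < ereal c" using cI by (rule order_le_less_trans)
    then show ?thesis by simp
  qed
  have "(INF p\<in>G. I p) < ennreal c" using cI c0 by (simp add: less_ennreal.rep_eq enn2ereal_ennreal)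
  then obtain p0 where p0: "p0 \<in> G" "I p0 < ennreal c" by (auto simp: INF_less_iff)
  then have p0f: "I p0 \<noteq> \<top>" by auto
  have Ip0: "I p0 = ennreal (enn2real (I p0))" using p0f by (simp add: less_top)
  then have fp0: "enn2real (I p0) < c" using p0(2) c0 by (metis ennreal_less_iff enn2real_nonneg)
  obtain r where r: "r > 0" "ball p0 r \<subseteq> G" using G p0(1) open_contains_ball by blast
  \<comment> \<open>\<open>N * r\<^sup>2 = c + 1\<close> exceeds the rate of \<open>p0\<close>, so a
    minimiser cannot afford a distance \<open>r\<close>.\<close>
  define N where "N = (c + 1) / r\<^sup>2"
  have N: "N > 0" using c0 r by (simp add: N_def)
  obtain q where q: "I q \<noteq> \<top>" "enn2real (I q) = ((2 * N) *\<^sub>R (p0 - q)) \<bullet> q - Lam ((2 * N) *\<^sub>R (p0 - q))"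
    "\<And>p. I p \<noteq> \<top> \<Longrightarrow> enn2real (I q) + N * (norm (q - p0))\<^sup>2 \<le> enn2real (I p) + N * (norm (p - p0))\<^sup>2"
    by (rule proximal_subgradient[OF N, of p0]) blast
  define l where "l = (2 * N) *\<^sub>R (p0 - q)"
  have le: "enn2real (I q) + N * (norm (q - p0))\<^sup>2 \<le> enn2real (I p0)" using q(3)[OF p0f] by simp
  have N0: "N * (norm (q - p0))\<^sup>2 \<ge> 0" using N by simp
  have "N * (norm (q - p0))\<^sup>2 < N * r\<^sup>2"
  proof -
    have "N * (norm (q - p0))\<^sup>2 < c + 1" using le fp0 enn2real_nonneg[of "I q"] by linarith
    also have "\<dots> = N * r\<^sup>2" using r by (simp add: N_def)
    finally show ?thesis .
  qed
  then have "norm (q - p0) < r" using N r by (simp add: power2_less_imp_less)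
  then have "q \<in> G" using r by (auto simp: dist_norm norm_minus_commute)
  have Iq: "I q = ennreal (enn2real (I q))" using q(1) by (simp add: less_top)
  have lq: "enn2real (I q) = l \<bullet> q - Lam l" using q(2) by (simp add: l_def)
  have "ereal (- (l \<bullet> q - Lam l)) \<le> ?X"
    by (rule lower_bound_exposed[OF _ _ G \<open>q \<in> G\<close>]) (use Iq lq enn2real_nonneg[of "I q"] in auto)
  moreover have "l \<bullet> q - Lam l < c" using lq le N0 fp0 by linarith
  moreover from this have "ereal d < ereal (- (l \<bullet> q - Lam l))" by (simp add: c_def)
  ultimately have "ereal d < ?X" by (meson order_less_le_trans)
  then show False using d(1) by (meson order_less_asym)
qed

theorem exposed_LDP: "LDP P s I"
  unfolding LDP_def using lower_bound upper_bound by blast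

theorem exposed_good: "good_rate I"
  unfolding good_rate_def using closed_sub compact_sub by auto

end

section \<open>Grid approximation of cadlag paths\<close>

lemma cadlag_right: "cadlag X \<Longrightarrow> t \<ge> 0 \<Longrightarrow> \<exists>d>0. \<forall>u\<in>{t..<t + d}. X u = X t"
  by (simp add: cadlag_def)

lemma left_lim_eqI:
  assumes "t > 0" "d > 0" "\<And>u. u \<in> {t - d<..<t} \<Longrightarrow> X u = v"
  shows "left_lim X t = v"
proof -
  have "(THE v. \<exists>d>0. \<forall>u\<in>{t - d<..<t}. X u = v) = v"
  proof (rule the_equality)
    show "\<exists>d>0. \<forall>u\<in>{t - d<..<t}. X u = v" using assms by blast
    fix w assume "\<exists>d>0. \<forall>u\<in>{t - d<..<t}. X u = w"
    then obtain d' where d': "d' > 0" "\<forall>u\<in>{t - d'<..<t}. X u = w" by blast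
    define u where "u = t - min d d' / 2"
    have "u \<in> {t - d<..<t}" "u \<in> {t - d'<..<t}" using assms(2) d'(1) by (auto simp: u_def min_def)
    then show "w = v" using assms(3)[of u] bspec[OF d'(2), of u] by blast
  qed
  then show ?thesis using assms(1) by (simp add: left_lim_def)
qed

lemma cadlag_left:
  assumes "cadlag X" "t > 0"
  obtains d where "d > 0" "\<And>u. u \<in> {t - d<..<t} \<Longrightarrow> X u = left_lim X t"
proof -
  obtain d v where d: "d > 0" "\<forall>u\<in>{t - d<..<t}. X u = v" using assms unfolding cadlag_def by blast
  then have "left_lim X t = v" by (intro left_lim_eqI[OF assms(2) d(1)]) blast
  then show thesis using that[of d] d by blast
qed

text \<open>Time 0 may be left out: \<open>left_lim X 0 = X 0\<close> by definition.\<close>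

definition jumps :: "real \<Rightarrow> (real \<Rightarrow> 'v) \<Rightarrow> real set" where
  "jumps T X = {t \<in> {0<..T}. left_lim X t \<noteq> X t}"

text \<open>Without jumps a cadlag path is locally constant on both sides of every point;
  connectedness of the interval does the rest.\<close>

lemma no_jump_const:
  assumes X: "cadlag X" and ab: "0 \<le> a" "a \<le> b" and nj: "\<And>t. t \<in> {a<..b} \<Longrightarrow> left_lim X t = X t" and t: "t \<in> {a..b}"
  shows "X t = X a"
proof -
  have "X a = X t"
  proof (rule connected_local_const[of "{a..b}"])
    show "\<forall>s\<in>{a..b}. eventually (\<lambda>u. X s = X u) (at s within {a..b})"
    proof
      fix s assume s: "s \<in> {a..b}"
      have "s \<ge> 0" using s ab by auto
      then obtain d1 where d1: "d1 > 0" "\<And>u. u \<in> {s..<s + d1} \<Longrightarrow> X u = X s" using cadlag_right[OF X] by blast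
      show "eventually (\<lambda>u. X s = X u) (at s within {a..b})"
      proof (cases "s = a")
        case True
        show ?thesis unfolding eventually_at
        proof (intro exI[of _ d1] conjI ballI impI)
          show "d1 > 0" by (rule d1)
          fix u assume "u \<in> {a..b}" "u \<noteq> s \<and> dist u s < d1"
          then have "X u = X s" using True by (intro d1(2)) (auto simp: dist_real_def)
          then show "X s = X u" ..
        qed
      next
        case False
        obtain d2 where d2: "d2 > 0" "\<And>u. u \<in> {s - d2<..<s} \<Longrightarrow> X u = left_lim X s"
          by (rule cadlag_left[OF X, of s]) (use s ab False in auto)
        have ls: "left_lim X s = X s" using nj s False by auto
        show ?thesis unfolding eventually_at
        proof (intro exI[of _ "min d1 d2"] conjI ballI impI)
          show "min d1 d2 > 0" using d1 d2 by simp
          fix u assume u: "u \<in> {a..b}" "u \<noteq> s \<and> dist u s < min d1 d2"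
          show "X s = X u"
          proof (cases "u < s")
            case True
            then have "X u = left_lim X s" using u by (intro d2(2)) (auto simp: dist_real_def)
            then show ?thesis using ls by simp
          next
            case False
            then have "u \<in> {s..<s + d1}" using u by (auto simp: dist_real_def)
            then show ?thesis by (rule d1(2)[symmetric])
          qed
        qed
      qed
    qed
  qed (use t ab in auto)
  then show ?thesis by simp
qed

text \<open>An accumulation point of jumps is impossible: the path is constant on a short interval
  to its right, and on a short interval strictly to its left.\<close>

lemma finite_jumps: assumes X: "cadlag X" shows "finite (jumps T X)"
proof (rule ccontr)
  assume "infinite (jumps T X)"
  moreover have "jumps T X \<subseteq> {0..T}" by (auto simp: jumps_def)
  ultimately obtain x where x: "x \<in> {0..T}" "x islimpt jumps T X"
    using compact_Icc[of 0 T] unfolding compact_eq_Bolzano_Weierstrass by blast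
  have "x \<ge> 0" using x by auto
  then obtain d1 where d1: "d1 > 0" "\<And>u. u \<in> {x..<x + d1} \<Longrightarrow> X u = X x" using cadlag_right[OF X] by blast
  \<comment> \<open>The restriction to \<open>u > 0\<close> covers \<open>x = 0\<close>, where no
    left limit is available.\<close>
  have "\<exists>d2>0. \<exists>v. \<forall>u\<in>{x - d2<..<x}. u > 0 \<longrightarrow> X u = v"
  proof (cases "x > 0")
    case True
    then have "\<exists>d>0. \<exists>v. \<forall>u\<in>{x - d<..<x}. X u = v" using X unfolding cadlag_def by blast
    then show ?thesis by blast
  next
    case False
    then show ?thesis using x by (intro exI[of _ 1]) auto
  qed
  then obtain d2 v where d2: "d2 > 0" "\<And>u. u \<in> {x - d2<..<x} \<Longrightarrow> u > 0 \<Longrightarrow> X u = v" by blast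
  define d where "d = min d1 d2"
  have d: "d > 0" using d1 d2 by (simp add: d_def)
  obtain y where y: "y \<in> jumps T X" "y \<noteq> x" "dist y x < d" using x(2) d unfolding islimpt_approachable by blast
  have y0: "y > 0" "left_lim X y \<noteq> X y" using y(1) by (auto simp: jumps_def)
  have "left_lim X y = X y"
  proof (cases "y > x")
    case True
    have yy: "y \<in> {x..<x + d1}" using y(3) True by (auto simp: d_def dist_real_def)
    show ?thesis
    proof (rule left_lim_eqI[OF y0(1), of "y - x"])
      show "y - x > 0" using True by simp
      fix u assume "u \<in> {y - (y - x)<..<y}"
      then have "X u = X x" using yy by (intro d1(2)) auto
      then show "X u = X y" using d1(2)[OF yy] by simp
    qed
  next
    case False
    then have yy: "y < x" "y \<in> {x - d2<..<x}" using y(2,3) by (auto simp: d_def dist_real_def)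
    define e where "e = min y (y - (x - d2))"
    show ?thesis
    proof (rule left_lim_eqI[OF y0(1), of e])
      show "e > 0" using y0 yy by (auto simp: e_def)
      fix u assume "u \<in> {y - e<..<y}"
      then have "u \<in> {x - d2<..<x}" "u > 0" using yy by (auto simp: e_def)
      then have "X u = v" by (rule d2(2))
      then show "X u = X y" using d2(2)[OF yy(2) y0(1)] by simp
    qed
  qed
  then show False using y0 by simp
qed

lemma single_jump:
  assumes X: "cadlag X" and a: "0 \<le> a" "a < u" "u \<le> b" and nj: "\<And>t. t \<in> {a<..b} \<Longrightarrow> t \<noteq> u \<Longrightarrow> left_lim X t = X t"
  shows "X a = left_lim X u" "X b = X u"
proof -
  obtain d where d: "d > 0" "\<And>s. s \<in> {u - d<..<u} \<Longrightarrow> X s = left_lim X u"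
    by (rule cadlag_left[OF X, of u]) (use a in auto)
  define s where "s = max a (u - d / 2)"
  have s: "s \<in> {u - d<..<u}" "a \<le> s" using a d by (auto simp: s_def)
  have "X s = X a" by (rule no_jump_const[OF X a(1) s(2)]) (use nj s a in auto)
  then show "X a = left_lim X u" using d(2)[OF s(1)] by simp
  show "X b = X u" by (rule no_jump_const[OF X]) (use nj a in auto)
qed

section \<open>Uniform grids\<close>

definition gp :: "real \<Rightarrow> nat \<Rightarrow> nat \<Rightarrow> real" where "gp T m i = real i * (T / real m)"

lemma gp_Suc: "gp T m (Suc i) = gp T m i + T / real m"
  unfolding gp_def by (simp only: of_nat_Suc distrib_right mult_1 add.commute)

lemma gp_bounds:
  assumes "T > 0" "m > 0" shows "0 \<le> gp T m i" "gp T m i < gp T m (Suc i)" "i \<le> m \<Longrightarrow> gp T m i \<le> T" "gp T m m = T"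
    "i \<le> j \<Longrightarrow> gp T m i \<le> gp T m j"
proof -
  show "0 \<le> gp T m i" "gp T m i < gp T m (Suc i)" using assms by (simp_all add: gp_def divide_simps)
  show "gp T m m = T" using assms by (simp add: gp_def)
  show mono: "i \<le> j \<Longrightarrow> gp T m i \<le> gp T m j" for j using assms unfolding gp_def by (intro mult_right_mono) auto
  show "i \<le> m \<Longrightarrow> gp T m i \<le> T" using mono[of m] \<open>gp T m m = T\<close> by simp
qed

text \<open>Cells are open on the left and closed on the right, so they partition
  \<open>{0<..T}\<close>, the range in which \<open>jumps\<close> are counted.\<close>

lemma gp_cell:
  assumes "T > 0" "m > 0" "t \<in> {0<..T}"
  shows "\<exists>!i. i < m \<and> t \<in> {gp T m i<..gp T m (Suc i)}"
proof -
  define d where "d = T / real m"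
  have d: "d > 0" using assms by (simp add: d_def)
  \<comment> \<open>The ceiling minus one, not the floor, since a grid point belongs to the cell on
    its left.\<close>
  define i where "i = nat (\<lceil>t / d\<rceil> - 1)"
  have pos: "\<lceil>t / d\<rceil> \<ge> 1" using d assms(3) by (simp add: less_ceiling_iff one_le_ceiling)
  have ri: "real i = of_int \<lceil>t / d\<rceil> - 1" using pos by (simp add: i_def)
  have b: "real i < t / d" "t / d \<le> real i + 1" using ri ceiling_correct[of "t / d"] by linarith+
  then have b': "real i * d < t" "t \<le> (real i + 1) * d" using d by (simp_all add: field_simps)
  have "real i * d < real m * d" using b'(1) assms by (simp add: d_def)
  then have im: "i < m" using d by simp
  show ?thesis
  proof (rule ex1I[of _ i])
    show "i < m \<and> t \<in> {gp T m i<..gp T m (Suc i)}" using im b' by (simp add: gp_def d_def[symmetric] add.commute)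
    fix j assume "j < m \<and> t \<in> {gp T m j<..gp T m (Suc j)}"
    then have "real j * d < t" "t \<le> (real j + 1) * d" by (auto simp: gp_def d_def[symmetric] add.commute)
    then have "real j * d < (real i + 1) * d" "real i * d < (real j + 1) * d" using b' by linarith+
    then have "real j < real i + 1" "real i < real j + 1" using d by simp_all
    then show "j = i" by linarith
  qed
qed

text \<open>A change over a cell requires a jump inside it, and cells are disjoint. The bound is
  uniform in \<open>m\<close>, which provides a dominating function for the grid
  functionals.\<close>

lemma grid_changes_le:
  assumes X: "cadlag X" and T: "T > 0" "m > 0"
  shows "card {i. i < m \<and> X (gp T m i) \<noteq> X (gp T m (Suc i))} \<le> card (jumps T X)"
proof -
  let ?A = "{i. i < m \<and> X (gp T m i) \<noteq> X (gp T m (Suc i))}"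
  have "\<forall>i\<in>?A. \<exists>t. t \<in> jumps T X \<and> t \<in> {gp T m i<..gp T m (Suc i)}"
  proof (rule ballI, rule ccontr)
    fix i assume i: "i \<in> ?A" and n: "\<not> (\<exists>t. t \<in> jumps T X \<and> t \<in> {gp T m i<..gp T m (Suc i)})"
    have "gp T m (Suc i) \<le> T" using gp_bounds(3)[OF T, of "Suc i"] i by simp
    have "X (gp T m (Suc i)) = X (gp T m i)"
    proof (rule no_jump_const[OF X gp_bounds(1)[OF T] less_imp_le[OF gp_bounds(2)[OF T]]])
      fix t assume t: "t \<in> {gp T m i<..gp T m (Suc i)}"
      then have "t \<in> {0<..T}" using gp_bounds(1)[OF T, of i] \<open>gp T m (Suc i) \<le> T\<close> by auto
      then show "left_lim X t = X t" using n t by (auto simp: jumps_def)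
    qed (use gp_bounds(2)[OF T, of i] in auto)
    then show False using i by simp
  qed
  from bchoice[OF this] obtain f where f: "\<And>i. i \<in> ?A \<Longrightarrow> f i \<in> jumps T X \<and> f i \<in> {gp T m i<..gp T m (Suc i)}" by blast
  have "inj_on f ?A"
  proof (rule inj_onI)
    fix i j assume ij: "i \<in> ?A" "j \<in> ?A" "f i = f j"
    have "f i \<in> {0<..T}" using f[OF ij(1)] by (auto simp: jumps_def)
    from gp_cell[OF T this] show "i = j" using f[OF ij(1)] f[OF ij(2)] ij by auto
  qed
  then show ?thesis by (rule card_inj_on_le) (use f finite_jumps[OF X] in auto)
qed

lemma finite_separated:
  fixes J :: "real set"
  assumes "finite J" shows "\<exists>h>0. \<forall>x\<in>J. \<forall>y\<in>J. x \<noteq> y \<longrightarrow> h \<le> \<bar>x - y\<bar>"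
proof -
  \<comment> \<open>1 is inserted so that the minimum exists even with fewer than two
    points.\<close>
  define D where "D = insert 1 ((\<lambda>(x, y). \<bar>x - y\<bar>) ` {(x, y) \<in> J \<times> J. x \<noteq> y})"
  have "finite {(x, y) \<in> J \<times> J. x \<noteq> y}" by (rule finite_subset[of _ "J \<times> J"]) (use assms in auto)
  then have fin: "finite D" unfolding D_def by simp
  have "Min D \<in> D" by (rule Min_in[OF fin]) (simp add: D_def)
  then have "Min D > 0" by (auto simp: D_def)
  moreover have "Min D \<le> \<bar>x - y\<bar>" if "x \<in> J" "y \<in> J" "x \<noteq> y" for x y
    by (rule Min_le[OF fin]) (use that in \<open>force simp: D_def\<close>)
  ultimately show ?thesis by blast
qed

text \<open>Once the mesh is below the smallest distance between jumps, each cell contains at most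
  one, and sending a cell with a change to its jump is a bijection.\<close>

lemma grid_jump_count:
  assumes X: "cadlag X" and T: "T > 0"
  shows "eventually (\<lambda>m. \<forall>y z. y \<noteq> z \<longrightarrow> card {i. i < m \<and> X (gp T m i) = y \<and> X (gp T m (Suc i)) = z} =
     card {t \<in> {0..T}. left_lim X t = y \<and> X t = z}) sequentially"
proof -
  obtain h where h: "h > 0" "\<And>x y. x \<in> jumps T X \<Longrightarrow> y \<in> jumps T X \<Longrightarrow> x \<noteq> y \<Longrightarrow> h \<le> \<bar>x - y\<bar>"
    using finite_separated[OF finite_jumps[OF X, of T]] by blast
  have "(\<lambda>m. T / real m) \<longlonglongrightarrow> 0" by (rule real_tendsto_divide_at_top[OF tendsto_const filterlim_real_sequentially])
  then have "eventually (\<lambda>m. T / real m < h) sequentially" using h(1) by (rule order_tendstoD(2))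
  then show ?thesis using eventually_gt_at_top[of 0]
  proof eventually_elim
    case (elim m)
    note m = elim(2)
    show ?case
    proof (intro allI impI)
      fix y z :: 'a assume yz: "y \<noteq> z"
      let ?A = "{i. i < m \<and> X (gp T m i) = y \<and> X (gp T m (Suc i)) = z}"
      let ?B = "{t \<in> {0..T}. left_lim X t = y \<and> X t = z}"
      \<comment> \<open>\<open>y \<noteq> z\<close> rules out time 0, where \<open>left_lim\<close>
        equals the value.\<close>
      have BJ: "?B \<subseteq> jumps T X" using yz by (auto simp: jumps_def left_lim_def)
      have cellT: "{gp T m i<..gp T m (Suc i)} \<subseteq> {0<..T}" if "i < m" for i
        using gp_bounds(1)[OF T m, of i] gp_bounds(3)[OF T m, of "Suc i"] that by auto
      have cell1: "u = t" if "u \<in> jumps T X" "t \<in> jumps T X" "u \<in> {gp T m i<..gp T m (Suc i)}" "t \<in> {gp T m i<..gp T m (Suc i)}" for u t i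
      proof (rule ccontr)
        assume "u \<noteq> t"
        then have "h \<le> \<bar>u - t\<bar>" using h(2) that by blast
        moreover have "\<bar>u - t\<bar> < T / real m" using that(3,4) unfolding gp_Suc by auto
        ultimately show False using elim(1) by simp
      qed
      have jc: "X (gp T m i) = left_lim X t \<and> X (gp T m (Suc i)) = X t"
        if "i < m" "t \<in> jumps T X" "t \<in> {gp T m i<..gp T m (Suc i)}" for i t
      proof -
        have nj: "left_lim X u = X u" if u: "u \<in> {gp T m i<..gp T m (Suc i)}" "u \<noteq> t" for u
        proof (rule ccontr)
          assume "left_lim X u \<noteq> X u"
          then have "u \<in> jumps T X" using u(1) cellT[OF \<open>i < m\<close>] by (auto simp: jumps_def)
          from cell1[OF this \<open>t \<in> jumps T X\<close> u(1) \<open>t \<in> {gp T m i<..gp T m (Suc i)}\<close>] show False using u(2) by simp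
        qed
        show ?thesis using single_jump[OF X gp_bounds(1)[OF T m], of i t "gp T m (Suc i)"] that nj by auto
      qed
      have "\<forall>i\<in>?A. \<exists>t. t \<in> jumps T X \<and> t \<in> {gp T m i<..gp T m (Suc i)}"
      proof (rule ballI, rule ccontr)
        fix i assume i: "i \<in> ?A" and n: "\<not> (\<exists>t. t \<in> jumps T X \<and> t \<in> {gp T m i<..gp T m (Suc i)})"
        have "X (gp T m (Suc i)) = X (gp T m i)"
        proof (rule no_jump_const[OF X gp_bounds(1)[OF T m] less_imp_le[OF gp_bounds(2)[OF T m]]])
          fix t assume t: "t \<in> {gp T m i<..gp T m (Suc i)}"
          then have "t \<in> {0<..T}" using subsetD[OF cellT[of i] t] i by auto
          then show "left_lim X t = X t" using n t by (auto simp: jumps_def)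
        qed (use gp_bounds(2)[OF T m, of i] in auto)
        then show False using i yz by auto
      qed
      from bchoice[OF this] obtain f where f: "\<And>i. i \<in> ?A \<Longrightarrow> f i \<in> jumps T X \<and> f i \<in> {gp T m i<..gp T m (Suc i)}" by blast
      have fB: "f i \<in> ?B" if "i \<in> ?A" for i
        using jc[of i "f i"] f[OF that] that by (auto simp: jumps_def)
      have "bij_betw f ?A ?B"
      proof (rule bij_betwI')
        fix i j assume ij: "i \<in> ?A" "j \<in> ?A"
        have "f i \<in> {0<..T}" using f[OF ij(1)] by (auto simp: jumps_def)
        from gp_cell[OF T m this] show "(f i = f j) = (i = j)" using f[OF ij(1)] f[OF ij(2)] ij by auto
      next
        fix t assume t: "t \<in> ?B"
        then have tJ: "t \<in> jumps T X" using BJ by blast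
        then have "t \<in> {0<..T}" by (auto simp: jumps_def)
        then obtain i where i: "i < m" "t \<in> {gp T m i<..gp T m (Suc i)}" using gp_cell[OF T m] by blast
        have iA: "i \<in> ?A" using jc[OF i(1) tJ i(2)] t i(1) by auto
        have "f i = t" using cell1[of "f i" t i] f[OF iA] tJ i(2) by blast
        then show "\<exists>i\<in>?A. t = f i" using iA by blast
      qed (use fB in blast)
      then show "card ?A = card ?B" by (rule bij_betw_same_card)
    qed
  qed
qed

text \<open>The path is sampled at right endpoints of cells, so constancy just to the right of each
  time makes the step functions eventually equal to the indicator; domination by the indicator of
  \<open>{0..T}\<close> concludes.\<close>

lemma grid_occupation:
  assumes X: "cadlag X" and T: "T > 0"
  shows "(\<lambda>m. real (card {i. i < m \<and> X (gp T m (Suc i)) = y}) * (T / real m)) \<longlonglongrightarrow> measure lborel {t \<in> {0..T}. X t = y}"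
proof -
  define f :: "nat \<Rightarrow> real \<Rightarrow> real" where "f m t = (\<Sum>i<m. (if X (gp T m (Suc i)) = y then 1 else 0) * indicator {gp T m i<..gp T m (Suc i)} t)" for m and t :: real
  define f0 where "f0 t = (indicator {t \<in> {0<..T}. X t = y} t :: real)" for t
  have fval: "f m t = (if X (gp T m (Suc i)) = y then 1 else 0)" if m: "m > 0" "i < m" "t \<in> {gp T m i<..gp T m (Suc i)}" for m i t
  proof -
    have tT: "t \<in> {0<..T}" using gp_bounds(1)[OF T m(1), of i] gp_bounds(3)[OF T m(1), of "Suc i"] m by auto
    have "indicator {gp T m j<..gp T m (Suc j)} t = (if j = i then 1 else 0 :: real)" if "j < m" for j
      using gp_cell[OF T m(1) tT] that m by (auto simp: indicator_def)
    then have "f m t = (\<Sum>j<m. (if X (gp T m (Suc j)) = y then 1 else 0) * (if j = i then 1 else 0))"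
      unfolding f_def by (intro sum.cong) auto
    also have "\<dots> = (if X (gp T m (Suc i)) = y then 1 else 0)" using m(2) by (subst sum.remove[of _ i]) auto
    finally show ?thesis .
  qed
  have f0': "f m t = 0" if "m > 0" "t \<notin> {0<..T}" for m t
  proof -
    have "indicator {gp T m j<..gp T m (Suc j)} t = (0::real)" if "j < m" for j
      using gp_bounds(1)[OF T \<open>m > 0\<close>, of j] gp_bounds(3)[OF T \<open>m > 0\<close>, of "Suc j"] that \<open>t \<notin> {0<..T}\<close> by (auto simp: indicator_def)
    then show ?thesis unfolding f_def by (intro sum.neutral) auto
  qed
  have lim: "(\<lambda>m. f (Suc m) t) \<longlonglongrightarrow> f0 t" for t
  proof (cases "t \<in> {0<..T}")
    case False
    then have "f (Suc m) t = 0" for m by (intro f0') auto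
    moreover have "f0 t = 0" using False by (auto simp: f0_def indicator_def)
    ultimately show ?thesis by simp
  next
    case True
    then have "t \<ge> 0" by auto
    then obtain d where d: "d > 0" "\<And>u. u \<in> {t..<t + d} \<Longrightarrow> X u = X t" using cadlag_right[OF X] by blast
    have "(\<lambda>m. T / real (Suc m)) \<longlonglongrightarrow> 0"
      by (rule LIMSEQ_Suc, rule real_tendsto_divide_at_top[OF tendsto_const filterlim_real_sequentially])
    then have "eventually (\<lambda>m. T / real (Suc m) < d) sequentially" using d(1) by (rule order_tendstoD(2))
    then have "eventually (\<lambda>m. f (Suc m) t = f0 t) sequentially"
    proof eventually_elim
      case (elim m)
      obtain i where i: "i < Suc m" "t \<in> {gp T (Suc m) i<..gp T (Suc m) (Suc i)}" using gp_cell[OF T _ True, of "Suc m"] by auto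
      then have "gp T (Suc m) (Suc i) \<in> {t..<t + d}" using elim unfolding gp_Suc by auto
      then have "X (gp T (Suc m) (Suc i)) = X t" by (rule d(2))
      then show ?case using fval[OF _ i] True by (simp add: f0_def)
    qed
    then show ?thesis by (rule tendsto_eventually)
  qed
  have tmod: "f m \<in> borel_measurable lborel" for m unfolding f_def by measurable
  have f0m: "f0 \<in> borel_measurable lborel"
    by (rule borel_measurable_LIMSEQ_real[OF lim]) (rule tmod)
  have fb: "norm (f (Suc m) t) \<le> indicator {0..T} t" for m t
  proof (cases "t \<in> {0<..T}")
    case True
    then obtain i where i: "i < Suc m" "t \<in> {gp T (Suc m) i<..gp T (Suc m) (Suc i)}" using gp_cell[OF T, of "Suc m" t] by auto
    show ?thesis using fval[OF _ i] True by (auto simp: indicator_def)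
  qed (use f0'[of "Suc m" t] in \<open>auto simp: indicator_def\<close>)
  have wi: "integrable lborel (\<lambda>t. indicator {0..T} t :: real)"
    using set_integrable_bounded[of "\<lambda>_. 1" 0 T 1] by (simp add: set_integrable_def)
  have conv: "(\<lambda>m. LINT t|lborel. f (Suc m) t) \<longlonglongrightarrow> (LINT t|lborel. f0 t)"
    by (rule integral_dominated_convergence[OF f0m tmod wi]) (use lim fb in auto)
  have "{t \<in> {0<..T}. X t = y} = f0 -` {1} \<inter> space lborel" by (auto simp: f0_def indicator_def)
  then have S: "{t \<in> {0<..T}. X t = y} \<in> sets lborel" using measurable_sets[OF f0m, of "{1}"] by simp
  have "(LINT t|lborel. f0 t) = measure lborel {t \<in> {0<..T}. X t = y}" unfolding f0_def using S by simp
  also have "\<dots> = measure lborel {t \<in> {0..T}. X t = y}"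
  proof -
    have n0: "{0::real} \<inter> {t. X t = y} \<in> null_sets lborel" by (intro countable_imp_null_set_lborel) auto
    have e: "{t \<in> {0..T}. X t = y} = {t \<in> {0<..T}. X t = y} \<union> ({0} \<inter> {t. X t = y})" using T by (auto simp: less_le)
    show ?thesis unfolding e using S n0 by (simp add: measure_Un_null_set)
  qed
  finally have L: "(LINT t|lborel. f0 t) = measure lborel {t \<in> {0..T}. X t = y}" .
  have "(LINT t|lborel. f (Suc m) t) = real (card {i. i < Suc m \<and> X (gp T (Suc m) (Suc i)) = y}) * (T / real (Suc m))" for m
  proof -
    have len: "measure lborel {gp T (Suc m) i<..gp T (Suc m) (Suc i)} = T / real (Suc m)" for i
      using gp_bounds(2)[OF T, of "Suc m" i] by (simp add: gp_Suc)
    have fin: "emeasure lborel {gp T (Suc m) i<..gp T (Suc m) (Suc i)} < \<infinity>" for i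
      using gp_bounds(2)[OF T, of "Suc m" i] by simp
    have "(LINT t|lborel. f (Suc m) t) = (\<Sum>i<Suc m. LINT t|lborel. (if X (gp T (Suc m) (Suc i)) = y then 1 else 0) * indicator {gp T (Suc m) i<..gp T (Suc m) (Suc i)} t)"
      unfolding f_def by (rule Bochner_Integration.integral_sum) (use fin in \<open>auto intro!: integrable_mult_right\<close>)
    also have "\<dots> = (\<Sum>i<Suc m. (if X (gp T (Suc m) (Suc i)) = y then 1 else 0) * (T / real (Suc m)))"
      by (intro sum.cong refl) (simp add: len)
    also have "\<dots> = (\<Sum>i<Suc m. (if X (gp T (Suc m) (Suc i)) = y then 1 else 0)) * (T / real (Suc m))"
      by (rule sum_distrib_right[symmetric])
    also have "(\<Sum>i<Suc m. (if X (gp T (Suc m) (Suc i)) = y then 1 else 0 :: real)) = real (card {i. i < Suc m \<and> X (gp T (Suc m) (Suc i)) = y})"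
      by (subst sum.inter_filter[symmetric]) (auto simp: lessThan_def Collect_conj_eq)
    finally show ?thesis .
  qed
  then have "(\<lambda>m. real (card {i. i < Suc m \<and> X (gp T (Suc m) (Suc i)) = y}) * (T / real (Suc m))) \<longlonglongrightarrow> measure lborel {t \<in> {0..T}. X t = y}"
    using conv L by simp
  then show ?thesis by (rule LIMSEQ_imp_Suc)
qed

context periodic_rates
begin

section \<open>The transition kernel and the Markov property\<close>

text \<open>\<open>gen\<close> written with the periodic extension of the rates; the sum may include
  the diagonal, which is zero.\<close>

definition gen_ext :: "real \<Rightarrow> 'v \<Rightarrow> 'v \<Rightarrow> real" where
  "gen_ext u w z = (if w = z then - (\<Sum>z'\<in>UNIV. R u w z') else R u w z)"

lemma gen_GR: assumes "u \<ge> 0" shows "gen r u w z = gen_ext u w z"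
proof -
  have "(\<Sum>z'\<in>UNIV - {w}. R u w z') = (\<Sum>z'\<in>UNIV. R u w z')"
    by (rule sum.mono_neutral_left) (auto simp: R_diag)
  then show ?thesis using assms by (auto simp: gen_def gen_ext_def R_eq)
qed

lemma gen_ext_meas [measurable]: "(\<lambda>u. gen_ext u w z) \<in> borel_measurable borel"
  unfolding gen_ext_def by measurable

lemma gen_ext_bound: obtains c where "c > 0" "\<And>u w z. \<bar>gen_ext u w z\<bar> \<le> c"
proof -
  obtain C where C: "C > 0" "\<And>t y z. R t y z \<le> C" by (rule R_bound) blast
  define D where "D = (\<Sum>w\<in>(UNIV::'v set). C)"
  have CD: "C \<le> D" unfolding D_def by (rule member_le_sum[where f = "\<lambda>_. C"]) (use C in auto)
  have "\<bar>gen_ext u w z\<bar> \<le> D" for u w z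
  proof (cases "w = z")
    case True
    have "(\<Sum>z'\<in>UNIV. R u w z') \<le> D" unfolding D_def by (intro sum_mono C)
    moreover have "(\<Sum>z'\<in>UNIV. R u w z') \<ge> 0" by (intro sum_nonneg R_nonneg)
    ultimately show ?thesis using True by (simp add: gen_ext_def)
  next
    case False
    then show ?thesis using CD C(2)[of u w z] R_nonneg[of u w z] by (simp add: gen_ext_def)
  qed
  then show thesis using that[of D] CD C(1) by force
qed

text \<open>The kernel comes only with its forward equation. The largest row sum \<open>M\<close> of
  absolute values over a short interval satisfies \<open>M \<le> 1 + M / 2\<close>, so
  \<open>M \<le> 2\<close>; the equation then gives the first-order bound, and inserting this into
  the equation gives the second-order one.\<close>

lemma kernel_estimate:
  assumes fk: "forward_kernel r K"
  obtains c d0 where "c > 0" "d0 > 0"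
    "\<And>s t y z. 0 \<le> s \<Longrightarrow> s \<le> t \<Longrightarrow> t - s \<le> d0 \<Longrightarrow> \<bar>K s t y z - (if y = z then 1 else 0)\<bar> \<le> c * (t - s)"
    "\<And>s t y z. 0 \<le> s \<Longrightarrow> s \<le> t \<Longrightarrow> t - s \<le> d0 \<Longrightarrow>
      \<bar>K s t y z - (if y = z then 1 else 0) - (LINT u:{s..t}|lborel. gen_ext u y z)\<bar> \<le> c * (t - s)\<^sup>2"
proof -
  obtain c1 where c1: "c1 > 0" "\<And>u w z. \<bar>gen_ext u w z\<bar> \<le> c1" by (rule gen_ext_bound) blast
  define n where "n = real CARD('v)"
  have n: "n \<ge> 1" unfolding n_def by (simp add: Suc_leI)
  \<comment> \<open>Chosen so that \<open>n * c1 * d0 = 1 / 2\<close>, which lets the bound on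
    \<open>M\<close> below absorb itself.\<close>
  define d0 where "d0 = 1 / (2 * n * c1)"
  have d0: "d0 > 0" using n c1 by (simp add: d0_def)
  define c where "c = 2 * c1 + 2 * n * c1 * c1"
  have c: "c > 0" "2 * c1 \<le> c" "2 * n * c1 * c1 \<le> c" using n c1 by (auto simp: c_def add_pos_pos)
  let ?d = "\<lambda>y z. (if y = z then 1 else 0 :: real)"
  have main: "\<bar>K s t y z - ?d y z\<bar> \<le> 2 * c1 * (t - s) \<and>
      \<bar>K s t y z - ?d y z - (LINT u:{s..t}|lborel. gen_ext u y z)\<bar> \<le> 2 * n * c1 * c1 * (t - s)\<^sup>2"
    if st: "0 \<le> s" "s \<le> t" "t - s \<le> d0" for s t y z
  proof -
    define f where "f z u = (\<Sum>w\<in>UNIV. K s u y w * gen r u w z)" for z u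
    have fi: "set_integrable lborel {s..u} (f z)" if "s \<le> u" for u z
      using fk st(1) that unfolding forward_kernel_def f_def by blast
    have Keq: "K s u y z = ?d y z + (LINT v:{s..u}|lborel. f z v)" if "s \<le> u" for u z
      using fk st(1) that unfolding forward_kernel_def f_def by blast
    have Kc: "continuous_on {s..t} (\<lambda>u. K s u y z)" for z
    proof -
      have "continuous_on {s..t} (\<lambda>u. ?d y z + integral {s..u} (f z))"
        by (intro continuous_intros indefinite_integral_continuous_1 set_borel_integral_eq_integral(1) fi st)
      then show ?thesis
        by (rule continuous_on_eq) (use Keq set_borel_integral_eq_integral(2)[OF fi] in auto)
    qed
    define \<kappa> where "\<kappa> u = (\<Sum>w\<in>UNIV. \<bar>K s u y w\<bar>)" for u
    have "continuous_on {s..t} \<kappa>" unfolding \<kappa>_def by (intro continuous_intros Kc)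
    then obtain us where us: "us \<in> {s..t}" "\<And>u. u \<in> {s..t} \<Longrightarrow> \<kappa> u \<le> \<kappa> us"
      using continuous_attains_sup[OF compact_Icc _ \<open>continuous_on {s..t} \<kappa>\<close>] st by auto
    define M where "M = \<kappa> us"
    have M0: "M \<ge> 0" unfolding M_def \<kappa>_def by (intro sum_nonneg) auto
    have fb: "\<bar>f z u\<bar> \<le> c1 * M" if "u \<in> {s..t}" for z u
    proof -
      have u0: "u \<ge> 0" using that st by auto
      have "\<bar>f z u\<bar> \<le> (\<Sum>w\<in>UNIV. \<bar>K s u y w\<bar> * c1)"
        unfolding f_def gen_GR[OF u0]
        by (rule order_trans[OF sum_abs], rule sum_mono) (use c1 in \<open>auto simp: abs_mult intro!: mult_left_mono\<close>)
      also have "\<dots> = c1 * \<kappa> u" by (simp add: \<kappa>_def sum_distrib_left mult.commute)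
      also have "\<dots> \<le> c1 * M" unfolding M_def using us(2)[OF that] c1 by (intro mult_left_mono) auto
      finally show ?thesis .
    qed
    have Kd: "\<bar>K s u y z - ?d y z\<bar> \<le> c1 * M * (t - s)" if u: "u \<in> {s..t}" for u z
    proof -
      have "\<bar>LINT v:{s..u}|lborel. f z v\<bar> \<le> c1 * M * (u - s)"
        by (rule set_integral_abs_le[OF fi]) (use u fb in auto)
      also have "\<dots> \<le> c1 * M * (t - s)" using u c1 M0 by (intro mult_left_mono) auto
      finally show ?thesis using Keq[of u z] u by simp
    qed
    have "M \<le> (\<Sum>w\<in>UNIV. ?d y w + c1 * M * (t - s))"
      unfolding M_def \<kappa>_def
    proof (rule sum_mono)
      fix w
      have "\<bar>K s us y w\<bar> \<le> \<bar>?d y w\<bar> + \<bar>K s us y w - ?d y w\<bar>" by linarith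
      then show "\<bar>K s us y w\<bar> \<le> ?d y w + c1 * (\<Sum>w\<in>UNIV. \<bar>K s us y w\<bar>) * (t - s)"
        using Kd[OF us(1), of w] unfolding M_def \<kappa>_def by (auto split: if_splits)
    qed
    also have "\<dots> = 1 + n * (c1 * M * (t - s))" by (simp add: sum.distrib n_def)
    also have "n * (c1 * M * (t - s)) \<le> n * (c1 * M * d0)" using n c1 M0 st by (intro mult_left_mono) auto
    also have "n * (c1 * M * d0) = M / 2" using n c1 by (simp add: d0_def)
    finally have M2: "M \<le> 2" by simp
    have Kd2: "\<bar>K s u y z - ?d y z\<bar> \<le> 2 * c1 * (t - s)" if u: "u \<in> {s..t}" for u z
    proof -
      have "c1 * M * (t - s) \<le> c1 * 2 * (t - s)" using c1 M2 st by (intro mult_right_mono mult_left_mono) auto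
      then show ?thesis using Kd[OF u, of z] by simp
    qed
    have GRi: "set_integrable lborel {s..t} (\<lambda>u. gen_ext u y z)"
      by (rule set_integrable_bounded[OF gen_ext_meas c1(2)])
    have "K s t y z - ?d y z - (LINT u:{s..t}|lborel. gen_ext u y z) = (LINT u:{s..t}|lborel. f z u - gen_ext u y z)"
      using Keq[OF st(2), of z] set_integral_diff(2)[OF fi[OF st(2)] GRi] by simp
    also have "\<bar>\<dots>\<bar> \<le> (n * (2 * c1 * (t - s) * c1)) * (t - s)"
    proof (rule set_integral_abs_le[OF set_integral_diff(1)[OF fi[OF st(2)] GRi] _ st(2)])
      fix u assume u: "u \<in> {s..t}"
      have u0: "u \<ge> 0" using u st by auto
      have "gen_ext u y z = (\<Sum>w\<in>UNIV. ?d y w * gen_ext u w z)" by (simp add: if_distrib[of "\<lambda>a. a * _"] cong: if_cong)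
      then have "f z u - gen_ext u y z = (\<Sum>w\<in>UNIV. (K s u y w - ?d y w) * gen_ext u w z)"
        unfolding f_def gen_GR[OF u0] by (simp only: left_diff_distrib sum_subtractf)
      also have "\<bar>\<dots>\<bar> \<le> (\<Sum>w\<in>(UNIV::'v set). 2 * c1 * (t - s) * c1)"
        by (rule order_trans[OF sum_abs], rule sum_mono, unfold abs_mult, rule mult_mono)
           (use Kd2[OF u] c1(2) c1(1) st in \<open>auto\<close>)
      finally show "\<bar>f z u - gen_ext u y z\<bar> \<le> n * (2 * c1 * (t - s) * c1)" by (simp add: n_def)
    qed
    finally have "\<bar>K s t y z - ?d y z - (LINT u:{s..t}|lborel. gen_ext u y z)\<bar> \<le> 2 * n * c1 * c1 * (t - s)\<^sup>2"
      by (simp add: power2_eq_square mult_ac)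
    moreover have "t \<in> {s..t}" using st by simp
    ultimately show ?thesis using Kd2 by blast
  qed
  show thesis
  proof (rule that[OF c(1) d0])
    fix s t y z assume st: "0 \<le> s" "s \<le> t" "t - s \<le> d0"
    have "2 * c1 * (t - s) \<le> c * (t - s)" using st c by (intro mult_right_mono) auto
    then show "\<bar>K s t y z - ?d y z\<bar> \<le> c * (t - s)" using main[OF st, of y z] by linarith
    have "2 * n * c1 * c1 * (t - s)\<^sup>2 \<le> c * (t - s)\<^sup>2" using c by (intro mult_right_mono) auto
    then show "\<bar>K s t y z - ?d y z - (LINT u:{s..t}|lborel. gen_ext u y z)\<bar> \<le> c * (t - s)\<^sup>2" using main[OF st, of y z] by linarith
  qed
qed

end

locale periodic_chain = periodic_rates r T0 + prob_space M
  for r :: "'v::finite \<Rightarrow> 'v \<Rightarrow> real \<Rightarrow> real" and T0 :: real and M :: "'a measure" +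
  fixes x :: 'v and \<xi> :: "'a \<Rightarrow> real \<Rightarrow> 'v" and K :: "real \<Rightarrow> real \<Rightarrow> 'v \<Rightarrow> 'v \<Rightarrow> real"
  assumes xi_meas: "\<And>t. (\<lambda>\<omega>. \<xi> \<omega> t) \<in> measurable M (count_space UNIV)"
    and xi_cadlag: "\<And>\<omega>. \<omega> \<in> space M \<Longrightarrow> cadlag (\<xi> \<omega>)"
    and fk: "forward_kernel r K"
    and fdd: "\<And>k tt yy. tt 0 = 0 \<Longrightarrow> yy 0 = x \<Longrightarrow> (\<And>i. i < k \<Longrightarrow> tt i \<le> tt (Suc i)) \<Longrightarrow>
      measure M {\<omega>\<in>space M. \<forall>i\<in>{1..k::nat}. \<xi> \<omega> (tt i) = yy i} = (\<Prod>i\<in>{1..k}. K (tt (i - 1)) (tt i) (yy (i - 1)) (yy i))"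
begin

section \<open>Skeletons of the chain and integrating out the last step\<close>

context
  fixes tt :: "nat \<Rightarrow> real"
  assumes tt0: "tt 0 = 0" and tt_mono: "\<And>i. tt i \<le> tt (Suc i)"
begin

text \<open>The start is pinned to \<open>x\<close> because the finite-dimensional distributions only involve indices from 1 on;
  \<open>\<xi> \<omega> 0 = x\<close> holds almost surely.\<close>

definition skel :: "nat \<Rightarrow> 'a \<Rightarrow> 'v" where "skel i \<omega> = (if i = 0 then x else \<xi> \<omega> (tt i))"

definition ext :: "(nat \<Rightarrow> 'v) \<Rightarrow> nat \<Rightarrow> 'v" where "ext s i = (if i = 0 then x else s i)"

definition cyl :: "nat \<Rightarrow> (nat \<Rightarrow> 'v) \<Rightarrow> 'a set" where
  "cyl k s = {\<omega>\<in>space M. \<forall>i\<in>{1..k}. \<xi> \<omega> (tt i) = s i}"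

definition skel_paths :: "nat \<Rightarrow> (nat \<Rightarrow> 'v) set" where "skel_paths k = PiE {1..k} (\<lambda>_. UNIV)"

lemma skel_paths_finite: "finite (skel_paths k)" unfolding skel_paths_def by (intro finite_PiE) auto

lemma xi_event: "{\<omega>\<in>space M. \<xi> \<omega> t = y} \<in> events"
proof -
  have "(\<lambda>\<omega>. \<xi> \<omega> t) -` {y} \<inter> space M \<in> events" using xi_meas by (rule measurable_sets) simp
  moreover have "(\<lambda>\<omega>. \<xi> \<omega> t) -` {y} \<inter> space M = {\<omega>\<in>space M. \<xi> \<omega> t = y}" by auto
  ultimately show ?thesis by simp
qed

lemma cyl_event: "cyl k s \<in> events"
  unfolding cyl_def by (rule sets.sets_Collect_finite_All) (use xi_event in auto)

text \<open>The state space is finite, so a functional of finitely many skeleton points is a finite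
  combination of cylinder indicators, and its expectation a finite sum of finite-dimensional
  probabilities.\<close>

lemma cyl_expand:
  assumes dep: "\<And>a b. (\<And>i. i \<le> k \<Longrightarrow> a i = b i) \<Longrightarrow> G a = (G b :: real)" and w: "\<omega> \<in> space M"
  shows "G (\<lambda>i. skel i \<omega>) = (\<Sum>s\<in>skel_paths k. G (ext s) * indicator (cyl k s) \<omega>)"
proof -
  define s0 where "s0 = restrict (\<lambda>i. \<xi> \<omega> (tt i)) {1..k}"
  have s0: "s0 \<in> skel_paths k" by (simp add: s0_def skel_paths_def)
  have ind: "indicator (cyl k s) \<omega> = (if s = s0 then 1 else 0 :: real)" if "s \<in> skel_paths k" for s
  proof -
    have "\<omega> \<in> cyl k s \<longleftrightarrow> s = s0"
    proof
      assume "\<omega> \<in> cyl k s"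
      then have "\<forall>i\<in>{1..k}. s i = s0 i" by (auto simp: cyl_def s0_def)
      then show "s = s0" using that s0 unfolding skel_paths_def by (intro PiE_ext[of s "{1..k}" _ s0]) auto
    next
      assume "s = s0" then show "\<omega> \<in> cyl k s" using w by (auto simp: cyl_def s0_def)
    qed
    then show ?thesis by (simp add: indicator_def)
  qed
  have "(\<Sum>s\<in>skel_paths k. G (ext s) * indicator (cyl k s) \<omega>) = (\<Sum>s\<in>skel_paths k. if s = s0 then G (ext s) else 0)"
    by (intro sum.cong refl) (simp add: ind)
  also have "\<dots> = G (ext s0)" using s0 skel_paths_finite by simp
  also have "\<dots> = G (\<lambda>i. skel i \<omega>)" by (rule dep) (auto simp: ext_def skel_def s0_def)
  finally show ?thesis by simp
qed

lemma cyl_prob: "prob (cyl k s) = (\<Prod>i\<in>{1..k}. K (tt (i - 1)) (tt i) (ext s (i - 1)) (ext s i))"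
proof -
  have "cyl k s = {\<omega>\<in>space M. \<forall>i\<in>{1..k}. \<xi> \<omega> (tt i) = ext s i}" by (auto simp: cyl_def ext_def)
  then show ?thesis using fdd[of tt "ext s" k] tt0 tt_mono by (simp add: ext_def)
qed

lemma cyl_prob_Suc: "prob (cyl k s \<inter> {\<omega>\<in>space M. \<xi> \<omega> (tt (Suc k)) = z}) = prob (cyl k s) * K (tt k) (tt (Suc k)) (ext s k) z"
proof -
  define s' where "s' = s(Suc k := z)"
  have "cyl k s \<inter> {\<omega>\<in>space M. \<xi> \<omega> (tt (Suc k)) = z} = cyl (Suc k) s'"
  proof -
    have "{1..Suc k} = insert (Suc k) {1..k}" by auto
    then show ?thesis unfolding cyl_def by (auto simp: s'_def)
  qed
  then have "prob (cyl k s \<inter> {\<omega>\<in>space M. \<xi> \<omega> (tt (Suc k)) = z}) = (\<Prod>i\<in>{1..Suc k}. K (tt (i - 1)) (tt i) (ext s' (i - 1)) (ext s' i))"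
    using cyl_prob[of "Suc k" s'] by simp
  also have "\<dots> = (\<Prod>i\<in>{1..k}. K (tt (i - 1)) (tt i) (ext s' (i - 1)) (ext s' i)) * K (tt k) (tt (Suc k)) (ext s' k) (ext s' (Suc k))"
    by simp
  also have "(\<Prod>i\<in>{1..k}. K (tt (i - 1)) (tt i) (ext s' (i - 1)) (ext s' i)) = prob (cyl k s)"
    unfolding cyl_prob by (intro prod.cong refl) (auto simp: ext_def s'_def)
  also have "ext s' k = ext s k" by (auto simp: ext_def s'_def)
  also have "ext s' (Suc k) = z" by (auto simp: ext_def s'_def)
  finally show ?thesis .
qed

lemma path_integrable:
  assumes dep: "\<And>a b. (\<And>i. i \<le> k \<Longrightarrow> a i = b i) \<Longrightarrow> G a = (G b :: real)"
  shows "integrable M (\<lambda>\<omega>. G (\<lambda>i. skel i \<omega>))" "expectation (\<lambda>\<omega>. G (\<lambda>i. skel i \<omega>)) = (\<Sum>s\<in>skel_paths k. G (ext s) * prob (cyl k s))"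
proof -
  have i: "integrable M (\<lambda>\<omega>. G (ext s) * indicator (cyl k s) \<omega>)" for s
    using cyl_event by (intro integrable_mult_right) (simp add: emeasure_eq_measure)
  have c: "integrable M (\<lambda>\<omega>. G (\<lambda>i. skel i \<omega>)) \<longleftrightarrow> integrable M (\<lambda>\<omega>. \<Sum>s\<in>skel_paths k. G (ext s) * indicator (cyl k s) \<omega>)"
    by (rule Bochner_Integration.integrable_cong) (use cyl_expand[of k G, OF dep] in auto)
  show "integrable M (\<lambda>\<omega>. G (\<lambda>i. skel i \<omega>))" unfolding c by (intro Bochner_Integration.integrable_sum i)
  have "expectation (\<lambda>\<omega>. G (\<lambda>i. skel i \<omega>)) = expectation (\<lambda>\<omega>. \<Sum>s\<in>skel_paths k. G (ext s) * indicator (cyl k s) \<omega>)"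
    by (rule Bochner_Integration.integral_cong) (use cyl_expand[of k G, OF dep] in auto)
  also have "\<dots> = (\<Sum>s\<in>skel_paths k. expectation (\<lambda>\<omega>. G (ext s) * indicator (cyl k s) \<omega>))" by (rule Bochner_Integration.integral_sum[OF i])
  also have "\<dots> = (\<Sum>s\<in>skel_paths k. G (ext s) * prob (cyl k s))" using cyl_event by (intro sum.cong refl) simp
  finally show "expectation (\<lambda>\<omega>. G (\<lambda>i. skel i \<omega>)) = (\<Sum>s\<in>skel_paths k. G (ext s) * prob (cyl k s))" .
qed

text \<open>The Markov property, read off from the product form of the finite-dimensional
  distributions by extending each cylinder by one time.\<close>

lemma markov_step:
  assumes dep: "\<And>a b. (\<And>i. i \<le> k \<Longrightarrow> a i = b i) \<Longrightarrow> G a = (G b :: real)"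
  shows "expectation (\<lambda>\<omega>. G (\<lambda>i. skel i \<omega>) * (if skel (Suc k) \<omega> = z then 1 else 0)) =
    expectation (\<lambda>\<omega>. G (\<lambda>i. skel i \<omega>) * K (tt k) (tt (Suc k)) (skel k \<omega>) z)"
proof -
  let ?B = "{\<omega>\<in>space M. \<xi> \<omega> (tt (Suc k)) = z}"
  have ev: "cyl k s \<inter> ?B \<in> events" for s using cyl_event xi_event by (intro sets.Int)
  have "expectation (\<lambda>\<omega>. G (\<lambda>i. skel i \<omega>) * (if skel (Suc k) \<omega> = z then 1 else 0)) = expectation (\<lambda>\<omega>. \<Sum>s\<in>skel_paths k. G (ext s) * indicator (cyl k s \<inter> ?B) \<omega>)"
  proof (rule Bochner_Integration.integral_cong[OF refl])
    fix \<omega> assume w: "\<omega> \<in> space M"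
    have "(if skel (Suc k) \<omega> = z then 1 else 0 :: real) = indicator ?B \<omega>" using w by (auto simp: skel_def indicator_def)
    then show "G (\<lambda>i. skel i \<omega>) * (if skel (Suc k) \<omega> = z then 1 else 0) = (\<Sum>s\<in>skel_paths k. G (ext s) * indicator (cyl k s \<inter> ?B) \<omega>)"
      using cyl_expand[of k G, OF dep w] by (simp add: sum_distrib_right indicator_inter_arith mult.assoc)
  qed
  also have "\<dots> = (\<Sum>s\<in>skel_paths k. expectation (\<lambda>\<omega>. G (ext s) * indicator (cyl k s \<inter> ?B) \<omega>))"
    by (rule Bochner_Integration.integral_sum) (use ev in \<open>auto intro!: integrable_mult_right simp: emeasure_eq_measure\<close>)
  also have "\<dots> = (\<Sum>s\<in>skel_paths k. G (ext s) * prob (cyl k s \<inter> ?B))" using ev by (intro sum.cong refl) simp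
  also have "\<dots> = (\<Sum>s\<in>skel_paths k. (G (ext s) * K (tt k) (tt (Suc k)) (ext s k) z) * prob (cyl k s))"
    by (intro sum.cong refl) (simp add: cyl_prob_Suc)
  also have "\<dots> = expectation (\<lambda>\<omega>. G (\<lambda>i. skel i \<omega>) * K (tt k) (tt (Suc k)) (skel k \<omega>) z)"
  proof (rule path_integrable(2)[of k "\<lambda>a. G a * K (tt k) (tt (Suc k)) (a k) z", symmetric])
    fix a b :: "nat \<Rightarrow> 'v" assume ab: "\<And>i. i \<le> k \<Longrightarrow> a i = b i"
    then show "G a * K (tt k) (tt (Suc k)) (a k) z = G b * K (tt k) (tt (Suc k)) (b k) z" using dep[of a b] by simp
  qed
  finally show ?thesis .
qed

text \<open>The last factor is split according to the value \<open>z\<close> of the new state, and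
  \<open>markov_step\<close> replaces each indicator by the kernel.\<close>

lemma product_step:
  fixes w :: "nat \<Rightarrow> 'v \<Rightarrow> 'v \<Rightarrow> real"
  shows "integrable M (\<lambda>\<omega>. (\<Prod>i<k. w i (skel i \<omega>) (skel (Suc i) \<omega>)) * f (skel k \<omega>))"
    and "expectation (\<lambda>\<omega>. (\<Prod>i<Suc k. w i (skel i \<omega>) (skel (Suc i) \<omega>)) * f (skel (Suc k) \<omega>)) =
      expectation (\<lambda>\<omega>. (\<Prod>i<k. w i (skel i \<omega>) (skel (Suc i) \<omega>)) * (\<Sum>z\<in>UNIV. K (tt k) (tt (Suc k)) (skel k \<omega>) z * (w k (skel k \<omega>) z * f z)))"
proof -
  have dep: "(\<Prod>i<k. w i (a i) (a (Suc i))) * h (a k) = (\<Prod>i<k. w i (b i) (b (Suc i))) * h (b k)"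
    if "\<And>i. i \<le> k \<Longrightarrow> a i = b i" for a b and h :: "'v \<Rightarrow> real" and k
  proof -
    have "(\<Prod>i<k. w i (a i) (a (Suc i))) = (\<Prod>i<k. w i (b i) (b (Suc i)))" using that by (intro prod.cong) auto
    then show ?thesis using that[of k] by simp
  qed
  have pi: "integrable M (\<lambda>\<omega>. (\<Prod>i<k. w i (skel i \<omega>) (skel (Suc i) \<omega>)) * h (skel k \<omega>))" for k h
    by (rule path_integrable(1)[of k "\<lambda>a. (\<Prod>i<k. w i (a i) (a (Suc i))) * h (a k)"]) (rule dep)
  show "integrable M (\<lambda>\<omega>. (\<Prod>i<k. w i (skel i \<omega>) (skel (Suc i) \<omega>)) * f (skel k \<omega>))" by (rule pi)
  let ?P = "\<lambda>\<omega>. \<Prod>i<k. w i (skel i \<omega>) (skel (Suc i) \<omega>)"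
  have i1: "integrable M (\<lambda>\<omega>. ?P \<omega> * (w k (skel k \<omega>) z * f z) * (if skel (Suc k) \<omega> = z then 1 else 0))" for z
  proof -
    have "integrable M (\<lambda>\<omega>. (\<lambda>a. (\<Prod>i<k. w i (a i) (a (Suc i))) * (w k (a k) z * f z) * (if a (Suc k) = z then 1 else 0)) (\<lambda>i. skel i \<omega>))"
    proof (rule path_integrable(1)[of "Suc k"])
      fix a b :: "nat \<Rightarrow> 'v" assume ab: "\<And>i. i \<le> Suc k \<Longrightarrow> a i = b i"
      have "(\<Prod>i<k. w i (a i) (a (Suc i))) * (w k (a k) z * f z) = (\<Prod>i<k. w i (b i) (b (Suc i))) * (w k (b k) z * f z)"
        by (rule dep[of k a b "\<lambda>y. w k y z * f z"]) (use ab in auto)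
      then show "(\<Prod>i<k. w i (a i) (a (Suc i))) * (w k (a k) z * f z) * (if a (Suc k) = z then 1 else 0) =
          (\<Prod>i<k. w i (b i) (b (Suc i))) * (w k (b k) z * f z) * (if b (Suc k) = z then 1 else 0)"
        using ab[of "Suc k"] by simp
    qed
    then show ?thesis by simp
  qed
  have i2: "integrable M (\<lambda>\<omega>. ?P \<omega> * (w k (skel k \<omega>) z * f z) * K (tt k) (tt (Suc k)) (skel k \<omega>) z)" for z
    using pi[of k "\<lambda>y. (w k y z * f z) * K (tt k) (tt (Suc k)) y z"] by (simp add: mult.assoc)
  have "expectation (\<lambda>\<omega>. (\<Prod>i<Suc k. w i (skel i \<omega>) (skel (Suc i) \<omega>)) * f (skel (Suc k) \<omega>)) =
      expectation (\<lambda>\<omega>. \<Sum>z\<in>UNIV. ?P \<omega> * (w k (skel k \<omega>) z * f z) * (if skel (Suc k) \<omega> = z then 1 else 0))"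
  proof (rule Bochner_Integration.integral_cong[OF refl])
    fix \<omega>
    show "(\<Prod>i<Suc k. w i (skel i \<omega>) (skel (Suc i) \<omega>)) * f (skel (Suc k) \<omega>) = (\<Sum>z\<in>UNIV. ?P \<omega> * (w k (skel k \<omega>) z * f z) * (if skel (Suc k) \<omega> = z then 1 else 0))"
      by (subst sum.remove[of UNIV "skel (Suc k) \<omega>"]) (auto simp: mult.assoc intro!: sum.neutral)
  qed
  also have "\<dots> = (\<Sum>z\<in>UNIV. expectation (\<lambda>\<omega>. ?P \<omega> * (w k (skel k \<omega>) z * f z) * (if skel (Suc k) \<omega> = z then 1 else 0)))"
    by (rule Bochner_Integration.integral_sum[OF i1])
  also have "\<dots> = (\<Sum>z\<in>UNIV. expectation (\<lambda>\<omega>. ?P \<omega> * (w k (skel k \<omega>) z * f z) * K (tt k) (tt (Suc k)) (skel k \<omega>) z))"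
  proof (intro sum.cong refl)
    fix z
    show "expectation (\<lambda>\<omega>. ?P \<omega> * (w k (skel k \<omega>) z * f z) * (if skel (Suc k) \<omega> = z then 1 else 0)) =
        expectation (\<lambda>\<omega>. ?P \<omega> * (w k (skel k \<omega>) z * f z) * K (tt k) (tt (Suc k)) (skel k \<omega>) z)"
    proof (rule markov_step[of k "\<lambda>a. (\<Prod>i<k. w i (a i) (a (Suc i))) * (w k (a k) z * f z)"])
      fix a b :: "nat \<Rightarrow> 'v" assume "\<And>i. i \<le> k \<Longrightarrow> a i = b i"
      then show "(\<Prod>i<k. w i (a i) (a (Suc i))) * (w k (a k) z * f z) = (\<Prod>i<k. w i (b i) (b (Suc i))) * (w k (b k) z * f z)"
        by (rule dep[of k a b "\<lambda>y. w k y z * f z"])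
    qed
  qed
  also have "\<dots> = expectation (\<lambda>\<omega>. \<Sum>z\<in>UNIV. ?P \<omega> * (w k (skel k \<omega>) z * f z) * K (tt k) (tt (Suc k)) (skel k \<omega>) z)"
    by (rule Bochner_Integration.integral_sum[symmetric, OF i2])
  also have "\<dots> = expectation (\<lambda>\<omega>. ?P \<omega> * (\<Sum>z\<in>UNIV. K (tt k) (tt (Suc k)) (skel k \<omega>) z * (w k (skel k \<omega>) z * f z)))"
    by (simp add: sum_distrib_left mult_ac)
  finally show "expectation (\<lambda>\<omega>. (\<Prod>i<Suc k. w i (skel i \<omega>) (skel (Suc i) \<omega>)) * f (skel (Suc k) \<omega>)) =
      expectation (\<lambda>\<omega>. (\<Prod>i<k. w i (skel i \<omega>) (skel (Suc i) \<omega>)) * (\<Sum>z\<in>UNIV. K (tt k) (tt (Suc k)) (skel k \<omega>) z * (w k (skel k \<omega>) z * f z)))" .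
qed

text \<open>\<open>f\<close> is a discrete super- or subsolution of the backward recursion up to a
  factor \<open>q\<close> per step; integrating out the steps from the last to the first leaves
  \<open>q ^ m\<close> times the initial value.\<close>

lemma product_bounds:
  fixes w :: "nat \<Rightarrow> 'v \<Rightarrow> 'v \<Rightarrow> real" and f :: "nat \<Rightarrow> 'v \<Rightarrow> real"
  assumes w: "\<And>i y z. w i y z \<ge> 0"
  shows "(\<And>k y. k < m \<Longrightarrow> (\<Sum>z\<in>UNIV. K (tt k) (tt (Suc k)) y z * (w k y z * f (Suc k) z)) \<le> q * f k y) \<Longrightarrow> q \<ge> 0 \<Longrightarrow>
      expectation (\<lambda>\<omega>. (\<Prod>i<m. w i (skel i \<omega>) (skel (Suc i) \<omega>)) * f m (skel m \<omega>)) \<le> q ^ m * f 0 x"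
    and "(\<And>k y. k < m \<Longrightarrow> q * f k y \<le> (\<Sum>z\<in>UNIV. K (tt k) (tt (Suc k)) y z * (w k y z * f (Suc k) z))) \<Longrightarrow> q \<ge> 0 \<Longrightarrow>
      q ^ m * f 0 x \<le> expectation (\<lambda>\<omega>. (\<Prod>i<m. w i (skel i \<omega>) (skel (Suc i) \<omega>)) * f m (skel m \<omega>))"
proof -
  have P0: "(\<Prod>i<k. w i (skel i \<omega>) (skel (Suc i) \<omega>)) \<ge> 0" for k \<omega> by (intro prod_nonneg) (use w in auto)
  have base: "expectation (\<lambda>\<omega>. (\<Prod>i<0. w i (skel i \<omega>) (skel (Suc i) \<omega>)) * f 0 (skel 0 \<omega>)) = f 0 x"
    by (simp add: skel_def prob_space)
  show "expectation (\<lambda>\<omega>. (\<Prod>i<m. w i (skel i \<omega>) (skel (Suc i) \<omega>)) * f m (skel m \<omega>)) \<le> q ^ m * f 0 x"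
    if h: "\<And>k y. k < m \<Longrightarrow> (\<Sum>z\<in>UNIV. K (tt k) (tt (Suc k)) y z * (w k y z * f (Suc k) z)) \<le> q * f k y" and q: "q \<ge> 0"
    using h
  proof (induction m)
    case (Suc m)
    have "expectation (\<lambda>\<omega>. (\<Prod>i<Suc m. w i (skel i \<omega>) (skel (Suc i) \<omega>)) * f (Suc m) (skel (Suc m) \<omega>)) \<le>
        expectation (\<lambda>\<omega>. (\<Prod>i<m. w i (skel i \<omega>) (skel (Suc i) \<omega>)) * (q * f m (skel m \<omega>)))"
      unfolding product_step(2)
      by (intro integral_mono product_step(1)[where f = "\<lambda>y. \<Sum>z\<in>UNIV. K (tt m) (tt (Suc m)) y z * (w m y z * f (Suc m) z)"]
          product_step(1)[where f = "\<lambda>y. q * f m y"] mult_left_mono P0 Suc.prems) simp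
    also have "\<dots> = q * expectation (\<lambda>\<omega>. (\<Prod>i<m. w i (skel i \<omega>) (skel (Suc i) \<omega>)) * f m (skel m \<omega>))"
      by (subst integral_mult_right_zero[symmetric]) (simp add: mult_ac)
    also have "\<dots> \<le> q * (q ^ m * f 0 x)" by (intro mult_left_mono Suc.IH Suc.prems q) simp
    finally show ?case by simp
  qed (simp only: base power_0 mult_1 order_refl)
  show "q ^ m * f 0 x \<le> expectation (\<lambda>\<omega>. (\<Prod>i<m. w i (skel i \<omega>) (skel (Suc i) \<omega>)) * f m (skel m \<omega>))"
    if h: "\<And>k y. k < m \<Longrightarrow> q * f k y \<le> (\<Sum>z\<in>UNIV. K (tt k) (tt (Suc k)) y z * (w k y z * f (Suc k) z))" and q: "q \<ge> 0"
    using h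
  proof (induction m)
    case (Suc m)
    have "q * (q ^ m * f 0 x) \<le> q * expectation (\<lambda>\<omega>. (\<Prod>i<m. w i (skel i \<omega>) (skel (Suc i) \<omega>)) * f m (skel m \<omega>))"
      by (intro mult_left_mono Suc.IH Suc.prems q) simp
    also have "\<dots> = expectation (\<lambda>\<omega>. (\<Prod>i<m. w i (skel i \<omega>) (skel (Suc i) \<omega>)) * (q * f m (skel m \<omega>)))"
      by (subst integral_mult_right_zero[symmetric]) (simp add: mult_ac)
    also have "\<dots> \<le> expectation (\<lambda>\<omega>. (\<Prod>i<Suc m. w i (skel i \<omega>) (skel (Suc i) \<omega>)) * f (Suc m) (skel (Suc m) \<omega>))"
      unfolding product_step(2)
      by (intro integral_mono product_step(1)[where f = "\<lambda>y. \<Sum>z\<in>UNIV. K (tt m) (tt (Suc m)) y z * (w m y z * f (Suc m) z)"]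
          product_step(1)[where f = "\<lambda>y. q * f m y"] mult_left_mono P0 Suc.prems) simp
    finally show ?case by simp
  qed (simp only: base power_0 mult_1 order_refl)
qed

end

text \<open>The finite-dimensional formula prescribes the path at times with index at least 1;
  choosing that time equal to 0 reads off the initial law, as the forward equation over a degenerate
  interval gives \<open>K 0 0 x x = 1\<close>.\<close>

lemma start_AE: "AE \<omega> in M. \<xi> \<omega> 0 = x"
proof -
  have "measure M {\<omega>\<in>space M. \<forall>i\<in>{1..1::nat}. \<xi> \<omega> 0 = x} = (\<Prod>i\<in>{1..1::nat}. K 0 0 x x)"
    by (rule fdd[of "\<lambda>_. 0" "\<lambda>_. x" 1]) auto
  moreover have "K 0 0 x x = 1"
  proof -
    have "K 0 0 x x = 1 + (LINT u:{0..0}|lborel. (\<Sum>w\<in>UNIV. K 0 u x w * gen r u w x))"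
      using fk unfolding forward_kernel_def by force
    moreover have "(LINT u:{0..0}|lborel. (\<Sum>w\<in>UNIV. K 0 u x w * gen r u w x)) = 0"
      using set_integral_abs_le[of 0 0 "\<lambda>u. \<Sum>w\<in>UNIV. K 0 u x w * gen r u w x" "\<bar>\<Sum>w\<in>UNIV. K 0 0 x w * gen r 0 w x\<bar>"]
        fk unfolding forward_kernel_def by force
    ultimately show ?thesis by simp
  qed
  ultimately have "prob {\<omega>\<in>space M. \<xi> \<omega> 0 = x} = 1" by simp
  from AE_prob_1[OF this] show ?thesis by eventually_elim simp
qed

end

section \<open>Exponential moments of the empirical pair\<close>

lemma grid_changes_count:
  fixes X :: "real \<Rightarrow> 'v::finite"
  assumes X: "cadlag X" and T: "T > 0"
  shows "eventually (\<lambda>m. card {i. i < m \<and> X (gp T m i) \<noteq> X (gp T m (Suc i))} = card (jumps T X)) sequentially"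
proof -
  let ?P = "{(y, z). y \<noteq> (z::'v)}"
  have fin: "finite ?P" by (rule finite_subset[of _ UNIV]) auto
  have J: "card (jumps T X) = (\<Sum>(y, z)\<in>?P. card {t \<in> {0..T}. left_lim X t = y \<and> X t = z})"
  proof -
    have e: "jumps T X = (\<Union>p\<in>?P. {t \<in> {0..T}. left_lim X t = fst p \<and> X t = snd p})"
      by (auto simp: jumps_def left_lim_def)
    have "card (\<Union>p\<in>?P. {t \<in> {0..T}. left_lim X t = fst p \<and> X t = snd p}) = (\<Sum>p\<in>?P. card {t \<in> {0..T}. left_lim X t = fst p \<and> X t = snd p})"
    proof (rule card_UN_disjoint[OF fin])
      show "\<forall>p\<in>?P. finite {t \<in> {0..T}. left_lim X t = fst p \<and> X t = snd p}"
        using finite_jumps[OF X, of T] unfolding e by (auto intro: rev_finite_subset)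
    qed auto
    then show ?thesis unfolding e by (simp add: case_prod_beta)
  qed
  have A: "card {i. i < m \<and> X (gp T m i) \<noteq> X (gp T m (Suc i))} = (\<Sum>(y, z)\<in>?P. card {i. i < m \<and> X (gp T m i) = y \<and> X (gp T m (Suc i)) = z})" for m
  proof -
    have e: "{i. i < m \<and> X (gp T m i) \<noteq> X (gp T m (Suc i))} = (\<Union>p\<in>?P. {i. i < m \<and> X (gp T m i) = fst p \<and> X (gp T m (Suc i)) = snd p})"
      by auto
    have "card (\<Union>p\<in>?P. {i. i < m \<and> X (gp T m i) = fst p \<and> X (gp T m (Suc i)) = snd p}) = (\<Sum>p\<in>?P. card {i. i < m \<and> X (gp T m i) = fst p \<and> X (gp T m (Suc i)) = snd p})"
      by (rule card_UN_disjoint[OF fin]) auto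
    then show ?thesis unfolding e by (simp add: case_prod_beta)
  qed
  show ?thesis using grid_jump_count[OF X T]
  proof eventually_elim
    case (elim m)
    show ?case unfolding A J by (rule sum.cong) (use elim in auto)
  qed
qed

context periodic_rates
begin

lemma tilted_matrix_GR: "tilted_matrix l u z w = gen_ext u z w * exp (edge_tilt l z w) + (if z = w then fst l $ z else 0)"
  by (auto simp: tilted_matrix_def gen_ext_def edge_tilt_def edges_def)

text \<open>First-order terms cancel. By the backward equation the weighted function
  \<open>exp (b z (u - t)) g u z\<close> loses \<open>q z\<close> to first order over time
  \<open>h\<close>, and the first-order part \<open>p\<close> of the kernel gives \<open>q y\<close>
  back through the jumps. What remains is quadratic in \<open>h\<close>, uniformly in
  \<open>t\<close> and the state.\<close>

lemma one_step:
  assumes tl: "tilt l L g" and T: "T > 0" and fk: "forward_kernel r K"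
  obtains C d1 where "C > 0" "d1 > 0"
    "\<And>t h y. 0 \<le> t \<Longrightarrow> 0 \<le> h \<Longrightarrow> h \<le> d1 \<Longrightarrow> t + h \<le> T \<Longrightarrow>
      \<bar>(\<Sum>z\<in>UNIV. K t (t + h) y z * (exp (edge_tilt l y z) * (exp ((fst l $ z - L) * h) * g (t + h) z))) - g t y\<bar> \<le> C * h\<^sup>2"
proof -
  obtain c d0 where c: "c > 0" and d0: "d0 > 0"
    and K1: "\<And>s t y z. 0 \<le> s \<Longrightarrow> s \<le> t \<Longrightarrow> t - s \<le> d0 \<Longrightarrow>
      \<bar>K s t y z - (if y = z then 1 else 0) - (LINT u:{s..t}|lborel. gen_ext u y z)\<bar> \<le> c * (t - s)\<^sup>2"
    by (rule kernel_estimate[OF fk]) blast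
  obtain c1 where c1: "c1 > 0" "\<And>u w z. \<bar>gen_ext u w z\<bar> \<le> c1" by (rule gen_ext_bound) blast
  obtain m0 Gm where m0: "m0 > 0" and gm: "\<And>t y. m0 \<le> g t y" and gM: "\<And>t y. g t y \<le> Gm" by (rule g_bounds[OF tl]) blast
  have Gm: "Gm > 0" using m0 gm[of 0 undefined] gM[of 0 undefined] by linarith
  have g0: "g t y \<ge> 0" for t y using g_pos[OF tl, of t y] by simp
  define b where "b z = fst l $ z - L" for z
  define Ex where "Ex z w = exp (edge_tilt l z w)" for z w
  define Em where "Em = (\<Sum>p\<in>(UNIV :: ('v \<times> 'v) set). Ex (fst p) (snd p))"
  have Em: "Ex z w \<le> Em" for z w
    unfolding Em_def using member_le_sum[of "(z, w)" UNIV "\<lambda>p. Ex (fst p) (snd p)"] by (simp add: Ex_def)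
  have Ex0: "Ex z w > 0" for z w by (simp add: Ex_def)
  have Em0: "Em > 0" using Ex0[of undefined undefined] Em[of undefined undefined] by linarith
  have Exy: "Ex y y = 1" for y by (simp add: Ex_def edge_tilt_def edges_def)
  define n where "n = real CARD('v)"
  have n: "n \<ge> 1" unfolding n_def by (simp add: Suc_leI)
  have hl: "lip 0 T (\<lambda>u. exp (b z * u) * g u w)" for z w by (intro lip_mult lip_exp g_lip[OF tl])
  have "\<forall>p. \<exists>k. k \<ge> 0 \<and> (\<forall>s\<in>{0..T}. \<forall>t\<in>{0..T}. \<bar>exp (b (fst p) * s) * g s (snd p) - exp (b (fst p) * t) * g t (snd p)\<bar> \<le> k * \<bar>s - t\<bar>)"
  proof
    fix p show "\<exists>k. k \<ge> 0 \<and> (\<forall>s\<in>{0..T}. \<forall>t\<in>{0..T}. \<bar>exp (b (fst p) * s) * g s (snd p) - exp (b (fst p) * t) * g t (snd p)\<bar> \<le> k * \<bar>s - t\<bar>)"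
      by (rule lipE[OF hl[of "fst p" "snd p"]]) blast
  qed
  from choice[OF this] obtain k where k: "\<forall>p. k p \<ge> 0 \<and> (\<forall>s\<in>{0..T}. \<forall>t\<in>{0..T}. \<bar>exp (b (fst p) * s) * g s (snd p) - exp (b (fst p) * t) * g t (snd p)\<bar> \<le> k p * \<bar>s - t\<bar>)" ..
  define Lh where "Lh = (\<Sum>p\<in>UNIV. k p)"
  have Lh: "k p \<le> Lh" for p unfolding Lh_def by (rule member_le_sum) (use k in auto)
  have Lh0: "Lh \<ge> 0" unfolding Lh_def by (intro sum_nonneg) (use k in auto)
  define Bm where "Bm = (\<Sum>z\<in>UNIV. exp (\<bar>b z\<bar> * T))"
  have Bm: "exp (- (b z * t)) \<le> Bm" if "t \<in> {0..T}" for z t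
  proof -
    have "- (b z * t) \<le> \<bar>b z\<bar> * t" using that by (metis abs_ge_minus_self abs_mult abs_of_nonneg atLeastAtMost_iff)
    also have "\<dots> \<le> \<bar>b z\<bar> * T" using that by (intro mult_left_mono) auto
    finally have "exp (- (b z * t)) \<le> exp (\<bar>b z\<bar> * T)" by simp
    also have "\<dots> \<le> Bm" unfolding Bm_def by (rule member_le_sum[where f = "\<lambda>z. exp (\<bar>b z\<bar> * T)"]) auto
    finally show ?thesis .
  qed
  have Bm0: "Bm \<ge> 0" unfolding Bm_def by (intro sum_nonneg) auto
  define c5 where "c5 = Bm * Lh"
  have c50: "c5 \<ge> 0" using Bm0 Lh0 by (simp add: c5_def)
  have inc: "\<bar>exp (b z * (u - t)) * g u w - g t w\<bar> \<le> c5 * (u - t)" if "t \<in> {0..T}" "u \<in> {0..T}" "t \<le> u" for z w t u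
  proof -
    have e: "exp (b z * (u - t)) = exp (- (b z * t)) * exp (b z * u)" by (simp add: right_diff_distrib exp_diff exp_minus field_simps)
    have "exp (b z * (u - t)) * g u w - g t w = exp (- (b z * t)) * (exp (b z * u) * g u w - exp (b z * t) * g t w)"
      unfolding e by (simp add: right_diff_distrib mult.assoc[symmetric] flip: exp_add)
    then have "\<bar>exp (b z * (u - t)) * g u w - g t w\<bar> = exp (- (b z * t)) * \<bar>exp (b z * u) * g u w - exp (b z * t) * g t w\<bar>"
      by (simp add: abs_mult)
    also have "\<dots> \<le> Bm * (Lh * \<bar>u - t\<bar>)"
    proof (rule mult_mono[OF Bm[OF that(1)]])
      have "\<bar>exp (b z * u) * g u w - exp (b z * t) * g t w\<bar> \<le> k (z, w) * \<bar>u - t\<bar>" 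
        using bspec[OF bspec[OF conjunct2[OF spec[OF k, of "(z, w)"]] that(2)] that(1)] by simp
      also have "\<dots> \<le> Lh * \<bar>u - t\<bar>" by (intro mult_right_mono Lh) simp
      finally show "\<bar>exp (b z * u) * g u w - exp (b z * t) * g t w\<bar> \<le> Lh * \<bar>u - t\<bar>" .
    qed (use Bm0 in auto)
    finally show ?thesis using that by (simp add: c5_def mult.assoc)
  qed
  define C where "C = n * (c1 * Em * c5) + n * (Em * (c1 * c5 + c * (Gm + c5 * T))) + 1"
  have C0: "C > 0" using n c1 Em0 c50 c Gm T unfolding C_def by (intro add_nonneg_pos add_nonneg_nonneg mult_nonneg_nonneg) auto
  show thesis
  proof (rule that[OF C0 d0])
    fix t h :: real and y assume t: "0 \<le> t" "0 \<le> h" "h \<le> d0" "t + h \<le> T"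
    define f where "f z u = exp (b z * (u - t)) * g u z" for z u
    have tT: "t \<in> {0..T}" "t + h \<in> {0..T}" using t by auto
    define q where "q z = (LINT u:{t..t + h}|lborel. (\<Sum>w\<in>UNIV. gen_ext u z w * Ex z w * g t w))" for z
    define p where "p z = (LINT u:{t..t + h}|lborel. gen_ext u y z)" for z
    define e where "e z = K t (t + h) y z - (if y = z then 1 else 0) - p z" for z
    have eb: "\<bar>e z\<bar> \<le> c * h\<^sup>2" for z using K1[of t "t + h" y z] t by (simp add: e_def p_def)
    have pb: "\<bar>p z\<bar> \<le> c1 * h" for z
      using set_integral_bounded[OF gen_ext_meas c1(2), of t "t + h" y z] t by (simp add: p_def)
    have ft: "f z t = g t z" for z by (simp add: f_def)
    let ?D = "\<lambda>z u. exp (b z * (u - t)) * (\<Sum>w\<in>UNIV. gen_ext u z w * Ex z w * g u w)"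
    let ?C = "\<lambda>z u. \<Sum>w\<in>UNIV. gen_ext u z w * Ex z w * g t w"
    have fb: "\<bar>f z (t + h) - g t z\<bar> \<le> c5 * h" for z
      using inc[OF tT, of z z] t by (simp add: f_def)
    have fB: "\<bar>f z (t + h)\<bar> \<le> Gm + c5 * T" for z
    proof -
      have "c5 * h \<le> c5 * T" using t c50 by (intro mult_left_mono) auto
      then show ?thesis using fb[of z] gM[of t z] g0[of t z] by linarith
    qed
    have fint: "set_integrable lborel {t..t + h} (\<lambda>u. - (?D z u)) \<and>
        (LINT u:{t..t + h}|lborel. - (?D z u)) = f z (t + h) - f z t" for z
    proof -
      have "lip t (t + h) (\<lambda>u. exp (- (b z * t)) * (exp (b z * u) * g u z))" by (intro lip_cmult lip_mult lip_exp g_lip[OF tl])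
      then have l1: "lip t (t + h) (f z)"
        by (subst (asm) lip_cong[of _ _ _ "f z"]) (auto simp: f_def right_diff_distrib exp_diff exp_minus field_simps)
      have d: "(f z has_real_derivative - (?D z u)) (at u)" if u: "u \<notin> exc_times" for u
      proof -
        have s: "(\<Sum>w\<in>UNIV. tilted_matrix l u z w * g u w) = (\<Sum>w\<in>UNIV. gen_ext u z w * Ex z w * g u w) + fst l $ z * g u z"
          by (simp add: tilted_matrix_GR Ex_def distrib_right sum.distrib if_distrib[of "\<lambda>a. a * _"] cong: if_cong)
        have "((\<lambda>u. exp (b z * (u - t))) has_real_derivative b z * exp (b z * (u - t))) (at u)"
          by (auto intro!: derivative_eq_intros)
        from DERIV_mult[OF this g_der[OF tl u, of z]]
        have "(f z has_real_derivative b z * exp (b z * (u - t)) * g u z + (L * g u z - (\<Sum>w\<in>UNIV. tilted_matrix l u z w * g u w)) * exp (b z * (u - t))) (at u)"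
          unfolding f_def .
        moreover have "b z * exp (b z * (u - t)) * g u z + (L * g u z - (\<Sum>w\<in>UNIV. tilted_matrix l u z w * g u w)) * exp (b z * (u - t)) =
            - (?D z u)"
          unfolding s b_def by (simp add: algebra_simps)
        ultimately show ?thesis by simp
      qed
      have mm: "(\<lambda>u. - (?D z u)) \<in> borel_measurable borel"
        using g_meas[OF tl] by measurable
      show ?thesis using lip_FTC[OF l1 _ exc_times_null d mm] t by auto
    qed
    have qi: "set_integrable lborel {t..t + h} (\<lambda>u. \<Sum>w\<in>UNIV. gen_ext u z w * Ex z w * g t w)" for z
      by (intro set_integral_sum(1) set_integrable_mult_left set_integrable_bounded[OF gen_ext_meas c1(2)])
    have rb: "\<bar>f z (t + h) - g t z + q z\<bar> \<le> n * (c1 * Em * c5) * h\<^sup>2" for z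
    proof -
      have "f z (t + h) - g t z + q z = (LINT u:{t..t + h}|lborel. - (?D z u) + (?C z u))"
        using fint[of z] ft[of z] unfolding q_def by (subst set_integral_add(2)[OF _ qi]) auto
      also have "\<bar>\<dots>\<bar> \<le> (n * (c1 * Em * (c5 * h))) * ((t + h) - t)"
      proof (rule set_integral_abs_le[OF set_integral_add(1)[OF _ qi]])
        show "set_integrable lborel {t..t + h} (\<lambda>u. - (?D z u))" using fint by blast
        fix u assume u: "u \<in> {t..t + h}"
        have "- (?D z u) + (?C z u) =
            - (\<Sum>w\<in>UNIV. gen_ext u z w * Ex z w * (exp (b z * (u - t)) * g u w - g t w))"
          by (simp add: right_diff_distrib sum_subtractf sum_distrib_left mult_ac)
        also have "\<bar>\<dots>\<bar> \<le> (\<Sum>w\<in>(UNIV::'v set). c1 * Em * (c5 * h))"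
        proof (unfold abs_minus_cancel, rule order_trans[OF sum_abs], rule sum_mono)
          fix w
          have "\<bar>exp (b z * (u - t)) * g u w - g t w\<bar> \<le> c5 * (u - t)" by (rule inc) (use u t in auto)
          also have "\<dots> \<le> c5 * h" using u c50 by (intro mult_left_mono) auto
          finally have 1: "\<bar>exp (b z * (u - t)) * g u w - g t w\<bar> \<le> c5 * h" .
          have 2: "\<bar>gen_ext u z w\<bar> * \<bar>Ex z w\<bar> \<le> c1 * Em" using c1 Em[of z w] Ex0[of z w] by (intro mult_mono) auto
          show "\<bar>gen_ext u z w * Ex z w * (exp (b z * (u - t)) * g u w - g t w)\<bar> \<le> c1 * Em * (c5 * h)"
            unfolding abs_mult by (rule mult_mono[OF 2 1]) (use c1(1) Em0 in auto)
        qed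
        finally show "\<bar>- (?D z u) + (?C z u)\<bar> \<le> n * (c1 * Em * (c5 * h))"
          by (simp add: n_def)
      qed (use t in auto)
      finally show ?thesis by (simp add: power2_eq_square mult_ac)
    qed
    have qp: "q y = (\<Sum>z\<in>UNIV. Ex y z * p z * g t z)"
    proof -
      have "q y = (\<Sum>w\<in>UNIV. LINT u:{t..t + h}|lborel. gen_ext u y w * Ex y w * g t w)"
        unfolding q_def by (rule set_integral_sum(2)) (intro set_integrable_mult_left set_integrable_bounded[OF gen_ext_meas c1(2)])
      then show ?thesis by (simp add: p_def mult_ac)
    qed
    \<comment> \<open>The kernel is split into identity, first-order part \<open>p\<close> and
      quadratic remainder \<open>e\<close>; next to \<open>p\<close> the factor
      \<open>f z (t + h)\<close> is replaced by \<open>g t z\<close> at a further quadratic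
      cost.\<close>
    have "(\<Sum>z\<in>UNIV. K t (t + h) y z * (Ex y z * f z (t + h))) =
        (\<Sum>z\<in>UNIV. (if y = z then Ex y z * f z (t + h) else 0) + (Ex y z * p z * g t z + Ex y z * (p z * (f z (t + h) - g t z) + e z * f z (t + h))))"
      by (intro sum.cong refl) (auto simp: e_def algebra_simps)
    also have "\<dots> = f y (t + h) + q y + (\<Sum>z\<in>UNIV. Ex y z * (p z * (f z (t + h) - g t z) + e z * f z (t + h)))"
      by (simp add: sum.distrib qp Exy)
    finally have "(\<Sum>z\<in>UNIV. K t (t + h) y z * (Ex y z * f z (t + h))) - g t y =
        (f y (t + h) - g t y + q y) + (\<Sum>z\<in>UNIV. Ex y z * (p z * (f z (t + h) - g t z) + e z * f z (t + h)))" by simp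
    also have "\<bar>\<dots>\<bar> \<le> n * (c1 * Em * c5) * h\<^sup>2 + n * (Em * (c1 * c5 + c * (Gm + c5 * T))) * h\<^sup>2"
    proof (rule order_trans[OF abs_triangle_ineq], rule add_mono[OF rb])
      have "\<bar>\<Sum>z\<in>UNIV. Ex y z * (p z * (f z (t + h) - g t z) + e z * f z (t + h))\<bar> \<le> (\<Sum>z\<in>(UNIV::'v set). Em * ((c1 * h) * (c5 * h) + c * h\<^sup>2 * (Gm + c5 * T)))"
      proof (rule order_trans[OF sum_abs], rule sum_mono)
        fix z
        have 1: "\<bar>p z * (f z (t + h) - g t z)\<bar> \<le> (c1 * h) * (c5 * h)" unfolding abs_mult using pb fb t c1 by (intro mult_mono) auto
        have 2: "\<bar>e z * f z (t + h)\<bar> \<le> c * h\<^sup>2 * (Gm + c5 * T)" unfolding abs_mult using eb fB c by (intro mult_mono) auto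
        have "\<bar>p z * (f z (t + h) - g t z) + e z * f z (t + h)\<bar> \<le> (c1 * h) * (c5 * h) + c * h\<^sup>2 * (Gm + c5 * T)"
          using 1 2 by linarith
        then show "\<bar>Ex y z * (p z * (f z (t + h) - g t z) + e z * f z (t + h))\<bar> \<le> Em * ((c1 * h) * (c5 * h) + c * h\<^sup>2 * (Gm + c5 * T))"
          unfolding abs_mult[of "Ex y z"] using Em[of y z] Ex0[of y z] Em0 by (intro mult_mono) auto
      qed
      then show "\<bar>\<Sum>z\<in>UNIV. Ex y z * (p z * (f z (t + h) - g t z) + e z * f z (t + h))\<bar> \<le> n * (Em * (c1 * c5 + c * (Gm + c5 * T))) * h\<^sup>2"
        by (simp add: n_def power2_eq_square algebra_simps)
    qed
    also have "\<dots> \<le> C * h\<^sup>2" unfolding C_def distrib_right by simp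
    finally show "\<bar>(\<Sum>z\<in>UNIV. K t (t + h) y z * (exp (edge_tilt l y z) * (exp ((fst l $ z - L) * h) * g (t + h) z))) - g t y\<bar> \<le> C * h\<^sup>2"
      by (simp add: Ex_def f_def b_def)
  qed
qed

end

lemma real_card_lessThan: "real (card {i. i < m \<and> P i}) = (\<Sum>i<m. if P i then 1 else 0 :: real)" for m :: nat
proof -
  have "{i. i < m \<and> P i} = {..<m} \<inter> {i. P i}" by auto
  then show ?thesis by (simp add: sum.If_cases)
qed

context periodic_chain
begin

section \<open>Grid functionals and their limits\<close>

definition num_changes :: "real \<Rightarrow> nat \<Rightarrow> 'a \<Rightarrow> nat" where
  "num_changes T m \<omega> = card {i. i < m \<and> \<xi> \<omega> (gp T m i) \<noteq> \<xi> \<omega> (gp T m (Suc i))}"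

definition emp :: "real \<Rightarrow> 'a \<Rightarrow> (real^'v) \<times> (real^('v \<times> 'v))" where
  "emp T \<omega> = (emp_measure T (\<xi> \<omega>), emp_flow E T (\<xi> \<omega>))"

lemma gp_grid: assumes "T > 0" shows "gp T m 0 = 0" "\<And>i. gp T m i \<le> gp T m (Suc i)"
proof -
  show "gp T m 0 = 0" by (simp add: gp_def)
  show "gp T m i \<le> gp T m (Suc i)" for i using assms unfolding gp_Suc by simp
qed

lemma xi_pair_meas: "(\<lambda>\<omega>. h (\<xi> \<omega> s) (\<xi> \<omega> t) :: real) \<in> borel_measurable M"
  by (rule measurable_compose_countable[OF _ xi_meas], rule measurable_compose_countable[OF _ xi_meas]) simp

lemma xi_single_meas: "(\<lambda>\<omega>. h (\<xi> \<omega> t) :: real) \<in> borel_measurable M"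
  using xi_pair_meas[of "\<lambda>y z. h y" t t] by simp

lemma skel_AE: assumes "T > 0" shows "AE \<omega> in M. \<forall>i. skel (gp T m) i \<omega> = \<xi> \<omega> (gp T m i)"
  using start_AE by eventually_elim (simp add: skel_def gp_grid[OF assms])

text \<open>Transfers products from the skeleton pinned at \<open>x\<close> to the path itself, with
  which it agrees almost surely.\<close>

lemma grid_product:
  fixes w :: "nat \<Rightarrow> 'v \<Rightarrow> 'v \<Rightarrow> real" and f :: "'v \<Rightarrow> real"
  assumes "T > 0"
  shows "integrable M (\<lambda>\<omega>. (\<Prod>i<m. w i (\<xi> \<omega> (gp T m i)) (\<xi> \<omega> (gp T m (Suc i)))) * f (\<xi> \<omega> (gp T m m)))"
    "expectation (\<lambda>\<omega>. (\<Prod>i<m. w i (\<xi> \<omega> (gp T m i)) (\<xi> \<omega> (gp T m (Suc i)))) * f (\<xi> \<omega> (gp T m m))) =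
      expectation (\<lambda>\<omega>. (\<Prod>i<m. w i (skel (gp T m) i \<omega>) (skel (gp T m) (Suc i) \<omega>)) * f (skel (gp T m) m \<omega>))"
proof -
  let ?F = "(\<lambda>\<omega>. (\<Prod>i<m. w i (\<xi> \<omega> (gp T m i)) (\<xi> \<omega> (gp T m (Suc i)))) * f (\<xi> \<omega> (gp T m m)))"
  let ?G = "(\<lambda>\<omega>. (\<Prod>i<m. w i (skel (gp T m) i \<omega>) (skel (gp T m) (Suc i) \<omega>)) * f (skel (gp T m) m \<omega>))"
  have m1: "?F \<in> borel_measurable M"
    by (intro borel_measurable_times borel_measurable_prod xi_single_meas[where h = f]) (rule xi_pair_meas)
  have i: "integrable M ?G"
    by (rule product_step(1)[OF gp_grid[OF assms]])
  have ae: "AE \<omega> in M. (\<Prod>i<m. w i (skel (gp T m) i \<omega>) (skel (gp T m) (Suc i) \<omega>)) * f (skel (gp T m) m \<omega>) =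
      (\<Prod>i<m. w i (\<xi> \<omega> (gp T m i)) (\<xi> \<omega> (gp T m (Suc i)))) * f (\<xi> \<omega> (gp T m m))"
    using skel_AE[OF assms, of m] by eventually_elim simp
  show "integrable M ?F"
    by (rule integrable_cong_AE_imp[OF i m1]) (use ae in \<open>auto elim: AE_mp\<close>)
  show "expectation ?F =
      expectation ?G"
    by (rule integral_cong_AE[OF m1 borel_measurable_integrable[OF i]]) (use ae in \<open>auto elim: AE_mp\<close>)
qed

text \<open>Every grid change is weighted by \<open>exp a\<close>; one step multiplies the
  expectation by at most \<open>1 + B * h\<close>, so the exponential moment of the number of
  changes is at most \<open>exp (B * T)\<close> on every fine grid, and Fatou passes this to the
  jumps. It yields the dominating function in \<open>mgf_exact\<close>.\<close>

lemma exp_jumps_integrable: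
  assumes T: "T > 0" and a: "a \<ge> 0"
  shows "integrable M (\<lambda>\<omega>. exp (a * real (card (jumps T (\<xi> \<omega>)))))"
proof -
  obtain c d0 where c: "c > 0" and d0: "d0 > 0"
    and K1: "\<And>s t y z. 0 \<le> s \<Longrightarrow> s \<le> t \<Longrightarrow> t - s \<le> d0 \<Longrightarrow> \<bar>K s t y z - (if y = z then 1 else 0)\<bar> \<le> c * (t - s)"
    by (rule kernel_estimate[OF fk]) blast
  define B where "B = real CARD('v) * (c * exp a)"
  let ?n = "\<lambda>m \<omega>. exp (a * real (num_changes T m \<omega>))"
  let ?J = "\<lambda>\<omega>. exp (a * real (card (jumps T (\<xi> \<omega>))))"
  have B0: "B \<ge> 0" using c by (simp add: B_def)
  define w where "w y z = (if y = z then 1 else exp a)" for y z :: 'v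
  have nw: "exp (a * real (num_changes T m \<omega>)) = (\<Prod>i<m. w (\<xi> \<omega> (gp T m i)) (\<xi> \<omega> (gp T m (Suc i)))) * 1" for m \<omega>
    unfolding num_changes_def real_card_lessThan sum_distrib_left by (simp add: exp_sum w_def if_distrib cong: if_cong) (rule prod.cong; simp)
  have ni: "integrable M (\<lambda>\<omega>. exp (a * real (num_changes T m \<omega>)))" for m
    unfolding nw by (rule grid_product(1)[OF T, where w = "\<lambda>i. w" and f = "\<lambda>_. 1"])
  have nb: "expectation (\<lambda>\<omega>. exp (a * real (num_changes T m \<omega>))) \<le> exp (B * T)" if m: "m > 0" "T / real m \<le> d0" for m
  proof -
    define h where "h = T / real m"
    have h: "h \<ge> 0" "h \<le> d0" "real m * h = T" using T m by (auto simp: h_def)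
    have "expectation (\<lambda>\<omega>. exp (a * real (num_changes T m \<omega>))) = expectation (\<lambda>\<omega>. (\<Prod>i<m. w (skel (gp T m) i \<omega>) (skel (gp T m) (Suc i) \<omega>)) * 1)"
      unfolding nw by (rule grid_product(2)[OF T, where w = "\<lambda>i. w" and f = "\<lambda>_. 1"])
    also have "\<dots> \<le> (1 + B * h) ^ m * 1"
    proof (rule product_bounds(1)[OF gp_grid[OF T], where w = "\<lambda>i. w" and f = "\<lambda>_ _. 1"])
      show "w y z \<ge> 0" for y z by (simp add: w_def)
      show "1 + B * h \<ge> 0" using B0 h by simp
      fix k y assume "k < m"
      have "K (gp T m k) (gp T m (Suc k)) y z * (w y z * 1) \<le> (if y = z then 1 else 0) + c * exp a * h" for z
      proof -
        have k: "\<bar>K (gp T m k) (gp T m (Suc k)) y z - (if y = z then 1 else 0)\<bar> \<le> c * h"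
          using K1[of "gp T m k" "gp T m (Suc k)" y z] gp_bounds(1)[OF T m(1), of k] gp_grid(2)[OF T, of m k] h gp_Suc[of T m k]
          by (simp add: h_def)
        have ea: "1 \<le> exp a" using a by simp
        show ?thesis
        proof (cases "y = z")
          case True
          have "c * h * 1 \<le> c * h * exp a" using c h ea by (intro mult_left_mono) auto
          then show ?thesis using k True by (simp add: w_def mult_ac)
        next
          case False
          then have "K (gp T m k) (gp T m (Suc k)) y z \<le> c * h" using k by simp
          then have "K (gp T m k) (gp T m (Suc k)) y z * exp a \<le> c * h * exp a" by (rule mult_right_mono) simp
          then show ?thesis using False by (simp add: w_def mult_ac)
        qed
      qed
      then have "(\<Sum>z\<in>UNIV. K (gp T m k) (gp T m (Suc k)) y z * (w y z * 1)) \<le> (\<Sum>z\<in>UNIV. (if y = z then 1 else 0) + c * exp a * h)"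
        by (rule sum_mono)
      also have "\<dots> = (1 + B * h) * 1" by (simp add: sum.distrib B_def)
      finally show "(\<Sum>z\<in>UNIV. K (gp T m k) (gp T m (Suc k)) y z * (w y z * 1)) \<le> (1 + B * h) * 1" .
    qed
    also have "\<dots> \<le> exp (B * h) ^ m * 1" using B0 h by (intro mult_right_mono power_mono) auto
    also have "\<dots> = exp (B * T)" using h(3) by (simp add: mult_ac flip: exp_of_nat_mult)
    finally show ?thesis .
  qed
  have lim: "(\<lambda>m. exp (a * real (num_changes T m \<omega>))) \<longlonglongrightarrow> exp (a * real (card (jumps T (\<xi> \<omega>))))" if "\<omega> \<in> space M" for \<omega>
    by (rule tendsto_eventually, use grid_changes_count[OF xi_cadlag[OF that] T] in eventually_elim) (simp add: num_changes_def)
  have meas: "(\<lambda>\<omega>. exp (a * real (card (jumps T (\<xi> \<omega>))))) \<in> borel_measurable M"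
    by (rule borel_measurable_LIMSEQ_real[OF lim]) (use ni in auto)
  have "(\<integral>\<^sup>+\<omega>. ennreal (?J \<omega>) \<partial>M) = (\<integral>\<^sup>+\<omega>. liminf (\<lambda>m. ennreal (?n m \<omega>)) \<partial>M)"
  proof (rule nn_integral_cong)
    fix \<omega> assume "\<omega> \<in> space M"
    from tendsto_ennrealI[OF lim[OF this]]
    show "ennreal (?J \<omega>) = liminf (\<lambda>m. ennreal (?n m \<omega>))"
      using lim_imp_Liminf[OF sequentially_bot] by metis
  qed
  also have "\<dots> \<le> liminf (\<lambda>m. \<integral>\<^sup>+\<omega>. ennreal (?n m \<omega>) \<partial>M)"
    by (rule nn_integral_liminf) (use ni in auto)
  also have "\<dots> \<le> limsup (\<lambda>m. \<integral>\<^sup>+\<omega>. ennreal (?n m \<omega>) \<partial>M)" by (rule Liminf_le_Limsup) simp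
  also have "\<dots> \<le> ennreal (exp (B * T))"
  proof (rule Limsup_bounded)
    have "(\<lambda>m. T / real m) \<longlonglongrightarrow> 0" by (rule real_tendsto_divide_at_top[OF tendsto_const filterlim_real_sequentially])
    then have "eventually (\<lambda>m. T / real m < d0) sequentially" using d0 by (rule order_tendstoD(2))
    then show "eventually (\<lambda>m. (\<integral>\<^sup>+\<omega>. ennreal (?n m \<omega>) \<partial>M) \<le> ennreal (exp (B * T))) sequentially"
      using eventually_gt_at_top[of 0]
    proof eventually_elim
      case (elim m)
      show ?case using nb[of m] elim by (subst nn_integral_eq_integral[OF ni]) (auto intro!: ennreal_leI)
    qed
  qed
  finally have "(\<integral>\<^sup>+\<omega>. ennreal (?J \<omega>) \<partial>M) < \<infinity>"
    using le_less_trans[OF _ ennreal_less_top] by (simp add: less_top)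
  then show ?thesis by (intro integrableI_nonneg[OF meas]) auto
qed

lemma sum_at': "(\<Sum>i<m. edge_tilt l (u i) (v i)) = (\<Sum>e\<in>E. snd l $ e * real (card {i. i < m \<and> u i = fst e \<and> v i = snd e}))" for m :: nat
proof -
  have a: "edge_tilt l y z = (\<Sum>e\<in>E. snd l $ e * (if y = fst e \<and> z = snd e then 1 else 0))" for y z
  proof -
    have "(\<Sum>e\<in>E. snd l $ e * (if y = fst e \<and> z = snd e then 1 else 0)) = (\<Sum>e\<in>E. if (y, z) = e then snd l $ e else 0)"
      by (intro sum.cong refl) auto
    then show ?thesis by (simp add: edge_tilt_def sum.delta)
  qed
  show ?thesis unfolding a real_card_lessThan sum_distrib_left by (rule sum.swap)
qed

lemma sum_fst: "(\<Sum>i<m. h * fst l $ v i) = (\<Sum>y\<in>UNIV. fst l $ y * (real (card {i. i < m \<and> v i = y}) * h))"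
  for m :: nat and l :: "(real^'v) \<times> (real^('v \<times> 'v))"
proof -
  have a: "h * fst l $ z = (\<Sum>y\<in>UNIV. fst l $ y * ((if z = y then 1 else 0) * h))" for z
    by (simp add: if_distrib[of "\<lambda>a. a * _"] if_distrib[of "\<lambda>a. _ * a"] sum.delta mult.commute cong: if_cong)
  show ?thesis unfolding a real_card_lessThan sum_distrib_left sum_distrib_right by (rule sum.swap)
qed

lemma inner_emp:
  assumes T: "T > 0"
  shows "T * (l \<bullet> emp T \<omega>) = (\<Sum>e\<in>E. snd l $ e * real (card {t \<in> {0..T}. left_lim (\<xi> \<omega>) t = fst e \<and> \<xi> \<omega> t = snd e})) +
    (\<Sum>y\<in>UNIV. fst l $ y * measure lborel {t \<in> {0..T}. \<xi> \<omega> t = y})"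
proof -
  have "snd l \<bullet> emp_flow E T (\<xi> \<omega>) = (\<Sum>e\<in>E. snd l $ e * (real (card {t \<in> {0..T}. left_lim (\<xi> \<omega>) t = fst e \<and> \<xi> \<omega> t = snd e}) / T))"
    unfolding inner_vec_def emp_flow_def by (rule sum.mono_neutral_cong_right) auto
  then show ?thesis using T
    by (simp add: emp_def inner_prod_def emp_measure_def inner_vec_def distrib_left sum_distrib_left)
qed

text \<open>Grid version of \<open>exp (T * (l \<bullet> emp T \<omega>))\<close>; the state is read
  at the right end of each cell, as in \<open>grid_occupation\<close>.\<close>

definition W :: "(real^'v) \<times> (real^('v \<times> 'v)) \<Rightarrow> real \<Rightarrow> nat \<Rightarrow> 'a \<Rightarrow> real" where
  "W l T m \<omega> = (\<Prod>i<m. exp (edge_tilt l (\<xi> \<omega> (gp T m i)) (\<xi> \<omega> (gp T m (Suc i))) + T / real m * fst l $ \<xi> \<omega> (gp T m (Suc i))))"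

lemma W_exp: "W l T m \<omega> = exp ((\<Sum>i<m. edge_tilt l (\<xi> \<omega> (gp T m i)) (\<xi> \<omega> (gp T m (Suc i)))) + (\<Sum>i<m. T / real m * fst l $ \<xi> \<omega> (gp T m (Suc i))))"
  unfolding W_def by (simp only: exp_sum[symmetric] finite_lessThan sum.distrib)

lemma W_limit:
  assumes T: "T > 0" and w: "\<omega> \<in> space M"
  shows "(\<lambda>m. W l T m \<omega>) \<longlonglongrightarrow> exp (T * (l \<bullet> emp T \<omega>))"
  unfolding W_exp sum_at' sum_fst inner_emp[OF T]
proof (intro tendsto_exp tendsto_add tendsto_sum tendsto_mult tendsto_const grid_occupation[OF xi_cadlag[OF w] T])
  fix e assume e: "e \<in> E"
  then have ne: "fst e \<noteq> snd e" by (auto simp: edges_def)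
  show "(\<lambda>m. real (card {i. i < m \<and> \<xi> \<omega> (gp T m i) = fst e \<and> \<xi> \<omega> (gp T m (Suc i)) = snd e})) \<longlonglongrightarrow>
      real (card {t \<in> {0..T}. left_lim (\<xi> \<omega>) t = fst e \<and> \<xi> \<omega> t = snd e})"
    by (rule tendsto_eventually, use grid_jump_count[OF xi_cadlag[OF w] T] in eventually_elim) (use ne in simp)
qed

lemma W_bound:
  assumes T: "T > 0"
  obtains A B where "A \<ge> 0" "\<And>m \<omega>. m > 0 \<Longrightarrow> \<omega> \<in> space M \<Longrightarrow> W l T m \<omega> \<le> exp (A * real (card (jumps T (\<xi> \<omega>)))) * B"
proof -
  define A where "A = (\<Sum>e\<in>UNIV. \<bar>snd l $ e\<bar>)"
  define B where "B = (\<Sum>y\<in>UNIV. \<bar>fst l $ y\<bar>)"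
  have A0: "A \<ge> 0" unfolding A_def by (intro sum_nonneg) auto
  have A: "edge_tilt l y z \<le> A * (if y \<noteq> z then 1 else 0)" for y z
  proof (cases "(y, z) \<in> E")
    case True
    then have "y \<noteq> z" by (auto simp: edges_def)
    moreover have "\<bar>snd l $ (y, z)\<bar> \<le> A" unfolding A_def by (rule member_le_sum[where f = "\<lambda>e. \<bar>snd l $ e\<bar>"]) auto
    ultimately show ?thesis using True by (simp add: edge_tilt_def)
  qed (use A0 in \<open>simp add: edge_tilt_def\<close>)
  have B: "fst l $ y \<le> B" for y
    using member_le_sum[of y UNIV "\<lambda>y. \<bar>fst l $ y\<bar>"] unfolding B_def by simp
  have "W l T m \<omega> \<le> exp (A * real (card (jumps T (\<xi> \<omega>)))) * exp (T * B)" if m: "m > 0" and w: "\<omega> \<in> space M" for m \<omega>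
  proof -
    have "(\<Sum>i<m. edge_tilt l (\<xi> \<omega> (gp T m i)) (\<xi> \<omega> (gp T m (Suc i)))) \<le> (\<Sum>i<m. A * (if \<xi> \<omega> (gp T m i) \<noteq> \<xi> \<omega> (gp T m (Suc i)) then 1 else 0))"
      by (intro sum_mono A)
    also have "\<dots> = A * real (card {i. i < m \<and> \<xi> \<omega> (gp T m i) \<noteq> \<xi> \<omega> (gp T m (Suc i))})"
      unfolding real_card_lessThan sum_distrib_left ..
    also have "\<dots> \<le> A * real (card (jumps T (\<xi> \<omega>)))"
      using grid_changes_le[OF xi_cadlag[OF w] T m] A0 by (intro mult_left_mono) auto
    finally have 1: "(\<Sum>i<m. edge_tilt l (\<xi> \<omega> (gp T m i)) (\<xi> \<omega> (gp T m (Suc i)))) \<le> A * real (card (jumps T (\<xi> \<omega>)))" .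
    have "(\<Sum>i<m. T / real m * fst l $ \<xi> \<omega> (gp T m (Suc i))) \<le> (\<Sum>i<m. T / real m * B)"
      using T by (intro sum_mono mult_left_mono B) auto
    also have "\<dots> = T * B" using m by simp
    finally show ?thesis using 1 by (simp add: W_exp flip: exp_add)
  qed
  then show thesis by (rule that[OF A0])
qed

text \<open>Each of the \<open>m\<close> steps of length \<open>T / m\<close> changes the expectation by a factor \<open>1 + O((T / m)\<^sup>2)\<close>.\<close>

lemma mgf_grid:
  assumes tl: "tilt l L g" and T: "T > 0"
  shows "(\<lambda>m. expectation (\<lambda>\<omega>. W l T m \<omega> * (exp (- (L * T)) * g T (\<xi> \<omega> T)))) \<longlonglongrightarrow> g 0 x"
proof -
  let ?e = "\<lambda>m. expectation (\<lambda>\<omega>. W l T m \<omega> * (exp (- (L * T)) * g T (\<xi> \<omega> T)))"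
  obtain C d1 where C: "C > 0" and d1: "d1 > 0"
    and os: "\<And>t h y. 0 \<le> t \<Longrightarrow> 0 \<le> h \<Longrightarrow> h \<le> d1 \<Longrightarrow> t + h \<le> T \<Longrightarrow>
      \<bar>(\<Sum>z\<in>UNIV. K t (t + h) y z * (exp (edge_tilt l y z) * (exp ((fst l $ z - L) * h) * g (t + h) z))) - g t y\<bar> \<le> C * h\<^sup>2"
    by (rule one_step[OF tl T fk]) blast
  obtain m0 Gm where m0: "m0 > 0" and gm: "\<And>t y. m0 \<le> g t y" and gM: "\<And>t y. g t y \<le> Gm" by (rule g_bounds[OF tl]) blast
  \<comment> \<open>A relative error \<open>e = C h\<^sup>2 / m0\<close> per step adds up to
    \<open>m * e = a / m\<close> over the grid; dividing by the lower bound \<open>m0\<close> of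
    \<open>g\<close> turns the absolute error of \<open>one_step\<close> into a relative
    one.\<close>
  define a where "a = C * T\<^sup>2 / m0"
  have a: "a > 0" using C T m0 by (simp add: a_def)
  have gx: "g 0 x > 0" using gm[of 0 x] m0 by linarith
  have tz: "(\<lambda>m. c / real m) \<longlonglongrightarrow> 0" for c :: real
    by (rule real_tendsto_divide_at_top[OF tendsto_const filterlim_real_sequentially])
  have "eventually (\<lambda>m. T / real m < d1) sequentially" by (rule order_tendstoD(2)[OF tz d1])
  moreover have "eventually (\<lambda>m. a / real m < 1) sequentially" by (rule order_tendstoD(2)[OF tz]) simp
  ultimately have ev: "eventually (\<lambda>m. (1 - a / real m) * g 0 x \<le> (?e m) \<and>
      (?e m) \<le> exp (a / real m) * g 0 x) sequentially"
    using eventually_gt_at_top[of 0]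
  proof eventually_elim
    case (elim m)
    note m = \<open>0 < m\<close>
    define h where "h = T / real m"
    define e where "e = C * h\<^sup>2 / m0"
    define w where "w i y z = exp (edge_tilt l y z + T / real m * fst l $ z)" for i :: nat and y z
    \<comment> \<open>The discount \<open>exp (- L t)\<close> makes \<open>f\<close> reproduce
      itself under one step of the weighted recursion, up to a relative error
      \<open>e\<close>.\<close>
    define f where "f k y = exp (- (L * gp T m k)) * g (gp T m k) y" for k y
    have h: "h \<ge> 0" "h \<le> d1" using T elim by (auto simp: h_def)
    have em: "real m * e = a / real m" using m by (simp add: e_def a_def h_def power2_eq_square field_simps)
    have e0: "e \<ge> 0" using C m0 by (simp add: e_def)
    have "e \<le> real m * e" using m e0 by (simp add: mult_le_cancel_right1)
    then have e1: "e \<le> 1" using em elim by linarith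
    have gpm: "gp T m m = T" using gp_bounds(4)[OF T m] .
    let ?G = "(\<lambda>\<omega>. (\<Prod>i<m. w i (skel (gp T m) i \<omega>) (skel (gp T m) (Suc i) \<omega>)) * f m (skel (gp T m) m \<omega>))"
    let ?S = "\<lambda>t y. \<Sum>z\<in>UNIV. K t (t + h) y z * (exp (edge_tilt l y z) * (exp ((fst l $ z - L) * h) * g (t + h) z))"
    have eq: "(?e m) =
        expectation ?G"
      using grid_product(2)[OF T, where w = w and f = "f m" and m = m] by (simp add: W_def w_def f_def gpm)
    have st: "\<bar>(\<Sum>z\<in>UNIV. K (gp T m k) (gp T m (Suc k)) y z * (w k y z * f (Suc k) z)) - f k y\<bar> \<le> e * f k y" if k: "k < m" for k y
    proof -
      define t where "t = gp T m k"
      have t: "0 \<le> t" "t + h \<le> T" "gp T m (Suc k) = t + h"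
        using gp_bounds(1)[OF T m, of k] gp_bounds(3)[OF T m, of "Suc k"] k gp_Suc[of T m k] by (auto simp: t_def h_def)
      have wf: "w k y z * f (Suc k) z = exp (- (L * t)) * (exp (edge_tilt l y z) * (exp ((fst l $ z - L) * h) * g (t + h) z))" for z
      proof -
        have "w k y z * f (Suc k) z = exp (edge_tilt l y z + h * fst l $ z + - (L * (t + h))) * g (t + h) z"
          unfolding w_def f_def t(3) h_def[symmetric] exp_add by simp
        also have "edge_tilt l y z + h * fst l $ z + - (L * (t + h)) = - (L * t) + (edge_tilt l y z + (fst l $ z - L) * h)" by (simp add: algebra_simps)
        finally show ?thesis unfolding exp_add by (simp only: mult.assoc)
      qed
      have s: "(\<Sum>z\<in>UNIV. K (gp T m k) (gp T m (Suc k)) y z * (w k y z * f (Suc k) z)) =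
          exp (- (L * t)) * (?S t y)"
        unfolding wf t(3) t_def[symmetric] sum_distrib_left by (simp add: mult_ac)
      have "C * h\<^sup>2 = e * m0" using m0 by (simp add: e_def)
      also have "\<dots> \<le> e * g t y" using e0 gm by (intro mult_left_mono) auto
      finally have "\<bar>(?S t y) - g t y\<bar> \<le> e * g t y"
        using os[OF t(1) h t(2), of y] by linarith
      then have "exp (- (L * t)) * \<bar>(?S t y) - g t y\<bar> \<le> exp (- (L * t)) * (e * g t y)"
        by (rule mult_left_mono) simp
      moreover have fe: "f k y = exp (- (L * t)) * g t y" by (simp add: f_def t_def)
      ultimately show ?thesis
        unfolding s fe right_diff_distrib[symmetric] abs_mult abs_exp_cancel mult.left_commute[of e "exp (- (L * t))"] by blast
    qed
    have f0: "f 0 x = g 0 x" by (simp add: f_def gp_def)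
    have w0: "w i y z \<ge> 0" for i y z by (simp add: w_def)
    have up: "expectation ?G \<le> (1 + e) ^ m * f 0 x"
      by (rule product_bounds(1)[OF gp_grid[OF T] w0]) (use st e0 in \<open>auto simp: distrib_right abs_le_iff algebra_simps\<close>)
    have lo: "(1 - e) ^ m * f 0 x \<le> expectation ?G"
      by (rule product_bounds(2)[OF gp_grid[OF T] w0]) (use st e1 in \<open>auto simp: left_diff_distrib abs_le_iff algebra_simps\<close>)
    have "(1 + e) ^ m \<le> exp e ^ m" using e0 by (intro power_mono) auto
    also have "\<dots> = exp (a / real m)" unfolding em[symmetric] by (simp flip: exp_of_nat_mult)
    finally have "(1 + e) ^ m * f 0 x \<le> exp (a / real m) * g 0 x" unfolding f0 using gx by (intro mult_right_mono) auto
    moreover have "1 - a / real m \<le> (1 - e) ^ m" using Bernoulli_inequality[of "- e" m] e1 em by simp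
    then have "(1 - a / real m) * g 0 x \<le> (1 - e) ^ m * f 0 x" unfolding f0 using gx by (intro mult_right_mono) auto
    ultimately show ?case unfolding eq using up lo by linarith
  qed
  show ?thesis
  proof (rule tendsto_sandwich)
    show "eventually (\<lambda>m. (1 - a / real m) * g 0 x \<le> (?e m)) sequentially"
      using ev by eventually_elim simp
    show "eventually (\<lambda>m. (?e m) \<le> exp (a / real m) * g 0 x) sequentially"
      using ev by eventually_elim simp
    have "(\<lambda>m. (1 - a / real m) * g 0 x) \<longlonglongrightarrow> (1 - 0) * g 0 x" by (intro tendsto_intros tz)
    then show "(\<lambda>m. (1 - a / real m) * g 0 x) \<longlonglongrightarrow> g 0 x" by simp
    have "(\<lambda>m. exp (a / real m) * g 0 x) \<longlonglongrightarrow> exp 0 * g 0 x" by (intro tendsto_intros tz)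
    then show "(\<lambda>m. exp (a / real m) * g 0 x) \<longlonglongrightarrow> g 0 x" by simp
  qed
qed

lemma W_meas: "(\<lambda>\<omega>. W l T m \<omega>) \<in> borel_measurable M"
  unfolding W_def
  by (rule borel_measurable_prod) (rule xi_pair_meas[where h = "\<lambda>y z. exp (edge_tilt l y z + T / real m * fst l $ z)"])

text \<open>The martingale identity of the tilted process, as a limit over grids; all grids are
  dominated by an exponential of the number of jumps.\<close>

lemma mgf_exact:
  assumes tl: "tilt l L g" and T: "T > 0"
  shows "integrable M (\<lambda>\<omega>. exp (T * (l \<bullet> emp T \<omega>)) * (exp (- (L * T)) * g T (\<xi> \<omega> T)))"
    "expectation (\<lambda>\<omega>. exp (T * (l \<bullet> emp T \<omega>)) * (exp (- (L * T)) * g T (\<xi> \<omega> T))) = g 0 x"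
proof -
  let ?F = "(\<lambda>\<omega>. exp (T * (l \<bullet> emp T \<omega>)) * (exp (- (L * T)) * g T (\<xi> \<omega> T)))"
  \<comment> \<open>Indices start at 1 because the bound on \<open>W\<close> asks for at least one
    cell.\<close>
  let ?W = "\<lambda>i. \<lambda>\<omega>. W l T (Suc i) \<omega> * (exp (- (L * T)) * g T (\<xi> \<omega> T))"
  let ?n = "\<lambda>i \<omega>. W l T (Suc i) \<omega> * (exp (- (L * T)) * g T (\<xi> \<omega> T))"
  obtain m0 Gm where m0: "m0 > 0" and gm: "\<And>t y. m0 \<le> g t y" and gM: "\<And>t y. g t y \<le> Gm" by (rule g_bounds[OF tl]) blast
  obtain A B where A: "A \<ge> 0" and B: "\<And>m \<omega>. m > 0 \<Longrightarrow> \<omega> \<in> space M \<Longrightarrow> W l T m \<omega> \<le> exp (A * real (card (jumps T (\<xi> \<omega>)))) * B"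
    by (rule W_bound[OF T, of l]) blast
  have W0: "W l T m \<omega> > 0" for m \<omega> unfolding W_exp by simp
  have lim: "(\<lambda>m. W l T m \<omega>) \<longlonglongrightarrow> exp (T * (l \<bullet> emp T \<omega>))" if "\<omega> \<in> space M" for \<omega> by (rule W_limit[OF T that])
  have em: "(\<lambda>\<omega>. exp (T * (l \<bullet> emp T \<omega>))) \<in> borel_measurable M" by (rule borel_measurable_LIMSEQ_real[OF lim W_meas])
  have gmeas: "(\<lambda>\<omega>. exp (- (L * T)) * g T (\<xi> \<omega> T)) \<in> borel_measurable M"
    by (rule xi_single_meas[where h = "\<lambda>y. exp (- (L * T)) * g T y"])
  have m1: "?F \<in> borel_measurable M"
    by (rule borel_measurable_times[OF em gmeas])
  have m2: "(?W i) \<in> borel_measurable M" for i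
    by (rule borel_measurable_times[OF W_meas gmeas])
  have wi: "integrable M (\<lambda>\<omega>. exp (A * real (card (jumps T (\<xi> \<omega>)))) * (B * (exp (- (L * T)) * Gm)))"
    by (rule integrable_mult_left[OF exp_jumps_integrable[OF T A]])
  have l1: "AE \<omega> in M. (\<lambda>i. W l T (Suc i) \<omega> * (exp (- (L * T)) * g T (\<xi> \<omega> T))) \<longlonglongrightarrow> exp (T * (l \<bullet> emp T \<omega>)) * (exp (- (L * T)) * g T (\<xi> \<omega> T))"
    by (rule AE_I2, rule tendsto_mult[OF LIMSEQ_Suc[OF lim] tendsto_const])
  have bd: "AE \<omega> in M. norm (?n i \<omega>) \<le> exp (A * real (card (jumps T (\<xi> \<omega>)))) * (B * (exp (- (L * T)) * Gm))" for i
  proof (rule AE_I2)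
    fix \<omega> assume w: "\<omega> \<in> space M"
    have g0: "g T (\<xi> \<omega> T) \<ge> 0" using gm[of T "\<xi> \<omega> T"] m0 by linarith
    have "norm (?n i \<omega>) = W l T (Suc i) \<omega> * (exp (- (L * T)) * g T (\<xi> \<omega> T))"
      using W0[of "Suc i" \<omega>] g0 by (simp add: abs_mult)
    also have "\<dots> \<le> (exp (A * real (card (jumps T (\<xi> \<omega>)))) * B) * (exp (- (L * T)) * Gm)"
      by (intro mult_mono B[OF _ w] gM order_refl order_trans[OF less_imp_le[OF W0[of "Suc i" \<omega>]] B[OF _ w]]) (use g0 in auto)
    finally show "norm (?n i \<omega>) \<le> exp (A * real (card (jumps T (\<xi> \<omega>)))) * (B * (exp (- (L * T)) * Gm))"
      by (simp add: mult_ac)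
  qed
  show "integrable M ?F"
    by (rule integrable_dominated_convergence[OF m1 m2 wi l1 bd])
  have "(\<lambda>i. expectation (?W i)) \<longlonglongrightarrow> expectation ?F"
    by (rule integral_dominated_convergence[OF m1 m2 wi l1 bd])
  then show "expectation ?F = g 0 x"
    by (rule LIMSEQ_unique[OF _ LIMSEQ_Suc[OF mgf_grid[OF tl T]]])
qed

text \<open>The case \<open>n = 0\<close> of the family: division by \<open>T = 0\<close> yields
  0.\<close>

lemma emp_0: "emp 0 \<omega> = 0"
  by (simp add: emp_def emp_measure_def emp_flow_def vec_eq_iff prod_eq_iff)

lemma emp_meas: "T \<ge> 0 \<Longrightarrow> emp T \<in> borel_measurable M"
proof -
  assume "T \<ge> 0"
  show ?thesis
  proof (cases "T = 0")
    case True
    then have "emp T = (\<lambda>_. 0)" using emp_0 by auto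
    then show ?thesis by simp
  next
    case False
    then have T: "T > 0" using \<open>T \<ge> 0\<close> by simp
    have 1: "(\<lambda>\<omega>. measure lborel {t \<in> {0..T}. \<xi> \<omega> t = y}) \<in> borel_measurable M" for y
      by (rule borel_measurable_LIMSEQ_real[OF grid_occupation[OF xi_cadlag T]], assumption)
         (unfold real_card_lessThan, intro borel_measurable_times borel_measurable_sum xi_single_meas[where h = "\<lambda>z. if z = y then 1 else 0"] borel_measurable_const)
    have 2: "(\<lambda>\<omega>. real (card {t \<in> {0..T}. left_lim (\<xi> \<omega>) t = y \<and> \<xi> \<omega> t = z})) \<in> borel_measurable M" if ne: "y \<noteq> z" for y z
    proof (rule borel_measurable_LIMSEQ_real)
      fix \<omega> assume w: "\<omega> \<in> space M"
      show "(\<lambda>m. real (card {i. i < m \<and> \<xi> \<omega> (gp T m i) = y \<and> \<xi> \<omega> (gp T m (Suc i)) = z})) \<longlonglongrightarrow>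
          real (card {t \<in> {0..T}. left_lim (\<xi> \<omega>) t = y \<and> \<xi> \<omega> t = z})"
        by (rule tendsto_eventually, use grid_jump_count[OF xi_cadlag[OF w] T] in eventually_elim) (use ne in simp)
    next
      fix m
      show "(\<lambda>\<omega>. real (card {i. i < m \<and> \<xi> \<omega> (gp T m i) = y \<and> \<xi> \<omega> (gp T m (Suc i)) = z})) \<in> borel_measurable M"
        unfolding real_card_lessThan
        by (intro borel_measurable_sum xi_pair_meas[where h = "\<lambda>a b. if a = y \<and> b = z then 1 else 0"])
    qed
    have 3: "(\<lambda>\<omega>. emp_measure T (\<xi> \<omega>)) \<in> borel_measurable M"
      by (rule borel_measurable_vec) (unfold emp_measure_def vec_lambda_beta, intro borel_measurable_divide 1 borel_measurable_const)
    have 4: "(\<lambda>\<omega>. emp_flow E T (\<xi> \<omega>)) \<in> borel_measurable M"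
    proof (rule borel_measurable_vec)
      fix e :: "'v \<times> 'v"
      show "(\<lambda>\<omega>. emp_flow E T (\<xi> \<omega>) $ e) \<in> borel_measurable M"
      proof (cases "e \<in> E")
        case True
        then have "fst e \<noteq> snd e" by (auto simp: edges_def)
        from 2[OF this] True show ?thesis by (simp add: emp_flow_def)
      qed (simp add: emp_flow_def)
    qed
    show ?thesis using borel_measurable_Pair[OF 3 4] unfolding emp_def[abs_def] .
  qed
qed

text \<open>Any exponent admitting an eigenfunction; its value is fixed by \<open>emp_mgf\<close> as
  the exponential growth rate of the moments.\<close>

definition Lam :: "(real^'v) \<times> (real^('v \<times> 'v)) \<Rightarrow> real" where "Lam l = (SOME L. \<exists>g. tilt l L g)"

lemma Lam_tilt: "\<exists>g. tilt l (Lam l) g"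
  unfolding Lam_def by (rule someI_ex) (rule tilt_exists)

text \<open>Bounding \<open>g\<close> from both sides in the martingale identity places the moment
  between \<open>m0 / Gm\<close> and \<open>Gm / m0\<close> times \<open>exp (T * L)\<close>; these
  constants do not depend on \<open>T\<close>, so they vanish on the logarithmic scale.\<close>

lemma emp_mgf:
  assumes tl: "tilt l L g"
  obtains c C where "c > 0" "\<And>T. T \<ge> 0 \<Longrightarrow> integrable M (\<lambda>\<omega>. exp (T * (l \<bullet> emp T \<omega>)))"
    "\<And>T. T \<ge> 0 \<Longrightarrow> c * exp (T * L) \<le> expectation (\<lambda>\<omega>. exp (T * (l \<bullet> emp T \<omega>)))"
    "\<And>T. T \<ge> 0 \<Longrightarrow> expectation (\<lambda>\<omega>. exp (T * (l \<bullet> emp T \<omega>))) \<le> C * exp (T * L)"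
proof -
  obtain m0 Gm where m0: "m0 > 0" and gm: "\<And>t y. m0 \<le> g t y" and gM: "\<And>t y. g t y \<le> Gm" by (rule g_bounds[OF tl]) blast
  have mG: "m0 \<le> Gm" using gm[of 0 x] gM[of 0 x] by linarith
  then have G0: "Gm > 0" using m0 by linarith
  have main: "integrable M (\<lambda>\<omega>. exp (T * (l \<bullet> emp T \<omega>))) \<and> m0 / Gm * exp (T * L) \<le> expectation (\<lambda>\<omega>. exp (T * (l \<bullet> emp T \<omega>))) \<and>
      expectation (\<lambda>\<omega>. exp (T * (l \<bullet> emp T \<omega>))) \<le> Gm / m0 * exp (T * L)" if T0: "T \<ge> 0" for T
  proof (cases "T = 0")
    case True
    then show ?thesis using mG m0 G0 by (simp add: prob_space)
  next
    case False
    then have T: "T > 0" using T0 by simp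
    define X where "X \<omega> = exp (T * (l \<bullet> emp T \<omega>))" for \<omega>
    define Z where "Z \<omega> = X \<omega> * (exp (- (L * T)) * g T (\<xi> \<omega> T))" for \<omega>
    define e where "e = exp (- (L * T))"
    have e: "e > 0" "e * exp (T * L) = 1" by (simp_all add: e_def mult.commute flip: exp_add)
    have Zi: "integrable M Z" and Ze: "expectation Z = g 0 x"
      using mgf_exact[OF tl T] unfolding Z_def[abs_def] X_def by auto
    have Zl: "X \<omega> * (e * m0) \<le> Z \<omega>" and Zu: "Z \<omega> \<le> X \<omega> * (e * Gm)" for \<omega>
      unfolding Z_def e_def by (intro mult_left_mono gm gM; simp add: X_def)+
    have Xm: "X \<in> borel_measurable M"
    proof -
      have [measurable]: "emp T \<in> borel_measurable M" by (rule emp_meas[OF T0])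
      show ?thesis unfolding X_def[abs_def] by measurable
    qed
    have "integrable M (\<lambda>\<omega>. X \<omega> * (e * m0))"
    proof (rule Bochner_Integration.integrable_bound[OF Zi])
      show "(\<lambda>\<omega>. X \<omega> * (e * m0)) \<in> borel_measurable M" by (intro borel_measurable_times Xm borel_measurable_const)
      show "AE \<omega> in M. norm (X \<omega> * (e * m0)) \<le> norm (Z \<omega>)"
      proof (rule AE_I2)
        fix \<omega>
        have "X \<omega> * (e * m0) \<ge> 0" using m0 e(1) by (simp add: X_def)
        then show "norm (X \<omega> * (e * m0)) \<le> norm (Z \<omega>)" using Zl[of \<omega>] by simp
      qed
    qed
    then have Xi: "integrable M X" using m0 e by simp
    have "expectation (\<lambda>\<omega>. X \<omega> * (e * m0)) \<le> expectation Z" by (rule integral_mono[OF _ Zi Zl]) (use Xi in auto)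
    then have u: "expectation X * (e * m0) \<le> Gm" using gM[of 0 x] unfolding Ze by simp
    have "expectation Z \<le> expectation (\<lambda>\<omega>. X \<omega> * (e * Gm))" by (rule integral_mono[OF Zi _ Zu]) (use Xi in auto)
    then have l: "m0 \<le> expectation X * (e * Gm)" using gm[of 0 x] unfolding Ze by simp
    have et: "exp (T * L) = 1 / e" using e by (simp add: field_simps)
    have "m0 / Gm * exp (T * L) \<le> expectation X" "expectation X \<le> Gm / m0 * exp (T * L)"
      unfolding et using u l e(1) m0 G0 by (simp_all add: field_simps)
    then show ?thesis using Xi unfolding X_def[abs_def] by blast
  qed
  show thesis by (rule that[of "m0 / Gm" "Gm / m0"]) (use main m0 G0 in auto)
qed

lemma empirical_LDP:
  "LDP (\<lambda>n. distr M borel (emp (real n * T0))) (\<lambda>n. real n * T0) (Ibar r T0)" "good_rate (Ibar r T0)"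
proof -
  have nT: "real n * T0 \<ge> 0" for n using T0_pos by simp
  have em: "emp (real n * T0) \<in> borel_measurable M" for n by (rule emp_meas[OF nT])
  have me: "(\<lambda>p. exp (c * (l \<bullet> p))) \<in> borel_measurable borel" for c and l :: "(real^'v) \<times> (real^('v \<times> 'v))" by measurable
  interpret L: exposed_ldp "Ibar r T0" Lam "\<lambda>n. distr M borel (emp (real n * T0))" "\<lambda>n. real n * T0"
  proof (rule exposed_ldp.intro)
    fix l :: "(real^'v) \<times> (real^('v \<times> 'v))"
    obtain g where tl: "tilt l (Lam l) g" using Lam_tilt by blast
    show "ennreal (l \<bullet> p - Lam l) \<le> Ibar r T0 p" for p by (rule Ibar_lower[OF tl])
    show "\<exists>p. Ibar r T0 p = ennreal (l \<bullet> p - Lam l) \<and> l \<bullet> p - Lam l \<ge> 0"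
      by (rule Ibar_attained[OF tl]) blast
    show "p = q" if p: "Ibar r T0 p \<le> ennreal (l \<bullet> p - Lam l)" "l \<bullet> p - Lam l \<ge> 0"
      and q: "Ibar r T0 q \<le> ennreal (l \<bullet> q - Lam l)" "l \<bullet> q - Lam l \<ge> 0" for p q
    proof -
      \<comment> \<open>\<open>optimal_unique\<close> speaks of paths; \<open>Ibar_minimizer\<close>
        provides one for each point attaining the bound.\<close>
      obtain p0 where p0: "\<And>p \<mu> Q. adm p \<mu> Q \<Longrightarrow> l \<bullet> p - Lam l \<ge> 0 \<Longrightarrow>
          (\<integral>\<^sup>+ t\<in>{0..T0}. It r t (\<mu> t) (Q t) \<partial>lborel) \<le> ennreal (T0 * (l \<bullet> p - Lam l)) \<Longrightarrow> p = p0"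
        by (rule optimal_unique[OF tl]) blast
      have "p = p0" if h: "Ibar r T0 p \<le> ennreal (l \<bullet> p - Lam l)" "l \<bullet> p - Lam l \<ge> 0" for p
      proof -
        obtain \<mu> Q where "adm p \<mu> Q" "energy \<mu> Q \<le> ennreal (T0 * (l \<bullet> p - Lam l))" by (rule Ibar_minimizer[OF h]) blast
        then show ?thesis using p0[of p \<mu> Q] h(2) unfolding energy_def by blast
      qed
      then show ?thesis using p q by metis
    qed
    obtain c C where c: "c > 0" "\<And>T. T \<ge> 0 \<Longrightarrow> integrable M (\<lambda>\<omega>. exp (T * (l \<bullet> emp T \<omega>)))"
      "\<And>T. T \<ge> 0 \<Longrightarrow> c * exp (T * Lam l) \<le> expectation (\<lambda>\<omega>. exp (T * (l \<bullet> emp T \<omega>)))"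
      "\<And>T. T \<ge> 0 \<Longrightarrow> expectation (\<lambda>\<omega>. exp (T * (l \<bullet> emp T \<omega>))) \<le> C * exp (T * Lam l)"
      by (rule emp_mgf[OF tl]) blast
    show "integrable (distr M borel (emp (real n * T0))) (\<lambda>p. exp (real n * T0 * (l \<bullet> p)))" for n
      unfolding integrable_distr_eq[OF em me] by (rule c(2)[OF nT])
    show "\<exists>c>0. \<exists>C. \<forall>n. c * exp (real n * T0 * Lam l) \<le> (\<integral>p. exp (real n * T0 * (l \<bullet> p)) \<partial>distr M borel (emp (real n * T0))) \<and>
      (\<integral>p. exp (real n * T0 * (l \<bullet> p)) \<partial>distr M borel (emp (real n * T0))) \<le> C * exp (real n * T0 * Lam l)"
      unfolding integral_distr[OF em me] using c(1) c(3)[OF nT] c(4)[OF nT] by blast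
  next
    show "convex_rate (Ibar r T0)" by (rule Ibar_convex)
    show "closed {p. Ibar r T0 p \<le> c}" for c by (rule Ibar_closed)
    show "filterlim (\<lambda>n. real n * T0) at_top sequentially"
      by (rule filterlim_at_top_mult_tendsto_pos[OF tendsto_const T0_pos filterlim_real_sequentially])
    show "real n * T0 \<ge> 0" for n by (rule nT)
    show "prob_space (distr M borel (emp (real n * T0)))" for n by (rule prob_space_distr[OF em])
    show "sets (distr M borel (emp (real n * T0))) = sets borel" for n by simp
  qed
  show "LDP (\<lambda>n. distr M borel (emp (real n * T0))) (\<lambda>n. real n * T0) (Ibar r T0)" by (rule L.exposed_LDP)
  show "good_rate (Ibar r T0)" by (rule L.exposed_good)
qed

end

theorem theorem1:
  fixes r :: "'v::finite \<Rightarrow> 'v \<Rightarrow> real \<Rightarrow> real" and T0 :: real and x :: 'v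
    and M :: "'a measure" and \<xi> :: "'a \<Rightarrow> real \<Rightarrow> 'v"
  assumes T0_pos: "T0 > 0"
    and r_nonneg: "\<forall>y z t. t \<ge> 0 \<longrightarrow> r y z t \<ge> 0"
    and r_loc_int: "\<forall>y z b. set_integrable lborel {0..b} (r y z)"
    and r_periodic: "\<forall>y z t. t \<ge> 0 \<longrightarrow> r y z (t + T0) = r y z t"
    and r_diag: "\<forall>y t. t \<ge> 0 \<longrightarrow> r y y t = 0"
    and A1: "\<forall>y z. (\<exists>t>0. r y z t > 0) \<longrightarrow> (\<forall>t>0. r y z t > 0)"
    and A2: "\<forall>y z. (y, z) \<in> (edges r)\<^sup>*"
    and A3_sup: "\<exists>C. \<forall>(y, z)\<in>edges r. \<forall>t\<in>{0..T0}. r y z t \<le> C"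
    and A3_inf: "\<exists>c>0. \<forall>(y, z)\<in>edges r. \<forall>t\<in>{0..T0}. c \<le> r y z t"
    and A4: "{t\<in>{0..T0}. \<exists>y z. \<not> isCont (r y z) t} \<in> null_sets lborel"
    and chain: "is_chain r x M \<xi>"
  shows "LDP (\<lambda>n. distr M borel
                 (\<lambda>\<omega>. (emp_measure (real n * T0) (\<xi> \<omega>), emp_flow (edges r) (real n * T0) (\<xi> \<omega>))))
             (\<lambda>n. real n * T0) (Ibar r T0)
         \<and> good_rate (Ibar r T0) \<and> convex_rate (Ibar r T0)"
proof -
  from chain obtain K where K: "forward_kernel r K"
    "\<forall>k (tt :: nat \<Rightarrow> real) (yy :: nat \<Rightarrow> 'v). tt 0 = 0 \<and> yy 0 = x \<and> (\<forall>i<k. tt i \<le> tt (Suc i)) \<longrightarrow>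
      measure M {\<omega>\<in>space M. \<forall>i\<in>{1..k}. \<xi> \<omega> (tt i) = yy i} = (\<Prod>i\<in>{1..k}. K (tt (i - 1)) (tt i) (yy (i - 1)) (yy i))"
    and P: "prob_space M" "\<forall>t. (\<lambda>\<omega>. \<xi> \<omega> t) \<in> measurable M (count_space UNIV)" "\<forall>\<omega>\<in>space M. cadlag (\<xi> \<omega>)"
    unfolding is_chain_def by blast
  interpret prob_space M by (rule P(1))
  interpret periodic_chain r T0 M x \<xi> K
    by unfold_locales (use T0_pos r_nonneg r_loc_int r_periodic r_diag A1 A2 A3_sup A3_inf A4 K P in auto)
  show ?thesis using empirical_LDP Ibar_convex unfolding emp_def[abs_def] by blast
qed

end
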